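(* Let $k$ be a commutative ring, $H$ a $k$-bialgebra that is finitely generated and projective as a $k$-module, and $A$ a right lax $H$-comodule algebra; equip $A^{\rm op}$ with the left lax $H^{*{\rm cop}}$-module algebra structure $h^*\rightharpoonup a=h^*(a_{[1]})a_{[0]}$. Then ${}^*(A\otimes H)^{\rm op}$ is isomorphic to $A^{\rm op}\#H^{*{\rm cop}}$ as left unital lax $A^{\rm op}$-rings, and ${}^*(\underline{A\otimes H})^{\rm op}$ is isomorphic to $\underline{A^{\rm op}\#H^{*{\rm cop}}}$ as $A^{\rm op}$-rings. Consequently, the categories ${}_{\underline{A^{\rm op}\#H^{*{\rm cop}}}}\mathcal{M}$ (left modules) and $\mathcal{M}_A^H$ are isomorphic.
   Context: $\otimes=\otimes_k$; $h_{(1)}\otimes h_{(2)}$ and $\epsilon$ are the comultiplication and counit of $H$. For a $k$-linear $\rho:A\to A\otimes H$ write $\rho(a)=a_{[0]}\otimes a_{[1]}=a_{[0']}\otimes a_{[1']}$, $\rho^2(a)=(\rho\otimes H)(\rho(a))=a_{[0]}\otimes a_{[1]}\otimes a_{[2]}$, $\rho(1_A)=1_{[0]}\otimes1_{[1]}$, $\rho^2(1_A)=1_{[0]}\otimes1_{[1]}\otimes1_{[2]}$. $(A,\rho)$ is a right lax $H$-comodule algebra if for all $a,b\in A$: $\rho(ab)=\rho(a)\rho(b)$; $\rho^2(a)=a_{[0]}1_{[0]}\otimes a_{[1](1)}1_{[1]}\otimes a_{[1](2)}$; $\epsilon(a_{[1]})a_{[0]}=\epsilon(1_{[1]})1_{[0]}a$;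 $\rho(1_A)=\epsilon(1_{[1']})1_{[0']}1_{[0]}\otimes1_{[1]}$. Bimodules need not be unital. A left (resp. right) unital lax $B$-ring over a ring $B$ is a $B$-bimodule $\mathcal{R}$, unital on the left (resp. right), with an associative $B$-bimodule map $\mathcal{R}\otimes_B\mathcal{R}\to\mathcal{R}$ and a $B$-bimodule map $\eta:B\to\mathcal{R}$ such that $\eta(1_B)r=r\eta(1_B)=r$ for all $r\in\underline{\mathcal{R}}$, where $\underline{\mathcal{R}}=\mathcal{R}1_B$ (resp. $1_B\mathcal{R}$). Then $\underline{\mathcal{R}}$ is a $B$-ring (an algebra in the monoidal category of unital $B$-bimodules, i.e. a ring with a ring morphism from $B$). If $\mathcal{R}$ is a right unital lax $A$-ring, $\mathcal{R}^{\rm op}$ (opposite multiplication, left and right actions interchanged) is a left unital lax $A^{\rm op}$-ring. $\mathcal{C}=A\otimes H$ is the left unital $A$-bimodule $b'(a\otimes h)b=b'ab_{[0]}\otimes hb_{[1]}$, with $\Delta(a\otimes h)=(a\otimes h_{(1)})\otimes_A(1_A\otimes h_{(2)})$ and $\underline{\varepsilon}(a\otimes h)=\epsilon(h1_{[1]})a1_{[0]}$, and $\underline{A\otimes H}=(A\otimes H)1_A$ is an $A$-coring by restriction. For $\mathcal{D}=A\otimes H$ or $\underline{A\otimes H}$, ${}^*\mathcal{D}={}_A{\rm Hom}(\mathcal{D},A)$ is a right unital lax $A$-ring (an $A$-ring in the second case) with $(afb)(c)=f(ca)b$, $(f\#g)(c)=g(c_{(1)}f(c_{(2)}))$, $\eta(a)(c)=\underline{\varepsilon}(c)a$.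 $H^*$ has convolution product $*$, unit $\epsilon$ and comultiplication given by $h^*(hg)=h^*_{(1)}(h)h^*_{(2)}(g)$; $H^{*{\rm cop}}$ has the opposite comultiplication. $A^{\rm op}\#H^{*{\rm cop}}$ is the $k$-module $A\otimes H^*$ with (products taken in $A$) multiplication $(a\#h^* )(b\#g^* )=(h^*_{(2)}\rightharpoonup b)a\#(h^*_{(1)}*g^* )$, $A^{\rm op}$-bimodule structure $b'(a\#h^* )b=(h^*_{(2)}\rightharpoonup b)ab'\#h^*_{(1)}$, and unit map $a\mapsto(\epsilon\rightharpoonup1_A)a\#\epsilon$; $\underline{A^{\rm op}\#H^{*{\rm cop}}}=(A^{\rm op}\#H^{*{\rm cop}})1_A$. $\mathcal{M}_A^H$: objects are right $A$-modules $M$ with a $k$-linear map $\rho:M\to M\otimes H$, $\rho(m)=m_{[0]}\otimes m_{[1]}$, such that $m_{[0]}\epsilon(m_{[1]})=m$, $(\rho\otimes H)(\rho(m))=m_{[0]}1_{[0]}\otimes m_{[1](1)}1_{[1]}\otimes m_{[1](2)}1_{[2]}$, $\rho(ma)=m_{[0]}a_{[0]}\otimes m_{[1]}a_{[1]}$; morphisms are right $A$-linear maps $f$ with $f(m_{[0]})\otimes m_{[1]}=f(m)_{[0]}\otimes f(m)_{[1]}$. *)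

theory Defs
  imports "HOL-Algebra.Module" "HOL-Algebra.Free_Abelian_Groups"
begin

section \<open>Tensor products\<close>

text \<open>
  As in \<^theory>\<open>HOL-Algebra.Module\<close>, modules are records extending \<^typ>\<open>'m ring\<close>; the fields
  \<^const>\<open>mult\<close> and \<^const>\<open>one\<close> of such a record are meaningful only for algebras.

  \<open>M \<otimes>\<^sub>R N\<close>, for a right action \<open>ra\<close> of \<open>R\<close> on \<open>M\<close> and a left action \<open>la\<close> of \<open>R\<close> on \<open>N\<close>, is the
  free abelian group on \<open>M \<times> N\<close> modulo the usual relators.  Its elements are cosets.
\<close>

type_synonym ('m, 'n) tens = "(('m \<times> 'n) \<Rightarrow>\<^sub>0 int) set"

definition tensor_relators ::
  "'r set \<Rightarrow> ('m \<Rightarrow> 'r \<Rightarrow> 'm) \<Rightarrow> ('r \<Rightarrow> 'n \<Rightarrow> 'n)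
    \<Rightarrow> ('m, 'x) ring_scheme \<Rightarrow> ('n, 'y) ring_scheme \<Rightarrow> (('m \<times> 'n) \<Rightarrow>\<^sub>0 int) set" where
  "tensor_relators R ra la M N =
     {frag_of (m \<oplus>\<^bsub>M\<^esub> m', n) - frag_of (m, n) - frag_of (m', n) | m m' n.
        m \<in> carrier M \<and> m' \<in> carrier M \<and> n \<in> carrier N}
   \<union> {frag_of (m, n \<oplus>\<^bsub>N\<^esub> n') - frag_of (m, n) - frag_of (m, n') | m n n'.
        m \<in> carrier M \<and> n \<in> carrier N \<and> n' \<in> carrier N}
   \<union> {frag_of (ra m r, n) - frag_of (m, la r n) | m r n.
        m \<in> carrier M \<and> r \<in> R \<and> n \<in> carrier N}"

definition tensor_kernel ::
  "'r set \<Rightarrow> ('m \<Rightarrow> 'r \<Rightarrow> 'm) \<Rightarrow> ('r \<Rightarrow> 'n \<Rightarrow> 'n)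
    \<Rightarrow> ('m, 'x) ring_scheme \<Rightarrow> ('n, 'y) ring_scheme \<Rightarrow> (('m \<times> 'n) \<Rightarrow>\<^sub>0 int) set" where
  "tensor_kernel R ra la M N =
     generate (free_Abelian_group (carrier M \<times> carrier N)) (tensor_relators R ra la M N)"

definition bal_tensor ::
  "'r set \<Rightarrow> ('m \<Rightarrow> 'r \<Rightarrow> 'm) \<Rightarrow> ('r \<Rightarrow> 'n \<Rightarrow> 'n)
    \<Rightarrow> ('m, 'x) ring_scheme \<Rightarrow> ('n, 'y) ring_scheme \<Rightarrow> ('m, 'n) tens monoid" where
  "bal_tensor R ra la M N =
     free_Abelian_group (carrier M \<times> carrier N) Mod tensor_kernel R ra la M N"

definition bal_pure ::
  "'r set \<Rightarrow> ('m \<Rightarrow> 'r \<Rightarrow> 'm) \<Rightarrow> ('r \<Rightarrow> 'n \<Rightarrow> 'n)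
    \<Rightarrow> ('m, 'x) ring_scheme \<Rightarrow> ('n, 'y) ring_scheme \<Rightarrow> 'm \<Rightarrow> 'n \<Rightarrow> ('m, 'n) tens" where
  "bal_pure R ra la M N m n =
     tensor_kernel R ra la M N #>\<^bsub>free_Abelian_group (carrier M \<times> carrier N)\<^esub> frag_of (m, n)"

text \<open>
  The additive map \<open>M \<otimes>\<^sub>R N \<rightarrow> G\<close> induced by a balanced biadditive map \<open>\<beta>\<close>, applied to \<open>t\<close>.
  This is how Sweedler-type expressions are rendered below: if \<open>t = t\<^sub>1 \<otimes> t\<^sub>2\<close> in Sweedler notation,
  then \<open>\<beta> t\<^sub>1 t\<^sub>2\<close>, as an element of \<open>G\<close>, is the image of \<open>t\<close> under the map induced by \<open>\<beta>\<close>.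
\<close>

definition bal_lift ::
  "'r set \<Rightarrow> ('m \<Rightarrow> 'r \<Rightarrow> 'm) \<Rightarrow> ('r \<Rightarrow> 'n \<Rightarrow> 'n)
    \<Rightarrow> ('m, 'x) ring_scheme \<Rightarrow> ('n, 'y) ring_scheme \<Rightarrow> ('g, 'z) ring_scheme
    \<Rightarrow> ('m, 'n) tens \<Rightarrow> ('m \<Rightarrow> 'n \<Rightarrow> 'g) \<Rightarrow> 'g" where
  "bal_lift R ra la M N G t \<beta> =
     (THE f. f \<in> extensional (carrier (bal_tensor R ra la M N))
           \<and> f \<in> hom (bal_tensor R ra la M N) (add_monoid G)
           \<and> (\<forall>m\<in>carrier M. \<forall>n\<in>carrier N. f (bal_pure R ra la M N m n) = \<beta> m n)) t"


subsection \<open>Modules and tensor products over a commutative ring\<close>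

definition ground :: "'k ring \<Rightarrow> ('k, 'k) module" where
  "ground K = ring.extend K \<lparr>smult = mult K\<rparr>"

definition linear_maps :: "'k ring \<Rightarrow> ('k, 'm) module \<Rightarrow> ('k, 'n) module \<Rightarrow> ('m \<Rightarrow> 'n) set" where
  "linear_maps K M N =
     {f \<in> carrier M \<rightarrow> carrier N.
        (\<forall>x\<in>carrier M. \<forall>y\<in>carrier M. f (x \<oplus>\<^bsub>M\<^esub> y) = f x \<oplus>\<^bsub>N\<^esub> f y) \<and>
        (\<forall>c\<in>carrier K. \<forall>x\<in>carrier M. f (c \<odot>\<^bsub>M\<^esub> x) = c \<odot>\<^bsub>N\<^esub> f x)}"

definition tpure :: "'k ring \<Rightarrow> ('k, 'm) module \<Rightarrow> ('k, 'n) module \<Rightarrow> 'm \<Rightarrow> 'n \<Rightarrow> ('m, 'n) tens" where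
  "tpure K M N = bal_pure (carrier K) (\<lambda>m c. c \<odot>\<^bsub>M\<^esub> m) (\<lambda>c n. c \<odot>\<^bsub>N\<^esub> n) M N"

definition sweedler ::
  "'k ring \<Rightarrow> ('k, 'm) module \<Rightarrow> ('k, 'n) module \<Rightarrow> ('g, 'z) ring_scheme
    \<Rightarrow> ('m, 'n) tens \<Rightarrow> ('m \<Rightarrow> 'n \<Rightarrow> 'g) \<Rightarrow> 'g" where
  "sweedler K M N = bal_lift (carrier K) (\<lambda>m c. c \<odot>\<^bsub>M\<^esub> m) (\<lambda>c n. c \<odot>\<^bsub>N\<^esub> n) M N"

text \<open>The underlying abelian group of \<open>M \<otimes>\<^sub>K N\<close>; it is needed as a target for \<^const>\<open>sweedler\<close>.\<close>

definition tgroup :: "'k ring \<Rightarrow> ('k, 'm) module \<Rightarrow> ('k, 'n) module \<Rightarrow> ('m, 'n) tens ring" where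
  "tgroup K M N =
     (let T = bal_tensor (carrier K) (\<lambda>m c. c \<odot>\<^bsub>M\<^esub> m) (\<lambda>c n. c \<odot>\<^bsub>N\<^esub> n) M N
      in \<lparr>carrier = carrier T, mult = undefined, one = undefined, ring.zero = one T, add = mult T\<rparr>)"

text \<open>The multiplication and the unit are those of the tensor product of two algebras.\<close>

definition tensor ::
  "'k ring \<Rightarrow> ('k, 'm) module \<Rightarrow> ('k, 'n) module \<Rightarrow> ('k, ('m, 'n) tens) module" where
  "tensor K M N =
     \<lparr>carrier = carrier (tgroup K M N),
      mult = (\<lambda>s t. sweedler K M N (tgroup K M N) s (\<lambda>m n.
                    sweedler K M N (tgroup K M N) t (\<lambda>m' n'.
                      tpure K M N (m \<otimes>\<^bsub>M\<^esub> m') (n \<otimes>\<^bsub>N\<^esub> n')))),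
      one = tpure K M N \<one>\<^bsub>M\<^esub> \<one>\<^bsub>N\<^esub>,
      ring.zero = \<zero>\<^bsub>tgroup K M N\<^esub>,
      add = add (tgroup K M N),
      smult = (\<lambda>c t. sweedler K M N (tgroup K M N) t (\<lambda>m n. tpure K M N (c \<odot>\<^bsub>M\<^esub> m) n))\<rparr>"

definition finitely_generated :: "'k ring \<Rightarrow> ('k, 'm) module \<Rightarrow> bool" where
  "finitely_generated K M \<longleftrightarrow>
     (\<exists>S. finite S \<and> S \<subseteq> carrier M \<and>
        (\<forall>x\<in>carrier M. \<exists>c\<in>S \<rightarrow> carrier K. x = (\<Oplus>\<^bsub>M\<^esub>s\<in>S. c s \<odot>\<^bsub>M\<^esub> s)))"

definition free_module :: "'k ring \<Rightarrow> 'i set \<Rightarrow> ('k, 'i \<Rightarrow> 'k) module" where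
  "free_module K I =
     \<lparr>carrier = {v \<in> I \<rightarrow>\<^sub>E carrier K. finite {i \<in> I. v i \<noteq> \<zero>\<^bsub>K\<^esub>}},
      mult = undefined, one = undefined,
      ring.zero = (\<lambda>i\<in>I. \<zero>\<^bsub>K\<^esub>),
      add = (\<lambda>v w. \<lambda>i\<in>I. v i \<oplus>\<^bsub>K\<^esub> w i),
      smult = (\<lambda>c v. \<lambda>i\<in>I. c \<otimes>\<^bsub>K\<^esub> v i)\<rparr>"

text \<open>
  Direct summands (up to isomorphism) of free modules.  Index sets in the type of \<open>M\<close> suffice:
  a direct summand of any free module is one of the free module on \<^term>\<open>carrier M\<close>.
\<close>

definition projective :: "'k ring \<Rightarrow> ('k, 'm) module \<Rightarrow> bool" where
  "projective K M \<longleftrightarrow>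
     (\<exists>(I :: 'm set) i p. i \<in> linear_maps K M (free_module K I)
        \<and> p \<in> linear_maps K (free_module K I) M \<and> (\<forall>x\<in>carrier M. p (i x) = x))"


subsection \<open>Bimodules and tensor products over a ring\<close>

record ('b, 'm) bimodule = "'m ring" +
  lact :: "'b \<Rightarrow> 'm \<Rightarrow> 'm"
  ract :: "'m \<Rightarrow> 'b \<Rightarrow> 'm"

locale bimodule = B?: ring B + M?: abelian_group M
  for B (structure) and M :: "('b, 'm, 'x) bimodule_scheme" (structure) +
  assumes lact_closed: "\<lbrakk>b \<in> carrier B; x \<in> carrier M\<rbrakk> \<Longrightarrow> lact M b x \<in> carrier M"
    and ract_closed: "\<lbrakk>x \<in> carrier M; b \<in> carrier B\<rbrakk> \<Longrightarrow> ract M x b \<in> carrier M"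
    and lact_add: "\<lbrakk>b \<in> carrier B; x \<in> carrier M; y \<in> carrier M\<rbrakk>
          \<Longrightarrow> lact M b (x \<oplus>\<^bsub>M\<^esub> y) = lact M b x \<oplus>\<^bsub>M\<^esub> lact M b y"
    and add_lact: "\<lbrakk>b \<in> carrier B; c \<in> carrier B; x \<in> carrier M\<rbrakk>
          \<Longrightarrow> lact M (b \<oplus>\<^bsub>B\<^esub> c) x = lact M b x \<oplus>\<^bsub>M\<^esub> lact M c x"
    and lact_lact: "\<lbrakk>b \<in> carrier B; c \<in> carrier B; x \<in> carrier M\<rbrakk>
          \<Longrightarrow> lact M (b \<otimes>\<^bsub>B\<^esub> c) x = lact M b (lact M c x)"
    and ract_add: "\<lbrakk>x \<in> carrier M; b \<in> carrier B; c \<in> carrier B\<rbrakk>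
          \<Longrightarrow> ract M x (b \<oplus>\<^bsub>B\<^esub> c) = ract M x b \<oplus>\<^bsub>M\<^esub> ract M x c"
    and add_ract: "\<lbrakk>x \<in> carrier M; y \<in> carrier M; b \<in> carrier B\<rbrakk>
          \<Longrightarrow> ract M (x \<oplus>\<^bsub>M\<^esub> y) b = ract M x b \<oplus>\<^bsub>M\<^esub> ract M y b"
    and ract_ract: "\<lbrakk>x \<in> carrier M; b \<in> carrier B; c \<in> carrier B\<rbrakk>
          \<Longrightarrow> ract M x (b \<otimes>\<^bsub>B\<^esub> c) = ract M (ract M x b) c"
    and lact_ract: "\<lbrakk>b \<in> carrier B; x \<in> carrier M; c \<in> carrier B\<rbrakk>
          \<Longrightarrow> ract M (lact M b x) c = lact M b (ract M x c)"

definition regular_bimodule :: "('b, 'z) ring_scheme \<Rightarrow> ('b, 'b) bimodule" where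
  "regular_bimodule B =
     \<lparr>carrier = carrier B, mult = mult B, one = one B, ring.zero = \<zero>\<^bsub>B\<^esub>, add = add B,
      lact = mult B, ract = mult B\<rparr>"

definition bimodule_maps ::
  "('b, 'z) ring_scheme \<Rightarrow> ('b, 'm, 'x) bimodule_scheme \<Rightarrow> ('b, 'n, 'y) bimodule_scheme
    \<Rightarrow> ('m \<Rightarrow> 'n) set" where
  "bimodule_maps B M N =
     {f \<in> carrier M \<rightarrow> carrier N.
        (\<forall>x\<in>carrier M. \<forall>y\<in>carrier M. f (x \<oplus>\<^bsub>M\<^esub> y) = f x \<oplus>\<^bsub>N\<^esub> f y) \<and>
        (\<forall>b\<in>carrier B. \<forall>x\<in>carrier M. f (lact M b x) = lact N b (f x)) \<and>
        (\<forall>b\<in>carrier B. \<forall>x\<in>carrier M. f (ract M x b) = ract N (f x) b)}"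

definition btpure ::
  "('b, 'z) ring_scheme \<Rightarrow> ('b, 'm, 'x) bimodule_scheme \<Rightarrow> ('b, 'n, 'y) bimodule_scheme
    \<Rightarrow> 'm \<Rightarrow> 'n \<Rightarrow> ('m, 'n) tens" where
  "btpure B M N = bal_pure (carrier B) (ract M) (lact N) M N"

definition bsweedler ::
  "('b, 'z) ring_scheme \<Rightarrow> ('b, 'm, 'x) bimodule_scheme \<Rightarrow> ('b, 'n, 'y) bimodule_scheme
    \<Rightarrow> ('g, 'w) ring_scheme \<Rightarrow> ('m, 'n) tens \<Rightarrow> ('m \<Rightarrow> 'n \<Rightarrow> 'g) \<Rightarrow> 'g" where
  "bsweedler B M N = bal_lift (carrier B) (ract M) (lact N) M N"

definition btgroup ::
  "('b, 'z) ring_scheme \<Rightarrow> ('b, 'm, 'x) bimodule_scheme \<Rightarrow> ('b, 'n, 'y) bimodule_scheme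
    \<Rightarrow> ('m, 'n) tens ring" where
  "btgroup B M N =
     (let T = bal_tensor (carrier B) (ract M) (lact N) M N
      in \<lparr>carrier = carrier T, mult = undefined, one = undefined, ring.zero = one T, add = mult T\<rparr>)"

definition btensor ::
  "('b, 'z) ring_scheme \<Rightarrow> ('b, 'm, 'x) bimodule_scheme \<Rightarrow> ('b, 'n, 'y) bimodule_scheme
    \<Rightarrow> ('b, ('m, 'n) tens) bimodule" where
  "btensor B M N = ring.extend (btgroup B M N)
     \<lparr>lact = (\<lambda>b t. bsweedler B M N (btgroup B M N) t (\<lambda>m n. btpure B M N (lact M b m) n)),
      ract = (\<lambda>t b. bsweedler B M N (btgroup B M N) t (\<lambda>m n. btpure B M N m (ract N n b)))\<rparr>"


section \<open>Left unital lax rings\<close>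

text \<open>
  In a lax ring the field \<^const>\<open>one\<close> plays no role; the unit is the map \<open>unit_map\<close> (\<open>\<eta>\<close>).
\<close>

record ('b, 'r) lax_ring = "('b, 'r) bimodule" +
  unit_map :: "'b \<Rightarrow> 'r"

definition left_unital_lax_ring :: "('b, 'z) ring_scheme \<Rightarrow> ('b, 'r) lax_ring \<Rightarrow> bool" where
  "left_unital_lax_ring B R \<longleftrightarrow>
     bimodule B R \<and>
     (\<forall>r\<in>carrier R. lact R \<one>\<^bsub>B\<^esub> r = r) \<and>
     (\<exists>\<mu>\<in>bimodule_maps B (btensor B R R) R.
        \<forall>r\<in>carrier R. \<forall>s\<in>carrier R. \<mu> (btpure B R R r s) = r \<otimes>\<^bsub>R\<^esub> s) \<and>
     (\<forall>r\<in>carrier R. \<forall>s\<in>carrier R. \<forall>t\<in>carrier R.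
        (r \<otimes>\<^bsub>R\<^esub> s) \<otimes>\<^bsub>R\<^esub> t = r \<otimes>\<^bsub>R\<^esub> (s \<otimes>\<^bsub>R\<^esub> t)) \<and>
     unit_map R \<in> bimodule_maps B (regular_bimodule B) R \<and>
     (\<forall>r \<in> (\<lambda>x. ract R x \<one>\<^bsub>B\<^esub>) ` carrier R.
        unit_map R \<one>\<^bsub>B\<^esub> \<otimes>\<^bsub>R\<^esub> r = r \<and> r \<otimes>\<^bsub>R\<^esub> unit_map R \<one>\<^bsub>B\<^esub> = r)"

text \<open>A \<open>B\<close>-ring: a ring with a ring morphism from \<open>B\<close> and the bimodule structure it induces.\<close>

definition over_ring :: "('b, 'z) ring_scheme \<Rightarrow> ('b, 'r) lax_ring \<Rightarrow> bool" where
  "over_ring B R \<longleftrightarrow>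
     ring B \<and> ring R \<and> unit_map R \<in> ring_hom B R \<and>
     (\<forall>b\<in>carrier B. \<forall>r\<in>carrier R. lact R b r = unit_map R b \<otimes>\<^bsub>R\<^esub> r) \<and>
     (\<forall>b\<in>carrier B. \<forall>r\<in>carrier R. ract R r b = r \<otimes>\<^bsub>R\<^esub> unit_map R b)"

definition lax_ring_iso ::
  "('b, 'z) ring_scheme \<Rightarrow> ('b, 'r) lax_ring \<Rightarrow> ('b, 's) lax_ring \<Rightarrow> ('r \<Rightarrow> 's) set" where
  "lax_ring_iso B R S =
     {\<phi> \<in> bimodule_maps B R S.
        bij_betw \<phi> (carrier R) (carrier S) \<and>
        (\<forall>r\<in>carrier R. \<forall>s\<in>carrier R. \<phi> (r \<otimes>\<^bsub>R\<^esub> s) = \<phi> r \<otimes>\<^bsub>S\<^esub> \<phi> s) \<and>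
        (\<forall>b\<in>carrier B. \<phi> (unit_map R b) = unit_map S b)}"

definition isomorphic_left_unital_lax_rings ::
  "('b, 'z) ring_scheme \<Rightarrow> ('b, 'r) lax_ring \<Rightarrow> ('b, 's) lax_ring \<Rightarrow> bool" where
  "isomorphic_left_unital_lax_rings B R S \<longleftrightarrow>
     left_unital_lax_ring B R \<and> left_unital_lax_ring B S \<and> lax_ring_iso B R S \<noteq> {}"

definition isomorphic_over_rings ::
  "('b, 'z) ring_scheme \<Rightarrow> ('b, 'r) lax_ring \<Rightarrow> ('b, 's) lax_ring \<Rightarrow> bool" where
  "isomorphic_over_rings B R S \<longleftrightarrow>
     over_ring B R \<and> over_ring B S \<and> lax_ring_iso B R S \<noteq> {}"

definition op_ring :: "('a, 'x) ring_scheme \<Rightarrow> ('a, 'x) ring_scheme" where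
  "op_ring A = A\<lparr>mult := (\<lambda>x y. y \<otimes>\<^bsub>A\<^esub> x)\<rparr>"

definition op_lax_ring :: "('b, 'r) lax_ring \<Rightarrow> ('b, 'r) lax_ring" where
  "op_lax_ring R =
     R\<lparr>mult := (\<lambda>x y. y \<otimes>\<^bsub>R\<^esub> x), lact := (\<lambda>b r. ract R r b), ract := (\<lambda>r b. lact R b r)\<rparr>"

text \<open>\<open>R 1\<^sub>B\<close>, with the operations of \<open>R\<close>.\<close>

definition underline :: "('b, 'z) ring_scheme \<Rightarrow> ('b, 'r, 'x) bimodule_scheme
    \<Rightarrow> ('b, 'r, 'x) bimodule_scheme" where
  "underline B R = R\<lparr>carrier := (\<lambda>r. ract R r \<one>\<^bsub>B\<^esub>) ` carrier R\<rparr>"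


section \<open>Bialgebras and lax comodule algebras\<close>

locale unital_algebra = module K A + ring A for K (structure) and A (structure) +
  assumes smult_mult_left: "\<lbrakk>c \<in> carrier K; x \<in> carrier A; y \<in> carrier A\<rbrakk>
          \<Longrightarrow> (c \<odot>\<^bsub>A\<^esub> x) \<otimes>\<^bsub>A\<^esub> y = c \<odot>\<^bsub>A\<^esub> (x \<otimes>\<^bsub>A\<^esub> y)"
    and smult_mult_right: "\<lbrakk>c \<in> carrier K; x \<in> carrier A; y \<in> carrier A\<rbrakk>
          \<Longrightarrow> x \<otimes>\<^bsub>A\<^esub> (c \<odot>\<^bsub>A\<^esub> y) = c \<odot>\<^bsub>A\<^esub> (x \<otimes>\<^bsub>A\<^esub> y)"

locale bialgebra = unital_algebra K H
  for K :: "'k ring" and H :: "('k, 'h) module" +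
  fixes \<Delta> :: "'h \<Rightarrow> ('h, 'h) tens" and \<epsilon> :: "'h \<Rightarrow> 'k"
  assumes comult_linear: "\<Delta> \<in> linear_maps K H (tensor K H H)"
    and counit_linear: "\<epsilon> \<in> linear_maps K H (ground K)"
    and coassoc: "h \<in> carrier H \<Longrightarrow>
          sweedler K H H (tensor K (tensor K H H) H) (\<Delta> h) (\<lambda>x y. tpure K (tensor K H H) H (\<Delta> x) y)
        = sweedler K H H (tensor K (tensor K H H) H) (\<Delta> h) (\<lambda>x y.
          sweedler K H H (tensor K (tensor K H H) H) (\<Delta> y) (\<lambda>y1 y2.
            tpure K (tensor K H H) H (tpure K H H x y1) y2))"
    and counit_left: "h \<in> carrier H \<Longrightarrow> sweedler K H H H (\<Delta> h) (\<lambda>x y. \<epsilon> x \<odot>\<^bsub>H\<^esub> y) = h"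
    and counit_right: "h \<in> carrier H \<Longrightarrow> sweedler K H H H (\<Delta> h) (\<lambda>x y. \<epsilon> y \<odot>\<^bsub>H\<^esub> x) = h"
    and comult_ring_hom: "\<Delta> \<in> ring_hom H (tensor K H H)"
    and counit_ring_hom: "\<epsilon> \<in> ring_hom H K"

text \<open>Threefold tensor products \<open>A \<otimes> H \<otimes> H\<close> are bracketed to the left.\<close>

locale lax_comodule_algebra = bialgebra K H \<Delta> \<epsilon> + A?: unital_algebra K A
  for K :: "'k ring" and H :: "('k, 'h) module" and \<Delta> \<epsilon> and A :: "('k, 'a) module" +
  fixes \<rho> :: "'a \<Rightarrow> ('a, 'h) tens"
  assumes rho_linear: "\<rho> \<in> linear_maps K A (tensor K A H)"
    and rho_mult: "\<lbrakk>a \<in> carrier A; b \<in> carrier A\<rbrakk> \<Longrightarrow> \<rho> (a \<otimes>\<^bsub>A\<^esub> b) = \<rho> a \<otimes>\<^bsub>tensor K A H\<^esub> \<rho> b"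
    and rho_lax_coassoc: "a \<in> carrier A \<Longrightarrow>
          sweedler K A H (tensor K (tensor K A H) H) (\<rho> a) (\<lambda>x h. tpure K (tensor K A H) H (\<rho> x) h)
        = sweedler K A H (tensor K (tensor K A H) H) (\<rho> a) (\<lambda>x h.
          sweedler K H H (tensor K (tensor K A H) H) (\<Delta> h) (\<lambda>h1 h2.
          sweedler K A H (tensor K (tensor K A H) H) (\<rho> \<one>\<^bsub>A\<^esub>) (\<lambda>u v.
            tpure K (tensor K A H) H (tpure K A H (x \<otimes>\<^bsub>A\<^esub> u) (h1 \<otimes>\<^bsub>H\<^esub> v)) h2)))"
    and rho_lax_counit: "a \<in> carrier A \<Longrightarrow>
          sweedler K A H A (\<rho> a) (\<lambda>x h. \<epsilon> h \<odot>\<^bsub>A\<^esub> x)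
        = sweedler K A H A (\<rho> \<one>\<^bsub>A\<^esub>) (\<lambda>u v. (\<epsilon> v \<odot>\<^bsub>A\<^esub> u) \<otimes>\<^bsub>A\<^esub> a)"
    and rho_one: "\<rho> \<one>\<^bsub>A\<^esub> =
          sweedler K A H (tensor K A H) (\<rho> \<one>\<^bsub>A\<^esub>) (\<lambda>u' v'.
          sweedler K A H (tensor K A H) (\<rho> \<one>\<^bsub>A\<^esub>) (\<lambda>u v.
            tpure K A H ((\<epsilon> v' \<odot>\<^bsub>A\<^esub> u') \<otimes>\<^bsub>A\<^esub> u) v))"


section \<open>The lax coring \<open>A \<otimes> H\<close> and left duals\<close>

record ('a, 'c) coring = "('a, 'c) bimodule" +
  comul :: "'c \<Rightarrow> ('c, 'c) tens"
  counit :: "'c \<Rightarrow> 'a"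

definition AH_bimodule ::
  "'k ring \<Rightarrow> ('k, 'h) module \<Rightarrow> ('k, 'a) module \<Rightarrow> ('a \<Rightarrow> ('a, 'h) tens)
    \<Rightarrow> ('a, ('a, 'h) tens) bimodule" where
  "AH_bimodule K H A \<rho> = ring.extend (tgroup K A H)
     \<lparr>lact = (\<lambda>b t. sweedler K A H (tgroup K A H) t (\<lambda>a h. tpure K A H (b \<otimes>\<^bsub>A\<^esub> a) h)),
      ract = (\<lambda>t b. sweedler K A H (tgroup K A H) t (\<lambda>a h.
                    sweedler K A H (tgroup K A H) (\<rho> b) (\<lambda>b0 b1.
                      tpure K A H (a \<otimes>\<^bsub>A\<^esub> b0) (h \<otimes>\<^bsub>H\<^esub> b1))))\<rparr>"

definition AH_coring ::
  "'k ring \<Rightarrow> ('k, 'h) module \<Rightarrow> ('h \<Rightarrow> ('h, 'h) tens) \<Rightarrow> ('h \<Rightarrow> 'k)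
    \<Rightarrow> ('k, 'a) module \<Rightarrow> ('a \<Rightarrow> ('a, 'h) tens) \<Rightarrow> ('a, ('a, 'h) tens) coring" where
  "AH_coring K H \<Delta> \<epsilon> A \<rho> =
     (let C = AH_bimodule K H A \<rho> in bimodule.extend C
       \<lparr>comul = (\<lambda>t. sweedler K A H (btensor A C C) t (\<lambda>a h.
                     sweedler K H H (btensor A C C) (\<Delta> h) (\<lambda>h1 h2.
                       btpure A C C (tpure K A H a h1) (tpure K A H \<one>\<^bsub>A\<^esub> h2)))),
        counit = (\<lambda>t. sweedler K A H A t (\<lambda>a h.
                      sweedler K A H A (\<rho> \<one>\<^bsub>A\<^esub>) (\<lambda>u v. \<epsilon> (h \<otimes>\<^bsub>H\<^esub> v) \<odot>\<^bsub>A\<^esub> (a \<otimes>\<^bsub>A\<^esub> u))))\<rparr>)"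

text \<open>
  The coring \<open>C 1\<^sub>A\<close>, whose comultiplication is that of \<open>C\<close>, restricted and corestricted along the map
  \<open>C 1\<^sub>A \<otimes>\<^sub>A C 1\<^sub>A \<rightarrow> C \<otimes>\<^sub>A C\<close> induced by the inclusion.  This map is injective: it is
  split by the map induced by \<open>c \<mapsto> c 1\<^sub>A\<close>.
\<close>

definition underline_coring ::
  "('a, 'x) ring_scheme \<Rightarrow> ('a, 'c) coring \<Rightarrow> ('a, 'c) coring" where
  "underline_coring A C =
     (let D = underline A C in D
       \<lparr>comul := (\<lambda>c. THE t. t \<in> carrier (btensor A D D)
                        \<and> bsweedler A D D (btensor A C C) t (\<lambda>x y. btpure A C C x y) = comul C c)\<rparr>)"

definition left_dual :: "('a, 'x) ring_scheme \<Rightarrow> ('a, 'c) coring \<Rightarrow> ('a, 'c \<Rightarrow> 'a) lax_ring" where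
  "left_dual A D =
     \<lparr>carrier = {f \<in> carrier D \<rightarrow>\<^sub>E carrier A.
                   (\<forall>c\<in>carrier D. \<forall>d\<in>carrier D. f (c \<oplus>\<^bsub>D\<^esub> d) = f c \<oplus>\<^bsub>A\<^esub> f d) \<and>
                   (\<forall>a\<in>carrier A. \<forall>c\<in>carrier D. f (lact D a c) = a \<otimes>\<^bsub>A\<^esub> f c)},
      mult = (\<lambda>f g. \<lambda>c\<in>carrier D. g (bsweedler A D D D (comul D c) (\<lambda>c1 c2. ract D c1 (f c2)))),
      one = (\<lambda>c\<in>carrier D. counit D c),
      ring.zero = (\<lambda>c\<in>carrier D. \<zero>\<^bsub>A\<^esub>),
      add = (\<lambda>f g. \<lambda>c\<in>carrier D. f c \<oplus>\<^bsub>A\<^esub> g c),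
      lact = (\<lambda>a f. \<lambda>c\<in>carrier D. f (ract D c a)),
      ract = (\<lambda>f b. \<lambda>c\<in>carrier D. f c \<otimes>\<^bsub>A\<^esub> b),
      unit_map = (\<lambda>a. \<lambda>c\<in>carrier D. counit D c \<otimes>\<^bsub>A\<^esub> a)\<rparr>"


section \<open>The dual bialgebra and the smash product\<close>

definition dual_algebra ::
  "'k ring \<Rightarrow> ('k, 'h) module \<Rightarrow> ('h \<Rightarrow> ('h, 'h) tens) \<Rightarrow> ('h \<Rightarrow> 'k) \<Rightarrow> ('k, 'h \<Rightarrow> 'k) module" where
  "dual_algebra K H \<Delta> \<epsilon> =
     \<lparr>carrier = linear_maps K H (ground K) \<inter> extensional (carrier H),
      mult = (\<lambda>f g. \<lambda>h\<in>carrier H. sweedler K H H K (\<Delta> h) (\<lambda>h1 h2. f h1 \<otimes>\<^bsub>K\<^esub> g h2)),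
      one = (\<lambda>h\<in>carrier H. \<epsilon> h),
      ring.zero = (\<lambda>h\<in>carrier H. \<zero>\<^bsub>K\<^esub>),
      add = (\<lambda>f g. \<lambda>h\<in>carrier H. f h \<oplus>\<^bsub>K\<^esub> g h),
      smult = (\<lambda>c f. \<lambda>h\<in>carrier H. c \<otimes>\<^bsub>K\<^esub> f h)\<rparr>"

text \<open>
  Well-defined for \<open>H\<close> finitely generated and projective, because then \<open>H\<^sup>* \<otimes> H\<^sup>* \<rightarrow> (H \<otimes> H)\<^sup>*\<close> is bijective.
\<close>

definition dual_comult ::
  "'k ring \<Rightarrow> ('k, 'h) module \<Rightarrow> ('h \<Rightarrow> ('h, 'h) tens) \<Rightarrow> ('h \<Rightarrow> 'k)
    \<Rightarrow> ('h \<Rightarrow> 'k) \<Rightarrow> ('h \<Rightarrow> 'k, 'h \<Rightarrow> 'k) tens" where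
  "dual_comult K H \<Delta> \<epsilon> f =
     (let H' = dual_algebra K H \<Delta> \<epsilon> in
      THE t. t \<in> carrier (tensor K H' H') \<and>
        (\<forall>h\<in>carrier H. \<forall>g\<in>carrier H.
           sweedler K H' H' K t (\<lambda>f1 f2. f1 h \<otimes>\<^bsub>K\<^esub> f2 g) = f (h \<otimes>\<^bsub>H\<^esub> g)))"

definition dual_act ::
  "'k ring \<Rightarrow> ('k, 'h) module \<Rightarrow> ('k, 'a) module \<Rightarrow> ('a \<Rightarrow> ('a, 'h) tens)
    \<Rightarrow> ('h \<Rightarrow> 'k) \<Rightarrow> 'a \<Rightarrow> 'a" where
  "dual_act K H A \<rho> f a = sweedler K A H A (\<rho> a) (\<lambda>x h. f h \<odot>\<^bsub>A\<^esub> x)"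

text \<open>
  \<open>A\<^sup>o\<^sup>p # H\<^sup>*\<^sup>c\<^sup>o\<^sup>p\<close> as a lax ring over \<^term>\<open>op_ring A\<close>.  All products are taken in \<open>A\<close>, and \<^const>\<open>dual_comult\<close>
  is the comultiplication of \<open>H\<^sup>*\<close>, not of \<open>H\<^sup>*\<^sup>c\<^sup>o\<^sup>p\<close>.
\<close>

definition smash ::
  "'k ring \<Rightarrow> ('k, 'h) module \<Rightarrow> ('h \<Rightarrow> ('h, 'h) tens) \<Rightarrow> ('h \<Rightarrow> 'k)
    \<Rightarrow> ('k, 'a) module \<Rightarrow> ('a \<Rightarrow> ('a, 'h) tens) \<Rightarrow> ('a, ('a, 'h \<Rightarrow> 'k) tens) lax_ring" where
  "smash K H \<Delta> \<epsilon> A \<rho> =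
     (let H' = dual_algebra K H \<Delta> \<epsilon>; T = tgroup K A H' in
      \<lparr>carrier = carrier T,
       mult = (\<lambda>s t. sweedler K A H' T s (\<lambda>a f.
                     sweedler K A H' T t (\<lambda>b g.
                     sweedler K H' H' T (dual_comult K H \<Delta> \<epsilon> f) (\<lambda>f1 f2.
                       tpure K A H' (dual_act K H A \<rho> f2 b \<otimes>\<^bsub>A\<^esub> a) (f1 \<otimes>\<^bsub>H'\<^esub> g))))),
       one = tpure K A H' (dual_act K H A \<rho> \<epsilon> \<one>\<^bsub>A\<^esub>) \<one>\<^bsub>H'\<^esub>,
       ring.zero = \<zero>\<^bsub>T\<^esub>,
       add = add T,
       lact = (\<lambda>b' s. sweedler K A H' T s (\<lambda>a f. tpure K A H' (a \<otimes>\<^bsub>A\<^esub> b') f)),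
       ract = (\<lambda>s b. sweedler K A H' T s (\<lambda>a f.
                     sweedler K H' H' T (dual_comult K H \<Delta> \<epsilon> f) (\<lambda>f1 f2.
                       tpure K A H' (dual_act K H A \<rho> f2 b \<otimes>\<^bsub>A\<^esub> a) f1))),
       unit_map = (\<lambda>a. tpure K A H' (dual_act K H A \<rho> \<epsilon> \<one>\<^bsub>A\<^esub> \<otimes>\<^bsub>A\<^esub> a) \<one>\<^bsub>H'\<^esub>)\<rparr>)"


section \<open>Categories\<close>

record ('o, 'f) category =
  Obj :: "'o set"
  Hom :: "'o \<Rightarrow> 'o \<Rightarrow> 'f set"
  Ident :: "'o \<Rightarrow> 'f"
  Comp :: "'o \<Rightarrow> 'o \<Rightarrow> 'o \<Rightarrow> 'f \<Rightarrow> 'f \<Rightarrow> 'f"  \<comment> \<open>\<open>Comp C X Y Z g f\<close> is \<open>g \<circ> f\<close> for \<open>f : X \<rightarrow> Y\<close>, \<open>g : Y \<rightarrow> Z\<close>\<close>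

locale category =
  fixes C :: "('o, 'f) category"
  assumes Ident_in: "X \<in> Obj C \<Longrightarrow> Ident C X \<in> Hom C X X"
    and Comp_in: "\<lbrakk>X \<in> Obj C; Y \<in> Obj C; Z \<in> Obj C; f \<in> Hom C X Y; g \<in> Hom C Y Z\<rbrakk>
          \<Longrightarrow> Comp C X Y Z g f \<in> Hom C X Z"
    and Comp_Ident: "\<lbrakk>X \<in> Obj C; Y \<in> Obj C; f \<in> Hom C X Y\<rbrakk> \<Longrightarrow> Comp C X X Y f (Ident C X) = f"
    and Ident_Comp: "\<lbrakk>X \<in> Obj C; Y \<in> Obj C; f \<in> Hom C X Y\<rbrakk> \<Longrightarrow> Comp C X Y Y (Ident C Y) f = f"
    and Comp_assoc: "\<lbrakk>W \<in> Obj C; X \<in> Obj C; Y \<in> Obj C; Z \<in> Obj C;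
            f \<in> Hom C W X; g \<in> Hom C X Y; h \<in> Hom C Y Z\<rbrakk>
          \<Longrightarrow> Comp C W Y Z h (Comp C W X Y g f) = Comp C W X Z (Comp C X Y Z h g) f"

definition is_functor ::
  "('o, 'f) category \<Rightarrow> ('p, 'g) category \<Rightarrow> ('o \<Rightarrow> 'p) \<Rightarrow> ('o \<Rightarrow> 'o \<Rightarrow> 'f \<Rightarrow> 'g) \<Rightarrow> bool" where
  "is_functor C D F0 F1 \<longleftrightarrow>
     (\<forall>X\<in>Obj C. F0 X \<in> Obj D) \<and>
     (\<forall>X\<in>Obj C. \<forall>Y\<in>Obj C. \<forall>f\<in>Hom C X Y. F1 X Y f \<in> Hom D (F0 X) (F0 Y)) \<and>
     (\<forall>X\<in>Obj C. F1 X X (Ident C X) = Ident D (F0 X)) \<and>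
     (\<forall>X\<in>Obj C. \<forall>Y\<in>Obj C. \<forall>Z\<in>Obj C. \<forall>f\<in>Hom C X Y. \<forall>g\<in>Hom C Y Z.
        F1 X Z (Comp C X Y Z g f) = Comp D (F0 X) (F0 Y) (F0 Z) (F1 Y Z g) (F1 X Y f))"

definition isomorphic_categories :: "('o, 'f) category \<Rightarrow> ('p, 'g) category \<Rightarrow> bool" where
  "isomorphic_categories C D \<longleftrightarrow>
     category C \<and> category D \<and>
     (\<exists>F0 F1 G0 G1. is_functor C D F0 F1 \<and> is_functor D C G0 G1 \<and>
        (\<forall>X\<in>Obj C. G0 (F0 X) = X) \<and>
        (\<forall>X\<in>Obj C. \<forall>Y\<in>Obj C. \<forall>f\<in>Hom C X Y. G1 (F0 X) (F0 Y) (F1 X Y f) = f) \<and>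
        (\<forall>X\<in>Obj D. F0 (G0 X) = X) \<and>
        (\<forall>X\<in>Obj D. \<forall>Y\<in>Obj D. \<forall>f\<in>Hom D X Y. F1 (G0 X) (G0 Y) (G1 X Y f) = f))"

text \<open>
  The objects of the two categories below are the modules whose carriers are subsets of a fixed but
  arbitrary type \<open>'m\<close>.  Two module records that agree on the carrier denote the same module; to have
  equality of records coincide with equality of modules, the operations are required to be
  \<^const>\<open>undefined\<close> outside the carriers, and so are the unused fields \<^const>\<open>mult\<close> and \<^const>\<open>one\<close>.
\<close>

definition pure_additive :: "('m, 'x) ring_scheme \<Rightarrow> bool" where
  "pure_additive M \<longleftrightarrow> mult M = undefined \<and> one M = undefined \<and>
     (\<forall>x y. x \<notin> carrier M \<or> y \<notin> carrier M \<longrightarrow> x \<oplus>\<^bsub>M\<^esub> y = undefined)"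

record ('r, 'm) lmod = "'m ring" +
  act :: "'r \<Rightarrow> 'm \<Rightarrow> 'm"

definition left_module :: "('r, 'z) ring_scheme \<Rightarrow> ('r, 'm) lmod \<Rightarrow> bool" where
  "left_module R M \<longleftrightarrow>
     abelian_group M \<and>
     (\<forall>r\<in>carrier R. \<forall>x\<in>carrier M. act M r x \<in> carrier M) \<and>
     (\<forall>r\<in>carrier R. \<forall>x\<in>carrier M. \<forall>y\<in>carrier M.
        act M r (x \<oplus>\<^bsub>M\<^esub> y) = act M r x \<oplus>\<^bsub>M\<^esub> act M r y) \<and>
     (\<forall>r\<in>carrier R. \<forall>s\<in>carrier R. \<forall>x\<in>carrier M.
        act M (r \<oplus>\<^bsub>R\<^esub> s) x = act M r x \<oplus>\<^bsub>M\<^esub> act M s x) \<and>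
     (\<forall>r\<in>carrier R. \<forall>s\<in>carrier R. \<forall>x\<in>carrier M. act M (r \<otimes>\<^bsub>R\<^esub> s) x = act M r (act M s x)) \<and>
     (\<forall>x\<in>carrier M. act M \<one>\<^bsub>R\<^esub> x = x)"

definition left_module_category ::
  "('r, 'z) ring_scheme \<Rightarrow> (('r, 'm) lmod, 'm \<Rightarrow> 'm) category" where
  "left_module_category R =
     \<lparr>Obj = {M. left_module R M \<and> pure_additive M \<and>
                (\<forall>r x. r \<notin> carrier R \<or> x \<notin> carrier M \<longrightarrow> act M r x = undefined)},
      Hom = (\<lambda>M N. {f \<in> carrier M \<rightarrow>\<^sub>E carrier N.
                (\<forall>x\<in>carrier M. \<forall>y\<in>carrier M. f (x \<oplus>\<^bsub>M\<^esub> y) = f x \<oplus>\<^bsub>N\<^esub> f y) \<and>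
                (\<forall>r\<in>carrier R. \<forall>x\<in>carrier M. f (act M r x) = act N r (f x))}),
      Ident = (\<lambda>M. \<lambda>x\<in>carrier M. x),
      Comp = (\<lambda>L M N g f. compose (carrier L) g f)\<rparr>"

text \<open>
  Modules are unital.  For the objects of \<open>\<M>\<^sub>A\<^sup>H\<close> this is no restriction: coassociativity and the
  counit law put every \<open>m\<close> into \<open>M A\<close>.
\<close>

record ('a, 'h, 'm) hmod = "'m ring" +
  racton :: "'m \<Rightarrow> 'a \<Rightarrow> 'm"
  coact :: "'m \<Rightarrow> ('m, 'h) tens"

definition right_module :: "('a, 'z) ring_scheme \<Rightarrow> ('a, 'h, 'm) hmod \<Rightarrow> bool" where
  "right_module A M \<longleftrightarrow>
     abelian_group M \<and>
     (\<forall>x\<in>carrier M. \<forall>a\<in>carrier A. racton M x a \<in> carrier M) \<and>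
     (\<forall>x\<in>carrier M. \<forall>y\<in>carrier M. \<forall>a\<in>carrier A.
        racton M (x \<oplus>\<^bsub>M\<^esub> y) a = racton M x a \<oplus>\<^bsub>M\<^esub> racton M y a) \<and>
     (\<forall>x\<in>carrier M. \<forall>a\<in>carrier A. \<forall>b\<in>carrier A.
        racton M x (a \<oplus>\<^bsub>A\<^esub> b) = racton M x a \<oplus>\<^bsub>M\<^esub> racton M x b) \<and>
     (\<forall>x\<in>carrier M. \<forall>a\<in>carrier A. \<forall>b\<in>carrier A. racton M x (a \<otimes>\<^bsub>A\<^esub> b) = racton M (racton M x a) b) \<and>
     (\<forall>x\<in>carrier M. racton M x \<one>\<^bsub>A\<^esub> = x)"

text \<open>The \<open>K\<close>-module underlying a right module over the \<open>K\<close>-algebra \<open>A\<close>.\<close>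

definition kmod :: "('k, 'a) module \<Rightarrow> ('a, 'h, 'm) hmod \<Rightarrow> ('k, 'm) module" where
  "kmod A M = ring.extend (ring.truncate M) \<lparr>smult = (\<lambda>c x. racton M x (c \<odot>\<^bsub>A\<^esub> \<one>\<^bsub>A\<^esub>))\<rparr>"

definition lax_hopf_module ::
  "'k ring \<Rightarrow> ('k, 'h) module \<Rightarrow> ('h \<Rightarrow> ('h, 'h) tens) \<Rightarrow> ('h \<Rightarrow> 'k)
    \<Rightarrow> ('k, 'a) module \<Rightarrow> ('a \<Rightarrow> ('a, 'h) tens) \<Rightarrow> ('a, 'h, 'm) hmod \<Rightarrow> bool" where
  "lax_hopf_module K H \<Delta> \<epsilon> A \<rho> M \<longleftrightarrow>
     (let M' = kmod A M; MH = tensor K M' H; MHH = tensor K MH H; AH = tensor K A H;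
          \<rho>2_one = sweedler K A H (tensor K AH H) (\<rho> \<one>\<^bsub>A\<^esub>) (\<lambda>u v. tpure K AH H (\<rho> u) v) in
      right_module A M \<and>
      coact M \<in> linear_maps K M' MH \<and>
      (\<forall>m\<in>carrier M. sweedler K M' H M' (coact M m) (\<lambda>x h. \<epsilon> h \<odot>\<^bsub>M'\<^esub> x) = m) \<and>
      (\<forall>m\<in>carrier M.
         sweedler K M' H MHH (coact M m) (\<lambda>x h. tpure K MH H (coact M x) h)
       = sweedler K M' H MHH (coact M m) (\<lambda>x h.
         sweedler K H H MHH (\<Delta> h) (\<lambda>h1 h2.
         sweedler K AH H MHH \<rho>2_one (\<lambda>s w.
         sweedler K A H MHH s (\<lambda>u v.
           tpure K MH H (tpure K M' H (racton M x u) (h1 \<otimes>\<^bsub>H\<^esub> v)) (h2 \<otimes>\<^bsub>H\<^esub> w)))))) \<and>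
      (\<forall>m\<in>carrier M. \<forall>a\<in>carrier A.
         coact M (racton M m a)
       = sweedler K M' H MH (coact M m) (\<lambda>x h.
         sweedler K A H MH (\<rho> a) (\<lambda>a0 a1. tpure K M' H (racton M x a0) (h \<otimes>\<^bsub>H\<^esub> a1)))))"

definition lax_hopf_module_category ::
  "'k ring \<Rightarrow> ('k, 'h) module \<Rightarrow> ('h \<Rightarrow> ('h, 'h) tens) \<Rightarrow> ('h \<Rightarrow> 'k)
    \<Rightarrow> ('k, 'a) module \<Rightarrow> ('a \<Rightarrow> ('a, 'h) tens) \<Rightarrow> (('a, 'h, 'm) hmod, 'm \<Rightarrow> 'm) category" where
  "lax_hopf_module_category K H \<Delta> \<epsilon> A \<rho> =
     \<lparr>Obj = {M. lax_hopf_module K H \<Delta> \<epsilon> A \<rho> M \<and> pure_additive M \<and>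
                (\<forall>x a. x \<notin> carrier M \<or> a \<notin> carrier A \<longrightarrow> racton M x a = undefined) \<and>
                coact M \<in> extensional (carrier M)},
      Hom = (\<lambda>M N. {f \<in> carrier M \<rightarrow>\<^sub>E carrier N.
                (\<forall>x\<in>carrier M. \<forall>y\<in>carrier M. f (x \<oplus>\<^bsub>M\<^esub> y) = f x \<oplus>\<^bsub>N\<^esub> f y) \<and>
                (\<forall>x\<in>carrier M. \<forall>a\<in>carrier A. f (racton M x a) = racton N (f x) a) \<and>
                (\<forall>x\<in>carrier M.
                   sweedler K (kmod A M) H (tensor K (kmod A N) H) (coact M x)
                     (\<lambda>y h. tpure K (kmod A N) H (f y) h)
                 = coact N (f x))}),
      Ident = (\<lambda>M. \<lambda>x\<in>carrier M. x),
      Comp = (\<lambda>L M N g f. compose (carrier L) g f)\<rparr>"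

end

theory Submission
  imports Defs
begin

text \<open>
  All four objects are compared with one model, the convolution ring \<open>E = Hom\<^sub>K(H, A)\<close> with product
  \<open>(u v)(h) = (v h\<^sub>2)\<^sub>[\<^sub>0\<^sub>] u(h\<^sub>1 (v h\<^sub>2)\<^sub>[\<^sub>1\<^sub>])\<close>, unit map \<open>a \<mapsto> (h \<mapsto> \<epsilon>(h) e a)\<close> for \<open>e = \<epsilon>(1\<^sub>[\<^sub>1\<^sub>])1\<^sub>[\<^sub>0\<^sub>]\<close>
  and \<open>A\<^sup>o\<^sup>p\<close>-actions \<open>(b u)(h) = u(h) b\<close> and \<open>(u b)(h) = b\<^sub>[\<^sub>0\<^sub>] u(h b\<^sub>[\<^sub>1\<^sub>])\<close>.  The laws of a left unital lax
  \<open>A\<^sup>o\<^sup>p\<close>-ring are verified for \<open>E\<close> only and carried over by \<open>u \<mapsto> (a \<otimes> h \<mapsto> a u(h))\<close> to the opposite of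
  the left dual of \<open>A \<otimes> H\<close>, and by the inverse of \<open>a # f \<mapsto> (h \<mapsto> f(h) a)\<close>, which is bijective by the
  dual basis lemma, to the smash product.

  A Hopf module is a module over \<open>E 1\<close> through \<open>u x = x\<^sub>[\<^sub>0\<^sub>] u(x\<^sub>[\<^sub>1\<^sub>])\<close>.  Conversely, for a dual basis
  \<open>b\<^sub>i, d\<^sub>i\<close> of \<open>H\<close>, an \<open>E 1\<close>-module carries the coaction \<open>x \<mapsto> \<Sum>\<^sub>i (U\<^sub>i x) \<otimes> b\<^sub>i\<close>, where \<open>U\<^sub>i \<in> E 1\<close> is the
  restriction \<open>h \<mapsto> 1\<^sub>[\<^sub>0\<^sub>] d\<^sub>i(h 1\<^sub>[\<^sub>1\<^sub>])\<close> of \<open>d\<^sub>i\<close>.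
\<close>

section \<open>Balanced tensor products\<close>

text \<open>A Sweedler expression is the value of a map singled out by a definite description, so a
  calculation may use it only where its body is known to be bilinear. Computations are therefore
  done between \<open>K\<close>-modules, where such obligations fall to resolution with rule lists
  like \<open>lin_rules\<close>; even \<open>C \<otimes>\<^sub>A C\<close> receives a scalar action
  for this purpose. The obstacle is that \<open>\<rho>\<close> need be neither unital nor counital:
  each use of lax coassociativity leaves a factor \<open>\<rho>(1)\<close> behind. It can be
  absorbed in three places: by a function of the form \<open>Q u a\<close>, because
  \<open>\<rho>(1) \<rho>(a) = \<rho>(a)\<close>; by a Hopf module coaction, because
  \<open>x 1 = x\<close>; and by \<open>\<otimes>\<^sub>A\<close>, where the right action of 1 on
  one factor is the trivial left action on the next. On arbitrary functions the right action of 1 is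
  merely idempotent, which is why modules are taken over \<open>E 1\<close>. The defect of
  counitality is controlled by the two identities \<open>\<rho>(e) = \<rho>(1)\<close> and
  \<open>e c e = e c\<close>.\<close>

locale balanced_pair =
  fixes R :: "'r set" and ra :: "'m \<Rightarrow> 'r \<Rightarrow> 'm" and la :: "'r \<Rightarrow> 'n \<Rightarrow> 'n"
    and M :: "('m, 'x) ring_scheme" and N :: "('n, 'y) ring_scheme"
  assumes abelian_M: "abelian_group M" and abelian_N: "abelian_group N"
    and ra_closed: "\<lbrakk>m \<in> carrier M; r \<in> R\<rbrakk> \<Longrightarrow> ra m r \<in> carrier M"
    and la_closed: "\<lbrakk>n \<in> carrier N; r \<in> R\<rbrakk> \<Longrightarrow> la r n \<in> carrier N"
begin

abbreviation "T \<equiv> bal_tensor R ra la M N"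
abbreviation "pure \<equiv> bal_pure R ra la M N"
abbreviation "F \<equiv> free_Abelian_group (carrier M \<times> carrier N)"
abbreviation "Ker \<equiv> tensor_kernel R ra la M N"

lemma add_closed_M: "\<lbrakk>m \<in> carrier M; m' \<in> carrier M\<rbrakk> \<Longrightarrow> m \<oplus>\<^bsub>M\<^esub> m' \<in> carrier M"
  by (rule abelian_monoid.a_closed [OF abelian_group.axioms(1) [OF abelian_M]])

lemma add_closed_N: "\<lbrakk>m \<in> carrier N; m' \<in> carrier N\<rbrakk> \<Longrightarrow> m \<oplus>\<^bsub>N\<^esub> m' \<in> carrier N"
  by (rule abelian_monoid.a_closed [OF abelian_group.axioms(1) [OF abelian_N]])

lemma tensor_relators_subset: "tensor_relators R ra la M N \<subseteq> carrier F"
proof -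
  have "frag_of (a, n) - frag_of (b, n') - frag_of (c, n'') \<in> carrier F"
       "frag_of (a, n) - frag_of (b, n') \<in> carrier F"
    if "a \<in> carrier M" "b \<in> carrier M" "c \<in> carrier M"
      "n \<in> carrier N" "n' \<in> carrier N" "n'' \<in> carrier N" for a b c n n' n''
    using that by (auto dest!: subsetD [OF keys_diff])
  then show ?thesis
    unfolding tensor_relators_def
    by (auto simp del: carrier_free_Abelian_group_iff
        simp add: add_closed_M add_closed_N ra_closed la_closed)
qed

lemma subgroup_Ker: "subgroup Ker F"
  unfolding tensor_kernel_def
  by (rule group.generate_is_subgroup [OF group_free_Abelian_group tensor_relators_subset])

lemma normal_Ker: "Ker \<lhd> F"
  by (rule comm_group.subgroup_imp_normal [OF abelian_free_Abelian_group subgroup_Ker])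

lemma comm_group_T: "comm_group T"
  unfolding bal_tensor_def
  by (rule comm_group.abelian_FactGroup [OF abelian_free_Abelian_group subgroup_Ker])

lemma rcos_add:
  assumes "x \<in> carrier F" "y \<in> carrier F"
  shows "(Ker #>\<^bsub>F\<^esub> x) \<otimes>\<^bsub>T\<^esub> (Ker #>\<^bsub>F\<^esub> y) = Ker #>\<^bsub>F\<^esub> (x + y)"
  using normal.rcos_sum [OF normal_Ker assms] by (simp add: bal_tensor_def)

lemma rcos_in_T: "x \<in> carrier F \<Longrightarrow> Ker #>\<^bsub>F\<^esub> x \<in> carrier T"
  by (auto simp: bal_tensor_def carrier_FactGroup)

lemma frag_of_closed: "\<lbrakk>m \<in> carrier M; n \<in> carrier N\<rbrakk> \<Longrightarrow> frag_of (m, n) \<in> carrier F"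
  by simp

lemma add_closed_F: "\<lbrakk>x \<in> carrier F; y \<in> carrier F\<rbrakk> \<Longrightarrow> x + y \<in> carrier F"
  using keys_add [of x y] by auto

lemma diff_closed_F: "\<lbrakk>x \<in> carrier F; y \<in> carrier F\<rbrakk> \<Longrightarrow> x - y \<in> carrier F"
  using keys_diff [of x y] by auto

lemma pure_closed: "\<lbrakk>m \<in> carrier M; n \<in> carrier N\<rbrakk> \<Longrightarrow> pure m n \<in> carrier T"
  unfolding bal_pure_def by (intro rcos_in_T frag_of_closed)

lemma rcos_eqI:
  assumes "x \<in> carrier F" "y \<in> carrier F" "x - y \<in> Ker"
  shows "Ker #>\<^bsub>F\<^esub> x = Ker #>\<^bsub>F\<^esub> y"
proof -
  have "x = (x - y) + y" by simp
  then have "x \<in> Ker #>\<^bsub>F\<^esub> y"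
    using assms(3) by (force simp: r_coset_def)
  then show ?thesis
    using group.repr_independence [OF group_free_Abelian_group _ assms(2) subgroup_Ker] by metis
qed

lemma relator_in_Ker: "x \<in> tensor_relators R ra la M N \<Longrightarrow> x \<in> Ker"
  unfolding tensor_kernel_def by (rule generate.incl)

lemma pure_add_left:
  assumes "m \<in> carrier M" "m' \<in> carrier M" "n \<in> carrier N"
  shows "pure (m \<oplus>\<^bsub>M\<^esub> m') n = pure m n \<otimes>\<^bsub>T\<^esub> pure m' n"
proof -
  have "frag_of (m \<oplus>\<^bsub>M\<^esub> m', n) - frag_of (m, n) - frag_of (m', n) \<in> tensor_relators R ra la M N"
    using assms unfolding tensor_relators_def by blast
  then have "frag_of (m \<oplus>\<^bsub>M\<^esub> m', n) - (frag_of (m, n) + frag_of (m', n)) \<in> Ker"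
    by (simp add: relator_in_Ker diff_diff_eq)
  then show ?thesis
    unfolding bal_pure_def using assms
    by (subst rcos_add) (simp_all add: rcos_eqI add_closed_F frag_of_closed add_closed_M
        del: carrier_free_Abelian_group_iff)
qed

lemma pure_add_right:
  assumes "m \<in> carrier M" "n \<in> carrier N" "n' \<in> carrier N"
  shows "pure m (n \<oplus>\<^bsub>N\<^esub> n') = pure m n \<otimes>\<^bsub>T\<^esub> pure m n'"
proof -
  have "frag_of (m, n \<oplus>\<^bsub>N\<^esub> n') - frag_of (m, n) - frag_of (m, n') \<in> tensor_relators R ra la M N"
    using assms unfolding tensor_relators_def by blast
  then have "frag_of (m, n \<oplus>\<^bsub>N\<^esub> n') - (frag_of (m, n) + frag_of (m, n')) \<in> Ker"
    by (simp add: relator_in_Ker diff_diff_eq)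
  then show ?thesis
    unfolding bal_pure_def using assms
    by (subst rcos_add) (simp_all add: rcos_eqI add_closed_F frag_of_closed add_closed_N
        del: carrier_free_Abelian_group_iff)
qed

lemma pure_balanced:
  assumes "m \<in> carrier M" "n \<in> carrier N" "r \<in> R"
  shows "pure (ra m r) n = pure m (la r n)"
proof -
  have "frag_of (ra m r, n) - frag_of (m, la r n) \<in> tensor_relators R ra la M N"
    using assms unfolding tensor_relators_def by blast
  then show ?thesis
    unfolding bal_pure_def using assms relator_in_Ker
    by (intro rcos_eqI) (simp_all add: ra_closed la_closed)
qed

lemma pure_zero_left:
  assumes "n \<in> carrier N" shows "pure \<zero>\<^bsub>M\<^esub> n = \<one>\<^bsub>T\<^esub>"
proof -
  interpret T: comm_group T by (rule comm_group_T)
  interpret M: abelian_group M by (rule abelian_M)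
  have "pure \<zero>\<^bsub>M\<^esub> n \<otimes>\<^bsub>T\<^esub> pure \<zero>\<^bsub>M\<^esub> n = pure \<zero>\<^bsub>M\<^esub> n"
    using pure_add_left [of "\<zero>\<^bsub>M\<^esub>" "\<zero>\<^bsub>M\<^esub>" n] assms by simp
  then show ?thesis
    using T.l_cancel_one [OF pure_closed pure_closed, of "\<zero>\<^bsub>M\<^esub>" n "\<zero>\<^bsub>M\<^esub>" n] assms by simp
qed

lemma pure_minus:
  assumes "m \<in> carrier M" "n \<in> carrier N" shows "pure (\<ominus>\<^bsub>M\<^esub> m) n = inv\<^bsub>T\<^esub> (pure m n)"
proof -
  interpret T: comm_group T by (rule comm_group_T)
  interpret M: abelian_group M by (rule abelian_M)
  have "pure (\<ominus>\<^bsub>M\<^esub> m) n \<otimes>\<^bsub>T\<^esub> pure m n = \<one>\<^bsub>T\<^esub>"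
    using assms by (simp flip: pure_add_left add: M.l_neg pure_zero_left)
  then show ?thesis using T.inv_equality pure_closed assms by simp
qed

text \<open>A coset is represented by an integer combination of pairs. Negative coefficients are
  covered by the case \<open>add\<close> as well, since the inverse of \<open>m \<otimes> n\<close>
  is again a pure tensor, namely \<open>(-m) \<otimes> n\<close>.\<close>

lemma tens_induct [consumes 1, case_names zero add]:
  assumes t: "t \<in> carrier T" and zero: "P \<one>\<^bsub>T\<^esub>"
    and add: "\<And>m n t. \<lbrakk>m \<in> carrier M; n \<in> carrier N; t \<in> carrier T; P t\<rbrakk> \<Longrightarrow> P (pure m n \<otimes>\<^bsub>T\<^esub> t)"
  shows "P t"
proof -
  interpret T: comm_group T by (rule comm_group_T)
  obtain x where x: "x \<in> carrier F" "t = Ker #>\<^bsub>F\<^esub> x"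
    using t by (auto simp: bal_tensor_def carrier_FactGroup simp del: carrier_free_Abelian_group_iff)
  \<comment> \<open>Strengthened to translation by the class of \<open>x\<close> and by its inverse:
    \<open>frag_induction\<close> builds elements by differences, and in a difference
    \<open>b\<close> enters with the opposite sign.\<close>
  have "x \<in> carrier F \<and> (\<forall>s\<in>carrier T. P s \<longrightarrow> P ((Ker #>\<^bsub>F\<^esub> x) \<otimes>\<^bsub>T\<^esub> s) \<and> P (inv\<^bsub>T\<^esub> (Ker #>\<^bsub>F\<^esub> x) \<otimes>\<^bsub>T\<^esub> s))"
    using x(1) unfolding carrier_free_Abelian_group_iff
  proof (induction x rule: frag_induction)
    case zero
    have "Ker #>\<^bsub>F\<^esub> 0 = \<one>\<^bsub>T\<^esub>"
      using group.coset_mult_one [OF group_free_Abelian_group subgroup.subset [OF subgroup_Ker]]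
      by (simp add: bal_tensor_def)
    then show ?case by simp
  next
    case (one x)
    obtain m n where mn: "x = (m, n)" "m \<in> carrier M" "n \<in> carrier N" using one by auto
    have "Ker #>\<^bsub>F\<^esub> frag_of x = pure m n" by (simp add: bal_pure_def mn)
    moreover have "inv\<^bsub>T\<^esub> (pure m n) = pure (\<ominus>\<^bsub>M\<^esub> m) n" "\<ominus>\<^bsub>M\<^esub> m \<in> carrier M"
      using mn by (auto simp: pure_minus abelian_group.a_inv_closed [OF abelian_M])
    ultimately show ?case using add mn by simp
  next
    case (diff a b)
    have ab: "a \<in> carrier F" "b \<in> carrier F" using diff by simp_all
    have c: "Ker #>\<^bsub>F\<^esub> a \<in> carrier T" "Ker #>\<^bsub>F\<^esub> b \<in> carrier T" "Ker #>\<^bsub>F\<^esub> (a - b) \<in> carrier T"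
      using ab diff_closed_F [OF ab] by (auto intro: rcos_in_T simp del: carrier_free_Abelian_group_iff)
    have "(Ker #>\<^bsub>F\<^esub> (a - b)) \<otimes>\<^bsub>T\<^esub> (Ker #>\<^bsub>F\<^esub> b) = Ker #>\<^bsub>F\<^esub> a"
      using ab diff_closed_F [OF ab] by (subst rcos_add) simp_all
    then have e: "Ker #>\<^bsub>F\<^esub> (a - b) = (Ker #>\<^bsub>F\<^esub> a) \<otimes>\<^bsub>T\<^esub> inv\<^bsub>T\<^esub> (Ker #>\<^bsub>F\<^esub> b)"
      using c by (metis T.inv_solve_right)
    have e2: "inv\<^bsub>T\<^esub> (Ker #>\<^bsub>F\<^esub> (a - b)) = inv\<^bsub>T\<^esub> (Ker #>\<^bsub>F\<^esub> a) \<otimes>\<^bsub>T\<^esub> (Ker #>\<^bsub>F\<^esub> b)"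
      unfolding e using c by (simp add: T.inv_mult)
    show ?case unfolding e2 unfolding e using c diff diff_closed_F [OF ab] by (simp add: T.m_assoc)
  qed
  then have "P (t \<otimes>\<^bsub>T\<^esub> \<one>\<^bsub>T\<^esub>)" using zero x by auto
  then show ?thesis using t by simp
qed

definition balanced :: "('g, 'z) ring_scheme \<Rightarrow> ('m \<Rightarrow> 'n \<Rightarrow> 'g) \<Rightarrow> bool" where
  "balanced G \<beta> \<longleftrightarrow>
     (\<forall>m\<in>carrier M. \<forall>n\<in>carrier N. \<beta> m n \<in> carrier G) \<and>
     (\<forall>m\<in>carrier M. \<forall>m'\<in>carrier M. \<forall>n\<in>carrier N. \<beta> (m \<oplus>\<^bsub>M\<^esub> m') n = \<beta> m n \<oplus>\<^bsub>G\<^esub> \<beta> m' n) \<and>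
     (\<forall>m\<in>carrier M. \<forall>n\<in>carrier N. \<forall>n'\<in>carrier N. \<beta> m (n \<oplus>\<^bsub>N\<^esub> n') = \<beta> m n \<oplus>\<^bsub>G\<^esub> \<beta> m n') \<and>
     (\<forall>m\<in>carrier M. \<forall>n\<in>carrier N. \<forall>r\<in>R. \<beta> (ra m r) n = \<beta> m (la r n))"

text \<open>Freeness gives a homomorphism on \<open>F\<close>; it kills the relators because
  \<open>\<beta>\<close> is balanced, and so factors through the quotient. Uniqueness holds because
  pure tensors generate, and the extensionality clause fixes the values outside the carrier. Hence
  the description in \<open>bal_lift\<close> denotes.\<close>

lemma ex1_bal_lift:
  assumes G: "abelian_group G" and \<beta>: "balanced G \<beta>"
  shows "\<exists>!f. f \<in> extensional (carrier T) \<and> f \<in> hom T (add_monoid G)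
           \<and> (\<forall>m\<in>carrier M. \<forall>n\<in>carrier N. f (pure m n) = \<beta> m n)"
proof -
  interpret G: abelian_group G by (rule G)
  have comm_G: "comm_group (add_monoid G)" by (rule abelian_group.a_comm_group [OF G])
  have group_G: "group (add_monoid G)" by (rule abelian_group.a_group [OF G])
  interpret T: comm_group T by (rule comm_group_T)
  obtain h where h: "h \<in> hom F (add_monoid G)"
      "\<And>x. x \<in> carrier M \<times> carrier N \<Longrightarrow> h (frag_of x) = \<beta> (fst x) (snd x)"
  proof (rule comm_group.free_Abelian_group_universal [OF comm_G, of "\<lambda>x. \<beta> (fst x) (snd x)" "carrier M \<times> carrier N"])
    show "(\<lambda>x. \<beta> (fst x) (snd x)) ` (carrier M \<times> carrier N) \<subseteq> carrier (add_monoid G)"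
      using \<beta> by (auto simp: balanced_def)
  qed (rule that)
  interpret h: group_hom F "add_monoid G" h
    by (simp add: group_hom_def group_hom_axioms_def h(1) group_G)
  have diff: "h (x - y) = h x \<ominus>\<^bsub>G\<^esub> h y" if "x \<in> carrier F" "y \<in> carrier F" for x y
  proof -
    have "h (x - y) \<oplus>\<^bsub>G\<^esub> h y = h ((x - y) + y)"
      using h.hom_mult [of "x - y" y] diff_closed_F [OF that] that(2) by simp
    moreover have "h (x - y) \<in> carrier G" "h x \<in> carrier G" "h y \<in> carrier G"
      using h.hom_closed that keys_diff [of x y] by auto
    ultimately show ?thesis by (simp add: G.add.inv_solve_right a_minus_def)
  qed
  \<comment> \<open>The biadditivity relators take this shape once \<open>h\<close> has been pushed
    through their two differences.\<close>
  have cancel: "p \<oplus>\<^bsub>G\<^esub> q \<oplus>\<^bsub>G\<^esub> \<ominus>\<^bsub>G\<^esub> p \<oplus>\<^bsub>G\<^esub> \<ominus>\<^bsub>G\<^esub> q = \<zero>\<^bsub>G\<^esub>"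
    if "p \<in> carrier G" "q \<in> carrier G" for p q
  proof -
    have "p \<oplus>\<^bsub>G\<^esub> q \<oplus>\<^bsub>G\<^esub> \<ominus>\<^bsub>G\<^esub> p \<oplus>\<^bsub>G\<^esub> \<ominus>\<^bsub>G\<^esub> q = (p \<oplus>\<^bsub>G\<^esub> q) \<oplus>\<^bsub>G\<^esub> \<ominus>\<^bsub>G\<^esub> (p \<oplus>\<^bsub>G\<^esub> q)"
      using that by (simp add: G.minus_add G.a_assoc)
    then show ?thesis using that by (simp add: G.r_neg)
  qed
  have "tensor_relators R ra la M N \<subseteq> kernel F (add_monoid G) h"
  proof
    fix x assume x: "x \<in> tensor_relators R ra la M N"
    have xF: "x \<in> carrier F" using x tensor_relators_subset by blast
    have "h x = \<zero>\<^bsub>G\<^esub>"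
      using x \<beta> unfolding tensor_relators_def balanced_def
      by (auto simp del: carrier_free_Abelian_group_iff
          simp add: diff h(2) diff_closed_F frag_of_closed add_closed_M add_closed_N ra_closed la_closed cancel G.minus_eq G.r_neg)
    then show "x \<in> kernel F (add_monoid G) h" using xF by (simp add: kernel_def)
  qed
  then have Ker: "Ker \<subseteq> kernel F (add_monoid G) h"
    unfolding tensor_kernel_def
    by (rule group.generate_subgroup_incl [OF group_free_Abelian_group _ h.subgroup_kernel])
  have "h x = h y"
    if "x \<in> carrier F" "y \<in> carrier F" "Ker #>\<^bsub>F\<^esub> x = Ker #>\<^bsub>F\<^esub> y" for x y
  proof -
    have "x \<in> Ker #>\<^bsub>F\<^esub> x"
      using group.rcos_self [OF group_free_Abelian_group that(1) subgroup_Ker] .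
    then have "x \<in> Ker #>\<^bsub>F\<^esub> y" using that(3) by simp
    then obtain k where k: "k \<in> Ker" "x = k + y" by (auto simp: r_coset_def)
    then have "k \<in> kernel F (add_monoid G) h" using Ker by blast
    then have k2: "k \<in> carrier F" "h k = \<zero>\<^bsub>G\<^esub>" by (simp_all add: kernel_def)
    have "h y \<in> carrier G" using h.hom_closed that(2) by auto
    then show ?thesis using h.hom_mult [OF k2(1) that(2)] k(2) k2(2) by simp
  qed
  then obtain g where g: "g \<in> hom (F Mod Ker) (add_monoid G)"
    "\<And>x. x \<in> carrier F \<Longrightarrow> g (Ker #>\<^bsub>F\<^esub> x) = h x"
    by (rule FactGroup_universal [OF h(1) normal_Ker]) auto
  have gp: "g (pure m n) = \<beta> m n" if "m \<in> carrier M" "n \<in> carrier N" for m n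
    unfolding bal_pure_def using that by (subst g(2)) (auto simp: h(2))
  have gT: "g \<in> hom T (add_monoid G)" using g(1) by (simp add: bal_tensor_def)
  let ?f = "restrict g (carrier T)"
  have f: "?f \<in> hom T (add_monoid G)" using gT T.m_closed by (auto simp: hom_def)
  have fp: "\<forall>m\<in>carrier M. \<forall>n\<in>carrier N. ?f (pure m n) = \<beta> m n"
    by (simp add: gp pure_closed)
  have uniq: "k = ?f"
    if k: "k \<in> extensional (carrier T)" "k \<in> hom T (add_monoid G)"
      "\<forall>m\<in>carrier M. \<forall>n\<in>carrier N. k (pure m n) = \<beta> m n" for k
  proof (rule extensionalityI [OF k(1)])
    fix t assume "t \<in> carrier T"
    then show "k t = ?f t"
    proof (induction t rule: tens_induct)
      case zero
      have "k \<one>\<^bsub>T\<^esub> = \<one>\<^bsub>add_monoid G\<^esub>" "?f \<one>\<^bsub>T\<^esub> = \<one>\<^bsub>add_monoid G\<^esub>"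
        using hom_one [OF k(2)] hom_one [OF f] T.group_axioms group_G by auto
      then show ?case by (simp only:)
    next
      case (add m n t)
      have "k (pure m n \<otimes>\<^bsub>T\<^esub> t) = k (pure m n) \<oplus>\<^bsub>G\<^esub> k t"
        using hom_mult [OF k(2)] add pure_closed by simp
      also have "\<dots> = ?f (pure m n) \<oplus>\<^bsub>G\<^esub> ?f t"
        using add(4) k(3) [rule_format, OF add(1,2)] fp [rule_format, OF add(1,2)] by (simp only:)
      also have "\<dots> = ?f (pure m n \<otimes>\<^bsub>T\<^esub> t)"
        using hom_mult [OF f, of "pure m n" t] add pure_closed by simp
      finally show ?case .
    qed
  qed simp
  show ?thesis
    by (rule ex1I [of _ ?f]) (use f fp uniq in auto)
qed

context
  fixes G :: "('g, 'z) ring_scheme" and \<beta> :: "'m \<Rightarrow> 'n \<Rightarrow> 'g"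
  assumes G: "abelian_group G" and \<beta>: "balanced G \<beta>"
begin

lemma bal_lift_spec:
  "(\<lambda>t. bal_lift R ra la M N G t \<beta>) \<in> extensional (carrier T)
     \<and> (\<lambda>t. bal_lift R ra la M N G t \<beta>) \<in> hom T (add_monoid G)
     \<and> (\<forall>m\<in>carrier M. \<forall>n\<in>carrier N. bal_lift R ra la M N G (pure m n) \<beta> = \<beta> m n)"
  unfolding bal_lift_def by (rule theI' [OF ex1_bal_lift [OF G \<beta>]])

lemma bal_lift_closed: "t \<in> carrier T \<Longrightarrow> bal_lift R ra la M N G t \<beta> \<in> carrier G"
  using bal_lift_spec by (auto simp: hom_def)

lemma bal_lift_add:
  "\<lbrakk>s \<in> carrier T; t \<in> carrier T\<rbrakk> \<Longrightarrow>
     bal_lift R ra la M N G (s \<otimes>\<^bsub>T\<^esub> t) \<beta> = bal_lift R ra la M N G s \<beta> \<oplus>\<^bsub>G\<^esub> bal_lift R ra la M N G t \<beta>"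
  using bal_lift_spec by (auto simp: hom_def)

lemma bal_lift_pure:
  "\<lbrakk>m \<in> carrier M; n \<in> carrier N\<rbrakk> \<Longrightarrow> bal_lift R ra la M N G (pure m n) \<beta> = \<beta> m n"
  using bal_lift_spec by auto

lemma bal_lift_one: "bal_lift R ra la M N G \<one>\<^bsub>T\<^esub> \<beta> = \<zero>\<^bsub>G\<^esub>"
  using hom_one [of "\<lambda>t. bal_lift R ra la M N G t \<beta>" T "add_monoid G"] bal_lift_spec
    comm_group.axioms(2) [OF comm_group_T] abelian_group.a_group [OF G] by auto

end

end

text \<open>Valid for arbitrary bodies: two bodies that agree on the carriers give the same
  description, whether or not it denotes. Rewriting under a Sweedler sum therefore produces no
  linearity goals.\<close>

lemma bal_lift_cong:
  assumes "\<And>m n. \<lbrakk>m \<in> carrier M; n \<in> carrier N\<rbrakk> \<Longrightarrow> \<beta> m n = \<gamma> m n"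
  shows "bal_lift R ra la M N G t \<beta> = bal_lift R ra la M N G t \<gamma>"
proof -
  have "(\<forall>m\<in>carrier M. \<forall>n\<in>carrier N. f (bal_pure R ra la M N m n) = \<beta> m n)
      \<longleftrightarrow> (\<forall>m\<in>carrier M. \<forall>n\<in>carrier N. f (bal_pure R ra la M N m n) = \<gamma> m n)" for f
    using assms by auto
  then show ?thesis unfolding bal_lift_def by presburger
qed

section \<open>Linear and bilinear maps\<close>

text \<open>Phrased as linearity in each variable separately, so that resolution with
  \<open>bilI\<close> turns a bilinearity goal into linearity goals in one variable.\<close>

definition bilinear_maps ::
  "'k ring \<Rightarrow> ('k, 'm) module \<Rightarrow> ('k, 'n) module \<Rightarrow> ('k, 'g) module \<Rightarrow> ('m \<Rightarrow> 'n \<Rightarrow> 'g) set" where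
  "bilinear_maps K M N G =
     {\<beta>. (\<forall>n\<in>carrier N. (\<lambda>m. \<beta> m n) \<in> linear_maps K M G) \<and>
         (\<forall>m\<in>carrier M. \<beta> m \<in> linear_maps K N G)}"

lemma linI:
  assumes "\<And>x. x \<in> carrier M \<Longrightarrow> f x \<in> carrier N"
    and "\<And>x y. \<lbrakk>x \<in> carrier M; y \<in> carrier M\<rbrakk> \<Longrightarrow> f (x \<oplus>\<^bsub>M\<^esub> y) = f x \<oplus>\<^bsub>N\<^esub> f y"
    and "\<And>c x. \<lbrakk>c \<in> carrier K; x \<in> carrier M\<rbrakk> \<Longrightarrow> f (c \<odot>\<^bsub>M\<^esub> x) = c \<odot>\<^bsub>N\<^esub> f x"
  shows "f \<in> linear_maps K M N"
  using assms by (simp add: linear_maps_def Pi_iff)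

lemma lin_closed: "\<lbrakk>f \<in> linear_maps K M N; x \<in> carrier M\<rbrakk> \<Longrightarrow> f x \<in> carrier N"
  by (simp add: linear_maps_def Pi_iff)

lemma lin_add:
  "\<lbrakk>f \<in> linear_maps K M N; x \<in> carrier M; y \<in> carrier M\<rbrakk> \<Longrightarrow> f (x \<oplus>\<^bsub>M\<^esub> y) = f x \<oplus>\<^bsub>N\<^esub> f y"
  by (simp add: linear_maps_def)

lemma lin_smult:
  "\<lbrakk>f \<in> linear_maps K M N; c \<in> carrier K; x \<in> carrier M\<rbrakk> \<Longrightarrow> f (c \<odot>\<^bsub>M\<^esub> x) = c \<odot>\<^bsub>N\<^esub> f x"
  by (simp add: linear_maps_def)

lemma lin_zero:
  assumes "f \<in> linear_maps K M N" "abelian_group M" "abelian_group N"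
  shows "f \<zero>\<^bsub>M\<^esub> = \<zero>\<^bsub>N\<^esub>"
proof -
  interpret M: abelian_group M by fact
  interpret N: abelian_group N by fact
  have "f \<zero>\<^bsub>M\<^esub> \<oplus>\<^bsub>N\<^esub> f \<zero>\<^bsub>M\<^esub> = f \<zero>\<^bsub>M\<^esub>"
    using lin_add [OF assms(1), of "\<zero>\<^bsub>M\<^esub>" "\<zero>\<^bsub>M\<^esub>"] by simp
  then show ?thesis using lin_closed [OF assms(1), of "\<zero>\<^bsub>M\<^esub>"] by simp
qed

lemma bilI:
  assumes "\<And>n. n \<in> carrier N \<Longrightarrow> (\<lambda>m. \<beta> m n) \<in> linear_maps K M G"
    and "\<And>m. m \<in> carrier M \<Longrightarrow> (\<lambda>n. \<beta> m n) \<in> linear_maps K N G"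
  shows "\<beta> \<in> bilinear_maps K M N G"
  using assms by (simp add: bilinear_maps_def)

lemma bil_left: "\<lbrakk>\<beta> \<in> bilinear_maps K M N G; n \<in> carrier N\<rbrakk> \<Longrightarrow> (\<lambda>m. \<beta> m n) \<in> linear_maps K M G"
  by (simp add: bilinear_maps_def)

lemma bil_right: "\<lbrakk>\<beta> \<in> bilinear_maps K M N G; m \<in> carrier M\<rbrakk> \<Longrightarrow> \<beta> m \<in> linear_maps K N G"
  by (simp add: bilinear_maps_def)

lemma bil_closed:
  "\<lbrakk>\<beta> \<in> bilinear_maps K M N G; m \<in> carrier M; n \<in> carrier N\<rbrakk> \<Longrightarrow> \<beta> m n \<in> carrier G"
  using bil_right lin_closed by fastforce

lemma lin_id: "(\<lambda>x. x) \<in> linear_maps K M M"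
  by (simp add: linear_maps_def)

lemma lin_comp:
  "\<lbrakk>u \<in> linear_maps K N G; f \<in> linear_maps K M N\<rbrakk> \<Longrightarrow> (\<lambda>x. u (f x)) \<in> linear_maps K M G"
  by (simp add: linear_maps_def Pi_iff)

lemma lin_scale:
  assumes "module K N" "c \<in> carrier K" "f \<in> linear_maps K M N"
  shows "(\<lambda>x. c \<odot>\<^bsub>N\<^esub> f x) \<in> linear_maps K M N"
proof -
  interpret module K N by fact
  show ?thesis
    by (rule linI) (use assms(2) lin_closed [OF assms(3)] in
        \<open>simp_all add: lin_add [OF assms(3)] lin_smult [OF assms(3)] smult_r_distr
          m_comm flip: smult_assoc1\<close>)
qed

lemma ground_simps [simp]:
  "carrier (ground K) = carrier K" "add (ground K) = add K" "\<zero>\<^bsub>ground K\<^esub> = \<zero>\<^bsub>K\<^esub>"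
  "mult (ground K) = mult K" "\<one>\<^bsub>ground K\<^esub> = \<one>\<^bsub>K\<^esub>" "smult (ground K) = mult K"
  by (simp_all add: ground_def ring.extend_def)

lemma module_ground:
  fixes K :: "'k ring" assumes "cring K" shows "module K (ground K)"
proof (rule moduleI)
  interpret cring K by fact
  show "cring K" by fact
  show "abelian_group (ground K)"
    by (rule abelian_groupI) (auto simp: a_ac intro: add.l_inv_ex)
qed (auto simp: cring.cring_simprules [OF assms] monoid.r_one [OF ring.is_monoid [OF cring.axioms(1) [OF assms]]])

lemma lin_scale_left:
  assumes "module K N" "y \<in> carrier N" "f \<in> linear_maps K M (ground K)"
  shows "(\<lambda>x. f x \<odot>\<^bsub>N\<^esub> y) \<in> linear_maps K M N"
proof -
  interpret module K N by fact
  show ?thesis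
    by (rule linI) (use assms(2) lin_closed [OF assms(3)] in
        \<open>simp_all add: lin_add [OF assms(3)] lin_smult [OF assms(3)] smult_l_distr smult_assoc1\<close>)
qed

lemma lin_ground_mult_left:
  assumes "cring K" "y \<in> carrier K" "f \<in> linear_maps K M (ground K)"
  shows "(\<lambda>x. f x \<otimes>\<^bsub>K\<^esub> y) \<in> linear_maps K M (ground K)"
  using lin_scale_left [OF module_ground [OF assms(1)], of y f M] assms by simp

lemma lin_ground_mult_right:
  assumes "cring K" "y \<in> carrier K" "f \<in> linear_maps K M (ground K)"
  shows "(\<lambda>x. y \<otimes>\<^bsub>K\<^esub> f x) \<in> linear_maps K M (ground K)"
  using lin_scale [OF module_ground [OF assms(1)], of y f M] assms by simp

lemma lin_mult_left:
  assumes "unital_algebra K A" "y \<in> carrier A" "f \<in> linear_maps K M A"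
  shows "(\<lambda>x. f x \<otimes>\<^bsub>A\<^esub> y) \<in> linear_maps K M A"
proof -
  interpret unital_algebra K A by fact
  show ?thesis
    by (rule linI) (use assms(2) lin_closed [OF assms(3)] in
        \<open>simp_all add: lin_add [OF assms(3)] lin_smult [OF assms(3)] l_distr smult_mult_left\<close>)
qed

lemma lin_mult_right:
  assumes "unital_algebra K A" "y \<in> carrier A" "f \<in> linear_maps K M A"
  shows "(\<lambda>x. y \<otimes>\<^bsub>A\<^esub> f x) \<in> linear_maps K M A"
proof -
  interpret unital_algebra K A by fact
  show ?thesis
    by (rule linI) (use assms(2) lin_closed [OF assms(3)] in
        \<open>simp_all add: lin_add [OF assms(3)] lin_smult [OF assms(3)] r_distr smult_mult_right\<close>)
qed

text \<open>Stated for additive maps between groups because it is later applied to sums in the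
  restricted convolution ring, along evaluation at \<open>h\<close> and along the action on a module
  element; that ring is not given a scalar multiplication.\<close>

lemma additive_finsum:
  assumes "abelian_group M" "abelian_group N"
    and f: "\<And>x. x \<in> carrier M \<Longrightarrow> f x \<in> carrier N"
    and add: "\<And>x y. \<lbrakk>x \<in> carrier M; y \<in> carrier M\<rbrakk> \<Longrightarrow> f (x \<oplus>\<^bsub>M\<^esub> y) = f x \<oplus>\<^bsub>N\<^esub> f y"
    and "finite I" "\<And>i. i \<in> I \<Longrightarrow> g i \<in> carrier M"
  shows "f (\<Oplus>\<^bsub>M\<^esub>i\<in>I. g i) = (\<Oplus>\<^bsub>N\<^esub>i\<in>I. f (g i))"
proof -
  interpret M: abelian_group M by fact
  interpret N: abelian_group N by fact
  have zero: "f \<zero>\<^bsub>M\<^esub> = \<zero>\<^bsub>N\<^esub>"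
    using add [of "\<zero>\<^bsub>M\<^esub>" "\<zero>\<^bsub>M\<^esub>"] f [of "\<zero>\<^bsub>M\<^esub>"] by simp
  show ?thesis using assms(5,6)
  proof (induction I rule: finite_induct)
    case empty then show ?case by (simp add: zero)
  next
    case (insert i I)
    then have "g \<in> I \<rightarrow> carrier M" "(\<lambda>i. f (g i)) \<in> I \<rightarrow> carrier N" "f (g i) \<in> carrier N"
      using f by auto
    with insert show ?case
      by (simp add: M.finsum_insert N.finsum_insert add)
  qed
qed

lemma lin_finsum:
  assumes f: "f \<in> linear_maps K M N" and M: "abelian_group M" and N: "abelian_group N"
    and "finite I" "\<And>i. i \<in> I \<Longrightarrow> g i \<in> carrier M"
  shows "f (\<Oplus>\<^bsub>M\<^esub>i\<in>I. g i) = (\<Oplus>\<^bsub>N\<^esub>i\<in>I. f (g i))"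
  by (rule additive_finsum [OF M N lin_closed [OF f] lin_add [OF f] assms(4,5)])

lemma lin_finsum_fun:
  assumes N: "module K N" "abelian_group M" and "finite I" "\<And>i. i \<in> I \<Longrightarrow> f i \<in> linear_maps K M N"
    "\<And>c x. \<lbrakk>c \<in> carrier K; x \<in> carrier M\<rbrakk> \<Longrightarrow> c \<odot>\<^bsub>M\<^esub> x \<in> carrier M"
  shows "(\<lambda>x. \<Oplus>\<^bsub>N\<^esub>i\<in>I. f i x) \<in> linear_maps K M N"
proof -
  interpret N: module K N by fact
  interpret M: abelian_group M by fact
  have c: "f i x \<in> carrier N" if "i \<in> I" "x \<in> carrier M" for i x
    using assms(4) that by (blast intro: lin_closed)
  show ?thesis
  proof (rule linI)
    fix x y assume xy: "x \<in> carrier M" "y \<in> carrier M"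
    have "(\<Oplus>\<^bsub>N\<^esub>i\<in>I. f i (x \<oplus>\<^bsub>M\<^esub> y)) = (\<Oplus>\<^bsub>N\<^esub>i\<in>I. f i x \<oplus>\<^bsub>N\<^esub> f i y)"
      using xy c assms(4) by (intro N.finsum_cong') (auto simp: lin_add [OF assms(4)])
    also have "\<dots> = (\<Oplus>\<^bsub>N\<^esub>i\<in>I. f i x) \<oplus>\<^bsub>N\<^esub> (\<Oplus>\<^bsub>N\<^esub>i\<in>I. f i y)"
      using xy c by (intro N.finsum_addf) auto
    finally show "(\<Oplus>\<^bsub>N\<^esub>i\<in>I. f i (x \<oplus>\<^bsub>M\<^esub> y)) = (\<Oplus>\<^bsub>N\<^esub>i\<in>I. f i x) \<oplus>\<^bsub>N\<^esub> (\<Oplus>\<^bsub>N\<^esub>i\<in>I. f i y)" .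
  next
    fix d x assume dx: "d \<in> carrier K" "x \<in> carrier M"
    have "(\<Oplus>\<^bsub>N\<^esub>i\<in>I. f i (d \<odot>\<^bsub>M\<^esub> x)) = (\<Oplus>\<^bsub>N\<^esub>i\<in>I. d \<odot>\<^bsub>N\<^esub> f i x)"
      using dx c assms(4) by (intro N.finsum_cong') (auto simp: lin_smult [OF assms(4)])
    also have "\<dots> = d \<odot>\<^bsub>N\<^esub> (\<Oplus>\<^bsub>N\<^esub>i\<in>I. f i x)"
      using dx c
      by (subst lin_finsum [where K = K and f = "\<lambda>y. d \<odot>\<^bsub>N\<^esub> y" and M = N and N = N])
        (auto intro!: lin_scale [OF N(1)] lin_id assms(3) N.abelian_group_axioms)
    finally show "(\<Oplus>\<^bsub>N\<^esub>i\<in>I. f i (d \<odot>\<^bsub>M\<^esub> x)) = d \<odot>\<^bsub>N\<^esub> (\<Oplus>\<^bsub>N\<^esub>i\<in>I. f i x)" .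
  qed (use c in \<open>auto intro: N.finsum_closed\<close>)
qed


section \<open>Sweedler calculus over a commutative ring\<close>

lemma module_balanced_pair:
  assumes "module K M" "module K N"
  shows "balanced_pair (carrier K) (\<lambda>m c. c \<odot>\<^bsub>M\<^esub> m) (\<lambda>c n. c \<odot>\<^bsub>N\<^esub> n) M N"
proof -
  interpret M: module K M by fact
  interpret N: module K N by fact
  show ?thesis
    by unfold_locales auto
qed

text \<open>The description mentions the target only through its carrier and addition. So
  \<open>tgroup\<close> may be exchanged for \<open>tensor\<close>, and the ring \<open>K\<close>
  for the module \<open>ground K\<close>, which the linear calculus needs.\<close>

lemma bal_lift_target:
  assumes "carrier G = carrier G'" "add G = add G'"
  shows "bal_lift R ra la M N G = bal_lift R ra la M N G'"
  unfolding bal_lift_def hom_def by (simp add: assms)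

lemma sweedler_target:
  assumes "carrier G = carrier G'" "add G = add G'"
  shows "sweedler K M N G = sweedler K M N G'"
  unfolding sweedler_def by (rule bal_lift_target [OF assms])

lemma tgroup_tensor [simp]:
  "carrier (tgroup K M N) = carrier (tensor K M N)" "add (tgroup K M N) = add (tensor K M N)"
  "\<zero>\<^bsub>tgroup K M N\<^esub> = \<zero>\<^bsub>tensor K M N\<^esub>"
  by (simp_all add: tensor_def)

lemma sweedler_tgroup: "sweedler K M N (tgroup K P Q) = sweedler K M N (tensor K P Q)"
  by (rule sweedler_target) simp_all

lemma sweedler_ring: "sweedler K M N K = sweedler K M N (ground K)"
  by (rule sweedler_target) simp_all

locale module_pair =
  fixes K :: "'k ring" and M :: "('k, 'm) module" and N :: "('k, 'n) module"
  assumes module_M: "module K M" and module_N: "module K N"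
begin

sublocale B: balanced_pair "carrier K" "\<lambda>m c. c \<odot>\<^bsub>M\<^esub> m" "\<lambda>c n. c \<odot>\<^bsub>N\<^esub> n" M N
  by (rule module_balanced_pair [OF module_M module_N])

sublocale M: module K M by (rule module_M)
sublocale N: module K N by (rule module_N)

lemma carrier_tensor: "carrier (tensor K M N) = carrier B.T"
  by (simp add: tensor_def tgroup_def Let_def)

lemma add_tensor: "add (tensor K M N) = mult B.T"
  by (simp add: tensor_def tgroup_def Let_def)

lemma zero_tensor: "\<zero>\<^bsub>tensor K M N\<^esub> = \<one>\<^bsub>B.T\<^esub>"
  by (simp add: tensor_def tgroup_def Let_def)

lemmas tensor_ops = carrier_tensor add_tensor zero_tensor

lemma abelian_group_tensor: "abelian_group (tensor K M N)"
proof -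
  interpret T: comm_group B.T by (rule B.comm_group_T)
  show ?thesis
    by (rule abelian_groupI) (auto simp only: tensor_ops T.m_ac T.m_closed T.one_closed T.l_one T.r_one intro: T.l_inv_ex)
qed

lemma abelian_group_tgroup: "abelian_group (tgroup K M N)"
proof -
  interpret T: abelian_group "tensor K M N" by (rule abelian_group_tensor)
  show ?thesis
    by (rule abelian_groupI)
      (auto simp only: tgroup_tensor T.a_ac T.a_closed T.zero_closed T.l_zero T.r_zero intro: T.add.l_inv_ex)
qed

lemma pure_closed: "\<lbrakk>m \<in> carrier M; n \<in> carrier N\<rbrakk> \<Longrightarrow> tpure K M N m n \<in> carrier (tensor K M N)"
  by (simp add: tpure_def tensor_ops B.pure_closed)

lemma induct [consumes 1, case_names zero add]:
  assumes "t \<in> carrier (tensor K M N)" "P \<zero>\<^bsub>tensor K M N\<^esub>"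
    and "\<And>m n t. \<lbrakk>m \<in> carrier M; n \<in> carrier N; t \<in> carrier (tensor K M N); P t\<rbrakk>
           \<Longrightarrow> P (tpure K M N m n \<oplus>\<^bsub>tensor K M N\<^esub> t)"
  shows "P t"
  using assms B.tens_induct [of t P] by (simp add: tensor_ops tpure_def)

lemma balancedI:
  assumes "module K G" "\<beta> \<in> bilinear_maps K M N G"
  shows "B.balanced G \<beta>"
proof -
  note l = bil_left [OF assms(2)] and r = bil_right [OF assms(2)]
  show ?thesis
    unfolding B.balanced_def
    using lin_closed [OF r] lin_add [OF l] lin_add [OF r] lin_smult [OF l] lin_smult [OF r]
    by auto
qed

lemma sweedler_closed:
  assumes "module K G" "\<beta> \<in> bilinear_maps K M N G" "t \<in> carrier (tensor K M N)"
  shows "sweedler K M N G t \<beta> \<in> carrier G"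
  using B.bal_lift_closed [OF module.axioms(2) [OF assms(1)] balancedI [OF assms(1,2)]] assms(3)
  by (simp add: tensor_ops sweedler_def)

lemma sweedler_add:
  assumes "module K G" "\<beta> \<in> bilinear_maps K M N G"
    "s \<in> carrier (tensor K M N)" "t \<in> carrier (tensor K M N)"
  shows "sweedler K M N G (s \<oplus>\<^bsub>tensor K M N\<^esub> t) \<beta> = sweedler K M N G s \<beta> \<oplus>\<^bsub>G\<^esub> sweedler K M N G t \<beta>"
  using B.bal_lift_add [OF module.axioms(2) [OF assms(1)] balancedI [OF assms(1,2)]] assms(3,4)
  by (simp add: tensor_ops sweedler_def)

lemma sweedler_pure:
  assumes "module K G" "\<beta> \<in> bilinear_maps K M N G" "m \<in> carrier M" "n \<in> carrier N"
  shows "sweedler K M N G (tpure K M N m n) \<beta> = \<beta> m n"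
  using B.bal_lift_pure [OF module.axioms(2) [OF assms(1)] balancedI [OF assms(1,2)]] assms(3,4)
  by (simp add: tpure_def sweedler_def)

lemma sweedler_zero:
  assumes "module K G" "\<beta> \<in> bilinear_maps K M N G"
  shows "sweedler K M N G \<zero>\<^bsub>tensor K M N\<^esub> \<beta> = \<zero>\<^bsub>G\<^esub>"
  using B.bal_lift_one [OF module.axioms(2) [OF assms(1)] balancedI [OF assms(1,2)]]
  by (simp add: tensor_ops sweedler_def)

lemma pure_add_left:
  "\<lbrakk>m \<in> carrier M; m' \<in> carrier M; n \<in> carrier N\<rbrakk> \<Longrightarrow>
     tpure K M N (m \<oplus>\<^bsub>M\<^esub> m') n = tpure K M N m n \<oplus>\<^bsub>tensor K M N\<^esub> tpure K M N m' n"
  by (simp add: tpure_def tensor_ops B.pure_add_left)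

lemma pure_add_right:
  "\<lbrakk>m \<in> carrier M; n \<in> carrier N; n' \<in> carrier N\<rbrakk> \<Longrightarrow>
     tpure K M N m (n \<oplus>\<^bsub>N\<^esub> n') = tpure K M N m n \<oplus>\<^bsub>tensor K M N\<^esub> tpure K M N m n'"
  by (simp add: tpure_def tensor_ops B.pure_add_right)

lemma pure_smult:
  "\<lbrakk>c \<in> carrier K; m \<in> carrier M; n \<in> carrier N\<rbrakk> \<Longrightarrow>
     tpure K M N (c \<odot>\<^bsub>M\<^esub> m) n = tpure K M N m (c \<odot>\<^bsub>N\<^esub> n)"
  by (simp add: tpure_def B.pure_balanced)

context
  fixes c assumes c: "c \<in> carrier K"
begin

text \<open>The scalar action on the tensor product is itself defined by a lift. Until it is known
  to give a module, only the universal property for abelian groups is available, so the lift is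
  handled with target \<open>tgroup\<close> and the lemmas on \<open>bal_lift\<close>.\<close>

lemma smult_balanced: "B.balanced (tgroup K M N) (\<lambda>m n. tpure K M N (c \<odot>\<^bsub>M\<^esub> m) n)"
proof -
  have "d \<odot>\<^bsub>M\<^esub> (e \<odot>\<^bsub>M\<^esub> m) = e \<odot>\<^bsub>M\<^esub> (d \<odot>\<^bsub>M\<^esub> m)"
    if "d \<in> carrier K" "e \<in> carrier K" "m \<in> carrier M" for d e m
    using that by (simp add: M.R.m_comm flip: M.smult_assoc1)
  then show ?thesis
    using c unfolding B.balanced_def
    by (simp add: pure_closed pure_add_left pure_add_right M.smult_r_distr flip: pure_smult)
qed

lemma smult_tensor:
  "c \<odot>\<^bsub>tensor K M N\<^esub> t = bal_lift (carrier K) (\<lambda>m c. c \<odot>\<^bsub>M\<^esub> m) (\<lambda>c n. c \<odot>\<^bsub>N\<^esub> n) M N (tgroup K M N) t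
     (\<lambda>m n. tpure K M N (c \<odot>\<^bsub>M\<^esub> m) n)"
  by (simp add: tensor_def sweedler_def del: tgroup_tensor)

lemma smult_tensor_pure:
  "\<lbrakk>m \<in> carrier M; n \<in> carrier N\<rbrakk> \<Longrightarrow>
     c \<odot>\<^bsub>tensor K M N\<^esub> tpure K M N m n = tpure K M N (c \<odot>\<^bsub>M\<^esub> m) n"
  by (simp only: smult_tensor tpure_def)
    (rule B.bal_lift_pure [OF abelian_group_tgroup smult_balanced [unfolded tpure_def]])

lemma smult_tensor_closed:
  "t \<in> carrier (tensor K M N) \<Longrightarrow> c \<odot>\<^bsub>tensor K M N\<^esub> t \<in> carrier (tensor K M N)"
  using B.bal_lift_closed [OF abelian_group_tgroup smult_balanced]
  by (simp add: smult_tensor tensor_ops)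

lemma smult_tensor_add:
  "\<lbrakk>s \<in> carrier (tensor K M N); t \<in> carrier (tensor K M N)\<rbrakk> \<Longrightarrow>
     c \<odot>\<^bsub>tensor K M N\<^esub> (s \<oplus>\<^bsub>tensor K M N\<^esub> t)
       = c \<odot>\<^bsub>tensor K M N\<^esub> s \<oplus>\<^bsub>tensor K M N\<^esub> c \<odot>\<^bsub>tensor K M N\<^esub> t"
  using B.bal_lift_add [OF abelian_group_tgroup smult_balanced]
  by (simp add: smult_tensor tensor_ops)

lemma smult_tensor_zero: "c \<odot>\<^bsub>tensor K M N\<^esub> \<zero>\<^bsub>tensor K M N\<^esub> = \<zero>\<^bsub>tensor K M N\<^esub>"
  using B.bal_lift_one [OF abelian_group_tgroup smult_balanced]
  by (simp add: smult_tensor tensor_ops)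

end

lemma module_tensor: "module K (tensor K M N)"
proof (rule moduleI)
  interpret T: abelian_group "tensor K M N" by (rule abelian_group_tensor)
  show "cring K" by (rule M.R.is_cring)
  show "abelian_group (tensor K M N)" by (rule abelian_group_tensor)
  fix c t assume c: "c \<in> carrier K" and t: "t \<in> carrier (tensor K M N)"
  then show "c \<odot>\<^bsub>tensor K M N\<^esub> t \<in> carrier (tensor K M N)" by (rule smult_tensor_closed)
  {
    fix s assume "s \<in> carrier (tensor K M N)"
    then show "c \<odot>\<^bsub>tensor K M N\<^esub> (t \<oplus>\<^bsub>tensor K M N\<^esub> s)
        = c \<odot>\<^bsub>tensor K M N\<^esub> t \<oplus>\<^bsub>tensor K M N\<^esub> c \<odot>\<^bsub>tensor K M N\<^esub> s"
      using c t by (simp add: smult_tensor_add)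
  }
  fix d assume d: "d \<in> carrier K"
  show "(c \<oplus>\<^bsub>K\<^esub> d) \<odot>\<^bsub>tensor K M N\<^esub> t
      = c \<odot>\<^bsub>tensor K M N\<^esub> t \<oplus>\<^bsub>tensor K M N\<^esub> d \<odot>\<^bsub>tensor K M N\<^esub> t"
    using t
  proof (induction t rule: induct)
    case zero then show ?case using c d by (simp add: smult_tensor_zero)
  next
    case (add m n t)
    then show ?case using c d
      by (simp add: smult_tensor_add pure_closed smult_tensor_pure M.smult_l_distr pure_add_left
          T.a_ac smult_tensor_closed)
  qed
  show "(c \<otimes>\<^bsub>K\<^esub> d) \<odot>\<^bsub>tensor K M N\<^esub> t = c \<odot>\<^bsub>tensor K M N\<^esub> (d \<odot>\<^bsub>tensor K M N\<^esub> t)"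
    using t
  proof (induction t rule: induct)
    case zero then show ?case using c d by (simp add: smult_tensor_zero)
  next
    case (add m n t)
    then show ?case using c d
      by (simp add: smult_tensor_add pure_closed smult_tensor_pure M.smult_assoc1
          smult_tensor_closed)
  qed
next
  fix t assume "t \<in> carrier (tensor K M N)"
  then show "\<one>\<^bsub>K\<^esub> \<odot>\<^bsub>tensor K M N\<^esub> t = t"
  proof (induction t rule: induct)
    case zero then show ?case by (simp add: smult_tensor_zero)
  next
    case (add m n t)
    then show ?case by (simp add: smult_tensor_add pure_closed smult_tensor_pure)
  qed
qed

lemma pure_bilinear: "tpure K M N \<in> bilinear_maps K M N (tensor K M N)"
  by (intro bilI linI)
    (simp_all add: pure_closed pure_add_left pure_add_right smult_tensor_pure flip: pure_smult)

lemma sweedler_linear: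
  assumes "module K G" "\<beta> \<in> bilinear_maps K M N G"
  shows "(\<lambda>t. sweedler K M N G t \<beta>) \<in> linear_maps K (tensor K M N) G"
proof (rule linI)
  interpret G: module K G by fact
  interpret T: module K "tensor K M N" by (rule module_tensor)
  fix c t assume c: "c \<in> carrier K" and t: "t \<in> carrier (tensor K M N)"
  show "sweedler K M N G (c \<odot>\<^bsub>tensor K M N\<^esub> t) \<beta> = c \<odot>\<^bsub>G\<^esub> sweedler K M N G t \<beta>"
    using t
  proof (induction t rule: induct)
    case zero then show ?case using c by (simp add: sweedler_zero [OF assms])
  next
    case (add m n t)
    then show ?case using c
      by (simp add: sweedler_add [OF assms] pure_closed smult_tensor_pure sweedler_pure [OF assms]
          lin_smult [OF bil_left [OF assms(2)]] T.smult_r_distr G.smult_r_distr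
          sweedler_closed [OF assms] bil_closed [OF assms(2)])
  qed
qed (simp_all add: sweedler_closed [OF assms] sweedler_add [OF assms])

lemma tensor_ext:
  assumes "module K G" "f \<in> linear_maps K (tensor K M N) G" "g \<in> linear_maps K (tensor K M N) G"
    and "\<And>m n. \<lbrakk>m \<in> carrier M; n \<in> carrier N\<rbrakk> \<Longrightarrow> f (tpure K M N m n) = g (tpure K M N m n)"
    and "t \<in> carrier (tensor K M N)"
  shows "f t = g t"
  using assms(5)
proof (induction t rule: induct)
  case zero
  then show ?case
    using lin_zero assms(1-3) module.axioms(2) abelian_group_tensor by metis
next
  case (add m n t)
  then show ?case by (simp add: lin_add [OF assms(2)] lin_add [OF assms(3)] pure_closed assms(4))
qed

end

lemma module_tensor: "\<lbrakk>module K M; module K N\<rbrakk> \<Longrightarrow> module K (tensor K M N)"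
  by (simp add: module_pair.intro module_pair.module_tensor)

lemma tpure_closed:
  "\<lbrakk>module K M; module K N; m \<in> carrier M; n \<in> carrier N\<rbrakk>
     \<Longrightarrow> tpure K M N m n \<in> carrier (tensor K M N)"
  by (simp add: module_pair.intro module_pair.pure_closed)

lemma lin_tpure_left:
  assumes "module K M" "module K N" "n \<in> carrier N" "f \<in> linear_maps K X M"
  shows "(\<lambda>x. tpure K M N (f x) n) \<in> linear_maps K X (tensor K M N)"
  by (rule lin_comp [OF bil_left [OF module_pair.pure_bilinear
        [OF module_pair.intro [OF assms(1,2)]] assms(3)] assms(4)])

lemma lin_tpure_right:
  assumes "module K M" "module K N" "m \<in> carrier M" "f \<in> linear_maps K X N"
  shows "(\<lambda>x. tpure K M N m (f x)) \<in> linear_maps K X (tensor K M N)"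
  by (rule lin_comp [OF bil_right [OF module_pair.pure_bilinear
        [OF module_pair.intro [OF assms(1,2)]] assms(3)] assms(4)])

lemma sw_closed:
  "\<lbrakk>module K M; module K N; module K G; t \<in> carrier (tensor K M N); \<beta> \<in> bilinear_maps K M N G\<rbrakk>
     \<Longrightarrow> sweedler K M N G t \<beta> \<in> carrier G"
  by (simp add: module_pair.intro module_pair.sweedler_closed)

lemma sw_pure:
  "\<lbrakk>module K M; module K N; module K G; \<beta> \<in> bilinear_maps K M N G; m \<in> carrier M; n \<in> carrier N\<rbrakk>
     \<Longrightarrow> sweedler K M N G (tpure K M N m n) \<beta> = \<beta> m n"
  by (simp add: module_pair.intro module_pair.sweedler_pure)

lemma sw_cong:
  assumes "\<And>m n. \<lbrakk>m \<in> carrier M; n \<in> carrier N\<rbrakk> \<Longrightarrow> \<beta> m n = \<gamma> m n"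
  shows "sweedler K M N G t \<beta> = sweedler K M N G t \<gamma>"
  unfolding sweedler_def by (rule bal_lift_cong [OF assms])

lemma lin_sw_arg:
  assumes "module K M" "module K N" "module K G" "\<beta> \<in> bilinear_maps K M N G"
    "f \<in> linear_maps K X (tensor K M N)"
  shows "(\<lambda>x. sweedler K M N G (f x) \<beta>) \<in> linear_maps K X G"
  by (rule lin_comp [OF module_pair.sweedler_linear
        [OF module_pair.intro [OF assms(1,2)] assms(3,4)] assms(5)])

text \<open>Concerns a parameter in the body rather than in the tensor; induction on
  \<open>t\<close> reduces the claim to pure tensors, where it is the premise \<open>l\<close>.
  Together with \<open>lin_sw_arg\<close> it lets resolution prove the linearity of nested Sweedler
  expressions in any variable.\<close>

lemma lin_sw_body:
  assumes M: "module K M" and N: "module K N" and G: "module K G" and X: "module K X"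
    and t: "t \<in> carrier (tensor K M N)"
    and b: "\<And>x. x \<in> carrier X \<Longrightarrow> (\<lambda>m n. \<beta> x m n) \<in> bilinear_maps K M N G"
    and l: "\<And>m n. \<lbrakk>m \<in> carrier M; n \<in> carrier N\<rbrakk> \<Longrightarrow> (\<lambda>x. \<beta> x m n) \<in> linear_maps K X G"
  shows "(\<lambda>x. sweedler K M N G t (\<lambda>m n. \<beta> x m n)) \<in> linear_maps K X G"
proof -
  interpret module_pair K M N using M N by (simp add: module_pair.intro)
  interpret G: module K G by fact
  interpret X: module K X by fact
  have "bb \<in> bilinear_maps K M N G \<Longrightarrow> sweedler K M N G s bb \<in> carrier G"
    if "s \<in> carrier (tensor K M N)" for bb s
    using sweedler_closed [OF G _ that] .
  note c = this
  show ?thesis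
  proof (rule linI)
    fix x y assume xy: "x \<in> carrier X" "y \<in> carrier X"
    note b' = b [OF xy(1)] b [OF xy(2)] b [OF X.M.a_closed [OF xy]]
    show "sweedler K M N G t (\<beta> (x \<oplus>\<^bsub>X\<^esub> y)) = sweedler K M N G t (\<beta> x) \<oplus>\<^bsub>G\<^esub> sweedler K M N G t (\<beta> y)"
      using t
    proof (induction t rule: induct)
      case zero then show ?case using b' by (simp add: sweedler_zero [OF G])
    next
      case (add m n t)
      have l': "\<beta> (x \<oplus>\<^bsub>X\<^esub> y) m n = \<beta> x m n \<oplus>\<^bsub>G\<^esub> \<beta> y m n"
        using lin_add [OF l] add xy by simp
      show ?case
        using add b' l' bil_closed [OF b'(1)] bil_closed [OF b'(2)] c
        by (simp add: sweedler_add [OF G] sweedler_pure [OF G] pure_closed G.M.a_ac)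
    qed
  next
    fix d x assume d: "d \<in> carrier K" and x: "x \<in> carrier X"
    note b' = b [OF x] b [OF X.smult_closed [OF d x]]
    show "sweedler K M N G t (\<beta> (d \<odot>\<^bsub>X\<^esub> x)) = d \<odot>\<^bsub>G\<^esub> sweedler K M N G t (\<beta> x)"
      using t
    proof (induction t rule: induct)
      case zero then show ?case using b' d by (simp add: sweedler_zero [OF G])
    next
      case (add m n t)
      have l': "\<beta> (d \<odot>\<^bsub>X\<^esub> x) m n = d \<odot>\<^bsub>G\<^esub> \<beta> x m n"
        using lin_smult [OF l] add d x by simp
      show ?case
        using add b' l' bil_closed [OF b'(1)] c d
        by (simp add: sweedler_add [OF G] sweedler_pure [OF G] pure_closed G.smult_r_distr)
    qed
  qed (use b t in \<open>simp add: sweedler_closed [OF G]\<close>)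
qed

text \<open>The rule that moves a linear map into a Sweedler sum or, read backwards, out of it: both
  sides are linear in \<open>t\<close> and agree on pure tensors.\<close>

lemma lin_sw:
  assumes "module K M" "module K N" "module K G" "module K G'"
    "\<phi> \<in> linear_maps K G G'" "\<beta> \<in> bilinear_maps K M N G" "t \<in> carrier (tensor K M N)"
  shows "\<phi> (sweedler K M N G t \<beta>) = sweedler K M N G' t (\<lambda>m n. \<phi> (\<beta> m n))"
proof -
  interpret module_pair K M N using assms by (simp add: module_pair.intro)
  have b: "(\<lambda>m n. \<phi> (\<beta> m n)) \<in> bilinear_maps K M N G'"
    using lin_comp [OF assms(5) bil_left [OF assms(6)]]
      lin_comp [OF assms(5) bil_right [OF assms(6)]] by (rule bilI)
  show ?thesis
    by (rule tensor_ext [OF assms(4) _ _ _ assms(7)])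
      (use assms b in \<open>simp_all add: sweedler_linear sweedler_pure lin_comp [OF assms(5)]\<close>)
qed

text \<open>Fubini for two tensors that do not depend on each other. Both sides are linear in
  \<open>s\<close>, and for a pure \<open>s\<close> the sum over \<open>s\<close> disappears on both
  sides.\<close>

lemma sw_swap:
  assumes M: "module K M" and N: "module K N" and P: "module K P" and Q: "module K Q"
    and G: "module K G"
    and s: "s \<in> carrier (tensor K M N)" and t: "t \<in> carrier (tensor K P Q)"
    and b1: "\<And>p q. \<lbrakk>p \<in> carrier P; q \<in> carrier Q\<rbrakk> \<Longrightarrow> (\<lambda>m n. \<gamma> m n p q) \<in> bilinear_maps K M N G"
    and b2: "\<And>m n. \<lbrakk>m \<in> carrier M; n \<in> carrier N\<rbrakk> \<Longrightarrow> (\<lambda>p q. \<gamma> m n p q) \<in> bilinear_maps K P Q G"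
  shows "sweedler K M N G s (\<lambda>m n. sweedler K P Q G t (\<lambda>p q. \<gamma> m n p q))
       = sweedler K P Q G t (\<lambda>p q. sweedler K M N G s (\<lambda>m n. \<gamma> m n p q))"
proof -
  interpret module_pair K M N using M N by (simp add: module_pair.intro)
  have 1: "(\<lambda>m n. sweedler K P Q G t (\<lambda>p q. \<gamma> m n p q)) \<in> bilinear_maps K M N G"
    by (intro bilI lin_sw_body [OF P Q G _ t] M N b2) (use bil_left [OF b1] bil_right [OF b1] in auto)
  have 2: "(\<lambda>p q. sweedler K M N G s' (\<lambda>m n. \<gamma> m n p q)) \<in> bilinear_maps K P Q G"
    if "s' \<in> carrier (tensor K M N)" for s'
    by (intro bilI lin_sw_body [OF M N G _ that] P Q b1) (use bil_left [OF b2] bil_right [OF b2] in auto)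
  show ?thesis
  proof (rule tensor_ext [OF G _ _ _ s, where g = "\<lambda>s. sweedler K P Q G t (\<lambda>p q. sweedler K M N G s (\<lambda>m n. \<gamma> m n p q))"])
    show "(\<lambda>s. sweedler K M N G s (\<lambda>m n. sweedler K P Q G t (\<lambda>p q. \<gamma> m n p q)))
        \<in> linear_maps K (tensor K M N) G"
      by (rule sweedler_linear [OF G 1])
    show "(\<lambda>s. sweedler K P Q G t (\<lambda>p q. sweedler K M N G s (\<lambda>m n. \<gamma> m n p q)))
        \<in> linear_maps K (tensor K M N) G"
      by (rule lin_sw_body [OF P Q G module_tensor t 2]) (auto intro: sweedler_linear [OF G] b1)
    fix m n assume mn: "m \<in> carrier M" "n \<in> carrier N"
    show "sweedler K M N G (tpure K M N m n) (\<lambda>m n. sweedler K P Q G t (\<lambda>p q. \<gamma> m n p q))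
      = sweedler K P Q G t (\<lambda>p q. sweedler K M N G (tpure K M N m n) (\<lambda>m n. \<gamma> m n p q))"
      using mn by (simp add: sweedler_pure [OF G 1] sw_cong [OF sweedler_pure [OF G b1]])
  qed
qed

text \<open>The instance of \<open>lin_sw\<close> for the linear map induced by
  \<open>\<beta>\<close>. It flattens a sum over a tensor that is itself given by a Sweedler
  expression.\<close>

lemma sw_sw:
  assumes "module K M" "module K N" "module K P" "module K Q" "module K G"
    and "s \<in> carrier (tensor K M N)"
    and "(\<lambda>m n. \<gamma> m n) \<in> bilinear_maps K M N (tensor K P Q)" "\<beta> \<in> bilinear_maps K P Q G"
  shows "sweedler K P Q G (sweedler K M N (tensor K P Q) s (\<lambda>m n. \<gamma> m n)) \<beta>
       = sweedler K M N G s (\<lambda>m n. sweedler K P Q G (\<gamma> m n) \<beta>)"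
  by (rule lin_sw [where \<phi> = "\<lambda>z. sweedler K P Q G z \<beta>"])
    (use assms in \<open>auto intro!: module_tensor module_pair.sweedler_linear module_pair.intro\<close>)

text \<open>The identity is the linear map induced by \<open>tpure\<close>. Read backwards this puts
  a bare tensor into Sweedler form, so that the other rules apply to it.\<close>

lemma sw_tpure:
  assumes "module K M" "module K N" "t \<in> carrier (tensor K M N)"
  shows "sweedler K M N (tensor K M N) t (tpure K M N) = t"
proof -
  interpret module_pair K M N using assms by (simp add: module_pair.intro)
  show ?thesis
    by (rule tensor_ext [OF module_tensor sweedler_linear [OF module_tensor pure_bilinear] lin_id _ assms(3)])
      (simp add: sweedler_pure [OF module_tensor pure_bilinear])
qed

lemma lin_add_fun:
  assumes "module K N" "f \<in> linear_maps K M N" "g \<in> linear_maps K M N"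
  shows "(\<lambda>x. f x \<oplus>\<^bsub>N\<^esub> g x) \<in> linear_maps K M N"
proof -
  interpret module K N by fact
  show ?thesis
    by (rule linI) (simp_all add: lin_closed [OF assms(2)] lin_closed [OF assms(3)]
        lin_add [OF assms(2)] lin_add [OF assms(3)] lin_smult [OF assms(2)] lin_smult [OF assms(3)]
        M.a_ac smult_r_distr)
qed

lemma sw_add_body:
  assumes "module K M" "module K N" "module K G" "t \<in> carrier (tensor K M N)"
    "\<beta> \<in> bilinear_maps K M N G" "\<gamma> \<in> bilinear_maps K M N G"
  shows "sweedler K M N G t (\<lambda>m n. \<beta> m n \<oplus>\<^bsub>G\<^esub> \<gamma> m n) = sweedler K M N G t \<beta> \<oplus>\<^bsub>G\<^esub> sweedler K M N G t \<gamma>"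
proof -
  interpret module_pair K M N using assms by (simp add: module_pair.intro)
  interpret G: module K G by fact
  have b: "(\<lambda>m n. \<beta> m n \<oplus>\<^bsub>G\<^esub> \<gamma> m n) \<in> bilinear_maps K M N G"
    by (intro bilI lin_add_fun assms(3) bil_left [OF assms(5)] bil_left [OF assms(6)]
        bil_right [OF assms(5)] bil_right [OF assms(6)])
  show ?thesis
    by (rule tensor_ext [OF assms(3) sweedler_linear [OF assms(3) b] lin_add_fun [OF assms(3)
          sweedler_linear [OF assms(3,5)] sweedler_linear [OF assms(3,6)]] _ assms(4)])
      (simp add: sweedler_pure [OF assms(3)] b assms(5,6))
qed

text \<open>\<open>\<gamma>\<close> induces a linear map on \<open>(M \<otimes> N) \<otimes> P\<close>; the two premises together say that it is trilinear.\<close>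

lemma trilinear_functional:
  assumes M: "module K M" and N: "module K N" and P: "module K P" and G: "module K G"
    and xy: "\<And>z. z \<in> carrier P \<Longrightarrow> (\<lambda>x y. \<gamma> x y z) \<in> bilinear_maps K M N G"
    and z: "\<And>x y. \<lbrakk>x \<in> carrier M; y \<in> carrier N\<rbrakk> \<Longrightarrow> (\<lambda>z. \<gamma> x y z) \<in> linear_maps K P G"
  obtains \<Phi> where "\<Phi> \<in> linear_maps K (tensor K (tensor K M N) P) G"
    and "\<And>s z. \<lbrakk>s \<in> carrier (tensor K M N); z \<in> carrier P\<rbrakk> \<Longrightarrow>
           \<Phi> (tpure K (tensor K M N) P s z) = sweedler K M N G s (\<lambda>x y. \<gamma> x y z)"
    and "\<And>x y z. \<lbrakk>x \<in> carrier M; y \<in> carrier N; z \<in> carrier P\<rbrakk> \<Longrightarrow>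
           \<Phi> (tpure K (tensor K M N) P (tpure K M N x y) z) = \<gamma> x y z"
proof -
  have MN: "module K (tensor K M N)" by (rule module_tensor [OF M N])
  interpret MN: module_pair K M N using M N by (rule module_pair.intro)
  interpret MNP: module_pair K "tensor K M N" P using MN P by (rule module_pair.intro)
  have b: "(\<lambda>s z. sweedler K M N G s (\<lambda>x y. \<gamma> x y z)) \<in> bilinear_maps K (tensor K M N) P G"
    by (intro bilI lin_sw_arg lin_sw_body xy z assms lin_id)
  let ?\<Phi> = "\<lambda>t. sweedler K (tensor K M N) P G t (\<lambda>s z. sweedler K M N G s (\<lambda>x y. \<gamma> x y z))"
  have s: "?\<Phi> (tpure K (tensor K M N) P s z) = sweedler K M N G s (\<lambda>x y. \<gamma> x y z)"
    if "s \<in> carrier (tensor K M N)" "z \<in> carrier P" for s z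
    by (rule sw_pure [OF MN P G b that])
  show thesis
  proof (rule that [of ?\<Phi>])
    show "?\<Phi> \<in> linear_maps K (tensor K (tensor K M N) P) G"
      by (rule MNP.sweedler_linear [OF G b])
  qed (use s in \<open>simp_all add: sw_pure [OF M N G xy] tpure_closed [OF M N]\<close>)
qed

lemma sw_finsum_body:
  assumes M: "module K M" and N: "module K N" and G: "module K G" and t: "t \<in> carrier (tensor K M N)"
    and I: "finite I" and b: "\<And>i. i \<in> I \<Longrightarrow> \<beta> i \<in> bilinear_maps K M N G"
  shows "sweedler K M N G t (\<lambda>m n. \<Oplus>\<^bsub>G\<^esub>i\<in>I. \<beta> i m n) = (\<Oplus>\<^bsub>G\<^esub>i\<in>I. sweedler K M N G t (\<beta> i))"
proof -
  interpret module_pair K M N using M N by (rule module_pair.intro)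
  interpret G: module K G by fact
  interpret T: module K "tensor K M N" by (rule module_tensor)
  have 1: "(\<lambda>m n. \<Oplus>\<^bsub>G\<^esub>i\<in>I. \<beta> i m n) \<in> bilinear_maps K M N G"
    by (intro bilI lin_finsum_fun G I M.M.abelian_group_axioms N.M.abelian_group_axioms
        M.smult_closed N.smult_closed bil_left [OF b] bil_right [OF b])
  have 2: "(\<lambda>t. \<Oplus>\<^bsub>G\<^esub>i\<in>I. sweedler K M N G t (\<beta> i)) \<in> linear_maps K (tensor K M N) G"
    by (intro lin_finsum_fun G I T.M.abelian_group_axioms T.smult_closed sweedler_linear b)
  show ?thesis
  proof (rule tensor_ext [OF G sweedler_linear [OF G 1] 2 _ t])
    fix m n assume mn: "m \<in> carrier M" "n \<in> carrier N"
    show "sweedler K M N G (tpure K M N m n) (\<lambda>m n. \<Oplus>\<^bsub>G\<^esub>i\<in>I. \<beta> i m n)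
      = (\<Oplus>\<^bsub>G\<^esub>i\<in>I. sweedler K M N G (tpure K M N m n) (\<beta> i))"
      unfolding sweedler_pure [OF G 1 mn]
      by (rule G.finsum_cong') (use mn in \<open>auto simp: sweedler_pure [OF G b] bil_closed [OF b]\<close>)
  qed
qed

section \<open>Dual bases\<close>

text \<open>Applied to \<open>H\<close> and, with vectors and functionals exchanged, to the dual of
  \<open>H\<close>.\<close>

locale dual_basis =
  fixes K :: "'k ring" and N :: "('k, 'n) module" and I :: "'i set"
    and b :: "'i \<Rightarrow> 'n" and d :: "'i \<Rightarrow> 'n \<Rightarrow> 'k"
  assumes module_N: "module K N" and finite_I: "finite I"
    and b_closed: "i \<in> I \<Longrightarrow> b i \<in> carrier N"
    and d_linear: "i \<in> I \<Longrightarrow> d i \<in> linear_maps K N (ground K)"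
    and expand: "x \<in> carrier N \<Longrightarrow> x = (\<Oplus>\<^bsub>N\<^esub>i\<in>I. d i x \<odot>\<^bsub>N\<^esub> b i)"
begin

sublocale N: module K N by (rule module_N)

lemma d_closed: "\<lbrakk>i \<in> I; x \<in> carrier N\<rbrakk> \<Longrightarrow> d i x \<in> carrier K"
  using lin_closed [OF d_linear] by simp

lemma linear_expand:
  assumes "f \<in> linear_maps K N G" "module K G" "x \<in> carrier N"
  shows "f x = (\<Oplus>\<^bsub>G\<^esub>i\<in>I. d i x \<odot>\<^bsub>G\<^esub> f (b i))"
proof -
  interpret G: module K G by fact
  have "f x = f (\<Oplus>\<^bsub>N\<^esub>i\<in>I. d i x \<odot>\<^bsub>N\<^esub> b i)" using expand [OF assms(3)] by simp
  also have "\<dots> = (\<Oplus>\<^bsub>G\<^esub>i\<in>I. f (d i x \<odot>\<^bsub>N\<^esub> b i))"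
    by (rule lin_finsum [OF assms(1) N.M.abelian_group_axioms G.M.abelian_group_axioms finite_I])
      (simp add: d_closed b_closed assms)
  also have "\<dots> = (\<Oplus>\<^bsub>G\<^esub>i\<in>I. d i x \<odot>\<^bsub>G\<^esub> f (b i))"
    by (rule G.finsum_cong')
      (auto simp: lin_smult [OF assms(1)] d_closed b_closed assms lin_closed [OF assms(1)])
  finally show ?thesis .
qed

lemma slice_bilinear:
  assumes "module K M" "i \<in> I"
  shows "(\<lambda>m n. d i n \<odot>\<^bsub>M\<^esub> m) \<in> bilinear_maps K M N M"
  by (intro bilI lin_scale lin_scale_left lin_id assms d_linear d_closed)

lemma slice_closed:
  assumes "module K M" "i \<in> I" "t \<in> carrier (tensor K M N)"
  shows "sweedler K M N M t (\<lambda>m n. d i n \<odot>\<^bsub>M\<^esub> m) \<in> carrier M"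
  by (intro sw_closed slice_bilinear assms module_N)

text \<open>For a pure tensor this is the expansion of \<open>n\<close> along the basis, with the
  coefficient \<open>d i n\<close> moved over to the first factor.\<close>

lemma sw_expand:
  assumes M: "module K M" and G: "module K G" and b: "\<beta> \<in> bilinear_maps K M N G"
    and t: "t \<in> carrier (tensor K M N)"
  shows "sweedler K M N G t \<beta> = (\<Oplus>\<^bsub>G\<^esub>i\<in>I. \<beta> (sweedler K M N M t (\<lambda>m n. d i n \<odot>\<^bsub>M\<^esub> m)) (b i))"
proof -
  interpret M: module K M by fact
  interpret G: module K G by fact
  interpret module_pair K M N using M module_N by (rule module_pair.intro)
  interpret T: module K "tensor K M N" by (rule module_tensor)
  have 1: "(\<lambda>t. \<Oplus>\<^bsub>G\<^esub>i\<in>I. \<beta> (sweedler K M N M t (\<lambda>m n. d i n \<odot>\<^bsub>M\<^esub> m)) (b i))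
      \<in> linear_maps K (tensor K M N) G"
    by (intro lin_finsum_fun G finite_I T.M.abelian_group_axioms T.smult_closed
        lin_comp [OF bil_left [OF b]] b_closed sweedler_linear M slice_bilinear)
  show ?thesis
  proof (rule tensor_ext [OF G sweedler_linear [OF G b] 1 _ t])
    fix m n assume mn: "m \<in> carrier M" "n \<in> carrier N"
    have "sweedler K M N G (tpure K M N m n) \<beta> = \<beta> m n"
      by (rule sweedler_pure [OF G b mn])
    also have "\<dots> = (\<Oplus>\<^bsub>G\<^esub>i\<in>I. d i n \<odot>\<^bsub>G\<^esub> \<beta> m (b i))"
      by (rule linear_expand [OF bil_right [OF b mn(1)] G mn(2)])
    also have "\<dots> = (\<Oplus>\<^bsub>G\<^esub>i\<in>I. \<beta> (sweedler K M N M (tpure K M N m n) (\<lambda>m n. d i n \<odot>\<^bsub>M\<^esub> m)) (b i))"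
    proof (rule G.finsum_cong' [OF refl])
      fix i assume i: "i \<in> I"
      show "d i n \<odot>\<^bsub>G\<^esub> \<beta> m (b i) = \<beta> (sweedler K M N M (tpure K M N m n) (\<lambda>m n. d i n \<odot>\<^bsub>M\<^esub> m)) (b i)"
        unfolding sweedler_pure [OF M slice_bilinear [OF M i] mn]
        using lin_smult [OF bil_left [OF b b_closed [OF i]] d_closed [OF i mn(2)] mn(1)] by simp
    qed (use mn in \<open>auto intro!: bil_closed [OF b] slice_closed M pure_closed b_closed\<close>)
    finally show "sweedler K M N G (tpure K M N m n) \<beta>
      = (\<Oplus>\<^bsub>G\<^esub>i\<in>I. \<beta> (sweedler K M N M (tpure K M N m n) (\<lambda>m n. d i n \<odot>\<^bsub>M\<^esub> m)) (b i))" .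
  qed
qed

lemma tensor_expand:
  assumes M: "module K M" and t: "t \<in> carrier (tensor K M N)"
  shows "t = (\<Oplus>\<^bsub>tensor K M N\<^esub>i\<in>I. tpure K M N (sweedler K M N M t (\<lambda>m n. d i n \<odot>\<^bsub>M\<^esub> m)) (b i))"
  using sw_expand [OF M module_tensor [OF M module_N]
      module_pair.pure_bilinear [OF module_pair.intro [OF M module_N]] t]
    sw_tpure [OF M module_N t] by simp

text \<open>By \<open>tensor_expand\<close> the slices of a tensor by the functionals
  \<open>d i\<close> serve as its coordinates. This criterion carries both the injectivity of the
  comparison map for the smash product and the laws of the coaction built from a module.\<close>

lemma tensor_eqI:
  assumes M: "module K M" and s: "s \<in> carrier (tensor K M N)" and t: "t \<in> carrier (tensor K M N)"
    and eq: "\<And>i. i \<in> I \<Longrightarrow> sweedler K M N M s (\<lambda>m n. d i n \<odot>\<^bsub>M\<^esub> m)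
       = sweedler K M N M t (\<lambda>m n. d i n \<odot>\<^bsub>M\<^esub> m)"
  shows "s = t"
proof -
  interpret T: module K "tensor K M N" by (rule module_tensor [OF M module_N])
  show ?thesis
    by (subst tensor_expand [OF M s], subst tensor_expand [OF M t], rule T.finsum_cong')
      (auto simp: eq intro!: tpure_closed M module_N slice_closed t b_closed)
qed

end

text \<open>The index set \<open>X\<close> may be infinite, so a vector is expanded over a finite
  set outside of which it vanishes. Induction on \<open>J\<close> splits off one coordinate at a
  time.\<close>

lemma linear_map_finite_support:
  assumes M: "module K M" and p: "p \<in> linear_maps K (free_module K X) M"
    and J: "finite J" "J \<subseteq> X"
  defines "\<delta> \<equiv> \<lambda>j. \<lambda>i\<in>X. if i = j then \<one>\<^bsub>K\<^esub> else \<zero>\<^bsub>K\<^esub>"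
  assumes v: "v \<in> carrier (free_module K X)" "\<And>i. i \<in> X - J \<Longrightarrow> v i = \<zero>\<^bsub>K\<^esub>"
  shows "p v = (\<Oplus>\<^bsub>M\<^esub>j\<in>J. v j \<odot>\<^bsub>M\<^esub> p (\<delta> j))"
    and "j \<in> X \<Longrightarrow> \<delta> j \<in> carrier (free_module K X)"
proof -
  interpret M: module K M by fact
  have \<delta>: "\<delta> j \<in> carrier (free_module K X)" if "j \<in> X" for j
    using that by (auto simp: \<delta>_def free_module_def intro: finite_subset [of _ "{j}"])
  have zero: "p (\<lambda>i\<in>X. \<zero>\<^bsub>K\<^esub>) = \<zero>\<^bsub>M\<^esub>"
  proof -
    let ?z = "\<lambda>i\<in>X. \<zero>\<^bsub>K\<^esub>"
    have z: "?z \<in> carrier (free_module K X)" by (simp add: free_module_def)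
    have e: "\<zero>\<^bsub>K\<^esub> \<odot>\<^bsub>free_module K X\<^esub> ?z = ?z" by (auto simp: free_module_def)
    have "p (\<zero>\<^bsub>K\<^esub> \<odot>\<^bsub>free_module K X\<^esub> ?z) = \<zero>\<^bsub>K\<^esub> \<odot>\<^bsub>M\<^esub> p ?z"
      by (rule lin_smult [OF p]) (simp_all add: z)
    then show ?thesis using lin_closed [OF p z] unfolding e by simp
  qed
  have "finite J \<Longrightarrow> J \<subseteq> X \<Longrightarrow> v \<in> carrier (free_module K X) \<Longrightarrow> \<forall>i\<in>X - J. v i = \<zero>\<^bsub>K\<^esub>
     \<Longrightarrow> p v = (\<Oplus>\<^bsub>M\<^esub>j\<in>J. v j \<odot>\<^bsub>M\<^esub> p (\<delta> j))" for v
  proof (induction J arbitrary: v rule: finite_induct)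
    case empty
    then have "v = (\<lambda>i\<in>X. \<zero>\<^bsub>K\<^esub>)" by (auto simp: free_module_def extensional_def fun_eq_iff)
    then show ?case using zero by (simp only: M.finsum_empty)
  next
    case (insert j J)
    then have j: "j \<in> X" and vK: "\<And>i. i \<in> X \<Longrightarrow> v i \<in> carrier K" by (auto simp: free_module_def)
    \<comment> \<open>The vector \<open>v\<close> with its coordinate at \<open>j\<close> erased, to
      which the induction hypothesis for the smaller index set applies.\<close>
    let ?w = "\<lambda>i\<in>X. if i = j then \<zero>\<^bsub>K\<^esub> else v i"
    have w: "?w \<in> carrier (free_module K X)"
      using insert.prems(2) by (auto simp: free_module_def elim!: rev_finite_subset)
    have vj: "v j \<odot>\<^bsub>free_module K X\<^esub> \<delta> j \<in> carrier (free_module K X)"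
      using vK [OF j] by (auto simp: free_module_def \<delta>_def intro: finite_subset [of _ "{j}"])
    have "v = ?w \<oplus>\<^bsub>free_module K X\<^esub> v j \<odot>\<^bsub>free_module K X\<^esub> \<delta> j"
      using insert.prems(2) vK j by (auto simp: free_module_def \<delta>_def fun_eq_iff PiE_def extensional_def)
    then have "p v = p ?w \<oplus>\<^bsub>M\<^esub> v j \<odot>\<^bsub>M\<^esub> p (\<delta> j)"
      using lin_add [OF p w vj] lin_smult [OF p vK [OF j] \<delta> [OF j]] by simp
    also have "p ?w = (\<Oplus>\<^bsub>M\<^esub>i\<in>J. ?w i \<odot>\<^bsub>M\<^esub> p (\<delta> i))"
      by (intro insert.IH w ballI) (use insert.prems in auto)
    also have "\<dots> = (\<Oplus>\<^bsub>M\<^esub>i\<in>J. v i \<odot>\<^bsub>M\<^esub> p (\<delta> i))"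
    proof (rule M.finsum_cong')
      fix i assume "i \<in> J"
      then have "i \<in> X" "i \<noteq> j" using insert by auto
      then show "?w i \<odot>\<^bsub>M\<^esub> p (\<delta> i) = v i \<odot>\<^bsub>M\<^esub> p (\<delta> i)" by simp
    qed (use insert.prems vK \<delta> lin_closed [OF p] in auto)
    finally show ?case
      using insert vK \<delta> lin_closed [OF p]
      by (subst M.finsum_insert) (auto intro!: M.M.a_comm M.finsum_closed)
  qed
  then show "p v = (\<Oplus>\<^bsub>M\<^esub>j\<in>J. v j \<odot>\<^bsub>M\<^esub> p (\<delta> j))" using J v by blast
  show "j \<in> X \<Longrightarrow> \<delta> j \<in> carrier (free_module K X)" by (rule \<delta>)
qed

text \<open>Projectivity embeds \<open>H\<close> into a free module with a retraction
  \<open>p\<close>. The coordinates of the embedding are the functionals and the images under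
  \<open>p\<close> of the unit vectors are the basis elements; finite generation cuts the index set
  down to a finite one.\<close>

lemma ex_dual_basis:
  fixes K :: "'k ring" and H :: "('k, 'h) module"
  assumes H: "module K H" and fg: "finitely_generated K H" and pr: "projective K H"
  obtains I and b :: "'h \<Rightarrow> 'h" and d where "dual_basis K H I b d"
proof -
  interpret H: module K H by fact
  obtain X :: "'h set" and i p where i: "i \<in> linear_maps K H (free_module K X)"
    and p: "p \<in> linear_maps K (free_module K X) H" and pi: "\<And>x. x \<in> carrier H \<Longrightarrow> p (i x) = x"
    using pr unfolding projective_def by blast
  obtain S where S: "finite S" "S \<subseteq> carrier H"
    and gen: "\<And>x. x \<in> carrier H \<Longrightarrow> \<exists>c\<in>S \<rightarrow> carrier K. x = (\<Oplus>\<^bsub>H\<^esub>s\<in>S. c s \<odot>\<^bsub>H\<^esub> s)"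
    using fg unfolding finitely_generated_def by blast
  \<comment> \<open>The union of the supports of the images of the generators. It is finite, and by
    linearity it contains the support of the image of every element of \<open>H\<close>.\<close>
  define J where "J = (\<Union>s\<in>S. {j \<in> X. i s j \<noteq> \<zero>\<^bsub>K\<^esub>})"
  have iF: "i x \<in> carrier (free_module K X)" if "x \<in> carrier H" for x
    using lin_closed [OF i that] .
  have J: "finite J" "J \<subseteq> X"
    using S iF by (auto simp: J_def free_module_def)
  have coord: "(\<lambda>x. i x j) \<in> linear_maps K H (ground K)" if "j \<in> X" for j
  proof (rule linI)
    fix x y assume xy: "x \<in> carrier H" "y \<in> carrier H"
    show "i (x \<oplus>\<^bsub>H\<^esub> y) j = i x j \<oplus>\<^bsub>ground K\<^esub> i y j"
      using lin_add [OF i xy] that by (simp add: free_module_def)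
  next
    fix c x assume cx: "c \<in> carrier K" "x \<in> carrier H"
    show "i (c \<odot>\<^bsub>H\<^esub> x) j = c \<odot>\<^bsub>ground K\<^esub> i x j"
      using lin_smult [OF i cx] that by (simp add: free_module_def)
  qed (use iF that in \<open>auto simp: free_module_def\<close>)
  interpret G: module K "ground K" by (rule module_ground) (rule H.R.is_cring)
  have supp: "i x j = \<zero>\<^bsub>K\<^esub>" if x: "x \<in> carrier H" and j: "j \<in> X - J" for x j
  proof -
    obtain c where c: "c \<in> S \<rightarrow> carrier K" "x = (\<Oplus>\<^bsub>H\<^esub>s\<in>S. c s \<odot>\<^bsub>H\<^esub> s)"
      using gen [OF x] by blast
    have "i x j = (\<Oplus>\<^bsub>ground K\<^esub>s\<in>S. i (c s \<odot>\<^bsub>H\<^esub> s) j)"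
      unfolding c(2)
      by (rule lin_finsum [OF coord H.M.abelian_group_axioms G.M.abelian_group_axioms S(1)])
        (use c S j in auto)
    also have "\<dots> = (\<Oplus>\<^bsub>ground K\<^esub>s\<in>S. \<zero>\<^bsub>ground K\<^esub>)"
    proof (rule G.finsum_cong')
      fix s assume s: "s \<in> S"
      have "i s j = \<zero>\<^bsub>K\<^esub>" using s j by (auto simp: J_def)
      moreover have "c s \<in> carrier K" "s \<in> carrier H" using c S s by auto
      ultimately show "i (c s \<odot>\<^bsub>H\<^esub> s) j = \<zero>\<^bsub>ground K\<^esub>"
        using lin_smult [OF coord, of j "c s" s] j by simp
    qed auto
    also have "\<dots> = \<zero>\<^bsub>ground K\<^esub>" by (rule G.finsum_zero)
    also have "\<dots> = \<zero>\<^bsub>K\<^esub>" by simp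
    finally show ?thesis .
  qed
  let ?\<delta> = "\<lambda>j. \<lambda>i\<in>X. if i = j then \<one>\<^bsub>K\<^esub> else \<zero>\<^bsub>K\<^esub>"
  have "dual_basis K H J (\<lambda>j. p (?\<delta> j)) (\<lambda>j x. i x j)"
  proof
    fix j assume "j \<in> J"
    then have "j \<in> X" using J by auto
    then show "p (?\<delta> j) \<in> carrier H"
      \<comment> \<open>That the unit vectors lie in the free module is stated relative to some
        vector vanishing outside \<open>J\<close>; the image of zero is taken as this
        vector.\<close>
      using lin_closed [OF p linear_map_finite_support(2) [OF H p J iF]] supp H.M.zero_closed by blast
    show "(\<lambda>x. i x j) \<in> linear_maps K H (ground K)" by (rule coord [OF \<open>j \<in> X\<close>])
  next
    fix x assume x: "x \<in> carrier H"
    show "x = (\<Oplus>\<^bsub>H\<^esub>j\<in>J. i x j \<odot>\<^bsub>H\<^esub> p (?\<delta> j))"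
      using linear_map_finite_support(1) [OF H p J iF [OF x] supp [OF x]] pi [OF x] by simp
  qed (rule J)
  then show thesis by (rule that)
qed


section \<open>The dual module\<close>

context
  fixes K :: "'k ring" and H :: "('k, 'h) module" and \<Delta> :: "'h \<Rightarrow> ('h, 'h) tens" and \<epsilon> :: "'h \<Rightarrow> 'k"
  assumes H: "module K H"
begin

abbreviation (input) "H' \<equiv> dual_algebra K H \<Delta> \<epsilon>"

interpretation H: module K H by (rule H)

lemma dual_simps:
  "carrier H' = linear_maps K H (ground K) \<inter> extensional (carrier H)"
  "add H' = (\<lambda>f g. \<lambda>h\<in>carrier H. f h \<oplus>\<^bsub>K\<^esub> g h)"
  "\<zero>\<^bsub>H'\<^esub> = (\<lambda>h\<in>carrier H. \<zero>\<^bsub>K\<^esub>)"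
  "smult H' = (\<lambda>c f. \<lambda>h\<in>carrier H. c \<otimes>\<^bsub>K\<^esub> f h)"
  by (simp_all add: dual_algebra_def)

lemma dual_closed: "\<lbrakk>f \<in> carrier H'; h \<in> carrier H\<rbrakk> \<Longrightarrow> f h \<in> carrier K"
  using lin_closed [of f K H "ground K" h] by (simp add: dual_simps)

lemma dual_eqI:
  "\<lbrakk>f \<in> carrier H'; g \<in> carrier H'; \<And>h. h \<in> carrier H \<Longrightarrow> f h = g h\<rbrakk> \<Longrightarrow> f = g"
  by (auto simp: dual_simps intro: extensionalityI)

lemma restrict_dual:
  "f \<in> linear_maps K H (ground K) \<Longrightarrow> restrict f (carrier H) \<in> carrier H'"
  by (auto simp: dual_simps linear_maps_def Pi_iff)

lemma dual_linear: "f \<in> carrier H' \<Longrightarrow> f \<in> linear_maps K H (ground K)"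
  by (simp add: dual_simps)

lemma module_dual: "module K H'"
proof -
  have c: "cring K" by (rule H.R.is_cring)
  interpret G: module K "ground K" by (rule module_ground [OF c])
  have add: "f \<oplus>\<^bsub>H'\<^esub> g \<in> carrier H'" if "f \<in> carrier H'" "g \<in> carrier H'" for f g
    unfolding dual_simps(2) using dual_linear [OF that(1)] dual_linear [OF that(2)]
    by (intro restrict_dual linI)
      (simp_all add: lin_add lin_smult lin_closed [where N = "ground K", simplified]
        H.R.a_ac H.R.r_distr)
  have smult: "k \<odot>\<^bsub>H'\<^esub> f \<in> carrier H'" if "k \<in> carrier K" "f \<in> carrier H'" for k f
    unfolding dual_simps(4) using that by (intro restrict_dual lin_ground_mult_right c dual_linear)
  have zero: "\<zero>\<^bsub>H'\<^esub> \<in> carrier H'"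
    unfolding dual_simps(3) by (intro restrict_dual linI) simp_all
  have simps: "(f \<oplus>\<^bsub>H'\<^esub> g) h = f h \<oplus>\<^bsub>K\<^esub> g h" "(k \<odot>\<^bsub>H'\<^esub> f) h = k \<otimes>\<^bsub>K\<^esub> f h" "\<zero>\<^bsub>H'\<^esub> h = \<zero>\<^bsub>K\<^esub>"
    if "h \<in> carrier H" for f g k h
    using that by (simp_all add: dual_simps)
  show ?thesis
  proof (rule moduleI [OF c])
    show "abelian_group H'"
    proof (rule abelian_groupI)
      fix f assume f: "f \<in> carrier H'"
      show "\<exists>g\<in>carrier H'. g \<oplus>\<^bsub>H'\<^esub> f = \<zero>\<^bsub>H'\<^esub>"
      proof (rule bexI)
        show "(\<ominus>\<^bsub>K\<^esub> \<one>\<^bsub>K\<^esub>) \<odot>\<^bsub>H'\<^esub> f \<in> carrier H'" by (rule smult) (use f in simp_all)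
        then show "(\<ominus>\<^bsub>K\<^esub> \<one>\<^bsub>K\<^esub>) \<odot>\<^bsub>H'\<^esub> f \<oplus>\<^bsub>H'\<^esub> f = \<zero>\<^bsub>H'\<^esub>"
          by (intro dual_eqI add zero f)
            (simp_all add: simps f dual_closed H.R.l_minus H.R.l_neg)
      qed
    qed (auto intro!: dual_eqI add zero simp: simps dual_closed H.R.a_ac)
  qed (auto intro!: dual_eqI add smult simp: simps dual_closed H.R.l_distr H.R.r_distr H.R.m_assoc)
qed

lemma eval_linear: "h \<in> carrier H \<Longrightarrow> (\<lambda>f. f h) \<in> linear_maps K H' (ground K)"
  by (rule linI) (simp_all add: dual_closed dual_simps(2,4))

text \<open>Evaluation at \<open>h\<close> turns the claim into the expansion of the linear map
  \<open>f\<close> along the basis of \<open>H\<close>; the vectors \<open>b i\<close> reappear as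
  the functionals \<open>f \<mapsto> f (b i)\<close>.\<close>

lemma dual_basis_dual:
  assumes "dual_basis K H I b d"
  shows "dual_basis K H' I (\<lambda>i. restrict (d i) (carrier H)) (\<lambda>i f. f (b i))"
proof -
  interpret dual_basis K H I b d by fact
  interpret H': module K H' by (rule module_dual)
  have c: "cring K" by (rule H.R.is_cring)
  interpret G: module K "ground K" by (rule module_ground [OF c])
  show ?thesis
  proof
    fix f assume f: "f \<in> carrier H'"
    have cl: "f (b i) \<odot>\<^bsub>H'\<^esub> restrict (d i) (carrier H) \<in> carrier H'" if "i \<in> I" for i
      using that f by (intro H'.smult_closed dual_closed restrict_dual d_linear b_closed)
    show "f = (\<Oplus>\<^bsub>H'\<^esub>i\<in>I. f (b i) \<odot>\<^bsub>H'\<^esub> restrict (d i) (carrier H))"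
    proof (rule dual_eqI [OF f])
      fix h assume h: "h \<in> carrier H"
      have "f h = (\<Oplus>\<^bsub>ground K\<^esub>i\<in>I. d i h \<odot>\<^bsub>ground K\<^esub> f (b i))"
        by (rule linear_expand [OF dual_linear [OF f] G.module_axioms h])
      also have "\<dots> = (\<Oplus>\<^bsub>ground K\<^esub>i\<in>I. (f (b i) \<odot>\<^bsub>H'\<^esub> restrict (d i) (carrier H)) h)"
        by (rule G.finsum_cong')
          (use h f in \<open>auto simp: dual_simps(4) d_closed dual_closed b_closed H.R.m_comm\<close>)
      also have "\<dots> = (\<Oplus>\<^bsub>H'\<^esub>i\<in>I. f (b i) \<odot>\<^bsub>H'\<^esub> restrict (d i) (carrier H)) h"
        by (rule lin_finsum [symmetric, OF eval_linear [OF h] H'.M.abelian_group_axioms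
              G.M.abelian_group_axioms finite_I cl])
      finally show "f h = (\<Oplus>\<^bsub>H'\<^esub>i\<in>I. f (b i) \<odot>\<^bsub>H'\<^esub> restrict (d i) (carrier H)) h" .
    qed (use cl in \<open>auto intro!: H'.finsum_closed\<close>)
  qed (use d_linear in \<open>simp_all add: finite_I restrict_dual eval_linear b_closed\<close>)
qed

end

lemma mult_tensor:
  "s \<otimes>\<^bsub>tensor K M N\<^esub> t = sweedler K M N (tensor K M N) s (\<lambda>m n.
     sweedler K M N (tensor K M N) t (\<lambda>m' n'. tpure K M N (m \<otimes>\<^bsub>M\<^esub> m') (n \<otimes>\<^bsub>N\<^esub> n')))"
proof -
  have "s \<otimes>\<^bsub>tensor K M N\<^esub> t = sweedler K M N (tgroup K M N) s (\<lambda>m n.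
     sweedler K M N (tgroup K M N) t (\<lambda>m' n'. tpure K M N (m \<otimes>\<^bsub>M\<^esub> m') (n \<otimes>\<^bsub>N\<^esub> n')))"
    by (simp add: tensor_def del: tgroup_tensor)
  then show ?thesis by (simp only: sweedler_tgroup)
qed

section \<open>The convolution ring \<open>Hom\<^sub>K(H, A)\<close>\<close>

context lax_comodule_algebra
begin

lemma algA: "unital_algebra K A"
  by unfold_locales

lemma algH: "unital_algebra K H"
  by unfold_locales

lemma cringK: "cring K"
  by (rule R.is_cring)

lemma modA: "module K A"
  using algA by (rule unital_algebra.axioms)

lemma modH: "module K H"
  using algH by (rule unital_algebra.axioms)

lemma modK: "module K (ground K)"
  by (rule module_ground [OF cringK])

lemma counit_closed: "h \<in> carrier H \<Longrightarrow> \<epsilon> h \<in> carrier K"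
  using lin_closed [OF counit_linear] by simp

lemma ground_closedI: "c \<in> carrier K \<Longrightarrow> c \<in> carrier (ground K)"
  by simp

lemma multA_closed: "\<lbrakk>x \<in> carrier A; y \<in> carrier A\<rbrakk> \<Longrightarrow> x \<otimes>\<^bsub>A\<^esub> y \<in> carrier A"
  by simp

lemma multH_closed: "\<lbrakk>x \<in> carrier H; y \<in> carrier H\<rbrakk> \<Longrightarrow> x \<otimes>\<^bsub>H\<^esub> y \<in> carrier H"
  by simp

lemma oneA_closed: "\<one>\<^bsub>A\<^esub> \<in> carrier A"
  by simp

lemma oneH_closed: "\<one>\<^bsub>H\<^esub> \<in> carrier H"
  by simp

lemma multK_closed: "\<lbrakk>x \<in> carrier K; y \<in> carrier K\<rbrakk> \<Longrightarrow> x \<otimes>\<^bsub>K\<^esub> y \<in> carrier K"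
  by simp

lemma multA_assoc:
  "\<lbrakk>x \<in> carrier A; y \<in> carrier A; z \<in> carrier A\<rbrakk> \<Longrightarrow> x \<otimes>\<^bsub>A\<^esub> y \<otimes>\<^bsub>A\<^esub> z = x \<otimes>\<^bsub>A\<^esub> (y \<otimes>\<^bsub>A\<^esub> z)"
  using algA by (simp add: unital_algebra_def ring.ring_simprules)

lemma multH_assoc:
  "\<lbrakk>x \<in> carrier H; y \<in> carrier H; z \<in> carrier H\<rbrakk> \<Longrightarrow> x \<otimes>\<^bsub>H\<^esub> y \<otimes>\<^bsub>H\<^esub> z = x \<otimes>\<^bsub>H\<^esub> (y \<otimes>\<^bsub>H\<^esub> z)"
  using algH by (simp add: unital_algebra_def ring.ring_simprules)

lemma smult_closed_of_module: "\<lbrakk>module K M; c \<in> carrier K; x \<in> carrier M\<rbrakk> \<Longrightarrow> c \<odot>\<^bsub>M\<^esub> x \<in> carrier M"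
  by (rule module.smult_closed)

text \<open>The outermost operation of a body selects the rule, so
  \<open>(intro lin_rules ...; assumption)+\<close> settles all linearity and closure premises of a
  Sweedler step. The closure facts above are stated one by one so that the leaves of this search are
  reached by resolution as well.\<close>

lemmas lin_rules =
  bilI lin_id lin_scale lin_scale_left lin_ground_mult_left [OF cringK] lin_ground_mult_right [OF cringK]
  lin_mult_left [OF algA] lin_mult_right [OF algA] lin_mult_left [OF algH] lin_mult_right [OF algH]
  lin_tpure_left lin_tpure_right lin_sw_arg lin_sw_body
  lin_comp [OF rho_linear] lin_comp [OF comult_linear] lin_comp [OF counit_linear]
  lin_closed [OF rho_linear] lin_closed [OF comult_linear] counit_closed
  modA modH modK module_tensor sw_closed tpure_closed smult_closed_of_module
  multA_closed multH_closed multK_closed oneA_closed oneH_closed ground_closedI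

section \<open>The axioms of \<open>H\<close> and \<open>A\<close> as rewriting rules for Sweedler
  sums\<close>

lemma sw_rho_mult:
  assumes G: "module K G" and b: "\<beta> \<in> bilinear_maps K A H G"
    and a: "a \<in> carrier A" "a' \<in> carrier A"
  shows "sweedler K A H G (\<rho> (a \<otimes>\<^bsub>A\<^esub> a')) \<beta>
       = sweedler K A H G (\<rho> a) (\<lambda>x y. sweedler K A H G (\<rho> a') (\<lambda>x' y'. \<beta> (x \<otimes>\<^bsub>A\<^esub> x') (y \<otimes>\<^bsub>H\<^esub> y')))"
proof -
  have b': "sweedler K A H G (tpure K A H x y) \<beta> = \<beta> x y"
    if "x \<in> carrier A" "y \<in> carrier H" for x y
    by (rule sw_pure [OF modA modH G b that])
  have eq: "\<rho> (a \<otimes>\<^bsub>A\<^esub> a') = sweedler K A H (tensor K A H) (\<rho> a) (\<lambda>x y.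
      sweedler K A H (tensor K A H) (\<rho> a') (\<lambda>x' y'. tpure K A H (x \<otimes>\<^bsub>A\<^esub> x') (y \<otimes>\<^bsub>H\<^esub> y')))"
    by (simp only: rho_mult [OF a] mult_tensor)
  have "sweedler K A H G (\<rho> (a \<otimes>\<^bsub>A\<^esub> a')) \<beta> = sweedler K A H G (\<rho> a) (\<lambda>x y. sweedler K A H G
     (sweedler K A H (tensor K A H) (\<rho> a') (\<lambda>x' y'. tpure K A H (x \<otimes>\<^bsub>A\<^esub> x') (y \<otimes>\<^bsub>H\<^esub> y'))) \<beta>)"
    unfolding eq by (rule sw_sw) (intro lin_rules G b a; assumption)+
  also have "\<dots> = sweedler K A H G (\<rho> a) (\<lambda>x y. sweedler K A H G (\<rho> a') (\<lambda>x' y'.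
      sweedler K A H G (tpure K A H (x \<otimes>\<^bsub>A\<^esub> x') (y \<otimes>\<^bsub>H\<^esub> y')) \<beta>))"
    by (rule sw_cong, rule sw_sw) (intro lin_rules G b a; assumption)+
  also have "\<dots> = sweedler K A H G (\<rho> a) (\<lambda>x y. sweedler K A H G (\<rho> a') (\<lambda>x' y'. \<beta> (x \<otimes>\<^bsub>A\<^esub> x') (y \<otimes>\<^bsub>H\<^esub> y')))"
    by (intro sw_cong b' multA_closed multH_closed)
  finally show ?thesis .
qed

lemma sw_comult_mult:
  assumes G: "module K G" and b: "\<beta> \<in> bilinear_maps K H H G"
    and a: "a \<in> carrier H" "a' \<in> carrier H"
  shows "sweedler K H H G (\<Delta> (a \<otimes>\<^bsub>H\<^esub> a')) \<beta>
       = sweedler K H H G (\<Delta> a) (\<lambda>x y. sweedler K H H G (\<Delta> a') (\<lambda>x' y'. \<beta> (x \<otimes>\<^bsub>H\<^esub> x') (y \<otimes>\<^bsub>H\<^esub> y')))"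
proof -
  have b': "sweedler K H H G (tpure K H H x y) \<beta> = \<beta> x y"
    if "x \<in> carrier H" "y \<in> carrier H" for x y
    by (rule sw_pure [OF modH modH G b that])
  have eq: "\<Delta> (a \<otimes>\<^bsub>H\<^esub> a') = sweedler K H H (tensor K H H) (\<Delta> a) (\<lambda>x y.
      sweedler K H H (tensor K H H) (\<Delta> a') (\<lambda>x' y'. tpure K H H (x \<otimes>\<^bsub>H\<^esub> x') (y \<otimes>\<^bsub>H\<^esub> y')))"
    by (simp only: ring_hom_mult [OF comult_ring_hom a] mult_tensor)
  have "sweedler K H H G (\<Delta> (a \<otimes>\<^bsub>H\<^esub> a')) \<beta> = sweedler K H H G (\<Delta> a) (\<lambda>x y. sweedler K H H G
     (sweedler K H H (tensor K H H) (\<Delta> a') (\<lambda>x' y'. tpure K H H (x \<otimes>\<^bsub>H\<^esub> x') (y \<otimes>\<^bsub>H\<^esub> y'))) \<beta>)"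
    unfolding eq by (rule sw_sw) (intro lin_rules G b a; assumption)+
  also have "\<dots> = sweedler K H H G (\<Delta> a) (\<lambda>x y. sweedler K H H G (\<Delta> a') (\<lambda>x' y'.
      sweedler K H H G (tpure K H H (x \<otimes>\<^bsub>H\<^esub> x') (y \<otimes>\<^bsub>H\<^esub> y')) \<beta>))"
    by (rule sw_cong, rule sw_sw) (intro lin_rules G b a; assumption)+
  also have "\<dots> = sweedler K H H G (\<Delta> a) (\<lambda>x y. sweedler K H H G (\<Delta> a') (\<lambda>x' y'. \<beta> (x \<otimes>\<^bsub>H\<^esub> x') (y \<otimes>\<^bsub>H\<^esub> y')))"
    by (intro sw_cong b' multH_closed)
  finally show ?thesis .
qed

text \<open>Coassociativity is an equation between elements of a threefold tensor product. The
  trilinear body is turned into a linear functional \<open>\<Phi>\<close> there,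
  \<open>\<Phi>\<close> is applied to both sides of the axiom, and it is then pushed back under the
  sums.\<close>

lemma sw_coassoc:
  assumes G: "module K G" and h: "h \<in> carrier H"
    and xy: "\<And>z. z \<in> carrier H \<Longrightarrow> (\<lambda>x y. \<gamma> x y z) \<in> bilinear_maps K H H G"
    and z: "\<And>x y. \<lbrakk>x \<in> carrier H; y \<in> carrier H\<rbrakk> \<Longrightarrow> (\<lambda>z. \<gamma> x y z) \<in> linear_maps K H G"
  shows "sweedler K H H G (\<Delta> h) (\<lambda>x y. sweedler K H H G (\<Delta> x) (\<lambda>x1 x2. \<gamma> x1 x2 y))
       = sweedler K H H G (\<Delta> h) (\<lambda>x y. sweedler K H H G (\<Delta> y) (\<lambda>y1 y2. \<gamma> x y1 y2))"
proof -
  obtain \<Phi> where \<Phi>: "\<Phi> \<in> linear_maps K (tensor K (tensor K H H) H) G"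
    and s: "\<And>s z. \<lbrakk>s \<in> carrier (tensor K H H); z \<in> carrier H\<rbrakk> \<Longrightarrow>
           \<Phi> (tpure K (tensor K H H) H s z) = sweedler K H H G s (\<lambda>x y. \<gamma> x y z)"
    and p: "\<And>x y z. \<lbrakk>x \<in> carrier H; y \<in> carrier H; z \<in> carrier H\<rbrakk> \<Longrightarrow>
           \<Phi> (tpure K (tensor K H H) H (tpure K H H x y) z) = \<gamma> x y z"
    by (rule trilinear_functional [OF modH modH modH G xy z]) auto
  have "sweedler K H H G (\<Delta> h) (\<lambda>x y. sweedler K H H G (\<Delta> x) (\<lambda>x1 x2. \<gamma> x1 x2 y))
      = sweedler K H H G (\<Delta> h) (\<lambda>x y. \<Phi> (tpure K (tensor K H H) H (\<Delta> x) y))"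
    by (rule sw_cong) (simp add: s lin_closed [OF comult_linear])
  also have "\<dots> = \<Phi> (sweedler K H H (tensor K (tensor K H H) H) (\<Delta> h)
      (\<lambda>x y. tpure K (tensor K H H) H (\<Delta> x) y))"
    by (rule lin_sw [symmetric, OF _ _ _ _ \<Phi>]) (intro lin_rules G h; assumption)+
  also have "\<dots> = \<Phi> (sweedler K H H (tensor K (tensor K H H) H) (\<Delta> h) (\<lambda>x y.
          sweedler K H H (tensor K (tensor K H H) H) (\<Delta> y) (\<lambda>y1 y2.
            tpure K (tensor K H H) H (tpure K H H x y1) y2)))"
    by (simp only: coassoc [OF h])
  also have "\<dots> = sweedler K H H G (\<Delta> h) (\<lambda>x y. \<Phi> (sweedler K H H (tensor K (tensor K H H) H) (\<Delta> y)
      (\<lambda>y1 y2. tpure K (tensor K H H) H (tpure K H H x y1) y2)))"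
    by (rule lin_sw [OF _ _ _ _ \<Phi>]) (intro lin_rules G h; assumption)+
  also have "\<dots> = sweedler K H H G (\<Delta> h) (\<lambda>x y. sweedler K H H G (\<Delta> y)
      (\<lambda>y1 y2. \<Phi> (tpure K (tensor K H H) H (tpure K H H x y1) y2)))"
    by (rule sw_cong, rule lin_sw [OF _ _ _ _ \<Phi>]) (intro lin_rules G h; assumption)+
  also have "\<dots> = sweedler K H H G (\<Delta> h) (\<lambda>x y. sweedler K H H G (\<Delta> y) (\<lambda>y1 y2. \<gamma> x y1 y2))"
    by (intro sw_cong p)
  finally show ?thesis .
qed

text \<open>The same method as for \<open>sw_coassoc\<close>. Compared with an ordinary coaction
  there is an additional factor \<open>\<rho>(1)\<close>, which multiplies the first two legs and
  leaves the third alone.\<close>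

lemma sw_lax_coassoc:
  assumes G: "module K G" and a: "a \<in> carrier A"
    and xy: "\<And>z. z \<in> carrier H \<Longrightarrow> (\<lambda>x y. \<gamma> x y z) \<in> bilinear_maps K A H G"
    and z: "\<And>x y. \<lbrakk>x \<in> carrier A; y \<in> carrier H\<rbrakk> \<Longrightarrow> (\<lambda>z. \<gamma> x y z) \<in> linear_maps K H G"
  shows "sweedler K A H G (\<rho> a) (\<lambda>x h. sweedler K A H G (\<rho> x) (\<lambda>x0 x1. \<gamma> x0 x1 h))
       = sweedler K A H G (\<rho> a) (\<lambda>x h. sweedler K H H G (\<Delta> h) (\<lambda>h1 h2.
           sweedler K A H G (\<rho> \<one>\<^bsub>A\<^esub>) (\<lambda>u v. \<gamma> (x \<otimes>\<^bsub>A\<^esub> u) (h1 \<otimes>\<^bsub>H\<^esub> v) h2)))"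
proof -
  let ?AHH = "tensor K (tensor K A H) H"
  obtain \<Phi> where \<Phi>: "\<Phi> \<in> linear_maps K ?AHH G"
    and s: "\<And>s z. \<lbrakk>s \<in> carrier (tensor K A H); z \<in> carrier H\<rbrakk> \<Longrightarrow>
           \<Phi> (tpure K (tensor K A H) H s z) = sweedler K A H G s (\<lambda>x y. \<gamma> x y z)"
    and p: "\<And>x y z. \<lbrakk>x \<in> carrier A; y \<in> carrier H; z \<in> carrier H\<rbrakk> \<Longrightarrow>
           \<Phi> (tpure K (tensor K A H) H (tpure K A H x y) z) = \<gamma> x y z"
    by (rule trilinear_functional [OF modA modH modH G xy z]) auto
  let ?p = "\<lambda>x h1 h2 u v. tpure K (tensor K A H) H (tpure K A H (x \<otimes>\<^bsub>A\<^esub> u) (h1 \<otimes>\<^bsub>H\<^esub> v)) h2"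
  have "sweedler K A H G (\<rho> a) (\<lambda>x h. sweedler K A H G (\<rho> x) (\<lambda>x0 x1. \<gamma> x0 x1 h))
      = sweedler K A H G (\<rho> a) (\<lambda>x y. \<Phi> (tpure K (tensor K A H) H (\<rho> x) y))"
    by (rule sw_cong) (simp add: s lin_closed [OF rho_linear])
  also have "\<dots> = \<Phi> (sweedler K A H ?AHH (\<rho> a) (\<lambda>x y. tpure K (tensor K A H) H (\<rho> x) y))"
    by (rule lin_sw [symmetric, OF _ _ _ _ \<Phi>]) (intro lin_rules G a; assumption)+
  also have "\<dots> = \<Phi> (sweedler K A H ?AHH (\<rho> a) (\<lambda>x h. sweedler K H H ?AHH (\<Delta> h) (\<lambda>h1 h2.
          sweedler K A H ?AHH (\<rho> \<one>\<^bsub>A\<^esub>) (\<lambda>u v. ?p x h1 h2 u v))))"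
    by (simp only: rho_lax_coassoc [OF a])
  also have "\<dots> = sweedler K A H G (\<rho> a) (\<lambda>x h. \<Phi> (sweedler K H H ?AHH (\<Delta> h) (\<lambda>h1 h2.
          sweedler K A H ?AHH (\<rho> \<one>\<^bsub>A\<^esub>) (\<lambda>u v. ?p x h1 h2 u v))))"
    by (rule lin_sw [OF _ _ _ _ \<Phi>]) (intro lin_rules G a; assumption)+
  also have "\<dots> = sweedler K A H G (\<rho> a) (\<lambda>x h. sweedler K H H G (\<Delta> h) (\<lambda>h1 h2.
          \<Phi> (sweedler K A H ?AHH (\<rho> \<one>\<^bsub>A\<^esub>) (\<lambda>u v. ?p x h1 h2 u v))))"
    by (rule sw_cong, rule lin_sw [OF _ _ _ _ \<Phi>]) (intro lin_rules G a; assumption)+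
  also have "\<dots> = sweedler K A H G (\<rho> a) (\<lambda>x h. sweedler K H H G (\<Delta> h) (\<lambda>h1 h2.
          sweedler K A H G (\<rho> \<one>\<^bsub>A\<^esub>) (\<lambda>u v. \<Phi> (?p x h1 h2 u v))))"
    by (rule sw_cong, rule sw_cong, rule lin_sw [OF _ _ _ _ \<Phi>]) (intro lin_rules G a; assumption)+
  also have "\<dots> = sweedler K A H G (\<rho> a) (\<lambda>x h. sweedler K H H G (\<Delta> h) (\<lambda>h1 h2.
           sweedler K A H G (\<rho> \<one>\<^bsub>A\<^esub>) (\<lambda>u v. \<gamma> (x \<otimes>\<^bsub>A\<^esub> u) (h1 \<otimes>\<^bsub>H\<^esub> v) h2)))"
    by (intro sw_cong p multA_closed multH_closed)
  finally show ?thesis .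
qed

lemma sw_counit_left:
  assumes "module K G" "f \<in> linear_maps K H G" "h \<in> carrier H"
  shows "sweedler K H H G (\<Delta> h) (\<lambda>x y. \<epsilon> x \<odot>\<^bsub>G\<^esub> f y) = f h"
proof -
  have "f (sweedler K H H H (\<Delta> h) (\<lambda>x y. \<epsilon> x \<odot>\<^bsub>H\<^esub> y)) = sweedler K H H G (\<Delta> h) (\<lambda>x y. f (\<epsilon> x \<odot>\<^bsub>H\<^esub> y))"
    by (rule lin_sw [OF _ _ _ _ assms(2)]) (intro lin_rules assms; assumption)+
  also have "\<dots> = sweedler K H H G (\<Delta> h) (\<lambda>x y. \<epsilon> x \<odot>\<^bsub>G\<^esub> f y)"
    by (rule sw_cong) (simp add: lin_smult [OF assms(2)] counit_closed)
  finally show ?thesis by (simp add: counit_left assms)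
qed

lemma sw_counit_right:
  assumes "module K G" "f \<in> linear_maps K H G" "h \<in> carrier H"
  shows "sweedler K H H G (\<Delta> h) (\<lambda>x y. \<epsilon> y \<odot>\<^bsub>G\<^esub> f x) = f h"
proof -
  have "f (sweedler K H H H (\<Delta> h) (\<lambda>x y. \<epsilon> y \<odot>\<^bsub>H\<^esub> x)) = sweedler K H H G (\<Delta> h) (\<lambda>x y. f (\<epsilon> y \<odot>\<^bsub>H\<^esub> x))"
    by (rule lin_sw [OF _ _ _ _ assms(2)]) (intro lin_rules assms; assumption)+
  also have "\<dots> = sweedler K H H G (\<Delta> h) (\<lambda>x y. \<epsilon> y \<odot>\<^bsub>G\<^esub> f x)"
    by (rule sw_cong) (simp add: lin_smult [OF assms(2)] counit_closed)
  finally show ?thesis by (simp add: counit_right assms)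
qed

text \<open>Apply the multiplicative map \<open>\<rho>\<close> to \<open>1 a = a\<close>: although
  \<open>\<rho>(1)\<close> need not be the unit of \<open>A \<otimes> H\<close>, it is a left unit
  for the values of \<open>\<rho>\<close>.\<close>

lemma sw_rho_absorb_left:
  assumes "module K G" "\<beta> \<in> bilinear_maps K A H G" "a \<in> carrier A"
  shows "sweedler K A H G (\<rho> \<one>\<^bsub>A\<^esub>) (\<lambda>u v. sweedler K A H G (\<rho> a) (\<lambda>x y. \<beta> (u \<otimes>\<^bsub>A\<^esub> x) (v \<otimes>\<^bsub>H\<^esub> y)))
       = sweedler K A H G (\<rho> a) \<beta>"
  using sw_rho_mult [OF assms(1,2) oneA_closed assms(3)] assms(3) by simp

text \<open>\<open>e = \<epsilon>(1\<^sub>[\<^sub>1\<^sub>])1\<^sub>[\<^sub>0\<^sub>]\<close> measures the failure of the coaction to be counital.\<close>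

definition e where "e = sweedler K A H A (\<rho> \<one>\<^bsub>A\<^esub>) (\<lambda>u v. \<epsilon> v \<odot>\<^bsub>A\<^esub> u)"

lemma e_closed: "e \<in> carrier A"
  unfolding e_def by (intro lin_rules; assumption)

lemma e_mult: "a \<in> carrier A \<Longrightarrow> sweedler K A H A (\<rho> a) (\<lambda>x h. \<epsilon> h \<odot>\<^bsub>A\<^esub> x) = e \<otimes>\<^bsub>A\<^esub> a"
proof -
  assume a: "a \<in> carrier A"
  have "e \<otimes>\<^bsub>A\<^esub> a = sweedler K A H A (\<rho> \<one>\<^bsub>A\<^esub>) (\<lambda>u v. (\<epsilon> v \<odot>\<^bsub>A\<^esub> u) \<otimes>\<^bsub>A\<^esub> a)"
    unfolding e_def
    by (rule lin_sw [where \<phi> = "\<lambda>z. z \<otimes>\<^bsub>A\<^esub> a"]) (intro lin_rules a; assumption)+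
  then show ?thesis using rho_lax_counit [OF a] by simp
qed

text \<open>Applying \<open>\<epsilon>\<close> to the last leg of lax coassociativity at 1 gives
  \<open>\<rho>(e)\<close> on the left. On the right the counit of \<open>H\<close> removes the
  extra leg and leaves \<open>\<rho>(1) \<rho>(1) = \<rho>(1)\<close>.\<close>

lemma rho_e: "\<rho> e = \<rho> \<one>\<^bsub>A\<^esub>"
proof -
  let ?AH = "tensor K A H" and ?o = "\<rho> \<one>\<^bsub>A\<^esub>"
  have t: "sweedler K A H ?AH (\<rho> x) (\<lambda>x0 x1. tpure K A H x0 x1) = \<rho> x" if "x \<in> carrier A" for x
    by (rule sw_tpure [OF modA modH]) (intro lin_rules that)
  have "\<rho> e = sweedler K A H ?AH ?o (\<lambda>u v. \<rho> (\<epsilon> v \<odot>\<^bsub>A\<^esub> u))"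
    unfolding e_def by (rule lin_sw [OF _ _ _ _ rho_linear]) (intro lin_rules; assumption)+
  also have "\<dots> = sweedler K A H ?AH ?o (\<lambda>u v. \<epsilon> v \<odot>\<^bsub>?AH\<^esub> sweedler K A H ?AH (\<rho> u) (\<lambda>x0 x1. tpure K A H x0 x1))"
    by (rule sw_cong) (simp add: t lin_smult [OF rho_linear] counit_closed)
  also have "\<dots> = sweedler K A H ?AH ?o (\<lambda>u v. sweedler K A H ?AH (\<rho> u) (\<lambda>x0 x1. \<epsilon> v \<odot>\<^bsub>?AH\<^esub> tpure K A H x0 x1))"
    by (rule sw_cong, rule lin_sw) (intro lin_rules; assumption)+
  also have "\<dots> = sweedler K A H ?AH ?o (\<lambda>x h. sweedler K H H ?AH (\<Delta> h) (\<lambda>h1 h2.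
           sweedler K A H ?AH ?o (\<lambda>u v. \<epsilon> h2 \<odot>\<^bsub>?AH\<^esub> tpure K A H (x \<otimes>\<^bsub>A\<^esub> u) (h1 \<otimes>\<^bsub>H\<^esub> v))))"
    by (rule sw_lax_coassoc) (intro lin_rules; assumption)+
  also have "\<dots> = sweedler K A H ?AH ?o (\<lambda>x h. sweedler K H H ?AH (\<Delta> h) (\<lambda>h1 h2.
           \<epsilon> h2 \<odot>\<^bsub>?AH\<^esub> sweedler K A H ?AH ?o (\<lambda>u v. tpure K A H (x \<otimes>\<^bsub>A\<^esub> u) (h1 \<otimes>\<^bsub>H\<^esub> v))))"
    by (rule sw_cong, rule sw_cong, rule lin_sw [symmetric]) (intro lin_rules; assumption)+
  also have "\<dots> = sweedler K A H ?AH ?o (\<lambda>x h.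
           sweedler K A H ?AH ?o (\<lambda>u v. tpure K A H (x \<otimes>\<^bsub>A\<^esub> u) (h \<otimes>\<^bsub>H\<^esub> v)))"
    by (rule sw_cong, rule sw_counit_right) (intro lin_rules; assumption)+
  also have "\<dots> = sweedler K A H ?AH ?o (tpure K A H)"
    by (rule sw_rho_absorb_left) (intro lin_rules; assumption)+
  also have "\<dots> = ?o"
    by (rule t) (rule oneA_closed)
  finally show ?thesis .
qed

lemma rho_mult_e: "c \<in> carrier A \<Longrightarrow> \<rho> (c \<otimes>\<^bsub>A\<^esub> e) = \<rho> c"
  using rho_mult [of c e] rho_mult [of c "\<one>\<^bsub>A\<^esub>"] e_closed by (simp add: rho_e)

text \<open>Contracting the second leg of \<open>\<rho>(c e)\<close> with \<open>\<epsilon>\<close>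
  yields \<open>e c e\<close> by the lax counit law, while \<open>\<rho>(c e) = \<rho>(c)\<close>
  makes the same contraction equal to \<open>e c\<close>. In particular \<open>e\<close> is
  idempotent.\<close>

lemma e_c_e:
  assumes c: "c \<in> carrier A"
  shows "e \<otimes>\<^bsub>A\<^esub> c \<otimes>\<^bsub>A\<^esub> e = e \<otimes>\<^bsub>A\<^esub> c"
proof -
  have "e \<otimes>\<^bsub>A\<^esub> c \<otimes>\<^bsub>A\<^esub> e = e \<otimes>\<^bsub>A\<^esub> (c \<otimes>\<^bsub>A\<^esub> e)"
    using c e_closed by (simp add: multA_assoc)
  also have "\<dots> = sweedler K A H A (\<rho> (c \<otimes>\<^bsub>A\<^esub> e)) (\<lambda>x h. \<epsilon> h \<odot>\<^bsub>A\<^esub> x)"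
    using c e_closed by (simp add: e_mult)
  also have "\<dots> = e \<otimes>\<^bsub>A\<^esub> c"
    by (simp only: rho_mult_e c e_mult)
  finally show ?thesis .
qed

text \<open>The axiom \<open>rho_one\<close> amounts to
  \<open>(e \<otimes> 1) \<rho>(1) = \<rho>(1)\<close>; exchanging its two sums collects the primed
  legs into \<open>e\<close>.\<close>

lemma sw_rho_one_e:
  assumes "module K G" "\<beta> \<in> bilinear_maps K A H G"
  shows "sweedler K A H G (\<rho> \<one>\<^bsub>A\<^esub>) (\<lambda>u v. \<beta> (e \<otimes>\<^bsub>A\<^esub> u) v) = sweedler K A H G (\<rho> \<one>\<^bsub>A\<^esub>) \<beta>"
proof -
  let ?AH = "tensor K A H" and ?o = "\<rho> \<one>\<^bsub>A\<^esub>"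
  have "?o = sweedler K A H ?AH ?o (\<lambda>u' v'. sweedler K A H ?AH ?o (\<lambda>u v.
            tpure K A H ((\<epsilon> v' \<odot>\<^bsub>A\<^esub> u') \<otimes>\<^bsub>A\<^esub> u) v))"
    by (rule rho_one)
  also have "\<dots> = sweedler K A H ?AH (?o) (\<lambda>u v. sweedler K A H ?AH ?o (\<lambda>u' v'.
            tpure K A H ((\<epsilon> v' \<odot>\<^bsub>A\<^esub> u') \<otimes>\<^bsub>A\<^esub> u) v))"
    by (rule sw_swap) (intro lin_rules; assumption)+
  also have "\<dots> = sweedler K A H ?AH (?o) (\<lambda>u v. tpure K A H (e \<otimes>\<^bsub>A\<^esub> u) v)"
    unfolding e_def
    by (rule sw_cong, rule lin_sw [symmetric, where \<phi> = "\<lambda>z. tpure K A H (z \<otimes>\<^bsub>A\<^esub> _) _"])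
      (intro lin_rules; assumption)+
  finally have 1: "?o = sweedler K A H ?AH ?o (\<lambda>u v. tpure K A H (e \<otimes>\<^bsub>A\<^esub> u) v)" .
  have "sweedler K A H G ?o \<beta> = sweedler K A H G (sweedler K A H ?AH ?o (\<lambda>u v. tpure K A H (e \<otimes>\<^bsub>A\<^esub> u) v)) \<beta>"
    using 1 by simp
  also have "\<dots> = sweedler K A H G ?o (\<lambda>u v. sweedler K A H G (tpure K A H (e \<otimes>\<^bsub>A\<^esub> u) v) \<beta>)"
    by (rule sw_sw) (intro lin_rules e_closed assms; assumption)+
  also have "\<dots> = sweedler K A H G ?o (\<lambda>u v. \<beta> (e \<otimes>\<^bsub>A\<^esub> u) v)"
    by (rule sw_cong, rule sw_pure) (intro lin_rules e_closed assms; assumption)+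
  finally show ?thesis by simp
qed

section \<open>The action \<open>Q\<close> and the convolution product\<close>

text \<open>\<open>Q u a h = a\<^sub>[\<^sub>0\<^sub>] u(h a\<^sub>[\<^sub>1\<^sub>])\<close> is the right action of \<open>a\<close>, read in the opposite ring, on \<open>u\<close>.\<close>

definition Q where "Q u a h = sweedler K A H A (\<rho> a) (\<lambda>x y. x \<otimes>\<^bsub>A\<^esub> u (h \<otimes>\<^bsub>H\<^esub> y))"

definition conv where "conv u v h = sweedler K H H A (\<Delta> h) (\<lambda>p q. Q u (v q) p)"

lemma Q_cong: "(\<And>h. h \<in> carrier H \<Longrightarrow> u h = u' h) \<Longrightarrow> h \<in> carrier H \<Longrightarrow> Q u a h = Q u' a h"
  unfolding Q_def by (rule sw_cong) simp

lemma conv_cong: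
  assumes "\<And>h. h \<in> carrier H \<Longrightarrow> u h = u' h" "\<And>h. h \<in> carrier H \<Longrightarrow> v h = v' h"
  shows "conv u v h = conv u' v' h"
  unfolding conv_def by (rule sw_cong) (simp add: assms(2) Q_cong [OF assms(1)])

context
  fixes u assumes u: "u \<in> linear_maps K H A"
begin

lemma Q_linear_A: "h \<in> carrier H \<Longrightarrow> (\<lambda>a. Q u a h) \<in> linear_maps K A A"
  unfolding Q_def by (intro lin_rules lin_comp [OF u] lin_closed [OF u]; assumption)

lemma Q_linear_H: "a \<in> carrier A \<Longrightarrow> (\<lambda>h. Q u a h) \<in> linear_maps K H A"
  unfolding Q_def by (intro lin_rules lin_comp [OF u] lin_closed [OF u]; assumption)

lemma Q_closed: "\<lbrakk>a \<in> carrier A; h \<in> carrier H\<rbrakk> \<Longrightarrow> Q u a h \<in> carrier A"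
  using lin_closed [OF Q_linear_H] .

lemmas u_rules = lin_rules lin_comp [OF u] lin_closed [OF u]
  lin_comp [OF Q_linear_A] lin_comp [OF Q_linear_H] Q_closed

text \<open>Multiplicativity of \<open>\<rho>\<close> separates the legs of \<open>x\<close> from
  those of \<open>a\<close>. For \<open>x = \<one>\<close> the identity says that
  \<open>Q u a\<close> absorbs a factor \<open>\<rho>(1)\<close>, which is how such factors
  disappear inside the convolution ring.\<close>

lemma Q_left:
  assumes "x \<in> carrier A" "a \<in> carrier A" "h \<in> carrier H"
  shows "Q u (x \<otimes>\<^bsub>A\<^esub> a) h = sweedler K A H A (\<rho> x) (\<lambda>x0 x1. x0 \<otimes>\<^bsub>A\<^esub> Q u a (h \<otimes>\<^bsub>H\<^esub> x1))"
proof -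
  have "Q u (x \<otimes>\<^bsub>A\<^esub> a) h = sweedler K A H A (\<rho> x) (\<lambda>x0 x1. sweedler K A H A (\<rho> a)
      (\<lambda>y0 y1. x0 \<otimes>\<^bsub>A\<^esub> y0 \<otimes>\<^bsub>A\<^esub> u (h \<otimes>\<^bsub>H\<^esub> (x1 \<otimes>\<^bsub>H\<^esub> y1))))"
    unfolding Q_def by (rule sw_rho_mult) (intro u_rules assms; assumption)+
  also have "\<dots> = sweedler K A H A (\<rho> x) (\<lambda>x0 x1. sweedler K A H A (\<rho> a)
      (\<lambda>y0 y1. x0 \<otimes>\<^bsub>A\<^esub> (y0 \<otimes>\<^bsub>A\<^esub> u (h \<otimes>\<^bsub>H\<^esub> x1 \<otimes>\<^bsub>H\<^esub> y1))))"
    by (intro sw_cong) (simp add: assms multA_assoc multH_assoc lin_closed [OF u])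
  also have "\<dots> = sweedler K A H A (\<rho> x) (\<lambda>x0 x1. x0 \<otimes>\<^bsub>A\<^esub> Q u a (h \<otimes>\<^bsub>H\<^esub> x1))"
    unfolding Q_def by (rule sw_cong, rule lin_sw [symmetric]) (intro u_rules assms; assumption)+
  finally show ?thesis .
qed

lemma Q_Q: "\<lbrakk>a \<in> carrier A; b \<in> carrier A; h \<in> carrier H\<rbrakk> \<Longrightarrow> Q (Q u b) a h = Q u (a \<otimes>\<^bsub>A\<^esub> b) h"
  by (subst Q_left) (simp_all add: Q_def [of "Q u b"])

lemma Q_mult_right:
  assumes "a \<in> carrier A" "b \<in> carrier A" "h \<in> carrier H"
  shows "Q (\<lambda>h. u h \<otimes>\<^bsub>A\<^esub> b) a h = Q u a h \<otimes>\<^bsub>A\<^esub> b"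
proof -
  have "Q u a h \<otimes>\<^bsub>A\<^esub> b = sweedler K A H A (\<rho> a) (\<lambda>x y. x \<otimes>\<^bsub>A\<^esub> u (h \<otimes>\<^bsub>H\<^esub> y) \<otimes>\<^bsub>A\<^esub> b)"
    unfolding Q_def
    by (rule lin_sw [where \<phi> = "\<lambda>z. z \<otimes>\<^bsub>A\<^esub> b"]) (intro u_rules assms; assumption)+
  also have "\<dots> = Q (\<lambda>h. u h \<otimes>\<^bsub>A\<^esub> b) a h"
    unfolding Q_def by (rule sw_cong) (simp add: assms multA_assoc lin_closed [OF u])
  finally show ?thesis by simp
qed

end

lemma conv_linear:
  assumes u: "u \<in> linear_maps K H A" and v: "v \<in> linear_maps K H A"
  shows "conv u v \<in> linear_maps K H A"
proof -
  have "(\<lambda>h. conv u v h) \<in> linear_maps K H A"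
    unfolding conv_def by (intro u_rules [OF u] u_rules [OF v]; assumption)
  then show ?thesis by simp
qed

text \<open>Compatibility of the product with the right action; associativity rests on it. By
  \<open>Q_left\<close> the first leg of \<open>b\<close> coacts once more. Lax coassociativity
  trades this for a splitting of the second leg, at the price of a factor \<open>\<rho>(1)\<close>
  that \<open>Q u\<close> absorbs. Multiplicativity of \<open>\<Delta>\<close> then joins the split
  leg to the legs of \<open>h\<close>.\<close>

lemma Q_conv:
  assumes u: "u \<in> linear_maps K H A" and v: "v \<in> linear_maps K H A"
    and b: "b \<in> carrier A" and h: "h \<in> carrier H"
  shows "Q (conv u v) b h = conv u (Q v b) h"
proof -
  note r = u_rules [OF u] u_rules [OF v] b h
  have "conv u (Q v b) h = sweedler K H H A (\<Delta> h) (\<lambda>p q. sweedler K A H A (\<rho> b)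
      (\<lambda>x y. Q u (x \<otimes>\<^bsub>A\<^esub> v (q \<otimes>\<^bsub>H\<^esub> y)) p))"
    unfolding conv_def Q_def [of v]
    by (rule sw_cong, rule lin_sw [where \<phi> = "\<lambda>z. Q u z _"]) (intro r; assumption)+
  also have "\<dots> = sweedler K H H A (\<Delta> h) (\<lambda>p q. sweedler K A H A (\<rho> b) (\<lambda>x y.
      sweedler K A H A (\<rho> x) (\<lambda>x0 x1. x0 \<otimes>\<^bsub>A\<^esub> Q u (v (q \<otimes>\<^bsub>H\<^esub> y)) (p \<otimes>\<^bsub>H\<^esub> x1))))"
    by (intro sw_cong Q_left r)
  also have "\<dots> = sweedler K H H A (\<Delta> h) (\<lambda>p q. sweedler K A H A (\<rho> b) (\<lambda>x y.
      sweedler K H H A (\<Delta> y) (\<lambda>y1 y2. sweedler K A H A (\<rho> \<one>\<^bsub>A\<^esub>)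
        (\<lambda>o0 o1. x \<otimes>\<^bsub>A\<^esub> o0 \<otimes>\<^bsub>A\<^esub> Q u (v (q \<otimes>\<^bsub>H\<^esub> y2)) (p \<otimes>\<^bsub>H\<^esub> (y1 \<otimes>\<^bsub>H\<^esub> o1))))))"
    by (rule sw_cong, rule sw_lax_coassoc) (intro r; assumption)+
  also have "\<dots> = sweedler K H H A (\<Delta> h) (\<lambda>p q. sweedler K A H A (\<rho> b) (\<lambda>x y.
      sweedler K H H A (\<Delta> y) (\<lambda>y1 y2. sweedler K A H A (\<rho> \<one>\<^bsub>A\<^esub>)
        (\<lambda>o0 o1. x \<otimes>\<^bsub>A\<^esub> (o0 \<otimes>\<^bsub>A\<^esub> Q u (v (q \<otimes>\<^bsub>H\<^esub> y2)) (p \<otimes>\<^bsub>H\<^esub> y1 \<otimes>\<^bsub>H\<^esub> o1))))))"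
    by (intro sw_cong) (simp add: multA_assoc multH_assoc Q_closed [OF u] lin_closed [OF v])
  also have "\<dots> = sweedler K H H A (\<Delta> h) (\<lambda>p q. sweedler K A H A (\<rho> b) (\<lambda>x y.
      sweedler K H H A (\<Delta> y) (\<lambda>y1 y2. x \<otimes>\<^bsub>A\<^esub> sweedler K A H A (\<rho> \<one>\<^bsub>A\<^esub>)
        (\<lambda>o0 o1. o0 \<otimes>\<^bsub>A\<^esub> Q u (v (q \<otimes>\<^bsub>H\<^esub> y2)) (p \<otimes>\<^bsub>H\<^esub> y1 \<otimes>\<^bsub>H\<^esub> o1)))))"
    by (rule sw_cong, rule sw_cong, rule sw_cong, rule lin_sw [symmetric]) (intro r; assumption)+
  also have "\<dots> = sweedler K H H A (\<Delta> h) (\<lambda>p q. sweedler K A H A (\<rho> b) (\<lambda>x y.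
      sweedler K H H A (\<Delta> y) (\<lambda>y1 y2. x \<otimes>\<^bsub>A\<^esub> Q u (v (q \<otimes>\<^bsub>H\<^esub> y2)) (p \<otimes>\<^bsub>H\<^esub> y1))))"
    using Q_left [OF u oneA_closed, symmetric]
    by (intro sw_cong) (simp add: lin_closed [OF v])
  also have "\<dots> = sweedler K A H A (\<rho> b) (\<lambda>x y. sweedler K H H A (\<Delta> h) (\<lambda>p q.
      sweedler K H H A (\<Delta> y) (\<lambda>y1 y2. x \<otimes>\<^bsub>A\<^esub> Q u (v (q \<otimes>\<^bsub>H\<^esub> y2)) (p \<otimes>\<^bsub>H\<^esub> y1))))"
    by (rule sw_swap) (intro r; assumption)+
  also have "\<dots> = sweedler K A H A (\<rho> b) (\<lambda>x y.
      sweedler K H H A (\<Delta> (h \<otimes>\<^bsub>H\<^esub> y)) (\<lambda>p q. x \<otimes>\<^bsub>A\<^esub> Q u (v q) p))"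
    by (rule sw_cong, rule sw_comult_mult [symmetric]) (intro r; assumption)+
  also have "\<dots> = sweedler K A H A (\<rho> b) (\<lambda>x y. x \<otimes>\<^bsub>A\<^esub> conv u v (h \<otimes>\<^bsub>H\<^esub> y))"
    unfolding conv_def by (rule sw_cong, rule lin_sw [symmetric]) (intro r; assumption)+
  also have "\<dots> = Q (conv u v) b h"
    by (simp add: Q_def)
  finally show ?thesis by simp
qed

text \<open>\<open>Q_conv\<close> moves the action of \<open>w q\<close> from the product
  \<open>u v\<close> onto \<open>v\<close>; what remains is coassociativity of
  \<open>\<Delta>\<close>.\<close>

lemma conv_assoc:
  assumes u: "u \<in> linear_maps K H A" and v: "v \<in> linear_maps K H A" and w: "w \<in> linear_maps K H A"
    and h: "h \<in> carrier H"
  shows "conv (conv u v) w h = conv u (conv v w) h"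
proof -
  note r = u_rules [OF u] u_rules [OF v] u_rules [OF w] h
  have "conv (conv u v) w h = sweedler K H H A (\<Delta> h) (\<lambda>p q. Q (conv u v) (w q) p)"
    by (simp add: conv_def [of _ w])
  also have "\<dots> = sweedler K H H A (\<Delta> h) (\<lambda>p q. sweedler K H H A (\<Delta> p) (\<lambda>s t. Q u (Q v (w q) t) s))"
    unfolding conv_def [of u "Q v _", symmetric] by (intro sw_cong Q_conv r)
  also have "\<dots> = sweedler K H H A (\<Delta> h) (\<lambda>p q. sweedler K H H A (\<Delta> q) (\<lambda>s t. Q u (Q v (w t) s) p))"
    by (rule sw_coassoc) (intro r; assumption)+
  also have "\<dots> = sweedler K H H A (\<Delta> h) (\<lambda>p q. Q u (conv v w q) p)"
    unfolding conv_def
    by (rule sw_cong, rule lin_sw [symmetric, where \<phi> = "\<lambda>z. Q u z _"]) (intro r; assumption)+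
  also have "\<dots> = conv u (conv v w) h"
    by (simp add: conv_def [of u])
  finally show ?thesis .
qed

section \<open>The unit map and the unit laws up to the factor \<open>e\<close>\<close>

definition eta where "eta a h = \<epsilon> h \<odot>\<^bsub>A\<^esub> (e \<otimes>\<^bsub>A\<^esub> a)"

lemma eta_linear_A: "h \<in> carrier H \<Longrightarrow> (\<lambda>a. eta a h) \<in> linear_maps K A A"
  unfolding eta_def by (intro lin_rules e_closed; assumption)

lemma eta_linear: "a \<in> carrier A \<Longrightarrow> eta a \<in> linear_maps K H A"
proof -
  assume "a \<in> carrier A"
  then have "(\<lambda>h. eta a h) \<in> linear_maps K H A"
    unfolding eta_def by (intro lin_rules e_closed; assumption)
  then show ?thesis by simp
qed

lemma counit_mult: "\<lbrakk>h \<in> carrier H; g \<in> carrier H\<rbrakk> \<Longrightarrow> \<epsilon> (h \<otimes>\<^bsub>H\<^esub> g) = \<epsilon> h \<otimes>\<^bsub>K\<^esub> \<epsilon> g"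
  by (rule ring_hom_mult [OF counit_ring_hom])

text \<open>Since \<open>\<epsilon>\<close> is multiplicative, the sum over \<open>\<rho>(c)\<close>
  contracts to \<open>e c\<close>. The second \<open>e\<close>, which comes from \<open>eta\<close>,
  is removed by \<open>e c e = e c\<close>.\<close>

lemma Q_eta:
  assumes b: "b \<in> carrier A" and c: "c \<in> carrier A" and h: "h \<in> carrier H"
  shows "Q (eta b) c h = eta (c \<otimes>\<^bsub>A\<^esub> b) h"
proof -
  have "Q (eta b) c h = sweedler K A H A (\<rho> c) (\<lambda>x y. \<epsilon> h \<odot>\<^bsub>A\<^esub> ((\<epsilon> y \<odot>\<^bsub>A\<^esub> x) \<otimes>\<^bsub>A\<^esub> (e \<otimes>\<^bsub>A\<^esub> b)))"
    unfolding Q_def eta_def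
    by (rule sw_cong)
      (simp add: b h counit_mult counit_closed e_closed A.smult_assoc1 A.smult_mult_left A.smult_mult_right)
  also have "\<dots> = \<epsilon> h \<odot>\<^bsub>A\<^esub> (sweedler K A H A (\<rho> c) (\<lambda>x y. \<epsilon> y \<odot>\<^bsub>A\<^esub> x) \<otimes>\<^bsub>A\<^esub> (e \<otimes>\<^bsub>A\<^esub> b))"
    by (rule lin_sw [symmetric, where \<phi> = "\<lambda>z. \<epsilon> h \<odot>\<^bsub>A\<^esub> (z \<otimes>\<^bsub>A\<^esub> (e \<otimes>\<^bsub>A\<^esub> b))"])
      (intro lin_rules e_closed b c h; assumption)+
  also have "\<dots> = \<epsilon> h \<odot>\<^bsub>A\<^esub> (e \<otimes>\<^bsub>A\<^esub> c \<otimes>\<^bsub>A\<^esub> e \<otimes>\<^bsub>A\<^esub> b)"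
    by (simp add: e_mult c b e_closed multA_assoc)
  also have "\<dots> = eta (c \<otimes>\<^bsub>A\<^esub> b) h"
    by (simp only: e_c_e c) (simp add: c b e_closed multA_assoc eta_def)
  finally show ?thesis .
qed

text \<open>\<open>Q_eta\<close> reduces the product to a sum over \<open>\<Delta> h\<close> against
  the counit. The factor \<open>e\<close> that stays on the left is removed by
  \<open>e_Q_one\<close> for functions of the form \<open>Q u \<one>\<close>, that is, on the image
  of the right action of 1.\<close>

lemma conv_eta_left:
  assumes a: "a \<in> carrier A" and v: "v \<in> linear_maps K H A" and h: "h \<in> carrier H"
  shows "conv (eta a) v h = e \<otimes>\<^bsub>A\<^esub> v h \<otimes>\<^bsub>A\<^esub> a"
proof -
  have "conv (eta a) v h = sweedler K H H A (\<Delta> h) (\<lambda>p q. \<epsilon> p \<odot>\<^bsub>A\<^esub> (e \<otimes>\<^bsub>A\<^esub> v q \<otimes>\<^bsub>A\<^esub> a))"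
    unfolding conv_def
    by (rule sw_cong) (simp add: Q_eta lin_closed [OF v] a, simp add: eta_def lin_closed [OF v] a multA_assoc e_closed)
  also have "\<dots> = e \<otimes>\<^bsub>A\<^esub> v h \<otimes>\<^bsub>A\<^esub> a"
    by (rule sw_counit_left) (intro u_rules [OF v] e_closed a h; assumption)+
  finally show ?thesis .
qed

lemma conv_eta_right:
  assumes a: "a \<in> carrier A" and u: "u \<in> linear_maps K H A" and h: "h \<in> carrier H"
  shows "conv u (eta a) h = Q u (e \<otimes>\<^bsub>A\<^esub> a) h"
proof -
  have "conv u (eta a) h = sweedler K H H A (\<Delta> h) (\<lambda>p q. \<epsilon> q \<odot>\<^bsub>A\<^esub> Q u (e \<otimes>\<^bsub>A\<^esub> a) p)"
    unfolding conv_def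
    by (rule sw_cong) (simp add: eta_def lin_smult [OF Q_linear_A [OF u]] a e_closed counit_closed)
  also have "\<dots> = Q u (e \<otimes>\<^bsub>A\<^esub> a) h"
    by (rule sw_counit_right) (intro u_rules [OF u] Q_linear_H [OF u] e_closed a h; assumption)+
  finally show ?thesis .
qed

lemma Q_e_left:
  assumes u: "u \<in> linear_maps K H A" and a: "a \<in> carrier A" and h: "h \<in> carrier H"
  shows "Q u (e \<otimes>\<^bsub>A\<^esub> a) h = Q u a h"
  using Q_left [OF u e_closed a h] Q_left [OF u oneA_closed a h] a by (simp add: rho_e)

text \<open>\<open>Q u \<one>\<close> is a sum over \<open>\<rho>(1)\<close> whose first leg stands
  leftmost, so the identity \<open>(e \<otimes> 1) \<rho>(1) = \<rho>(1)\<close> applies. This is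
  how the axiom \<open>rho_one\<close> enters the left unit law.\<close>

lemma e_Q_one:
  assumes u: "u \<in> linear_maps K H A" and h: "h \<in> carrier H"
  shows "e \<otimes>\<^bsub>A\<^esub> Q u \<one>\<^bsub>A\<^esub> h = Q u \<one>\<^bsub>A\<^esub> h"
proof -
  have "e \<otimes>\<^bsub>A\<^esub> Q u \<one>\<^bsub>A\<^esub> h = sweedler K A H A (\<rho> \<one>\<^bsub>A\<^esub>) (\<lambda>x y. e \<otimes>\<^bsub>A\<^esub> (x \<otimes>\<^bsub>A\<^esub> u (h \<otimes>\<^bsub>H\<^esub> y)))"
    unfolding Q_def by (rule lin_sw) (intro u_rules [OF u] e_closed h; assumption)+
  also have "\<dots> = sweedler K A H A (\<rho> \<one>\<^bsub>A\<^esub>) (\<lambda>x y. (e \<otimes>\<^bsub>A\<^esub> x) \<otimes>\<^bsub>A\<^esub> u (h \<otimes>\<^bsub>H\<^esub> y))"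
    by (rule sw_cong) (simp add: multA_assoc e_closed lin_closed [OF u] h)
  also have "\<dots> = Q u \<one>\<^bsub>A\<^esub> h"
    unfolding Q_def by (rule sw_rho_one_e) (intro u_rules [OF u] h; assumption)+
  finally show ?thesis .
qed

end

section \<open>Lax rings and their transport\<close>

locale bimodule_pair = M: bimodule B M + N: bimodule B N
  for B :: "('b, 'z) ring_scheme" and M :: "('b, 'm, 'x) bimodule_scheme"
    and N :: "('b, 'n, 'y) bimodule_scheme"
begin

sublocale P: balanced_pair "carrier B" "ract M" "lact N" M N
  by (intro balanced_pair.intro M.abelian_group_axioms N.abelian_group_axioms M.ract_closed N.lact_closed)

lemma btgroup_ops:
  "carrier (btgroup B M N) = carrier P.T" "add (btgroup B M N) = mult P.T"
  "\<zero>\<^bsub>btgroup B M N\<^esub> = \<one>\<^bsub>P.T\<^esub>"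
  by (simp_all add: btgroup_def Let_def)

lemma btensor_ops:
  "carrier (btensor B M N) = carrier P.T" "add (btensor B M N) = mult P.T"
  "\<zero>\<^bsub>btensor B M N\<^esub> = \<one>\<^bsub>P.T\<^esub>"
  by (simp_all add: btensor_def ring.defs btgroup_ops)

lemma abelian_group_ops:
  fixes G :: "(('m, 'n) tens, 'w) ring_scheme"
  assumes "carrier G = carrier P.T" "add G = mult P.T" "\<zero>\<^bsub>G\<^esub> = \<one>\<^bsub>P.T\<^esub>"
  shows "abelian_group G"
proof -
  interpret T: comm_group P.T by (rule P.comm_group_T)
  show ?thesis
    by (rule abelian_groupI) (auto simp only: assms T.m_ac T.m_closed T.one_closed T.l_one T.r_one
        intro: T.l_inv_ex)
qed

lemma abelian_group_btgroup: "abelian_group (btgroup B M N)"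
  by (rule abelian_group_ops) (simp_all add: btgroup_ops)

lemma abelian_group_btensor: "abelian_group (btensor B M N)"
  by (rule abelian_group_ops) (simp_all add: btensor_ops)

lemma lact_balanced:
  "b \<in> carrier B \<Longrightarrow> P.balanced (btgroup B M N) (\<lambda>m n. btpure B M N (lact M b m) n)"
  unfolding P.balanced_def btpure_def
  by (simp add: btgroup_ops P.pure_closed M.lact_closed M.lact_add P.pure_add_left P.pure_add_right
      M.ract_closed P.pure_balanced flip: M.lact_ract)

lemma ract_balanced:
  "b \<in> carrier B \<Longrightarrow> P.balanced (btgroup B M N) (\<lambda>m n. btpure B M N m (ract N n b))"
  unfolding P.balanced_def btpure_def
  by (simp add: btgroup_ops P.pure_closed N.ract_closed N.add_ract P.pure_add_left P.pure_add_right
      N.lact_ract P.pure_balanced)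

lemma lact_btensor:
  "lact (btensor B M N) b t = bal_lift (carrier B) (ract M) (lact N) M N (btgroup B M N) t
     (\<lambda>m n. btpure B M N (lact M b m) n)"
  by (simp add: btensor_def ring.defs bsweedler_def)

lemma ract_btensor:
  "ract (btensor B M N) t b = bal_lift (carrier B) (ract M) (lact N) M N (btgroup B M N) t
     (\<lambda>m n. btpure B M N m (ract N n b))"
  by (simp add: btensor_def ring.defs bsweedler_def)

context
  fixes b assumes b: "b \<in> carrier B"
begin

lemma lact_btensor_pure:
  "\<lbrakk>m \<in> carrier M; n \<in> carrier N\<rbrakk> \<Longrightarrow> lact (btensor B M N) b (P.pure m n) = P.pure (lact M b m) n"
  using P.bal_lift_pure [OF abelian_group_btgroup lact_balanced [OF b]]
  by (simp only: lact_btensor btpure_def)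

lemma lact_btensor_add:
  "\<lbrakk>s \<in> carrier P.T; t \<in> carrier P.T\<rbrakk> \<Longrightarrow> lact (btensor B M N) b (s \<otimes>\<^bsub>P.T\<^esub> t)
     = lact (btensor B M N) b s \<otimes>\<^bsub>P.T\<^esub> lact (btensor B M N) b t"
  using P.bal_lift_add [OF abelian_group_btgroup lact_balanced [OF b]]
  by (simp only: lact_btensor btgroup_ops)

lemma lact_btensor_one: "lact (btensor B M N) b \<one>\<^bsub>P.T\<^esub> = \<one>\<^bsub>P.T\<^esub>"
  using P.bal_lift_one [OF abelian_group_btgroup lact_balanced [OF b]]
  by (simp only: lact_btensor btgroup_ops)

lemma lact_btensor_closed: "t \<in> carrier P.T \<Longrightarrow> lact (btensor B M N) b t \<in> carrier P.T"
  using P.bal_lift_closed [OF abelian_group_btgroup lact_balanced [OF b]]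
  by (simp only: lact_btensor btgroup_ops)

lemma ract_btensor_pure:
  "\<lbrakk>m \<in> carrier M; n \<in> carrier N\<rbrakk> \<Longrightarrow> ract (btensor B M N) (P.pure m n) b = P.pure m (ract N n b)"
  using P.bal_lift_pure [OF abelian_group_btgroup ract_balanced [OF b]]
  by (simp only: ract_btensor btpure_def)

lemma ract_btensor_add:
  "\<lbrakk>s \<in> carrier P.T; t \<in> carrier P.T\<rbrakk> \<Longrightarrow> ract (btensor B M N) (s \<otimes>\<^bsub>P.T\<^esub> t) b
     = ract (btensor B M N) s b \<otimes>\<^bsub>P.T\<^esub> ract (btensor B M N) t b"
  using P.bal_lift_add [OF abelian_group_btgroup ract_balanced [OF b]]
  by (simp only: ract_btensor btgroup_ops)

lemma ract_btensor_one: "ract (btensor B M N) \<one>\<^bsub>P.T\<^esub> b = \<one>\<^bsub>P.T\<^esub>"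
  using P.bal_lift_one [OF abelian_group_btgroup ract_balanced [OF b]]
  by (simp only: ract_btensor btgroup_ops)

lemma ract_btensor_closed: "t \<in> carrier P.T \<Longrightarrow> ract (btensor B M N) t b \<in> carrier P.T"
  using P.bal_lift_closed [OF abelian_group_btgroup ract_balanced [OF b]]
  by (simp only: ract_btensor btgroup_ops)

end

end

text \<open>A left unital lax ring in terms of elements. The bimodule map on
  \<open>R \<otimes>\<^sub>B R\<close> is replaced by distributivity, balance and compatibility of
  the product with both actions; these equations can be carried along a bijection without any tensor
  product being mentioned.\<close>

locale lax_ring_laws = bimodule B R
  for B :: "('b, 'z) ring_scheme" and R :: "('b, 'r) lax_ring" +
  assumes lact_one: "r \<in> carrier R \<Longrightarrow> lact R \<one>\<^bsub>B\<^esub> r = r"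
    and mult_closed: "\<lbrakk>r \<in> carrier R; s \<in> carrier R\<rbrakk> \<Longrightarrow> r \<otimes>\<^bsub>R\<^esub> s \<in> carrier R"
    and add_mult: "\<lbrakk>r \<in> carrier R; s \<in> carrier R; t \<in> carrier R\<rbrakk>
          \<Longrightarrow> (r \<oplus>\<^bsub>R\<^esub> s) \<otimes>\<^bsub>R\<^esub> t = r \<otimes>\<^bsub>R\<^esub> t \<oplus>\<^bsub>R\<^esub> s \<otimes>\<^bsub>R\<^esub> t"
    and mult_add: "\<lbrakk>r \<in> carrier R; s \<in> carrier R; t \<in> carrier R\<rbrakk>
          \<Longrightarrow> r \<otimes>\<^bsub>R\<^esub> (s \<oplus>\<^bsub>R\<^esub> t) = r \<otimes>\<^bsub>R\<^esub> s \<oplus>\<^bsub>R\<^esub> r \<otimes>\<^bsub>R\<^esub> t"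
    and mult_balanced: "\<lbrakk>r \<in> carrier R; b \<in> carrier B; s \<in> carrier R\<rbrakk>
          \<Longrightarrow> ract R r b \<otimes>\<^bsub>R\<^esub> s = r \<otimes>\<^bsub>R\<^esub> lact R b s"
    and lact_mult: "\<lbrakk>b \<in> carrier B; r \<in> carrier R; s \<in> carrier R\<rbrakk>
          \<Longrightarrow> lact R b (r \<otimes>\<^bsub>R\<^esub> s) = lact R b r \<otimes>\<^bsub>R\<^esub> s"
    and ract_mult: "\<lbrakk>b \<in> carrier B; r \<in> carrier R; s \<in> carrier R\<rbrakk>
          \<Longrightarrow> ract R (r \<otimes>\<^bsub>R\<^esub> s) b = r \<otimes>\<^bsub>R\<^esub> ract R s b"
    and mult_assoc: "\<lbrakk>r \<in> carrier R; s \<in> carrier R; t \<in> carrier R\<rbrakk>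
          \<Longrightarrow> (r \<otimes>\<^bsub>R\<^esub> s) \<otimes>\<^bsub>R\<^esub> t = r \<otimes>\<^bsub>R\<^esub> (s \<otimes>\<^bsub>R\<^esub> t)"
    and unit_closed: "b \<in> carrier B \<Longrightarrow> unit_map R b \<in> carrier R"
    and unit_add: "\<lbrakk>b \<in> carrier B; c \<in> carrier B\<rbrakk>
          \<Longrightarrow> unit_map R (b \<oplus>\<^bsub>B\<^esub> c) = unit_map R b \<oplus>\<^bsub>R\<^esub> unit_map R c"
    and unit_lact: "\<lbrakk>b \<in> carrier B; c \<in> carrier B\<rbrakk> \<Longrightarrow> unit_map R (b \<otimes>\<^bsub>B\<^esub> c) = lact R b (unit_map R c)"
    and unit_ract: "\<lbrakk>b \<in> carrier B; c \<in> carrier B\<rbrakk> \<Longrightarrow> unit_map R (c \<otimes>\<^bsub>B\<^esub> b) = ract R (unit_map R c) b"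
    and unit_left: "r \<in> carrier R \<Longrightarrow> unit_map R \<one>\<^bsub>B\<^esub> \<otimes>\<^bsub>R\<^esub> ract R r \<one>\<^bsub>B\<^esub> = ract R r \<one>\<^bsub>B\<^esub>"
    and unit_right: "r \<in> carrier R \<Longrightarrow> ract R r \<one>\<^bsub>B\<^esub> \<otimes>\<^bsub>R\<^esub> unit_map R \<one>\<^bsub>B\<^esub> = ract R r \<one>\<^bsub>B\<^esub>"
begin

text \<open>The product is biadditive and balanced, so it lifts to
  \<open>R \<otimes>\<^sub>B R\<close>; that the lift respects both actions is checked on pure
  tensors.\<close>

lemma left_unital_lax_ring: "left_unital_lax_ring B R"
proof -
  interpret P: bimodule_pair B R R by (intro bimodule_pair.intro bimodule_axioms)
  interpret T: comm_group P.P.T by (rule P.P.comm_group_T)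
  have bal: "P.P.balanced R (\<lambda>r s. r \<otimes>\<^bsub>R\<^esub> s)"
    unfolding P.P.balanced_def by (simp add: mult_closed add_mult mult_add mult_balanced)
  let ?\<mu> = "\<lambda>t. bal_lift (carrier B) (ract R) (lact R) R R R t (\<lambda>r s. r \<otimes>\<^bsub>R\<^esub> s)"
  note \<mu>_pure = P.P.bal_lift_pure [OF abelian_group_axioms bal]
    and \<mu>_add = P.P.bal_lift_add [OF abelian_group_axioms bal]
    and \<mu>_one = P.P.bal_lift_one [OF abelian_group_axioms bal]
    and \<mu>_closed = P.P.bal_lift_closed [OF abelian_group_axioms bal]
  have lact0: "lact R b \<zero>\<^bsub>R\<^esub> = \<zero>\<^bsub>R\<^esub>" "ract R \<zero>\<^bsub>R\<^esub> b = \<zero>\<^bsub>R\<^esub>" if "b \<in> carrier B" for b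
    using lact_add [OF that, of "\<zero>\<^bsub>R\<^esub>" "\<zero>\<^bsub>R\<^esub>"] lact_closed [OF that, of "\<zero>\<^bsub>R\<^esub>"]
      add_ract [of "\<zero>\<^bsub>R\<^esub>" "\<zero>\<^bsub>R\<^esub>", OF _ _ that] ract_closed [of "\<zero>\<^bsub>R\<^esub>", OF _ that] by simp_all
  have l: "?\<mu> (lact (btensor B R R) b t) = lact R b (?\<mu> t)"
    and r: "?\<mu> (ract (btensor B R R) t b) = ract R (?\<mu> t) b"
    if b: "b \<in> carrier B" and t: "t \<in> carrier P.P.T" for b t
    using t
  proof (induction t rule: P.P.tens_induct)
    case zero
    case 1 show ?case by (simp only: P.lact_btensor_one [OF b] \<mu>_one lact0 [OF b])
    case 2 show ?case by (simp only: P.ract_btensor_one [OF b] \<mu>_one lact0 [OF b])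
  next
    case (add m n t)
    note c = add P.P.pure_closed [OF add(1,2)] mult_closed \<mu>_closed b
    case 1 show ?case
      using c by (simp add: P.lact_btensor_add P.lact_btensor_pure P.lact_btensor_closed
          lact_closed P.P.pure_closed \<mu>_add \<mu>_pure lact_mult lact_add)
    case 2 show ?case
      using c by (simp add: P.ract_btensor_add P.ract_btensor_pure P.ract_btensor_closed
          ract_closed P.P.pure_closed \<mu>_add \<mu>_pure ract_mult add_ract)
  qed
  have "\<exists>\<mu>\<in>bimodule_maps B (btensor B R R) R.
     \<forall>r\<in>carrier R. \<forall>s\<in>carrier R. \<mu> (btpure B R R r s) = r \<otimes>\<^bsub>R\<^esub> s"
  proof (rule bexI [of _ ?\<mu>])
    show "?\<mu> \<in> bimodule_maps B (btensor B R R) R"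
      unfolding bimodule_maps_def by (simp add: P.btensor_ops \<mu>_closed \<mu>_add l r Pi_iff)
    show "\<forall>r\<in>carrier R. \<forall>s\<in>carrier R. ?\<mu> (btpure B R R r s) = r \<otimes>\<^bsub>R\<^esub> s"
      by (simp add: \<mu>_pure btpure_def)
  qed
  moreover have "unit_map R \<in> bimodule_maps B (regular_bimodule B) R"
    by (auto simp: bimodule_maps_def regular_bimodule_def unit_closed unit_add intro: unit_lact unit_ract)
  ultimately show ?thesis
    unfolding left_unital_lax_ring_def
    using bimodule_axioms
    by (intro conjI ballI) (auto simp: lact_one mult_assoc unit_left unit_right)
qed

text \<open>Left unitality gives \<open>\<eta>(1) = 1 \<eta>(1)\<close>. Balance moves this 1 onto
  \<open>r\<close>, and the unit law holds for \<open>r 1\<close>.\<close>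

lemma mult_unit_one: "r \<in> carrier R \<Longrightarrow> r \<otimes>\<^bsub>R\<^esub> unit_map R \<one>\<^bsub>B\<^esub> = ract R r \<one>\<^bsub>B\<^esub>"
proof -
  assume r: "r \<in> carrier R"
  have "r \<otimes>\<^bsub>R\<^esub> unit_map R \<one>\<^bsub>B\<^esub> = ract R r \<one>\<^bsub>B\<^esub> \<otimes>\<^bsub>R\<^esub> unit_map R \<one>\<^bsub>B\<^esub>"
    using mult_balanced [OF r _ unit_closed, of "\<one>\<^bsub>B\<^esub>" "\<one>\<^bsub>B\<^esub>"] lact_one unit_closed by simp
  then show ?thesis using unit_right [OF r] by simp
qed

lemma mult_unit: "\<lbrakk>r \<in> carrier R; b \<in> carrier B\<rbrakk> \<Longrightarrow> r \<otimes>\<^bsub>R\<^esub> unit_map R b = ract R r b"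
  using ract_mult [of b r "unit_map R \<one>\<^bsub>B\<^esub>"] unit_ract [of b "\<one>\<^bsub>B\<^esub>"]
    ract_ract [of r "\<one>\<^bsub>B\<^esub>" b] by (simp add: mult_unit_one unit_closed)

lemma ract_one_ract: "\<lbrakk>r \<in> carrier R; b \<in> carrier B\<rbrakk> \<Longrightarrow> ract R (ract R r b) \<one>\<^bsub>B\<^esub> = ract R r b"
  by (simp flip: ract_ract)

lemma underline_carrier: "r \<in> carrier (underline B R) \<longleftrightarrow> r \<in> carrier R \<and> ract R r \<one>\<^bsub>B\<^esub> = r"
  by (force simp: underline_def ract_closed ract_one_ract)

lemma underline_ops:
  "add (underline B R) = add R" "\<zero>\<^bsub>underline B R\<^esub> = \<zero>\<^bsub>R\<^esub>" "mult (underline B R) = mult R"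
  "\<one>\<^bsub>underline B R\<^esub> = \<one>\<^bsub>R\<^esub>" "lact (underline B R) = lact R" "ract (underline B R) = ract R"
  "unit_map (underline B R) = unit_map R"
  by (simp_all add: underline_def)

lemma ract_zero: "b \<in> carrier B \<Longrightarrow> ract R \<zero>\<^bsub>R\<^esub> b = \<zero>\<^bsub>R\<^esub>"
  using add_ract [of "\<zero>\<^bsub>R\<^esub>" "\<zero>\<^bsub>R\<^esub>" b] ract_closed [of "\<zero>\<^bsub>R\<^esub>" b] by simp

lemma ract_minus: "\<lbrakk>r \<in> carrier R; b \<in> carrier B\<rbrakk> \<Longrightarrow> ract R (\<ominus>\<^bsub>R\<^esub> r) b = \<ominus>\<^bsub>R\<^esub> ract R r b"
  using add_ract [of "\<ominus>\<^bsub>R\<^esub> r" r b]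
  by (intro M.minus_equality [symmetric]) (simp_all add: ract_closed M.l_neg ract_zero)

text \<open>The premise makes the field \<open>one\<close> agree with the unit map. On
  \<open>R 1\<close> the lax unit laws become genuine ones, and both actions become multiplication
  by values of the unit map: on the right by \<open>mult_unit\<close>, on the left because
  \<open>\<eta>(b) = b \<eta>(1)\<close>.\<close>

lemma over_ring_underline:
  assumes one: "\<one>\<^bsub>R\<^esub> = unit_map R \<one>\<^bsub>B\<^esub>"
  shows "over_ring B (underline B R)"
proof -
  have unit_ul: "unit_map R b \<in> carrier (underline B R)" if "b \<in> carrier B" for b
    using unit_ract [OF _ that, of "\<one>\<^bsub>B\<^esub>"] that by (simp add: underline_carrier unit_closed)
  have left: "unit_map R b \<otimes>\<^bsub>R\<^esub> r = lact R b r" if "b \<in> carrier B" "r \<in> carrier (underline B R)" for b r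
  proof -
    have "unit_map R b = lact R b (unit_map R \<one>\<^bsub>B\<^esub>)"
      using unit_lact [OF that(1), of "\<one>\<^bsub>B\<^esub>"] that by simp
    then show ?thesis
      using that unit_left [of r] lact_mult [of b "unit_map R \<one>\<^bsub>B\<^esub>" r]
      by (simp add: underline_carrier unit_closed)
  qed
  have ring: "ring (underline B R)"
  proof (rule ringI)
    show "abelian_group (underline B R)"
    proof (rule abelian_groupI)
      fix x assume "x \<in> carrier (underline B R)"
      then show "\<exists>y\<in>carrier (underline B R). y \<oplus>\<^bsub>underline B R\<^esub> x = \<zero>\<^bsub>underline B R\<^esub>"
        by (intro bexI [of _ "\<ominus>\<^bsub>R\<^esub> x"]) (simp_all add: underline_carrier underline_ops l_neg ract_minus)
    qed (simp_all add: underline_carrier underline_ops M.a_ac add_ract ract_zero)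
    show "monoid (underline B R)"
    proof (rule monoidI)
      fix x assume x: "x \<in> carrier (underline B R)"
      show "\<one>\<^bsub>underline B R\<^esub> \<otimes>\<^bsub>underline B R\<^esub> x = x" "x \<otimes>\<^bsub>underline B R\<^esub> \<one>\<^bsub>underline B R\<^esub> = x"
        using x unit_left [of x] unit_right [of x] by (simp_all add: underline_ops one underline_carrier)
    qed (use unit_ul in \<open>simp_all add: underline_ops one underline_carrier mult_closed ract_mult mult_assoc\<close>)
  qed (simp_all add: underline_carrier underline_ops add_mult mult_add)
  have "unit_map R \<in> ring_hom B (underline B R)"
    by (rule ring_hom_memI)
      (use unit_ul left in \<open>simp_all add: underline_ops one unit_add unit_lact\<close>)
  then show ?thesis
    unfolding over_ring_def
    using ring left B.ring_axioms mult_unit by (simp add: underline_ops underline_carrier)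
qed

end

section \<open>Transport of structure along a bijection\<close>

text \<open>\<open>\<psi>\<close> carries all operations of \<open>E\<close> to those of \<open>R\<close>; nothing is assumed about \<open>R\<close> itself.\<close>

definition lax_transport ::
  "('b, 'z) ring_scheme \<Rightarrow> ('b, 'r) lax_ring \<Rightarrow> ('b, 's) lax_ring \<Rightarrow> ('r \<Rightarrow> 's) \<Rightarrow> bool" where
  "lax_transport B E R \<psi> \<longleftrightarrow>
     bij_betw \<psi> (carrier E) (carrier R) \<and> \<psi> \<zero>\<^bsub>E\<^esub> = \<zero>\<^bsub>R\<^esub> \<and>
     (\<forall>r\<in>carrier E. \<forall>s\<in>carrier E. \<psi> (r \<oplus>\<^bsub>E\<^esub> s) = \<psi> r \<oplus>\<^bsub>R\<^esub> \<psi> s) \<and>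
     (\<forall>r\<in>carrier E. \<forall>s\<in>carrier E. \<psi> (r \<otimes>\<^bsub>E\<^esub> s) = \<psi> r \<otimes>\<^bsub>R\<^esub> \<psi> s) \<and>
     (\<forall>b\<in>carrier B. \<forall>r\<in>carrier E. \<psi> (lact E b r) = lact R b (\<psi> r)) \<and>
     (\<forall>b\<in>carrier B. \<forall>r\<in>carrier E. \<psi> (ract E r b) = ract R (\<psi> r) b) \<and>
     (\<forall>b\<in>carrier B. \<psi> (unit_map E b) = unit_map R b)"

text \<open>Common to lax rings and \<open>B\<close>-rings, so that \<open>lax_transport_iso\<close>
  serves both of the ring isomorphisms.\<close>

definition lax_ops_closed :: "('b, 'z) ring_scheme \<Rightarrow> ('b, 'r) lax_ring \<Rightarrow> bool" where
  "lax_ops_closed B E \<longleftrightarrow> abelian_group E \<and>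
     (\<forall>r\<in>carrier E. \<forall>s\<in>carrier E. r \<otimes>\<^bsub>E\<^esub> s \<in> carrier E) \<and>
     (\<forall>b\<in>carrier B. \<forall>r\<in>carrier E. lact E b r \<in> carrier E) \<and>
     (\<forall>b\<in>carrier B. \<forall>r\<in>carrier E. ract E r b \<in> carrier E) \<and>
     (\<forall>b\<in>carrier B. unit_map E b \<in> carrier E)"

lemma (in lax_ring_laws) ops_closed: "lax_ops_closed B R"
  by (simp add: lax_ops_closed_def abelian_group_axioms mult_closed lact_closed ract_closed unit_closed)

lemma over_ring_ops_closed: "over_ring B R \<Longrightarrow> lax_ops_closed B R"
  by (auto simp: over_ring_def lax_ops_closed_def ring.ring_simprules ring_hom_closed ring_def)

lemma lax_transport_image:
  assumes "lax_transport B E R \<psi>" "r \<in> carrier R"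
  obtains x where "x \<in> carrier E" "r = \<psi> x"
  using assms unfolding lax_transport_def bij_betw_def by blast

lemma lax_transport_abelian_group:
  assumes T: "lax_transport B E R \<psi>" and E: "abelian_group E"
  shows "abelian_group R"
proof -
  interpret E: abelian_group E by fact
  have c: "\<psi> x \<in> carrier R" if "x \<in> carrier E" for x
    using T that by (auto simp: lax_transport_def bij_betw_def)
  have add: "\<psi> x \<oplus>\<^bsub>R\<^esub> \<psi> y = \<psi> (x \<oplus>\<^bsub>E\<^esub> y)" if "x \<in> carrier E" "y \<in> carrier E" for x y
    using T that by (simp add: lax_transport_def)
  have zero: "\<zero>\<^bsub>R\<^esub> = \<psi> \<zero>\<^bsub>E\<^esub>" using T by (simp add: lax_transport_def)
  show ?thesis
  proof (rule abelian_groupI)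
    fix r assume "r \<in> carrier R"
    then obtain x where x: "x \<in> carrier E" "r = \<psi> x" by (rule lax_transport_image [OF T])
    show "\<exists>s\<in>carrier R. s \<oplus>\<^bsub>R\<^esub> r = \<zero>\<^bsub>R\<^esub>"
      by (rule bexI [of _ "\<psi> (\<ominus>\<^bsub>E\<^esub> x)"]) (simp_all add: x add zero c E.l_neg)
  qed (auto elim!: lax_transport_image [OF T] simp: add zero c E.a_ac)
qed

text \<open>Every element of \<open>R\<close> is some \<open>\<psi> x\<close>, and after the
  operations have been pulled inside \<open>\<psi>\<close> each law for \<open>R\<close> is the
  image of the same law for \<open>E\<close>.\<close>

lemma lax_transport_laws:
  assumes T: "lax_transport B E R \<psi>" and E: "lax_ring_laws B E"
  shows "lax_ring_laws B R"
proof -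
  interpret E: lax_ring_laws B E by fact
  have c: "\<psi> x \<in> carrier R" if "x \<in> carrier E" for x
    using T that by (auto simp: lax_transport_def bij_betw_def)
  have o: "\<psi> x \<oplus>\<^bsub>R\<^esub> \<psi> y = \<psi> (x \<oplus>\<^bsub>E\<^esub> y)" "\<psi> x \<otimes>\<^bsub>R\<^esub> \<psi> y = \<psi> (x \<otimes>\<^bsub>E\<^esub> y)"
    if "x \<in> carrier E" "y \<in> carrier E" for x y
    using T that by (simp_all add: lax_transport_def)
  have a: "lact R b (\<psi> x) = \<psi> (lact E b x)" "ract R (\<psi> x) b = \<psi> (ract E x b)" "unit_map R b = \<psi> (unit_map E b)"
    if "x \<in> carrier E" "b \<in> carrier B" for x b
    using T that by (simp_all add: lax_transport_def)
  note a3 = a(3) [OF E.M.zero_closed]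
  note simps = o a(1,2) a3 c E.lact_closed E.ract_closed E.mult_closed E.unit_closed
  have R: "abelian_group R"
    by (rule lax_transport_abelian_group [OF T E.abelian_group_axioms])
  show ?thesis
    by (intro lax_ring_laws.intro bimodule.intro R E.B.ring_axioms bimodule_axioms.intro
        lax_ring_laws_axioms.intro; (elim lax_transport_image [OF T])?)
      (simp_all only: simps E.M.a_closed E.B.a_closed E.B.m_closed E.B.one_closed,
        (rule arg_cong [where f = \<psi>],
          (rule E.lact_add E.add_lact E.lact_lact E.ract_add E.add_ract E.ract_ract E.lact_ract
            E.lact_one E.add_mult E.mult_add E.mult_balanced E.lact_mult E.ract_mult E.mult_assoc
            E.unit_add E.unit_lact E.unit_ract E.unit_left E.unit_right; assumption))+)
qed

text \<open>\<open>lax_transport\<close> makes no statement about the field \<open>one\<close>,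
  which a \<open>B\<close>-ring does refer to; hence the separate premise.\<close>

lemma lax_transport_over_ring:
  assumes T: "lax_transport B E R \<psi>" and E: "over_ring B E" and one: "\<psi> \<one>\<^bsub>E\<^esub> = \<one>\<^bsub>R\<^esub>"
  shows "over_ring B R"
proof -
  have rE: "ring E" and rB: "ring B" and hom: "unit_map E \<in> ring_hom B E"
    and la: "\<And>b r. \<lbrakk>b \<in> carrier B; r \<in> carrier E\<rbrakk> \<Longrightarrow> lact E b r = unit_map E b \<otimes>\<^bsub>E\<^esub> r"
    and ra: "\<And>b r. \<lbrakk>b \<in> carrier B; r \<in> carrier E\<rbrakk> \<Longrightarrow> ract E r b = r \<otimes>\<^bsub>E\<^esub> unit_map E b"
    using E by (auto simp: over_ring_def)
  interpret E: ring E by fact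
  have c: "\<psi> x \<in> carrier R" if "x \<in> carrier E" for x
    using T that by (auto simp: lax_transport_def bij_betw_def)
  have o: "\<psi> x \<oplus>\<^bsub>R\<^esub> \<psi> y = \<psi> (x \<oplus>\<^bsub>E\<^esub> y)" "\<psi> x \<otimes>\<^bsub>R\<^esub> \<psi> y = \<psi> (x \<otimes>\<^bsub>E\<^esub> y)"
    if "x \<in> carrier E" "y \<in> carrier E" for x y
    using T that by (simp_all add: lax_transport_def)
  have a: "lact R b (\<psi> x) = \<psi> (lact E b x)" "ract R (\<psi> x) b = \<psi> (ract E x b)" "unit_map R b = \<psi> (unit_map E b)"
    if "x \<in> carrier E" "b \<in> carrier B" for x b
    using T that by (simp_all add: lax_transport_def)
  note a3 = a(3) [OF E.zero_closed]
  have u: "unit_map E b \<in> carrier E" if "b \<in> carrier B" for b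
    using ring_hom_closed [OF hom that] .
  note simps = o a(1,2) a3 c one [symmetric] u la ra
  have ring: "ring R"
  proof (rule ringI)
    show "abelian_group R" by (rule lax_transport_abelian_group [OF T E.abelian_group_axioms])
    show "monoid R"
      by (rule monoidI; (elim lax_transport_image [OF T])?) (simp_all add: simps E.m_assoc)
  qed (elim lax_transport_image [OF T], simp add: simps E.l_distr E.r_distr)+
  have hom2: "unit_map R \<in> ring_hom B R"
    by (rule ring_hom_memI)
      (simp_all add: simps ring_hom_mult [OF hom] ring_hom_add [OF hom] ring_hom_one [OF hom]
        ring.ring_simprules [OF rB])
  have "lact R b r = unit_map R b \<otimes>\<^bsub>R\<^esub> r" "ract R r b = r \<otimes>\<^bsub>R\<^esub> unit_map R b"
    if b: "b \<in> carrier B" and "r \<in> carrier R" for b r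
    using that(2) by (rule lax_transport_image [OF T], simp add: simps b)+
  then show ?thesis using rB ring hom2 by (simp add: over_ring_def)
qed

text \<open>The isomorphism is the inverse of \<open>\<psi>\<close> followed by
  \<open>\<chi>\<close>. Both sides are compared through \<open>E\<close>, so what has to be known
  about \<open>E\<close> is that its operations are closed.\<close>

lemma lax_transport_iso:
  assumes T: "lax_transport B E R \<psi>" and T': "lax_transport B E S \<chi>" and E: "lax_ops_closed B E"
  shows "lax_ring_iso B R S \<noteq> {}"
proof -
  interpret E: abelian_group E using E by (simp add: lax_ops_closed_def)
  let ?i = "inv_into (carrier E) \<psi>"
  have bij: "bij_betw \<psi> (carrier E) (carrier R)" and bij': "bij_betw \<chi> (carrier E) (carrier S)"
    using T T' by (simp_all add: lax_transport_def)
  have i: "?i (\<psi> x) = x" if "x \<in> carrier E" for x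
    using bij that by (simp add: bij_betw_def)
  have c: "\<chi> x \<in> carrier S" if "x \<in> carrier E" for x
    using bij' that by (auto simp: bij_betw_def)
  have cl: "r \<otimes>\<^bsub>E\<^esub> s \<in> carrier E" "lact E b r \<in> carrier E" "ract E r b \<in> carrier E" "unit_map E b \<in> carrier E"
    if "r \<in> carrier E" "s \<in> carrier E" "b \<in> carrier B" for r s b
    using E that by (simp_all add: lax_ops_closed_def)
  have o: "\<psi> x \<oplus>\<^bsub>R\<^esub> \<psi> y = \<psi> (x \<oplus>\<^bsub>E\<^esub> y)" "\<psi> x \<otimes>\<^bsub>R\<^esub> \<psi> y = \<psi> (x \<otimes>\<^bsub>E\<^esub> y)"
      "\<chi> (x \<oplus>\<^bsub>E\<^esub> y) = \<chi> x \<oplus>\<^bsub>S\<^esub> \<chi> y" "\<chi> (x \<otimes>\<^bsub>E\<^esub> y) = \<chi> x \<otimes>\<^bsub>S\<^esub> \<chi> y"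
    if "x \<in> carrier E" "y \<in> carrier E" for x y
    using T T' that by (simp_all add: lax_transport_def)
  have a: "lact R b (\<psi> x) = \<psi> (lact E b x)" "ract R (\<psi> x) b = \<psi> (ract E x b)" "unit_map R b = \<psi> (unit_map E b)"
     "\<chi> (lact E b x) = lact S b (\<chi> x)" "\<chi> (ract E x b) = ract S (\<chi> x) b" "\<chi> (unit_map E b) = unit_map S b"
    if "x \<in> carrier E" "b \<in> carrier B" for x b
    using T T' that by (simp_all add: lax_transport_def)
  have m: "r \<otimes>\<^bsub>E\<^esub> s \<in> carrier E" if "r \<in> carrier E" "s \<in> carrier E" for r s
    using E that by (simp add: lax_ops_closed_def)
  note a3 = a(3,6) [OF E.zero_closed] cl(4) [OF E.zero_closed E.zero_closed]
  have "(\<lambda>x. \<chi> (?i x)) \<in> bimodule_maps B R S"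
    unfolding bimodule_maps_def
    by (auto elim!: lax_transport_image [OF T] simp: i c o a(1,2,4,5) cl(2,3))
  moreover have "bij_betw (\<lambda>x. \<chi> (?i x)) (carrier R) (carrier S)"
    using bij_betw_trans [OF bij_betw_inv_into [OF bij] bij'] by (simp add: comp_def)
  ultimately have "(\<lambda>x. \<chi> (?i x)) \<in> lax_ring_iso B R S"
    unfolding lax_ring_iso_def
    by (auto elim!: lax_transport_image [OF T] simp: i c o a3 m)
  then show ?thesis by blast
qed

text \<open>A transport intertwines the right actions of 1, hence maps \<open>E 1\<close> onto
  \<open>R 1\<close>; the operations are inherited.\<close>

lemma lax_transport_underline:
  assumes T: "lax_transport B E R \<psi>" and E: "lax_ring_laws B E"
  shows "lax_transport B (underline B E) (underline B R) \<psi>"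
proof -
  interpret E: lax_ring_laws B E by fact
  interpret R: lax_ring_laws B R by (rule lax_transport_laws [OF T E])
  have inj: "inj_on \<psi> (carrier E)" and im: "\<psi> ` carrier E = carrier R"
    using T by (auto simp: lax_transport_def bij_betw_def)
  have "\<psi> ` carrier (underline B E) = carrier (underline B R)"
  proof -
    have "\<psi> (ract E x \<one>\<^bsub>B\<^esub>) = ract R (\<psi> x) \<one>\<^bsub>B\<^esub>" if "x \<in> carrier E" for x
      using T that by (simp add: lax_transport_def)
    then show ?thesis
      by (simp add: underline_def image_image flip: im)
  qed
  moreover have sub: "carrier (underline B E) \<subseteq> carrier E"
    by (auto simp: E.underline_carrier)
  ultimately have "bij_betw \<psi> (carrier (underline B E)) (carrier (underline B R))"
    using inj by (simp add: bij_betw_def inj_on_subset)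
  then show ?thesis
    using T subsetD [OF sub] by (simp add: lax_transport_def E.underline_ops R.underline_ops)
qed

lemma ring_op_ring: "ring R \<Longrightarrow> ring (op_ring R)"
proof -
  assume "ring R"
  then interpret ring R .
  show ?thesis
  proof (rule ringI)
    show "abelian_group (op_ring R)"
      by (rule abelian_groupI) (auto simp: op_ring_def a_ac intro: add.l_inv_ex)
    show "monoid (op_ring R)"
      by (rule monoidI) (auto simp: op_ring_def m_assoc)
  qed (auto simp: op_ring_def l_distr r_distr)
qed

lemma op_ring_simps [simp]:
  "carrier (op_ring R) = carrier R" "add (op_ring R) = add R" "\<zero>\<^bsub>op_ring R\<^esub> = \<zero>\<^bsub>R\<^esub>"
  "\<one>\<^bsub>op_ring R\<^esub> = \<one>\<^bsub>R\<^esub>" "x \<otimes>\<^bsub>op_ring R\<^esub> y = y \<otimes>\<^bsub>R\<^esub> x"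
  by (simp_all add: op_ring_def)

lemma restrict_linear:
  assumes "module K M" "f \<in> linear_maps K M N"
  shows "restrict f (carrier M) \<in> linear_maps K M N \<inter> extensional (carrier M)"
proof -
  interpret module K M by fact
  show ?thesis using assms(2) by (auto simp: linear_maps_def Pi_iff)
qed

context lax_comodule_algebra
begin

section \<open>The lax ring laws of \<open>Hom(H, A)\<close>\<close>

definition conv_ring :: "('a, 'h \<Rightarrow> 'a) lax_ring" where
  "conv_ring =
     \<lparr>carrier = linear_maps K H A \<inter> extensional (carrier H),
      mult = (\<lambda>u v. \<lambda>h\<in>carrier H. conv u v h),
      one = (\<lambda>h\<in>carrier H. eta \<one>\<^bsub>A\<^esub> h),
      ring.zero = (\<lambda>h\<in>carrier H. \<zero>\<^bsub>A\<^esub>),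
      add = (\<lambda>u v. \<lambda>h\<in>carrier H. u h \<oplus>\<^bsub>A\<^esub> v h),
      lact = (\<lambda>b u. \<lambda>h\<in>carrier H. u h \<otimes>\<^bsub>A\<^esub> b),
      ract = (\<lambda>u b. \<lambda>h\<in>carrier H. Q u b h),
      unit_map = (\<lambda>a. \<lambda>h\<in>carrier H. eta a h)\<rparr>"

lemma conv_ring_simps:
  "carrier conv_ring = linear_maps K H A \<inter> extensional (carrier H)"
  "u \<otimes>\<^bsub>conv_ring\<^esub> v = (\<lambda>h\<in>carrier H. conv u v h)"
  "\<one>\<^bsub>conv_ring\<^esub> = (\<lambda>h\<in>carrier H. eta \<one>\<^bsub>A\<^esub> h)"
  "\<zero>\<^bsub>conv_ring\<^esub> = (\<lambda>h\<in>carrier H. \<zero>\<^bsub>A\<^esub>)"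
  "u \<oplus>\<^bsub>conv_ring\<^esub> v = (\<lambda>h\<in>carrier H. u h \<oplus>\<^bsub>A\<^esub> v h)"
  "lact conv_ring b u = (\<lambda>h\<in>carrier H. u h \<otimes>\<^bsub>A\<^esub> b)"
  "ract conv_ring u b = (\<lambda>h\<in>carrier H. Q u b h)"
  "unit_map conv_ring b = (\<lambda>h\<in>carrier H. eta b h)"
  by (simp_all add: conv_ring_def)

lemma conv_ring_linear: "u \<in> carrier conv_ring \<Longrightarrow> u \<in> linear_maps K H A"
  by (simp add: conv_ring_simps)

lemma conv_ring_eqI:
  "\<lbrakk>u \<in> carrier conv_ring; v \<in> carrier conv_ring; \<And>h. h \<in> carrier H \<Longrightarrow> u h = v h\<rbrakk> \<Longrightarrow> u = v"
  by (auto simp: conv_ring_simps intro: extensionalityI)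

lemma restrict_conv_ring: "f \<in> linear_maps K H A \<Longrightarrow> restrict f (carrier H) \<in> carrier conv_ring"
  using restrict_linear [OF modH] by (simp add: conv_ring_simps)

lemma Q_restrict: "h \<in> carrier H \<Longrightarrow> Q (restrict u (carrier H)) a h = Q u a h"
  by (rule Q_cong) simp_all

lemma conv_restrict:
  "conv (restrict u (carrier H)) v h = conv u v h"
  "conv u (restrict v (carrier H)) h = conv u v h"
  by (rule conv_cong; simp)+

lemma Q_add_fun:
  assumes u: "u \<in> linear_maps K H A" and v: "v \<in> linear_maps K H A"
    and a: "a \<in> carrier A" and h: "h \<in> carrier H"
  shows "Q (\<lambda>h. u h \<oplus>\<^bsub>A\<^esub> v h) a h = Q u a h \<oplus>\<^bsub>A\<^esub> Q v a h"
proof -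
  have "Q (\<lambda>h. u h \<oplus>\<^bsub>A\<^esub> v h) a h = sweedler K A H A (\<rho> a) (\<lambda>x y. x \<otimes>\<^bsub>A\<^esub> u (h \<otimes>\<^bsub>H\<^esub> y) \<oplus>\<^bsub>A\<^esub> x \<otimes>\<^bsub>A\<^esub> v (h \<otimes>\<^bsub>H\<^esub> y))"
    unfolding Q_def by (rule sw_cong) (simp add: h lin_closed [OF u] lin_closed [OF v] A.r_distr)
  also have "\<dots> = Q u a h \<oplus>\<^bsub>A\<^esub> Q v a h"
    unfolding Q_def
    by (rule sw_add_body) (intro u_rules [OF u] u_rules [OF v] a h; assumption)+
  finally show ?thesis .
qed

lemma conv_add:
  assumes u: "u \<in> linear_maps K H A" and v: "v \<in> linear_maps K H A" and w: "w \<in> linear_maps K H A"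
    and h: "h \<in> carrier H"
  shows "conv (\<lambda>h. u h \<oplus>\<^bsub>A\<^esub> v h) w h = conv u w h \<oplus>\<^bsub>A\<^esub> conv v w h"
    and "conv w (\<lambda>h. u h \<oplus>\<^bsub>A\<^esub> v h) h = conv w u h \<oplus>\<^bsub>A\<^esub> conv w v h"
proof -
  note r = u_rules [OF u] u_rules [OF v] u_rules [OF w] h
  have "conv (\<lambda>h. u h \<oplus>\<^bsub>A\<^esub> v h) w h = sweedler K H H A (\<Delta> h) (\<lambda>p q. Q u (w q) p \<oplus>\<^bsub>A\<^esub> Q v (w q) p)"
    unfolding conv_def by (intro sw_cong Q_add_fun u v lin_closed [OF w])
  also have "\<dots> = conv u w h \<oplus>\<^bsub>A\<^esub> conv v w h"
    unfolding conv_def by (rule sw_add_body) (intro r; assumption)+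
  finally show "conv (\<lambda>h. u h \<oplus>\<^bsub>A\<^esub> v h) w h = conv u w h \<oplus>\<^bsub>A\<^esub> conv v w h" .
  have "conv w (\<lambda>h. u h \<oplus>\<^bsub>A\<^esub> v h) h = sweedler K H H A (\<Delta> h) (\<lambda>p q. Q w (u q) p \<oplus>\<^bsub>A\<^esub> Q w (v q) p)"
    unfolding conv_def by (intro sw_cong lin_add [OF Q_linear_A [OF w]] lin_closed [OF u] lin_closed [OF v])
  also have "\<dots> = conv w u h \<oplus>\<^bsub>A\<^esub> conv w v h"
    unfolding conv_def by (rule sw_add_body) (intro r; assumption)+
  finally show "conv w (\<lambda>h. u h \<oplus>\<^bsub>A\<^esub> v h) h = conv w u h \<oplus>\<^bsub>A\<^esub> conv w v h" .
qed

text \<open>For the balance law both sides are sums of \<open>Q u (v q \<otimes> b) p\<close>, by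
  the action law \<open>Q_Q\<close>. The second identity pulls the common right factor
  \<open>b\<close> out of the sum.\<close>

lemma conv_ract_lact:
  assumes u: "u \<in> linear_maps K H A" and v: "v \<in> linear_maps K H A" and b: "b \<in> carrier A"
    and h: "h \<in> carrier H"
  shows "conv (Q u b) v h = conv u (\<lambda>h. v h \<otimes>\<^bsub>A\<^esub> b) h"
    and "conv (\<lambda>h. u h \<otimes>\<^bsub>A\<^esub> b) v h = conv u v h \<otimes>\<^bsub>A\<^esub> b"
proof -
  note r = u_rules [OF u] u_rules [OF v] h b
  show "conv (Q u b) v h = conv u (\<lambda>h. v h \<otimes>\<^bsub>A\<^esub> b) h"
    unfolding conv_def by (rule sw_cong) (simp add: Q_Q [OF u] lin_closed [OF v] b)
  have "conv (\<lambda>h. u h \<otimes>\<^bsub>A\<^esub> b) v h = sweedler K H H A (\<Delta> h) (\<lambda>p q. Q u (v q) p \<otimes>\<^bsub>A\<^esub> b)"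
    unfolding conv_def by (intro sw_cong Q_mult_right u b lin_closed [OF v])
  also have "\<dots> = conv u v h \<otimes>\<^bsub>A\<^esub> b"
    unfolding conv_def
    by (rule lin_sw [symmetric, where \<phi> = "\<lambda>z. z \<otimes>\<^bsub>A\<^esub> b"]) (intro r; assumption)+
  finally show "conv (\<lambda>h. u h \<otimes>\<^bsub>A\<^esub> b) v h = conv u v h \<otimes>\<^bsub>A\<^esub> b" .
qed

lemmas addA_ac =
  abelian_monoid.a_assoc [OF abelian_group.axioms(1) [OF module.axioms(2) [OF modA]]]
  abelian_monoid.a_comm [OF abelian_group.axioms(1) [OF module.axioms(2) [OF modA]]]
  abelian_monoid.a_lcomm [OF abelian_group.axioms(1) [OF module.axioms(2) [OF modA]]]

lemma conv_ring_abelian_group: "abelian_group conv_ring"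
proof -
  have ad: "u \<oplus>\<^bsub>conv_ring\<^esub> v \<in> carrier conv_ring"
    if "u \<in> carrier conv_ring" "v \<in> carrier conv_ring" for u v
    unfolding conv_ring_simps
    by (rule restrict_conv_ring [unfolded conv_ring_simps], rule lin_add_fun [OF modA])
      (use that in \<open>simp_all add: conv_ring_linear\<close>)
  have zero: "\<zero>\<^bsub>conv_ring\<^esub> \<in> carrier conv_ring"
    unfolding conv_ring_simps
    by (rule restrict_conv_ring [unfolded conv_ring_simps], rule linI) simp_all
  have cl: "u h \<in> carrier A" if "u \<in> carrier conv_ring" "h \<in> carrier H" for u h
    by (rule lin_closed [OF conv_ring_linear [OF that(1)] that(2)])
  have simps: "(u \<oplus>\<^bsub>conv_ring\<^esub> v) h = u h \<oplus>\<^bsub>A\<^esub> v h" "\<zero>\<^bsub>conv_ring\<^esub> h = \<zero>\<^bsub>A\<^esub>" if "h \<in> carrier H" for u v h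
    using that by (simp_all add: conv_ring_simps)
  show ?thesis
  proof (rule abelian_groupI)
    fix u assume u: "u \<in> carrier conv_ring"
    have n: "(\<lambda>h\<in>carrier H. \<ominus>\<^bsub>K\<^esub> \<one>\<^bsub>K\<^esub> \<odot>\<^bsub>A\<^esub> u h) \<in> carrier conv_ring"
      by (intro restrict_conv_ring lin_scale modA conv_ring_linear u) simp
    have "(\<lambda>h\<in>carrier H. \<ominus>\<^bsub>K\<^esub> \<one>\<^bsub>K\<^esub> \<odot>\<^bsub>A\<^esub> u h) \<oplus>\<^bsub>conv_ring\<^esub> u = \<zero>\<^bsub>conv_ring\<^esub>"
      by (rule conv_ring_eqI [OF ad [OF n u] zero])
        (simp add: simps cl [OF u] A.smult_l_minus abelian_group.l_neg [OF module.axioms(2) [OF modA]])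
    then show "\<exists>v\<in>carrier conv_ring. v \<oplus>\<^bsub>conv_ring\<^esub> u = \<zero>\<^bsub>conv_ring\<^esub>" using n by blast
  qed (auto intro!: conv_ring_eqI ad zero simp: simps cl addA_ac)
qed

text \<open>The numbered cases follow the axioms in their order: 1 to 9 are those of
  \<open>bimodule\<close>, 10 to 23 those of \<open>lax_ring_laws\<close>; the closure axioms are
  left to the final method. Each law becomes pointwise by \<open>conv_ring_eqI\<close> and is then
  one of the identities for \<open>Q\<close>, \<open>conv\<close> and \<open>eta\<close>.\<close>

lemma lax_ring_laws_conv_ring: "lax_ring_laws (op_ring A) conv_ring"
proof -
  have cl: "u h \<in> carrier A" if "u \<in> linear_maps K H A" "h \<in> carrier H" for u h
    by (rule lin_closed [OF that])
  have lac: "lact conv_ring b u \<in> carrier conv_ring" if "u \<in> linear_maps K H A" "b \<in> carrier A" for b u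
    unfolding conv_ring_simps(6) using that by (intro restrict_conv_ring lin_mult_left algA)
  have rac: "ract conv_ring u b \<in> carrier conv_ring" if "u \<in> linear_maps K H A" "b \<in> carrier A" for b u
    unfolding conv_ring_simps(7) using that Q_linear_H by (intro restrict_conv_ring) auto
  have mac: "u \<otimes>\<^bsub>conv_ring\<^esub> v \<in> carrier conv_ring" if "u \<in> linear_maps K H A" "v \<in> linear_maps K H A" for u v
    unfolding conv_ring_simps(2) using conv_linear [OF that] by (intro restrict_conv_ring) simp
  have uac: "unit_map conv_ring b \<in> carrier conv_ring" if "b \<in> carrier A" for b
    unfolding conv_ring_simps(8) using eta_linear [OF that] by (intro restrict_conv_ring) simp
  interpret E: abelian_group conv_ring by (rule conv_ring_abelian_group)
  show ?thesis
  proof (intro lax_ring_laws.intro bimodule.intro ring_op_ring conv_ring_abelian_group A.ring_axioms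
      bimodule_axioms.intro lax_ring_laws_axioms.intro, goal_cases)
    case (3 b x y) then show ?case
      by (intro conv_ring_eqI E.a_closed lac conv_ring_linear)
        (simp_all add: conv_ring_linear, simp add: conv_ring_simps cl A.l_distr)
  next
    case (4 b c x) then show ?case
      by (intro conv_ring_eqI E.a_closed lac conv_ring_linear)
        (simp_all add: conv_ring_linear, simp add: conv_ring_simps cl A.r_distr)
  next
    case (5 b c x) then show ?case
      by (intro conv_ring_eqI lac conv_ring_linear)
        (simp_all add: conv_ring_linear, simp add: conv_ring_simps cl multA_assoc)
  next
    case (6 x b c) then show ?case
      by (intro conv_ring_eqI E.a_closed rac conv_ring_linear)
        (simp_all add: conv_ring_linear, simp add: conv_ring_simps lin_add [OF Q_linear_A])
  next
    case (7 x y b) then show ?case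
      by (intro conv_ring_eqI E.a_closed rac conv_ring_linear)
        (simp_all add: conv_ring_linear, simp add: conv_ring_simps Q_restrict Q_add_fun)
  next
    case (8 x b c) then show ?case
      by (intro conv_ring_eqI rac conv_ring_linear)
        (simp_all add: conv_ring_linear, simp add: conv_ring_simps Q_restrict Q_Q)
  next
    case (9 b x c) then show ?case
      by (intro conv_ring_eqI rac lac conv_ring_linear)
        (simp_all add: conv_ring_linear, simp add: conv_ring_simps Q_restrict Q_mult_right)
  next
    case (10 r) then show ?case
      by (intro conv_ring_eqI lac conv_ring_linear)
        (simp_all add: conv_ring_linear, simp add: conv_ring_simps cl)
  next
    case (12 r s t) then show ?case
      by (intro conv_ring_eqI E.a_closed mac conv_ring_linear)
        (simp_all add: conv_ring_linear, simp add: conv_ring_simps conv_restrict conv_add)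
  next
    case (13 r s t) then show ?case
      by (intro conv_ring_eqI E.a_closed mac conv_ring_linear)
        (simp_all add: conv_ring_linear, simp add: conv_ring_simps conv_restrict conv_add)
  next
    case (14 r b s) then show ?case
      by (intro conv_ring_eqI mac rac lac conv_ring_linear)
        (simp_all add: conv_ring_linear, simp add: conv_ring_simps conv_restrict conv_ract_lact)
  next
    case (15 b r s) then show ?case
      by (intro conv_ring_eqI mac rac lac conv_ring_linear)
        (simp_all add: conv_ring_linear, simp add: conv_ring_simps conv_restrict conv_ract_lact)
  next
    case (16 b r s) then show ?case
      by (intro conv_ring_eqI mac rac lac conv_ring_linear)
        (simp_all add: conv_ring_linear, simp add: conv_ring_simps conv_restrict Q_restrict Q_conv)
  next
    case (17 r s t) then show ?case
      by (intro conv_ring_eqI mac conv_ring_linear)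
        (simp_all add: conv_ring_linear, simp add: conv_ring_simps conv_restrict conv_assoc)
  next
    case (19 b c) then show ?case
      by (intro conv_ring_eqI E.a_closed uac)
        (simp_all, simp add: conv_ring_simps lin_add [OF eta_linear_A])
  next
    case (20 b c) then show ?case
      by (intro conv_ring_eqI uac lac conv_ring_linear)
        (simp_all, simp add: conv_ring_simps eta_def A.smult_mult_left multA_assoc e_closed counit_closed)
  next
    case (21 b c) then show ?case
      by (intro conv_ring_eqI uac rac conv_ring_linear)
        (simp_all, simp add: conv_ring_simps Q_restrict Q_eta)
  next
    case (22 r)
    \<comment> \<open>The factor \<open>e\<close> left over by \<open>conv_eta_left\<close> acts
      trivially on \<open>Q r \<one>\<close>.\<close>
    have "conv (eta \<one>\<^bsub>A\<^esub>) (Q r \<one>\<^bsub>A\<^esub>) h = Q r \<one>\<^bsub>A\<^esub> h" if "h \<in> carrier H" for h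
      using conv_eta_left [OF oneA_closed Q_linear_H that, of r "\<one>\<^bsub>A\<^esub>"] 22 that
      by (simp add: conv_ring_linear e_closed Q_closed e_Q_one)
    with 22 show ?case
      by (intro conv_ring_eqI mac uac rac conv_ring_linear)
        (simp_all add: conv_ring_linear, simp add: conv_ring_simps conv_restrict)
  next
    case (23 r)
    \<comment> \<open>\<open>conv_eta_right\<close> leaves the action of \<open>e\<close> on
      \<open>Q r \<one>\<close>; it equals the action of 1, because
      \<open>\<rho>(e) = \<rho>(1)\<close>, and a second action of 1 changes nothing.\<close>
    have "conv (Q r \<one>\<^bsub>A\<^esub>) (eta \<one>\<^bsub>A\<^esub>) h = Q r \<one>\<^bsub>A\<^esub> h" if "h \<in> carrier H" for h
      using conv_eta_right [OF oneA_closed Q_linear_H that, of r "\<one>\<^bsub>A\<^esub>"] 23 that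
        Q_e_left [of "Q r \<one>\<^bsub>A\<^esub>" "\<one>\<^bsub>A\<^esub>" h] Q_linear_H [of r "\<one>\<^bsub>A\<^esub>"] Q_Q [of r "\<one>\<^bsub>A\<^esub>" "\<one>\<^bsub>A\<^esub>" h]
      by (simp add: conv_ring_linear)
    with 23 show ?case
      by (intro conv_ring_eqI mac uac rac conv_ring_linear)
        (simp_all add: conv_ring_linear, simp add: conv_ring_simps conv_restrict)
  qed (simp_all add: lac rac mac uac conv_ring_linear)
qed

lemma conv_ring_one: "\<one>\<^bsub>conv_ring\<^esub> = unit_map conv_ring \<one>\<^bsub>op_ring A\<^esub>"
  by (simp add: conv_ring_simps)

end

section \<open>The lax coring \<open>A \<otimes> H\<close> and its left dual\<close>

lemma tensor_relators_cong:
  assumes "carrier M = carrier M'" "add M = add M'" "carrier N = carrier N'" "add N = add N'"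
  shows "tensor_relators R ra la M N = tensor_relators R ra la M' N'"
  unfolding tensor_relators_def by (simp add: assms)

lemma tensor_kernel_cong:
  assumes "carrier M = carrier M'" "add M = add M'" "carrier N = carrier N'" "add N = add N'"
  shows "tensor_kernel R ra la M N = tensor_kernel R ra la M' N'"
  unfolding tensor_kernel_def tensor_relators_cong [OF assms] by (simp add: assms)

text \<open>Records that differ only outside carrier and addition have literally the same tensor
  product. This is needed wherever a coring is compared with the record from which it was
  built.\<close>

lemma bal_tensor_cong:
  assumes "carrier M = carrier M'" "add M = add M'" "carrier N = carrier N'" "add N = add N'"
  shows "bal_tensor R ra la M N = bal_tensor R ra la M' N'"
    and "bal_pure R ra la M N = bal_pure R ra la M' N'"
  unfolding bal_tensor_def bal_pure_def tensor_kernel_cong [OF assms] by (simp_all add: assms)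

context lax_comodule_algebra
begin

abbreviation "AH \<equiv> tensor K A H"

abbreviation "C \<equiv> AH_coring K H \<Delta> \<epsilon> A \<rho>"

lemma C_ops:
  "carrier C = carrier AH" "add C = add AH" "\<zero>\<^bsub>C\<^esub> = \<zero>\<^bsub>AH\<^esub>"
  by (simp_all add: AH_coring_def AH_bimodule_def bimodule.defs ring.defs Let_def)

lemma lact_C: "lact C b t = sweedler K A H AH t (\<lambda>a h. tpure K A H (b \<otimes>\<^bsub>A\<^esub> a) h)"
  by (simp add: AH_coring_def AH_bimodule_def bimodule.defs ring.defs Let_def sweedler_tgroup)

lemma ract_C: "ract C t b = sweedler K A H AH t (\<lambda>a h. sweedler K A H AH (\<rho> b)
    (\<lambda>b0 b1. tpure K A H (a \<otimes>\<^bsub>A\<^esub> b0) (h \<otimes>\<^bsub>H\<^esub> b1)))"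
  by (simp add: AH_coring_def AH_bimodule_def bimodule.defs ring.defs Let_def sweedler_tgroup)

lemma counit_C: "counit C t = sweedler K A H A t (\<lambda>a h. sweedler K A H A (\<rho> \<one>\<^bsub>A\<^esub>)
    (\<lambda>u v. \<epsilon> (h \<otimes>\<^bsub>H\<^esub> v) \<odot>\<^bsub>A\<^esub> (a \<otimes>\<^bsub>A\<^esub> u)))"
  by (simp add: AH_coring_def AH_bimodule_def bimodule.defs ring.defs Let_def)

lemma AH_pair: "module_pair K A H"
  using modA modH by (rule module_pair.intro)

lemmas modAH = module_tensor [OF modA modH]

lemma lact_C_linear: "b \<in> carrier A \<Longrightarrow> (\<lambda>t. lact C b t) \<in> linear_maps K AH AH"
  unfolding lact_C by (intro lin_rules; assumption)

lemma lact_C_linear_A: "t \<in> carrier AH \<Longrightarrow> (\<lambda>b. lact C b t) \<in> linear_maps K A AH"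
  unfolding lact_C by (intro lin_rules; assumption)

lemma ract_C_linear: "b \<in> carrier A \<Longrightarrow> (\<lambda>t. ract C t b) \<in> linear_maps K AH AH"
  unfolding ract_C by (intro lin_rules; assumption)

lemma ract_C_linear_A: "t \<in> carrier AH \<Longrightarrow> (\<lambda>b. ract C t b) \<in> linear_maps K A AH"
  unfolding ract_C by (intro lin_rules; assumption)

lemma lact_C_closed: "\<lbrakk>b \<in> carrier A; t \<in> carrier AH\<rbrakk> \<Longrightarrow> lact C b t \<in> carrier AH"
  by (rule lin_closed [OF lact_C_linear])

lemma ract_C_closed: "\<lbrakk>t \<in> carrier AH; b \<in> carrier A\<rbrakk> \<Longrightarrow> ract C t b \<in> carrier AH"
  by (rule lin_closed [OF ract_C_linear])

lemmas C_rules = lin_rules lin_comp [OF lact_C_linear] lin_comp [OF lact_C_linear_A]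
  lin_comp [OF ract_C_linear] lin_comp [OF ract_C_linear_A] lact_C_closed ract_C_closed

lemma lact_C_pure:
  assumes "b \<in> carrier A" "a \<in> carrier A" "h \<in> carrier H"
  shows "lact C b (tpure K A H a h) = tpure K A H (b \<otimes>\<^bsub>A\<^esub> a) h"
  unfolding lact_C by (rule sw_pure) (intro lin_rules assms; assumption)+

lemma ract_C_pure:
  assumes "b \<in> carrier A" "a \<in> carrier A" "h \<in> carrier H"
  shows "ract C (tpure K A H a h) b = sweedler K A H AH (\<rho> b)
    (\<lambda>b0 b1. tpure K A H (a \<otimes>\<^bsub>A\<^esub> b0) (h \<otimes>\<^bsub>H\<^esub> b1))"
  unfolding ract_C by (rule sw_pure) (intro lin_rules assms; assumption)+

lemma AH_ext:
  assumes "module K G" "f \<in> linear_maps K AH G" "g \<in> linear_maps K AH G"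
    and "\<And>a h. \<lbrakk>a \<in> carrier A; h \<in> carrier H\<rbrakk> \<Longrightarrow> f (tpure K A H a h) = g (tpure K A H a h)"
    and "t \<in> carrier AH"
  shows "f t = g t"
  by (rule module_pair.tensor_ext [OF AH_pair assms])

lemma lact_C_lact:
  assumes "b \<in> carrier A" "c \<in> carrier A" "t \<in> carrier AH"
  shows "lact C (b \<otimes>\<^bsub>A\<^esub> c) t = lact C b (lact C c t)"
  by (rule AH_ext [OF modAH _ _ _ assms(3)]; (intro C_rules assms; assumption)?)
    (simp add: lact_C_pure assms multA_assoc)

lemma lact_C_one: "t \<in> carrier AH \<Longrightarrow> lact C \<one>\<^bsub>A\<^esub> t = t"
  by (rule AH_ext [OF modAH]; (intro C_rules; assumption)?) (simp add: lact_C_pure)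

lemma lact_ract_C:
  assumes "b \<in> carrier A" "c \<in> carrier A" "t \<in> carrier AH"
  shows "ract C (lact C b t) c = lact C b (ract C t c)"
proof (rule AH_ext [OF modAH _ _ _ assms(3)])
  fix a h assume ah: "a \<in> carrier A" "h \<in> carrier H"
  have "lact C b (ract C (tpure K A H a h) c)
      = sweedler K A H AH (\<rho> c) (\<lambda>b0 b1. lact C b (tpure K A H (a \<otimes>\<^bsub>A\<^esub> b0) (h \<otimes>\<^bsub>H\<^esub> b1)))"
    unfolding ract_C_pure [OF assms(2) ah]
    by (rule lin_sw) (intro C_rules ah assms; assumption)+
  also have "\<dots> = ract C (lact C b (tpure K A H a h)) c"
    unfolding lact_C_pure [OF assms(1) ah] ract_C_pure [OF assms(2) multA_closed [OF assms(1) ah(1)] ah(2)]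
    by (rule sw_cong) (simp add: lact_C_pure assms ah multA_assoc)
  finally show "ract C (lact C b (tpure K A H a h)) c = lact C b (ract C (tpure K A H a h) c)" by simp
qed (intro C_rules assms; assumption)+

lemma ract_C_ract:
  assumes "b \<in> carrier A" "c \<in> carrier A" "t \<in> carrier AH"
  shows "ract C t (b \<otimes>\<^bsub>A\<^esub> c) = ract C (ract C t b) c"
proof (rule AH_ext [OF modAH _ _ _ assms(3)])
  fix a h assume ah: "a \<in> carrier A" "h \<in> carrier H"
  have "ract C (ract C (tpure K A H a h) b) c
      = sweedler K A H AH (\<rho> b) (\<lambda>b0 b1. ract C (tpure K A H (a \<otimes>\<^bsub>A\<^esub> b0) (h \<otimes>\<^bsub>H\<^esub> b1)) c)"
    unfolding ract_C_pure [OF assms(1) ah]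
    by (rule lin_sw) (intro C_rules ah assms; assumption)+
  also have "\<dots> = sweedler K A H AH (\<rho> b) (\<lambda>b0 b1. sweedler K A H AH (\<rho> c)
      (\<lambda>c0 c1. tpure K A H (a \<otimes>\<^bsub>A\<^esub> (b0 \<otimes>\<^bsub>A\<^esub> c0)) (h \<otimes>\<^bsub>H\<^esub> (b1 \<otimes>\<^bsub>H\<^esub> c1))))"
    by (rule sw_cong) (simp add: ract_C_pure ah assms multA_assoc multH_assoc cong: sw_cong)
  also have "\<dots> = sweedler K A H AH (\<rho> (b \<otimes>\<^bsub>A\<^esub> c)) (\<lambda>b0 b1. tpure K A H (a \<otimes>\<^bsub>A\<^esub> b0) (h \<otimes>\<^bsub>H\<^esub> b1))"
    by (rule sw_rho_mult [symmetric]) (intro C_rules ah assms; assumption)+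
  also have "\<dots> = ract C (tpure K A H a h) (b \<otimes>\<^bsub>A\<^esub> c)"
    by (rule ract_C_pure [symmetric]) (intro C_rules ah assms; assumption)+
  finally show "ract C (tpure K A H a h) (b \<otimes>\<^bsub>A\<^esub> c) = ract C (ract C (tpure K A H a h) b) c" by simp
qed (intro C_rules assms; assumption)+

lemma bimodule_C: "bimodule A C"
proof (intro bimodule.intro A.ring_axioms bimodule_axioms.intro)
  interpret M: module K AH by (rule modAH)
  show "abelian_group C"
    by (rule abelian_groupI) (auto simp: C_ops M.M.a_ac intro: M.M.add.l_inv_ex)
qed (simp_all add: C_ops lact_C_closed ract_C_closed lin_add [OF lact_C_linear]
    lin_add [OF lact_C_linear_A] lin_add [OF ract_C_linear] lin_add [OF ract_C_linear_A]
    lact_C_lact ract_C_ract lact_ract_C)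

lemma smult_AH: "\<lbrakk>c \<in> carrier K; t \<in> carrier AH\<rbrakk> \<Longrightarrow> lact C (c \<odot>\<^bsub>A\<^esub> \<one>\<^bsub>A\<^esub>) t = c \<odot>\<^bsub>AH\<^esub> t"
  by (simp add: lin_smult [OF lact_C_linear_A] lact_C_one)

sublocale C2: bimodule_pair A C C
  by (intro bimodule_pair.intro bimodule_C)

text \<open>\<open>C \<otimes>\<^sub>A C\<close> as a \<open>K\<close>-module, so that the calculus of linear maps applies to it.\<close>

definition CC :: "('k, (('a, 'h) tens, ('a, 'h) tens) tens) module" where
  "CC = \<lparr>carrier = carrier (btensor A C C), mult = undefined, one = undefined,
     ring.zero = \<zero>\<^bsub>btensor A C C\<^esub>, add = add (btensor A C C),
     smult = (\<lambda>c t. lact (btensor A C C) (c \<odot>\<^bsub>A\<^esub> \<one>\<^bsub>A\<^esub>) t)\<rparr>"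

abbreviation "cpure \<equiv> btpure A C C"

lemma CC_ops:
  "carrier CC = carrier C2.P.T" "add CC = mult C2.P.T" "\<zero>\<^bsub>CC\<^esub> = \<one>\<^bsub>C2.P.T\<^esub>"
  "c \<odot>\<^bsub>CC\<^esub> t = lact (btensor A C C) (c \<odot>\<^bsub>A\<^esub> \<one>\<^bsub>A\<^esub>) t"
  by (simp_all add: CC_def C2.btensor_ops)

lemma CC_induct [consumes 1, case_names zero add]:
  assumes "t \<in> carrier CC" "P \<zero>\<^bsub>CC\<^esub>"
    "\<And>x y t. \<lbrakk>x \<in> carrier AH; y \<in> carrier AH; t \<in> carrier CC; P t\<rbrakk> \<Longrightarrow> P (cpure x y \<oplus>\<^bsub>CC\<^esub> t)"
  shows "P t"
  using assms C2.P.tens_induct [of t P] by (simp add: CC_ops btpure_def C_ops)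

lemma cpure_closed: "\<lbrakk>x \<in> carrier AH; y \<in> carrier AH\<rbrakk> \<Longrightarrow> cpure x y \<in> carrier CC"
  using C2.P.pure_closed by (simp add: CC_ops btpure_def C_ops)

lemma abelian_group_CC: "abelian_group CC"
  by (rule C2.abelian_group_ops) (simp_all add: CC_ops)

lemma smult_CC_pure:
  "\<lbrakk>c \<in> carrier K; x \<in> carrier AH; y \<in> carrier AH\<rbrakk> \<Longrightarrow> c \<odot>\<^bsub>CC\<^esub> cpure x y = cpure (c \<odot>\<^bsub>AH\<^esub> x) y"
  using C2.lact_btensor_pure [of "c \<odot>\<^bsub>A\<^esub> \<one>\<^bsub>A\<^esub>" x y]
  by (simp add: CC_ops btpure_def C_ops smult_AH)

lemma smult_CC_add:
  "\<lbrakk>c \<in> carrier K; s \<in> carrier CC; t \<in> carrier CC\<rbrakk> \<Longrightarrow> c \<odot>\<^bsub>CC\<^esub> (s \<oplus>\<^bsub>CC\<^esub> t) = c \<odot>\<^bsub>CC\<^esub> s \<oplus>\<^bsub>CC\<^esub> c \<odot>\<^bsub>CC\<^esub> t"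
  using C2.lact_btensor_add by (simp add: CC_ops)

lemma smult_CC_zero: "c \<in> carrier K \<Longrightarrow> c \<odot>\<^bsub>CC\<^esub> \<zero>\<^bsub>CC\<^esub> = \<zero>\<^bsub>CC\<^esub>"
  using C2.lact_btensor_one by (simp add: CC_ops)

lemma smult_CC_closed: "\<lbrakk>c \<in> carrier K; t \<in> carrier CC\<rbrakk> \<Longrightarrow> c \<odot>\<^bsub>CC\<^esub> t \<in> carrier CC"
  using C2.lact_btensor_closed by (simp add: CC_ops)

lemma cpure_add_left:
  "\<lbrakk>x \<in> carrier AH; x' \<in> carrier AH; y \<in> carrier AH\<rbrakk> \<Longrightarrow> cpure (x \<oplus>\<^bsub>AH\<^esub> x') y = cpure x y \<oplus>\<^bsub>CC\<^esub> cpure x' y"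
  using C2.P.pure_add_left by (simp add: CC_ops btpure_def C_ops)

lemma cpure_add_right:
  "\<lbrakk>x \<in> carrier AH; y \<in> carrier AH; y' \<in> carrier AH\<rbrakk> \<Longrightarrow> cpure x (y \<oplus>\<^bsub>AH\<^esub> y') = cpure x y \<oplus>\<^bsub>CC\<^esub> cpure x y'"
  using C2.P.pure_add_right by (simp add: CC_ops btpure_def C_ops)

lemma cpure_balanced:
  "\<lbrakk>x \<in> carrier AH; y \<in> carrier AH; a \<in> carrier A\<rbrakk> \<Longrightarrow> cpure (ract C x a) y = cpure x (lact C a y)"
  using C2.P.pure_balanced by (simp add: btpure_def C_ops)

text \<open>The right action of \<open>K\<close> through \<open>A\<close> is not the scalar one, but left unitality of the second
  factor makes up for it.\<close>

lemma cpure_smult_right: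
  assumes "c \<in> carrier K" "x \<in> carrier AH" "y \<in> carrier AH"
  shows "cpure x (c \<odot>\<^bsub>AH\<^esub> y) = c \<odot>\<^bsub>CC\<^esub> cpure x y"
proof -
  have "cpure x (c \<odot>\<^bsub>AH\<^esub> y) = cpure (ract C x (c \<odot>\<^bsub>A\<^esub> \<one>\<^bsub>A\<^esub>)) y"
    using assms by (simp add: cpure_balanced smult_AH)
  also have "\<dots> = cpure (c \<odot>\<^bsub>AH\<^esub> ract C x \<one>\<^bsub>A\<^esub>) y"
    using assms by (simp add: lin_smult [OF ract_C_linear_A])
  also have "\<dots> = c \<odot>\<^bsub>CC\<^esub> cpure (ract C x \<one>\<^bsub>A\<^esub>) y"
    using assms by (simp add: smult_CC_pure ract_C_closed)
  also have "\<dots> = c \<odot>\<^bsub>CC\<^esub> cpure x y"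
    using assms by (simp add: cpure_balanced lact_C_one)
  finally show ?thesis .
qed

lemma modCC: "module K CC"
proof (rule moduleI [OF cringK abelian_group_CC])
  interpret CC: abelian_group CC by (rule abelian_group_CC)
  interpret AH: module K AH by (rule modAH)
  fix c t assume c: "c \<in> carrier K" and t: "t \<in> carrier CC"
  then show "c \<odot>\<^bsub>CC\<^esub> t \<in> carrier CC" by (rule smult_CC_closed)
  {
    fix s assume "s \<in> carrier CC"
    then show "c \<odot>\<^bsub>CC\<^esub> (t \<oplus>\<^bsub>CC\<^esub> s) = c \<odot>\<^bsub>CC\<^esub> t \<oplus>\<^bsub>CC\<^esub> c \<odot>\<^bsub>CC\<^esub> s"
      using c t by (simp add: smult_CC_add)
  }
  fix d assume d: "d \<in> carrier K"
  show "(c \<oplus>\<^bsub>K\<^esub> d) \<odot>\<^bsub>CC\<^esub> t = c \<odot>\<^bsub>CC\<^esub> t \<oplus>\<^bsub>CC\<^esub> d \<odot>\<^bsub>CC\<^esub> t"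
    using t
  proof (induction t rule: CC_induct)
    case zero then show ?case using c d by (simp add: smult_CC_zero)
  next
    case (add x y t)
    then show ?case using c d
      by (simp add: smult_CC_add cpure_closed smult_CC_pure AH.smult_l_distr cpure_add_left
          CC.a_ac smult_CC_closed)
  qed
  show "(c \<otimes>\<^bsub>K\<^esub> d) \<odot>\<^bsub>CC\<^esub> t = c \<odot>\<^bsub>CC\<^esub> (d \<odot>\<^bsub>CC\<^esub> t)"
    using t
  proof (induction t rule: CC_induct)
    case zero then show ?case using c d by (simp add: smult_CC_zero)
  next
    case (add x y t)
    then show ?case using c d
      by (simp add: smult_CC_add cpure_closed smult_CC_pure AH.smult_assoc1 smult_CC_closed)
  qed
next
  interpret CC: abelian_group CC by (rule abelian_group_CC)
  interpret AH: module K AH by (rule modAH)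
  fix t assume "t \<in> carrier CC"
  then show "\<one>\<^bsub>K\<^esub> \<odot>\<^bsub>CC\<^esub> t = t"
  proof (induction t rule: CC_induct)
    case zero then show ?case by (simp add: smult_CC_zero)
  next
    case (add x y t)
    then show ?case by (simp add: smult_CC_add cpure_closed smult_CC_pure)
  qed
qed

lemma cpure_linear_left: "y \<in> carrier AH \<Longrightarrow> (\<lambda>x. cpure x y) \<in> linear_maps K AH CC"
  by (intro linI) (simp_all add: cpure_closed cpure_add_left smult_CC_pure)

lemma cpure_linear_right: "x \<in> carrier AH \<Longrightarrow> (\<lambda>y. cpure x y) \<in> linear_maps K AH CC"
  by (intro linI) (simp_all add: cpure_closed cpure_add_right cpure_smult_right)

lemma comul_C: "comul C t = sweedler K A H CC t (\<lambda>a h. sweedler K H H CC (\<Delta> h)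
    (\<lambda>h1 h2. cpure (tpure K A H a h1) (tpure K A H \<one>\<^bsub>A\<^esub> h2)))"
proof -
  \<comment> \<open>The definition of the comultiplication forms its tensor product over the plain
    bimodule record, before the coring fields are attached.\<close>
  let ?C0 = "AH_bimodule K H A \<rho>"
  have eq: "carrier ?C0 = carrier C" "add ?C0 = add C" "ract ?C0 = ract C" "lact ?C0 = lact C"
    by (simp_all add: AH_coring_def bimodule.defs Let_def)
  have T: "bal_tensor (carrier A) (ract ?C0) (lact ?C0) ?C0 ?C0 = C2.P.T"
    unfolding eq(3,4) by (rule bal_tensor_cong(1)) (simp_all add: eq)
  have p: "btpure A ?C0 ?C0 = cpure"
    unfolding btpure_def eq(3,4) by (rule bal_tensor_cong(2)) (simp_all add: eq)
  have c: "carrier (btensor A ?C0 ?C0) = carrier CC" "add (btensor A ?C0 ?C0) = add CC"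
    by (simp_all add: btensor_def ring.defs btgroup_def Let_def T CC_ops)
  have "comul C t = sweedler K A H (btensor A ?C0 ?C0) t (\<lambda>a h. sweedler K H H (btensor A ?C0 ?C0) (\<Delta> h)
    (\<lambda>h1 h2. btpure A ?C0 ?C0 (tpure K A H a h1) (tpure K A H \<one>\<^bsub>A\<^esub> h2)))"
    by (simp add: AH_coring_def bimodule.defs Let_def)
  also have "\<dots> = sweedler K A H CC t (\<lambda>a h. sweedler K H H CC (\<Delta> h)
    (\<lambda>h1 h2. cpure (tpure K A H a h1) (tpure K A H \<one>\<^bsub>A\<^esub> h2)))"
    by (simp only: p sweedler_target [OF c])
  finally show ?thesis .
qed

lemmas CC_rules = C_rules lin_comp [OF cpure_linear_left] lin_comp [OF cpure_linear_right]
  cpure_closed modCC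

lemma comul_C_linear: "(\<lambda>t. comul C t) \<in> linear_maps K AH CC"
  unfolding comul_C by (intro CC_rules; assumption)

lemma comul_C_closed: "t \<in> carrier AH \<Longrightarrow> comul C t \<in> carrier CC"
  by (rule lin_closed [OF comul_C_linear])

lemma comul_C_pure:
  assumes "a \<in> carrier A" "h \<in> carrier H"
  shows "comul C (tpure K A H a h) = sweedler K H H CC (\<Delta> h)
    (\<lambda>h1 h2. cpure (tpure K A H a h1) (tpure K A H \<one>\<^bsub>A\<^esub> h2))"
  unfolding comul_C by (rule sw_pure) (intro CC_rules assms; assumption)+

text \<open>Scalars act on the first tensor factor and \<open>b\<close> acts on the second, so the
  two operations commute on pure tensors.\<close>

lemma CC_ract_linear:
  assumes b: "b \<in> carrier A"
  shows "(\<lambda>t. ract (btensor A C C) t b) \<in> linear_maps K CC CC"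
proof (rule linI)
  fix s t assume "s \<in> carrier CC" "t \<in> carrier CC"
  then show "ract (btensor A C C) (s \<oplus>\<^bsub>CC\<^esub> t) b = ract (btensor A C C) s b \<oplus>\<^bsub>CC\<^esub> ract (btensor A C C) t b"
    using b by (simp add: CC_ops C2.ract_btensor_add)
next
  interpret CC: module K CC by (rule modCC)
  have radd: "ract (btensor A C C) (s \<oplus>\<^bsub>CC\<^esub> t) b = ract (btensor A C C) s b \<oplus>\<^bsub>CC\<^esub> ract (btensor A C C) t b"
    if "s \<in> carrier CC" "t \<in> carrier CC" for s t
    using that b by (simp add: CC_ops C2.ract_btensor_add)
  have pure: "ract (btensor A C C) (cpure x y) b = cpure x (ract C y b)"
    if "x \<in> carrier AH" "y \<in> carrier AH" for x y
    using that b C2.ract_btensor_pure [of b x y] by (simp add: btpure_def C_ops)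
  have cl: "ract (btensor A C C) t b \<in> carrier CC" if "t \<in> carrier CC" for t
    using that b by (simp add: CC_ops C2.ract_btensor_closed)
  fix c t assume c: "c \<in> carrier K" and t: "t \<in> carrier CC"
  show "ract (btensor A C C) (c \<odot>\<^bsub>CC\<^esub> t) b = c \<odot>\<^bsub>CC\<^esub> ract (btensor A C C) t b"
    using t
  proof (induction t rule: CC_induct)
    case zero then show ?case
      using c b C2.ract_btensor_one [OF b] smult_CC_zero by (simp add: CC_ops(3))
  next
    case (add x y t)
    then show ?case using c b
      by (simp add: radd
          pure smult_CC_pure cpure_closed smult_CC_add cl ract_C_closed module.smult_closed [OF modAH])
  qed
qed (use b in \<open>simp add: CC_ops C2.ract_btensor_closed\<close>)

text \<open>Right \<open>A\<close>-linearity of the comultiplication. The first leg of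
  \<open>b\<close> is carried across \<open>\<otimes>\<^sub>A\<close>, where it coacts on the first
  factor; lax coassociativity turns this into a splitting of the second leg together with a factor
  \<open>\<rho>(1)\<close>. That factor is the right action of 1 on the first factor, and across
  \<open>\<otimes>\<^sub>A\<close> it becomes the trivial left action on the second.
  Multiplicativity of \<open>\<Delta>\<close> finishes the computation.\<close>

lemma comul_C_ract:
  assumes b: "b \<in> carrier A" and t: "t \<in> carrier AH"
  shows "comul C (ract C t b) = ract (btensor A C C) (comul C t) b"
proof (rule AH_ext [OF modCC _ _ _ t])
  show "(\<lambda>t. comul C (ract C t b)) \<in> linear_maps K AH CC"
    by (rule lin_comp [OF comul_C_linear ract_C_linear [OF b]])
  show "(\<lambda>t. ract (btensor A C C) (comul C t) b) \<in> linear_maps K AH CC"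
    by (rule lin_comp [OF CC_ract_linear [OF b] comul_C_linear])
  fix a h assume ah: "a \<in> carrier A" "h \<in> carrier H"
  note r = CC_rules ah b
  let ?p = "tpure K A H"
  have ract_pure: "ract (btensor A C C) (cpure x y) b = cpure x (ract C y b)"
    if "x \<in> carrier AH" "y \<in> carrier AH" for x y
    using that b C2.ract_btensor_pure [of b x y] by (simp add: btpure_def C_ops)
  \<comment> \<open>Balance over \<open>A\<close>. The product with \<open>\<one>\<close> is kept
    unreduced, since it displays the second factor as the left action of \<open>c\<close> on
    \<open>\<one> \<otimes> k\<close>.\<close>
  have move: "cpure (?p a h1) (?p (\<one>\<^bsub>A\<^esub> \<otimes>\<^bsub>A\<^esub> c) k)
      = cpure (sweedler K A H AH (\<rho> c) (\<lambda>x0 x1. ?p (a \<otimes>\<^bsub>A\<^esub> x0) (h1 \<otimes>\<^bsub>H\<^esub> x1))) (?p \<one>\<^bsub>A\<^esub> k)"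
    if "h1 \<in> carrier H" "k \<in> carrier H" "c \<in> carrier A" for h1 k c
    using that ah by (simp add: cpure_balanced lact_C_pure tpure_closed modA modH flip: ract_C_pure)
  have "ract (btensor A C C) (comul C (?p a h)) b
      = sweedler K H H CC (\<Delta> h) (\<lambda>h1 h2. ract (btensor A C C) (cpure (?p a h1) (?p \<one>\<^bsub>A\<^esub> h2)) b)"
    unfolding comul_C_pure [OF ah]
    by (rule lin_sw [OF _ _ _ _ CC_ract_linear [OF b]]) (intro r; assumption)+
  also have "\<dots> = sweedler K H H CC (\<Delta> h) (\<lambda>h1 h2. cpure (?p a h1) (sweedler K A H AH (\<rho> b)
      (\<lambda>b0 b1. ?p (\<one>\<^bsub>A\<^esub> \<otimes>\<^bsub>A\<^esub> b0) (h2 \<otimes>\<^bsub>H\<^esub> b1))))"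
    by (rule sw_cong) (simp add: ract_pure ract_C_pure ah b tpure_closed modA modH del: A.l_one)
  also have "\<dots> = sweedler K H H CC (\<Delta> h) (\<lambda>h1 h2. sweedler K A H CC (\<rho> b)
      (\<lambda>b0 b1. cpure (?p a h1) (?p (\<one>\<^bsub>A\<^esub> \<otimes>\<^bsub>A\<^esub> b0) (h2 \<otimes>\<^bsub>H\<^esub> b1))))"
    by (rule sw_cong, rule lin_sw) (intro r; assumption)+
  also have "\<dots> = sweedler K H H CC (\<Delta> h) (\<lambda>h1 h2. sweedler K A H CC (\<rho> b)
      (\<lambda>b0 b1. cpure (sweedler K A H AH (\<rho> b0) (\<lambda>x0 x1. ?p (a \<otimes>\<^bsub>A\<^esub> x0) (h1 \<otimes>\<^bsub>H\<^esub> x1))) (?p \<one>\<^bsub>A\<^esub> (h2 \<otimes>\<^bsub>H\<^esub> b1))))"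
    by (intro sw_cong move multH_closed)
  also have "\<dots> = sweedler K H H CC (\<Delta> h) (\<lambda>h1 h2. sweedler K A H CC (\<rho> b)
      (\<lambda>b0 b1. sweedler K A H CC (\<rho> b0) (\<lambda>x0 x1. cpure (?p (a \<otimes>\<^bsub>A\<^esub> x0) (h1 \<otimes>\<^bsub>H\<^esub> x1)) (?p \<one>\<^bsub>A\<^esub> (h2 \<otimes>\<^bsub>H\<^esub> b1)))))"
    by (rule sw_cong, rule sw_cong, rule lin_sw [where \<phi> = "\<lambda>z. cpure z _"]) (intro r; assumption)+
  also have "\<dots> = sweedler K H H CC (\<Delta> h) (\<lambda>h1 h2. sweedler K A H CC (\<rho> b)
      (\<lambda>b0 b1. sweedler K H H CC (\<Delta> b1) (\<lambda>y1 y2. sweedler K A H CC (\<rho> \<one>\<^bsub>A\<^esub>)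
       (\<lambda>u v. cpure (?p (a \<otimes>\<^bsub>A\<^esub> (b0 \<otimes>\<^bsub>A\<^esub> u)) (h1 \<otimes>\<^bsub>H\<^esub> (y1 \<otimes>\<^bsub>H\<^esub> v))) (?p \<one>\<^bsub>A\<^esub> (h2 \<otimes>\<^bsub>H\<^esub> y2))))))"
    by (rule sw_cong, rule sw_lax_coassoc) (intro r; assumption)+
  also have "\<dots> = sweedler K H H CC (\<Delta> h) (\<lambda>h1 h2. sweedler K A H CC (\<rho> b)
      (\<lambda>b0 b1. sweedler K H H CC (\<Delta> b1) (\<lambda>y1 y2. cpure (sweedler K A H AH (\<rho> \<one>\<^bsub>A\<^esub>)
       (\<lambda>u v. ?p (a \<otimes>\<^bsub>A\<^esub> (b0 \<otimes>\<^bsub>A\<^esub> u)) (h1 \<otimes>\<^bsub>H\<^esub> (y1 \<otimes>\<^bsub>H\<^esub> v)))) (?p \<one>\<^bsub>A\<^esub> (h2 \<otimes>\<^bsub>H\<^esub> y2)))))"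
    by (rule sw_cong, rule sw_cong, rule sw_cong, rule lin_sw [symmetric, where \<phi> = "\<lambda>z. cpure z _"])
      (intro r; assumption)+
  \<comment> \<open>The sum over \<open>\<rho>(1)\<close> is recognized as the right action of 1 on
    the first factor, ready to be carried across \<open>\<otimes>\<^sub>A\<close>.\<close>
  also have "\<dots> = sweedler K H H CC (\<Delta> h) (\<lambda>h1 h2. sweedler K A H CC (\<rho> b)
      (\<lambda>b0 b1. sweedler K H H CC (\<Delta> b1) (\<lambda>y1 y2. cpure (ract C (?p (a \<otimes>\<^bsub>A\<^esub> b0) (h1 \<otimes>\<^bsub>H\<^esub> y1)) \<one>\<^bsub>A\<^esub>)
        (?p \<one>\<^bsub>A\<^esub> (h2 \<otimes>\<^bsub>H\<^esub> y2)))))"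
    by (intro sw_cong) (simp add: ract_C_pure multA_assoc multH_assoc ah cong: sw_cong)
  also have "\<dots> = sweedler K H H CC (\<Delta> h) (\<lambda>h1 h2. sweedler K A H CC (\<rho> b)
      (\<lambda>b0 b1. sweedler K H H CC (\<Delta> b1) (\<lambda>y1 y2. cpure (?p (a \<otimes>\<^bsub>A\<^esub> b0) (h1 \<otimes>\<^bsub>H\<^esub> y1))
        (?p \<one>\<^bsub>A\<^esub> (h2 \<otimes>\<^bsub>H\<^esub> y2)))))"
    by (intro sw_cong) (simp add: cpure_balanced lact_C_one ah tpure_closed modA modH)
  also have "\<dots> = sweedler K A H CC (\<rho> b) (\<lambda>b0 b1. sweedler K H H CC (\<Delta> h) (\<lambda>h1 h2.
      sweedler K H H CC (\<Delta> b1) (\<lambda>y1 y2. cpure (?p (a \<otimes>\<^bsub>A\<^esub> b0) (h1 \<otimes>\<^bsub>H\<^esub> y1)) (?p \<one>\<^bsub>A\<^esub> (h2 \<otimes>\<^bsub>H\<^esub> y2)))))"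
    by (rule sw_swap) (intro r; assumption)+
  also have "\<dots> = sweedler K A H CC (\<rho> b) (\<lambda>b0 b1. sweedler K H H CC (\<Delta> (h \<otimes>\<^bsub>H\<^esub> b1)) (\<lambda>p q.
      cpure (?p (a \<otimes>\<^bsub>A\<^esub> b0) p) (?p \<one>\<^bsub>A\<^esub> q)))"
    by (rule sw_cong, rule sw_comult_mult [symmetric]) (intro r; assumption)+
  also have "\<dots> = sweedler K A H CC (\<rho> b) (\<lambda>b0 b1. comul C (?p (a \<otimes>\<^bsub>A\<^esub> b0) (h \<otimes>\<^bsub>H\<^esub> b1)))"
    by (rule sw_cong) (simp add: comul_C_pure ah)
  also have "\<dots> = comul C (ract C (?p a h) b)"
    unfolding ract_C_pure [OF b ah]
    by (rule lin_sw [symmetric, OF _ _ _ _ comul_C_linear]) (intro r; assumption)+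
  finally show "comul C (ract C (?p a h) b) = ract (btensor A C C) (comul C (?p a h)) b" by simp
qed

end

section \<open>The left dual of \<open>A \<otimes> H\<close> and its comparison with
  \<open>Hom(H, A)\<close>\<close>

lemma op_lax_ring_simps [simp]:
  "carrier (op_lax_ring R) = carrier R" "add (op_lax_ring R) = add R"
  "\<zero>\<^bsub>op_lax_ring R\<^esub> = \<zero>\<^bsub>R\<^esub>" "\<one>\<^bsub>op_lax_ring R\<^esub> = \<one>\<^bsub>R\<^esub>"
  "x \<otimes>\<^bsub>op_lax_ring R\<^esub> y = y \<otimes>\<^bsub>R\<^esub> x" "lact (op_lax_ring R) b x = ract R x b"
  "ract (op_lax_ring R) x b = lact R b x" "unit_map (op_lax_ring R) = unit_map R"
  by (simp_all add: op_lax_ring_def)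

lemma left_dual_simps:
  "carrier (left_dual A D) = {f \<in> carrier D \<rightarrow>\<^sub>E carrier A.
      (\<forall>c\<in>carrier D. \<forall>d\<in>carrier D. f (c \<oplus>\<^bsub>D\<^esub> d) = f c \<oplus>\<^bsub>A\<^esub> f d) \<and>
      (\<forall>a\<in>carrier A. \<forall>c\<in>carrier D. f (lact D a c) = a \<otimes>\<^bsub>A\<^esub> f c)}"
  "f \<otimes>\<^bsub>left_dual A D\<^esub> g = (\<lambda>c\<in>carrier D. g (bsweedler A D D D (comul D c) (\<lambda>c1 c2. ract D c1 (f c2))))"
  "\<one>\<^bsub>left_dual A D\<^esub> = (\<lambda>c\<in>carrier D. counit D c)"
  "\<zero>\<^bsub>left_dual A D\<^esub> = (\<lambda>c\<in>carrier D. \<zero>\<^bsub>A\<^esub>)"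
  "f \<oplus>\<^bsub>left_dual A D\<^esub> g = (\<lambda>c\<in>carrier D. f c \<oplus>\<^bsub>A\<^esub> g c)"
  "lact (left_dual A D) a f = (\<lambda>c\<in>carrier D. f (ract D c a))"
  "ract (left_dual A D) f a = (\<lambda>c\<in>carrier D. f c \<otimes>\<^bsub>A\<^esub> a)"
  "unit_map (left_dual A D) a = (\<lambda>c\<in>carrier D. counit D c \<otimes>\<^bsub>A\<^esub> a)"
  by (simp_all add: left_dual_def)

context lax_comodule_algebra
begin

sublocale E: lax_ring_laws "op_ring A" conv_ring
  by (rule lax_ring_laws_conv_ring)

text \<open>\<open>K\<close>-linearity follows from left \<open>A\<close>-linearity because scalars
  act through \<open>A\<close>, by \<open>smult_AH\<close>. It is included here so that the linear
  calculus applies to elements of the left dual.\<close>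

lemma left_dual_C_iff:
  "f \<in> carrier (left_dual A C) \<longleftrightarrow> f \<in> extensional (carrier AH) \<and> f \<in> linear_maps K AH A \<and>
     (\<forall>b\<in>carrier A. \<forall>x\<in>carrier AH. f (lact C b x) = b \<otimes>\<^bsub>A\<^esub> f x)"
proof -
  have "f (c \<odot>\<^bsub>AH\<^esub> x) = c \<odot>\<^bsub>A\<^esub> f x"
    if "\<forall>b\<in>carrier A. \<forall>x\<in>carrier AH. f (lact C b x) = b \<otimes>\<^bsub>A\<^esub> f x" "f \<in> carrier AH \<rightarrow> carrier A"
      "c \<in> carrier K" "x \<in> carrier AH" for c x
  proof -
    have "f (c \<odot>\<^bsub>AH\<^esub> x) = (c \<odot>\<^bsub>A\<^esub> \<one>\<^bsub>A\<^esub>) \<otimes>\<^bsub>A\<^esub> f x"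
      using that by (simp flip: smult_AH)
    moreover have "f x \<in> carrier A" using that by (simp add: Pi_iff)
    ultimately show ?thesis using that by (simp add: A.smult_mult_left)
  qed
  then show ?thesis
    by (auto simp: left_dual_simps C_ops linear_maps_def PiE_def)
qed

text \<open>The right translation \<open>c \<mapsto> c\<^sub>(\<^sub>1\<^sub>) f(c\<^sub>(\<^sub>2\<^sub>))\<close> on \<open>C \<otimes>\<^sub>A C\<close>.\<close>

context
  fixes f assumes f: "f \<in> carrier (left_dual A C)"
begin

lemma f_linear: "f \<in> linear_maps K AH A"
  and f_lact: "\<lbrakk>b \<in> carrier A; x \<in> carrier AH\<rbrakk> \<Longrightarrow> f (lact C b x) = b \<otimes>\<^bsub>A\<^esub> f x"
  using f by (simp_all add: left_dual_C_iff)

lemma translate_balanced: "C2.P.balanced C (\<lambda>x y. ract C x (f y))"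
  unfolding C2.P.balanced_def
  by (simp add: C_ops ract_C_closed lin_closed [OF f_linear] lin_add [OF ract_C_linear]
      lin_add [OF ract_C_linear_A] lin_add [OF f_linear] f_lact ract_C_ract)

lemma translate_linear:
  "(\<lambda>t. bsweedler A C C C t (\<lambda>x y. ract C x (f y))) \<in> linear_maps K CC AH"
proof -
  note ab = C2.M.abelian_group_axioms
  have tadd: "bsweedler A C C C (s \<oplus>\<^bsub>CC\<^esub> t) (\<lambda>x y. ract C x (f y))
     = bsweedler A C C C s (\<lambda>x y. ract C x (f y)) \<oplus>\<^bsub>AH\<^esub> bsweedler A C C C t (\<lambda>x y. ract C x (f y))"
    if "s \<in> carrier CC" "t \<in> carrier CC" for s t
    using C2.P.bal_lift_add [OF ab translate_balanced, of s t] that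
    by (simp add: CC_ops C_ops bsweedler_def)
  have cl: "bsweedler A C C C t (\<lambda>x y. ract C x (f y)) \<in> carrier AH" if "t \<in> carrier CC" for t
    using C2.P.bal_lift_closed [OF ab translate_balanced, of t] that
    by (simp add: CC_ops C_ops bsweedler_def)
  have pure: "bsweedler A C C C (cpure x y) (\<lambda>x y. ract C x (f y)) = ract C x (f y)"
    if "x \<in> carrier AH" "y \<in> carrier AH" for x y
    using C2.P.bal_lift_pure [OF ab translate_balanced, of x y] that
    by (simp add: C_ops bsweedler_def btpure_def)
  have tzero: "bsweedler A C C C \<zero>\<^bsub>CC\<^esub> (\<lambda>x y. ract C x (f y)) = \<zero>\<^bsub>AH\<^esub>"
    using C2.P.bal_lift_one [OF ab translate_balanced] by (simp add: CC_ops C_ops bsweedler_def)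
  interpret AH: module K AH by (rule modAH)
  interpret CC: module K CC by (rule modCC)
  have "bsweedler A C C C (c \<odot>\<^bsub>CC\<^esub> t) (\<lambda>x y. ract C x (f y))
      = c \<odot>\<^bsub>AH\<^esub> bsweedler A C C C t (\<lambda>x y. ract C x (f y))"
    if c: "c \<in> carrier K" and t: "t \<in> carrier CC" for c t
    using t
  proof (induction t rule: CC_induct)
    case zero
    then show ?case using c by (simp only: smult_CC_zero tzero AH.smult_r_null)
  next
    case (add x y t)
    then show ?case using c
      by (simp add: tadd
          smult_CC_add smult_CC_pure cpure_closed pure cl AH.smult_r_distr
          lin_smult [OF ract_C_linear] lin_closed [OF f_linear] ract_C_closed)
  qed
  then show ?thesis using tadd cl by (intro linI)
qed

lemma translate_pure:
  assumes "a \<in> carrier A" "h \<in> carrier H"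
  shows "bsweedler A C C C (comul C (tpure K A H a h)) (\<lambda>x y. ract C x (f y))
       = sweedler K H H AH (\<Delta> h) (\<lambda>h1 h2. ract C (tpure K A H a h1) (f (tpure K A H \<one>\<^bsub>A\<^esub> h2)))"
proof -
  have "bsweedler A C C C (comul C (tpure K A H a h)) (\<lambda>x y. ract C x (f y))
    = sweedler K H H AH (\<Delta> h) (\<lambda>h1 h2. bsweedler A C C C
        (cpure (tpure K A H a h1) (tpure K A H \<one>\<^bsub>A\<^esub> h2)) (\<lambda>x y. ract C x (f y)))"
    unfolding comul_C_pure [OF assms]
    by (rule lin_sw [OF _ _ _ _ translate_linear]) (intro CC_rules assms; assumption)+
  also have "\<dots> = sweedler K H H AH (\<Delta> h) (\<lambda>h1 h2. ract C (tpure K A H a h1) (f (tpure K A H \<one>\<^bsub>A\<^esub> h2)))"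
  proof (rule sw_cong)
    fix h1 h2 assume "h1 \<in> carrier H" "h2 \<in> carrier H"
    then show "bsweedler A C C C (cpure (tpure K A H a h1) (tpure K A H \<one>\<^bsub>A\<^esub> h2)) (\<lambda>x y. ract C x (f y))
        = ract C (tpure K A H a h1) (f (tpure K A H \<one>\<^bsub>A\<^esub> h2))"
      unfolding bsweedler_def btpure_def
      by (intro C2.P.bal_lift_pure [OF C2.M.abelian_group_axioms translate_balanced])
        (simp_all add: C_ops tpure_closed modA modH assms)
  qed
  finally show ?thesis .
qed

end

definition psi :: "('h \<Rightarrow> 'a) \<Rightarrow> ('a, 'h) tens \<Rightarrow> 'a" where
  "psi u = (\<lambda>c\<in>carrier AH. sweedler K A H A c (\<lambda>a h. a \<otimes>\<^bsub>A\<^esub> u h))"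

context
  fixes u assumes u: "u \<in> linear_maps K H A"
begin

lemma psi_linear: "psi u \<in> linear_maps K AH A"
proof -
  have "(\<lambda>c. sweedler K A H A c (\<lambda>a h. a \<otimes>\<^bsub>A\<^esub> u h)) \<in> linear_maps K AH A"
    by (intro u_rules [OF u]; assumption)
  then show ?thesis
    unfolding psi_def using restrict_linear [OF modAH] by blast
qed

lemma psi_pure:
  assumes "a \<in> carrier A" "h \<in> carrier H"
  shows "psi u (tpure K A H a h) = a \<otimes>\<^bsub>A\<^esub> u h"
  unfolding psi_def using assms
  by (simp add: tpure_closed modA modH, intro sw_pure) (intro u_rules [OF u] assms; assumption)+

lemma psi_closed: "c \<in> carrier AH \<Longrightarrow> psi u c \<in> carrier A"
  by (rule lin_closed [OF psi_linear])

lemma psi_lact: "\<lbrakk>b \<in> carrier A; c \<in> carrier AH\<rbrakk> \<Longrightarrow> psi u (lact C b c) = b \<otimes>\<^bsub>A\<^esub> psi u c"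
  by (rule AH_ext [OF modA]; (intro C_rules lin_comp [OF psi_linear]; assumption)?)
    (simp add: lact_C_pure psi_pure lin_closed [OF u] multA_assoc)

lemma psi_in: "psi u \<in> carrier (left_dual A C)"
  using psi_linear psi_lact by (simp add: left_dual_C_iff) (simp add: psi_def)

end

lemma psi_ract:
  assumes u: "u \<in> linear_maps K H A" and b: "b \<in> carrier A" and c: "c \<in> carrier AH"
  shows "psi u (ract C c b) = psi (Q u b) c"
proof (rule AH_ext [OF modA _ _ _ c])
  have lQ: "(\<lambda>h. Q u b h) \<in> linear_maps K H A" by (rule Q_linear_H [OF u b])
  have lQ': "Q u b \<in> linear_maps K H A" using lQ by simp
  show "psi (Q u b) \<in> linear_maps K AH A"
    by (rule psi_linear [OF lQ'])
  fix a h assume ah: "a \<in> carrier A" "h \<in> carrier H"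
  have "psi u (ract C (tpure K A H a h) b)
      = sweedler K A H A (\<rho> b) (\<lambda>b0 b1. psi u (tpure K A H (a \<otimes>\<^bsub>A\<^esub> b0) (h \<otimes>\<^bsub>H\<^esub> b1)))"
    unfolding ract_C_pure [OF b ah]
    by (rule lin_sw [OF _ _ _ _ psi_linear [OF u]]) (intro lin_rules ah b; assumption)+
  also have "\<dots> = sweedler K A H A (\<rho> b) (\<lambda>b0 b1. a \<otimes>\<^bsub>A\<^esub> (b0 \<otimes>\<^bsub>A\<^esub> u (h \<otimes>\<^bsub>H\<^esub> b1)))"
    by (rule sw_cong) (simp add: psi_pure [OF u] ah multA_assoc lin_closed [OF u])
  also have "\<dots> = a \<otimes>\<^bsub>A\<^esub> Q u b h"
    unfolding Q_def by (rule lin_sw [symmetric]) (intro u_rules [OF u] ah b; assumption)+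
  also have "\<dots> = psi (Q u b) (tpure K A H a h)"
    by (rule psi_pure [symmetric, OF lQ' ah])
  finally show "psi u (ract C (tpure K A H a h) b) = psi (Q u b) (tpure K A H a h)" .
qed (intro C_rules b lin_comp [OF psi_linear [OF u]]; assumption)

lemma psi_restrict: "psi (restrict u (carrier H)) = psi u"
  unfolding psi_def by (rule restrict_ext, rule sw_cong) simp

text \<open>As a left \<open>A\<close>-module \<open>A \<otimes> H\<close> is generated by the
  elements \<open>1 \<otimes> h\<close>.\<close>

lemma psi_eqI:
  assumes "f \<in> carrier (left_dual A C)" "g \<in> carrier (left_dual A C)"
    and "\<And>h. h \<in> carrier H \<Longrightarrow> f (tpure K A H \<one>\<^bsub>A\<^esub> h) = g (tpure K A H \<one>\<^bsub>A\<^esub> h)"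
  shows "f = g"
proof (rule extensionalityI)
  fix c assume c: "c \<in> carrier AH"
  show "f c = g c"
  proof (rule AH_ext [OF modA f_linear [OF assms(1)] f_linear [OF assms(2)] _ c])
    fix a h assume ah: "a \<in> carrier A" "h \<in> carrier H"
    have "tpure K A H a h = lact C a (tpure K A H \<one>\<^bsub>A\<^esub> h)"
      using ah by (simp add: lact_C_pure)
    then show "f (tpure K A H a h) = g (tpure K A H a h)"
      using ah assms(3) by (simp add: f_lact [OF assms(1)] f_lact [OF assms(2)] tpure_closed modA modH)
  qed
qed (use assms in \<open>simp_all add: left_dual_C_iff\<close>)

text \<open>The inverse restricts a functional along \<open>h \<mapsto> 1 \<otimes> h\<close>; that
  this is a two-sided inverse is \<open>psi_pure\<close> in one direction and \<open>psi_eqI\<close>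
  in the other.\<close>

lemma psi_bij: "bij_betw psi (carrier conv_ring) (carrier (left_dual A C))"
proof (rule bij_betwI')
  fix u v assume uv: "u \<in> carrier conv_ring" "v \<in> carrier conv_ring"
  have "u = v" if "psi u = psi v"
  proof (rule conv_ring_eqI [OF uv])
    fix h assume h: "h \<in> carrier H"
    have "\<one>\<^bsub>A\<^esub> \<otimes>\<^bsub>A\<^esub> u h = \<one>\<^bsub>A\<^esub> \<otimes>\<^bsub>A\<^esub> v h"
      using psi_pure [OF conv_ring_linear [OF uv(1)] oneA_closed h]
        psi_pure [OF conv_ring_linear [OF uv(2)] oneA_closed h] that by (simp only:)
    then show "u h = v h"
      using lin_closed [OF conv_ring_linear [OF uv(1)] h] lin_closed [OF conv_ring_linear [OF uv(2)] h] by simp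
  qed
  then show "psi u = psi v \<longleftrightarrow> u = v" by auto
next
  fix u assume "u \<in> carrier conv_ring"
  then show "psi u \<in> carrier (left_dual A C)" by (intro psi_in conv_ring_linear)
next
  fix f assume f: "f \<in> carrier (left_dual A C)"
  have l: "(\<lambda>h. f (tpure K A H \<one>\<^bsub>A\<^esub> h)) \<in> linear_maps K H A"
    by (intro lin_comp [OF f_linear [OF f]] lin_rules; assumption)
  let ?u = "\<lambda>h\<in>carrier H. f (tpure K A H \<one>\<^bsub>A\<^esub> h)"
  have "f = psi ?u"
    unfolding psi_restrict
    by (rule psi_eqI [OF f psi_in [OF l]])
      (simp add: psi_pure [OF l] lin_closed [OF f_linear [OF f]] tpure_closed modA modH)
  then show "\<exists>u\<in>carrier conv_ring. f = psi u"
    using restrict_conv_ring [OF l] by blast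
qed

text \<open>On \<open>a \<otimes> h\<close> the right-hand side is the sum of the values of
  \<open>psi u\<close> at \<open>(a \<otimes> h1) v(h2)\<close>, which are
  \<open>a Q u (v h2) h1\<close>. In the left dual this is the product of \<open>psi v\<close> and
  \<open>psi u\<close> in this order, so \<open>psi\<close> is multiplicative for the opposite
  ring.\<close>

lemma psi_conv:
  assumes u: "u \<in> linear_maps K H A" and v: "v \<in> linear_maps K H A" and c: "c \<in> carrier AH"
  shows "psi (conv u v) c = psi u (bsweedler A C C C (comul C c) (\<lambda>x y. ract C x (psi v y)))"
proof (rule AH_ext [OF modA psi_linear [OF conv_linear [OF u v]] _ _ c])
  note pv = psi_in [OF v]
  show "(\<lambda>c. psi u (bsweedler A C C C (comul C c) (\<lambda>x y. ract C x (psi v y)))) \<in> linear_maps K AH A"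
    by (intro lin_comp [OF psi_linear [OF u]] lin_comp [OF translate_linear [OF pv]] comul_C_linear [simplified])
  fix a h assume ah: "a \<in> carrier A" "h \<in> carrier H"
  note r = C_rules u_rules [OF u] u_rules [OF v] lin_comp [OF psi_linear [OF v]] psi_closed [OF v] ah
  have "psi u (bsweedler A C C C (comul C (tpure K A H a h)) (\<lambda>x y. ract C x (psi v y)))
      = sweedler K H H A (\<Delta> h) (\<lambda>h1 h2. psi u (ract C (tpure K A H a h1) (psi v (tpure K A H \<one>\<^bsub>A\<^esub> h2))))"
    unfolding translate_pure [OF pv ah]
    by (rule lin_sw [OF _ _ _ _ psi_linear [OF u]]) (intro r; assumption)+
  also have "\<dots> = sweedler K H H A (\<Delta> h) (\<lambda>h1 h2. a \<otimes>\<^bsub>A\<^esub> Q u (v h2) h1)"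
    using psi_pure [OF Q_linear_H [OF u], simplified]
    by (intro sw_cong) (simp add: psi_pure [OF v] psi_ract [OF u] lin_closed [OF v] ah tpure_closed modA modH)
  also have "\<dots> = a \<otimes>\<^bsub>A\<^esub> conv u v h"
    unfolding conv_def by (rule lin_sw [symmetric]) (intro r; assumption)+
  also have "\<dots> = psi (conv u v) (tpure K A H a h)"
    by (rule psi_pure [symmetric, OF conv_linear [OF u v] ah])
  finally show "psi (conv u v) (tpure K A H a h)
      = psi u (bsweedler A C C C (comul C (tpure K A H a h)) (\<lambda>x y. ract C x (psi v y)))" by simp
qed

text \<open>Multiplicativity of \<open>\<epsilon>\<close> contracts the sum over
  \<open>\<rho>(1)\<close> to \<open>e\<close>, so the counit of \<open>a \<otimes> h\<close> is
  \<open>\<epsilon>(h) a e\<close>. The counit of the coring thus corresponds to the unit map of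
  \<open>Hom(H, A)\<close> at 1.\<close>

lemma counit_C_psi: "c \<in> carrier AH \<Longrightarrow> counit C c = psi (eta \<one>\<^bsub>A\<^esub>) c"
proof -
  assume c: "c \<in> carrier AH"
  have "sweedler K A H A (\<rho> \<one>\<^bsub>A\<^esub>) (\<lambda>u v. \<epsilon> (h \<otimes>\<^bsub>H\<^esub> v) \<odot>\<^bsub>A\<^esub> (a \<otimes>\<^bsub>A\<^esub> u)) = a \<otimes>\<^bsub>A\<^esub> eta \<one>\<^bsub>A\<^esub> h"
    if ah: "a \<in> carrier A" "h \<in> carrier H" for a h
  proof -
    have "sweedler K A H A (\<rho> \<one>\<^bsub>A\<^esub>) (\<lambda>u v. \<epsilon> (h \<otimes>\<^bsub>H\<^esub> v) \<odot>\<^bsub>A\<^esub> (a \<otimes>\<^bsub>A\<^esub> u))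
        = sweedler K A H A (\<rho> \<one>\<^bsub>A\<^esub>) (\<lambda>u v. \<epsilon> h \<odot>\<^bsub>A\<^esub> (a \<otimes>\<^bsub>A\<^esub> (\<epsilon> v \<odot>\<^bsub>A\<^esub> u)))"
      by (rule sw_cong) (simp add: ah counit_mult counit_closed A.smult_assoc1 A.smult_mult_right)
    also have "\<dots> = \<epsilon> h \<odot>\<^bsub>A\<^esub> (a \<otimes>\<^bsub>A\<^esub> e)"
      unfolding e_def
      by (rule lin_sw [symmetric, where \<phi> = "\<lambda>z. \<epsilon> h \<odot>\<^bsub>A\<^esub> (a \<otimes>\<^bsub>A\<^esub> z)"]) (intro lin_rules ah; assumption)+
    finally show ?thesis
      using ah by (simp add: eta_def e_closed counit_closed A.smult_mult_right)
  qed
  then show ?thesis using c by (simp add: counit_C psi_def cong: sw_cong)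
qed

lemma psi_mult_right:
  assumes u: "u \<in> linear_maps K H A" and b: "b \<in> carrier A" and c: "c \<in> carrier AH"
  shows "psi (\<lambda>h. u h \<otimes>\<^bsub>A\<^esub> b) c = psi u c \<otimes>\<^bsub>A\<^esub> b"
  by (rule AH_ext [OF modA _ _ _ c]; (intro lin_rules lin_comp [OF u] lin_comp [OF psi_linear [OF u]] psi_linear b u; assumption)?)
    (simp_all add: psi_pure u b lin_mult_left [OF algA] lin_closed [OF u] multA_assoc psi_linear)

lemma psi_eta: "\<lbrakk>a \<in> carrier A; c \<in> carrier AH\<rbrakk> \<Longrightarrow> psi (eta a) c = counit C c \<otimes>\<^bsub>A\<^esub> a"
proof -
  assume a: "a \<in> carrier A" and c: "c \<in> carrier AH"
  have "psi (eta a) = psi (\<lambda>h. eta \<one>\<^bsub>A\<^esub> h \<otimes>\<^bsub>A\<^esub> a)"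
    unfolding psi_def
    by (rule restrict_ext, rule sw_cong) (simp add: eta_def a e_closed counit_closed A.smult_mult_left)
  then show ?thesis
    using psi_mult_right [OF eta_linear [OF oneA_closed] a c] by (simp add: counit_C_psi c)
qed

lemma psi_add:
  assumes u: "u \<in> linear_maps K H A" and v: "v \<in> linear_maps K H A" and c: "c \<in> carrier AH"
  shows "psi (\<lambda>h. u h \<oplus>\<^bsub>A\<^esub> v h) c = psi u c \<oplus>\<^bsub>A\<^esub> psi v c"
  by (rule AH_ext [OF modA _ _ _ c])
    (simp_all add: psi_linear lin_add_fun [OF modA] u v psi_pure lin_closed [OF u] lin_closed [OF v] A.r_distr)

lemma psi_zero: "c \<in> carrier AH \<Longrightarrow> psi (\<lambda>h. \<zero>\<^bsub>A\<^esub>) c = \<zero>\<^bsub>A\<^esub>"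
proof -
  assume c: "c \<in> carrier AH"
  have z: "(\<lambda>h. \<zero>\<^bsub>A\<^esub>) \<in> linear_maps K M A" for M :: "('k, 'm) module" by (rule linI) simp_all
  have z2: "(\<lambda>h. \<zero>\<^bsub>A\<^esub>) \<in> linear_maps K AH A" by (rule linI) simp_all
  have z1: "(\<lambda>h. \<zero>\<^bsub>A\<^esub>) \<in> linear_maps K H A" by (rule linI) simp_all
  show ?thesis
    by (rule AH_ext [OF modA psi_linear [OF z1] z2 _ c]) (simp add: psi_pure [OF z1])
qed

theorem transport_left_dual_C:
  "lax_transport (op_ring A) conv_ring (op_lax_ring (left_dual A C)) psi"
proof -
  have car: "carrier C = carrier AH" by (simp add: C_ops)
  have ext: "psi u = (\<lambda>c\<in>carrier AH. psi u c)" for u by (simp add: psi_def cong: restrict_cong)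
  have eq: "psi u = (\<lambda>c\<in>carrier AH. F c)" if "\<And>c. c \<in> carrier AH \<Longrightarrow> psi u c = F c" for u F
    by (subst ext) (rule restrict_ext, rule that)
  show ?thesis
    unfolding lax_transport_def op_lax_ring_simps op_ring_simps left_dual_simps(2-) car
  proof (intro conjI ballI)
    show "bij_betw psi (carrier conv_ring) (carrier (left_dual A C))" by (rule psi_bij)
  qed (rule eq; simp add: conv_ring_simps(2-) psi_restrict psi_zero psi_add psi_conv psi_mult_right
      psi_ract psi_eta conv_ring_linear)+
qed

end

section \<open>The coring \<open>(A \<otimes> H) 1\<close> and its left dual\<close>

lemma bal_lift_source_cong:
  assumes "carrier M = carrier M'" "add M = add M'" "carrier N = carrier N'" "add N = add N'"
  shows "bal_lift R ra la M N G = bal_lift R ra la M' N' G"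
  by (intro ext) (simp add: bal_lift_def bal_tensor_cong [OF assms] assms)

context lax_comodule_algebra
begin

abbreviation "D \<equiv> underline_coring A C"

text \<open>The right action of 1 is idempotent, so its image is its set of fixed points; membership
  becomes an equation.\<close>

lemma D_carrier: "x \<in> carrier D \<longleftrightarrow> x \<in> carrier AH \<and> ract C x \<one>\<^bsub>A\<^esub> = x"
proof -
  have "ract C (ract C x \<one>\<^bsub>A\<^esub>) \<one>\<^bsub>A\<^esub> = ract C x \<one>\<^bsub>A\<^esub>" if "x \<in> carrier AH" for x
    using that by (simp flip: ract_C_ract)
  then show ?thesis
    by (force simp: underline_coring_def underline_def Let_def C_ops ract_C_closed)
qed

lemma D_ops:
  "add D = add AH" "\<zero>\<^bsub>D\<^esub> = \<zero>\<^bsub>AH\<^esub>" "lact D = lact C" "ract D = ract C" "counit D = counit C"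
  by (simp_all add: underline_coring_def underline_def Let_def C_ops)

lemma D_ract: "\<lbrakk>x \<in> carrier AH; b \<in> carrier A\<rbrakk> \<Longrightarrow> ract C x b \<in> carrier D"
  by (simp add: D_carrier ract_C_closed flip: ract_C_ract)

lemma D_lact: "\<lbrakk>x \<in> carrier D; b \<in> carrier A\<rbrakk> \<Longrightarrow> lact C b x \<in> carrier D"
  by (simp add: D_carrier lact_C_closed lact_ract_C)

lemma D_AH: "x \<in> carrier D \<Longrightarrow> x \<in> carrier AH"
  by (simp add: D_carrier)

lemma D_one: "x \<in> carrier D \<Longrightarrow> ract C x \<one>\<^bsub>A\<^esub> = x"
  by (simp add: D_carrier)

lemma D_add: "\<lbrakk>x \<in> carrier D; y \<in> carrier D\<rbrakk> \<Longrightarrow> x \<oplus>\<^bsub>AH\<^esub> y \<in> carrier D"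
  using abelian_monoid.a_closed [OF abelian_group.axioms(1) [OF module.axioms(2) [OF modAH]]]
  by (simp add: D_carrier lin_add [OF ract_C_linear])

lemma bimodule_D: "bimodule A D"
proof (intro bimodule.intro A.ring_axioms bimodule_axioms.intro)
  interpret AH: module K AH by (rule modAH)
  show "abelian_group D"
  proof (rule abelian_groupI)
    show "\<zero>\<^bsub>D\<^esub> \<in> carrier D"
      using lin_zero [OF ract_C_linear [OF oneA_closed] AH.M.abelian_group_axioms AH.M.abelian_group_axioms]
      by (simp add: D_carrier D_ops)
    fix x assume x: "x \<in> carrier D"
    have "\<ominus>\<^bsub>K\<^esub> \<one>\<^bsub>K\<^esub> \<odot>\<^bsub>AH\<^esub> x \<in> carrier D"
      using x by (simp add: D_carrier lin_smult [OF ract_C_linear])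
    moreover have "(\<ominus>\<^bsub>K\<^esub> \<one>\<^bsub>K\<^esub> \<odot>\<^bsub>AH\<^esub> x) \<oplus>\<^bsub>D\<^esub> x = \<zero>\<^bsub>D\<^esub>"
      using D_AH [OF x] by (simp add: D_ops AH.smult_l_minus AH.M.l_neg)
    ultimately show "\<exists>y\<in>carrier D. y \<oplus>\<^bsub>D\<^esub> x = \<zero>\<^bsub>D\<^esub>" by blast
  qed (simp_all add: D_ops D_add D_AH AH.M.a_ac)
qed (simp_all add: D_ops D_AH D_lact D_ract lin_add [OF lact_C_linear]
    lin_add [OF lact_C_linear_A] lin_add [OF ract_C_linear] lin_add [OF ract_C_linear_A]
    lact_C_lact ract_C_ract lact_ract_C)

sublocale D2: bimodule_pair A D D
  by (intro bimodule_pair.intro bimodule_D)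

abbreviation "dpure \<equiv> btpure A D D"

lemma iota_balanced: "D2.P.balanced (btensor A C C) (\<lambda>x y. cpure x y)"
  unfolding D2.P.balanced_def
  using cpure_closed cpure_add_left cpure_add_right cpure_balanced
  by (simp add: D_ops D_AH C2.btensor_ops CC_ops)

text \<open>To carry \<open>a\<close> across the tensor sign over \<open>D\<close> it must act on an
  element of \<open>D\<close>. This is arranged by the identity
  \<open>(x a) 1 = x a = (x 1) a\<close>.\<close>

lemma pi_balanced: "C2.P.balanced (btensor A D D) (\<lambda>x y. dpure (ract C x \<one>\<^bsub>A\<^esub>) (ract C y \<one>\<^bsub>A\<^esub>))"
proof -
  have "dpure (ract C (ract C x a) \<one>\<^bsub>A\<^esub>) (ract C y \<one>\<^bsub>A\<^esub>) = dpure (ract C x \<one>\<^bsub>A\<^esub>) (ract C (lact C a y) \<one>\<^bsub>A\<^esub>)"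
    if "x \<in> carrier AH" "y \<in> carrier AH" "a \<in> carrier A" for x y a
  proof -
    have "ract C (ract C x a) \<one>\<^bsub>A\<^esub> = ract C (ract C x \<one>\<^bsub>A\<^esub>) a"
      using that by (simp flip: ract_C_ract)
    then show ?thesis
      using that D2.P.pure_balanced [of "ract C x \<one>\<^bsub>A\<^esub>" "ract C y \<one>\<^bsub>A\<^esub>" a]
      by (simp add: D_ract D_ops btpure_def lact_ract_C)
  qed
  then show ?thesis
    unfolding C2.P.balanced_def
    using D2.P.pure_closed D2.P.pure_add_left D2.P.pure_add_right
    by (simp add: D_ops C_ops D_ract D2.btensor_ops btpure_def lin_add [OF ract_C_linear])
qed

abbreviation "iota t \<equiv> bsweedler A D D (btensor A C C) t (\<lambda>x y. cpure x y)"

abbreviation "pi t \<equiv> bsweedler A C C (btensor A D D) t (\<lambda>x y. dpure (ract C x \<one>\<^bsub>A\<^esub>) (ract C y \<one>\<^bsub>A\<^esub>))"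

lemmas iota_simps =
  D2.P.bal_lift_closed [OF C2.abelian_group_btensor iota_balanced, folded bsweedler_def]
  D2.P.bal_lift_add [OF C2.abelian_group_btensor iota_balanced, folded bsweedler_def]
  D2.P.bal_lift_pure [OF C2.abelian_group_btensor iota_balanced, folded bsweedler_def btpure_def]
  D2.P.bal_lift_one [OF C2.abelian_group_btensor iota_balanced, folded bsweedler_def]

lemmas pi_simps =
  C2.P.bal_lift_closed [OF D2.abelian_group_btensor pi_balanced, folded bsweedler_def]
  C2.P.bal_lift_add [OF D2.abelian_group_btensor pi_balanced, folded bsweedler_def]
  C2.P.bal_lift_pure [OF D2.abelian_group_btensor pi_balanced, folded bsweedler_def btpure_def]
  C2.P.bal_lift_one [OF D2.abelian_group_btensor pi_balanced, folded bsweedler_def]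

lemma pi_iota:
  assumes "t \<in> carrier D2.P.T" shows "pi (iota t) = t"
  using assms
proof (induction t rule: D2.P.tens_induct)
  case zero then show ?case
    by (simp only: iota_simps pi_simps C2.btensor_ops D2.btensor_ops)
next
  case (add m n t)
  have c: "cpure m n \<in> carrier C2.P.T"
    using cpure_closed add D_AH by (simp add: CC_ops)
  have i: "iota t \<in> carrier C2.P.T"
    using iota_simps(1) [OF add(3)] by (simp add: C2.btensor_ops)
  have "iota (D2.P.pure m n \<otimes>\<^bsub>D2.P.T\<^esub> t) = cpure m n \<otimes>\<^bsub>C2.P.T\<^esub> iota t"
    using iota_simps(2) [OF D2.P.pure_closed [OF add(1,2)] add(3)] iota_simps(3) [OF add(1,2)]
    by (simp add: C2.btensor_ops btpure_def)
  moreover have "pi (cpure m n) = D2.P.pure m n"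
    using pi_simps(3) [of m n] add D_AH D_one by (simp add: C_ops btpure_def)
  ultimately show ?case
    using pi_simps(2) [OF c i] add(4) by (simp add: D2.btensor_ops)
qed

text \<open>On \<open>m \<otimes> n\<close> the composite gives \<open>m 1 \<otimes> n 1\<close>. In
  \<open>C \<otimes>\<^sub>A C\<close> the first 1 passes over to the second factor, where it acts
  trivially from the left, and only the right action on \<open>n\<close> remains.\<close>

lemma iota_pi:
  assumes "t \<in> carrier C2.P.T" shows "iota (pi t) = ract (btensor A C C) t \<one>\<^bsub>A\<^esub>"
  using assms
proof (induction t rule: C2.P.tens_induct)
  case zero then show ?case
    using C2.ract_btensor_one [OF oneA_closed]
    by (simp only: iota_simps pi_simps C2.btensor_ops D2.btensor_ops)
next
  case (add m n t)
  have mn: "m \<in> carrier AH" "n \<in> carrier AH" using add by (simp_all add: C_ops)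
  have d: "dpure (ract C m \<one>\<^bsub>A\<^esub>) (ract C n \<one>\<^bsub>A\<^esub>) \<in> carrier D2.P.T"
    using D2.P.pure_closed D_ract mn by (simp add: btpure_def)
  have p: "pi t \<in> carrier D2.P.T"
    using pi_simps(1) [OF add(3)] by (simp add: D2.btensor_ops)
  have "pi (C2.P.pure m n \<otimes>\<^bsub>C2.P.T\<^esub> t) = dpure (ract C m \<one>\<^bsub>A\<^esub>) (ract C n \<one>\<^bsub>A\<^esub>) \<otimes>\<^bsub>D2.P.T\<^esub> pi t"
    using pi_simps(2) [OF C2.P.pure_closed [OF add(1,2)] add(3)] pi_simps(3) [OF add(1,2)]
    by (simp add: D2.btensor_ops btpure_def)
  moreover have "iota (dpure (ract C m \<one>\<^bsub>A\<^esub>) (ract C n \<one>\<^bsub>A\<^esub>)) = C2.P.pure m (ract C n \<one>\<^bsub>A\<^esub>)"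
    using iota_simps(3) [OF D_ract D_ract] mn cpure_balanced [of m "ract C n \<one>\<^bsub>A\<^esub>" "\<one>\<^bsub>A\<^esub>"]
    by (simp add: btpure_def ract_C_closed lact_C_one)
  ultimately show ?case
    using iota_simps(2) [OF d p] add C2.ract_btensor_add [OF oneA_closed C2.P.pure_closed [OF add(1,2)] add(3)]
      C2.ract_btensor_pure [OF oneA_closed add(1,2)]
    by (simp add: C2.btensor_ops)
qed

text \<open>For \<open>c\<close> in \<open>D\<close> right linearity of the comultiplication gives
  \<open>\<Delta>(c) = \<Delta>(c 1) = \<Delta>(c) 1\<close>, so \<open>iota_pi\<close> exhibits
  \<open>pi (comul C c)\<close> as a preimage under \<open>iota\<close>. It is the only one since
  \<open>pi\<close> is a left inverse of \<open>iota\<close>. Hence the description defining the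
  comultiplication of \<open>D\<close> denotes.\<close>

lemma comul_D:
  assumes c: "c \<in> carrier D"
  shows "comul D c \<in> carrier D2.P.T" and "iota (comul D c) = comul C c"
proof -
  have T: "comul C c \<in> carrier C2.P.T"
    using comul_C_closed [OF D_AH [OF c]] by (simp add: CC_ops)
  have 1: "pi (comul C c) \<in> carrier (btensor A D D)" by (rule pi_simps(1) [OF T])
  have 2: "iota (pi (comul C c)) = comul C c"
    using iota_pi [OF T] comul_C_ract [OF oneA_closed D_AH [OF c]] D_one [OF c] by simp
  have ex1: "\<exists>!t. t \<in> carrier (btensor A D D) \<and> iota t = comul C c"
  proof (rule ex1I [of _ "pi (comul C c)"])
    fix t assume "t \<in> carrier (btensor A D D) \<and> iota t = comul C c"
    then show "t = pi (comul C c)" using pi_iota [of t] by (simp add: D2.btensor_ops)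
  qed (simp add: 1 2)
  \<comment> \<open>The description in the definition refers to the record before its field
    \<open>comul\<close> is replaced; the tensor products agree because carriers, additions and
    actions do.\<close>
  have eqs: "btensor A (underline A C) (underline A C) = btensor A D D"
    "bsweedler A (underline A C) (underline A C) = (bsweedler A D D :: ('z, 'w) ring_scheme \<Rightarrow> _)"
  proof -
    have eq: "carrier (underline A C) = carrier D" "add (underline A C) = add D"
      "lact (underline A C) = lact D" "ract (underline A C) = ract D"
      by (simp_all add: underline_coring_def Let_def)
    have T: "bal_tensor R ra la (underline A C) (underline A C) = bal_tensor R ra la D D"
      and P: "bal_pure R ra la (underline A C) (underline A C) = bal_pure R ra la D D" for R ra la
      by (rule bal_tensor_cong; simp add: eq)+
    note L = bal_lift_source_cong [OF eq(1,2) eq(1,2)]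
    show "bsweedler A (underline A C) (underline A C) = bsweedler A D D"
      by (intro ext) (simp add: bsweedler_def L eq)
    show "btensor A (underline A C) (underline A C) = btensor A D D"
      by (simp add: btensor_def btgroup_def bsweedler_def btpure_def L T P eq)
  qed
  have "comul D c = (THE t. t \<in> carrier (btensor A (underline A C) (underline A C))
      \<and> bsweedler A (underline A C) (underline A C) (btensor A C C) t (\<lambda>x y. cpure x y) = comul C c)"
    by (subst underline_coring_def) (simp add: Let_def)
  then have "comul D c = (THE t. t \<in> carrier (btensor A D D) \<and> iota t = comul C c)"
    unfolding eqs .
  then show "comul D c \<in> carrier D2.P.T" "iota (comul D c) = comul C c"
    using theI' [OF ex1] by (simp_all only: D2.btensor_ops)
qed

text \<open>The expression \<open>c1 f(c2)\<close> is compared on pure tensors, where both sides are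
  \<open>ract C x (f y)\<close>. Through \<open>comul_D\<close> it reduces products in the dual of
  \<open>D\<close> to products in the dual of \<open>C\<close>.\<close>

lemma translate_D:
  assumes f: "f \<in> carrier (left_dual A C)" and t: "t \<in> carrier D2.P.T"
  shows "bsweedler A D D D t (\<lambda>x y. ract D x (restrict f (carrier D) y))
       = bsweedler A C C C (iota t) (\<lambda>x y. ract C x (f y))"
proof -
  have b: "D2.P.balanced D (\<lambda>x y. ract D x (restrict f (carrier D) y))"
    unfolding D2.P.balanced_def
    using f_linear [OF f] f_lact [OF f]
    by (simp add: D_ops D_AH D_ract D_lact D_add lin_closed lin_add [OF ract_C_linear]
        lin_add [OF ract_C_linear_A] lin_add [OF f_linear [OF f]] ract_C_ract)
  note D_simps = D2.P.bal_lift_add [OF D2.M.abelian_group_axioms b, folded bsweedler_def]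
    D2.P.bal_lift_pure [OF D2.M.abelian_group_axioms b, folded bsweedler_def btpure_def]
    D2.P.bal_lift_one [OF D2.M.abelian_group_axioms b, folded bsweedler_def]
  note C_simps = C2.P.bal_lift_add [OF C2.M.abelian_group_axioms translate_balanced [OF f], folded bsweedler_def]
    C2.P.bal_lift_pure [OF C2.M.abelian_group_axioms translate_balanced [OF f], folded bsweedler_def btpure_def]
    C2.P.bal_lift_one [OF C2.M.abelian_group_axioms translate_balanced [OF f], folded bsweedler_def]
  show ?thesis
    using t
  proof (induction t rule: D2.P.tens_induct)
    case zero
    then show ?case
      by (simp only: D_simps(3) iota_simps(4) C2.btensor_ops(3) C_simps(3)) (simp only: D_ops C_ops)
  next
    case (add m n t)
    have c: "cpure m n \<in> carrier C2.P.T"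
      using cpure_closed add D_AH by (simp add: CC_ops)
    have i: "iota t \<in> carrier C2.P.T"
      using iota_simps(1) [OF add(3)] by (simp add: C2.btensor_ops)
    have "iota (D2.P.pure m n \<otimes>\<^bsub>D2.P.T\<^esub> t) = cpure m n \<otimes>\<^bsub>C2.P.T\<^esub> iota t"
      using iota_simps(2) [OF D2.P.pure_closed [OF add(1,2)] add(3)] iota_simps(3) [OF add(1,2)]
      by (simp add: C2.btensor_ops btpure_def)
    then show ?case
      using D_simps(1) [OF D2.P.pure_closed [OF add(1,2)] add(3)] D_simps(2) [OF add(1,2)]
        C_simps(1) [OF c i] C_simps(2) [of m n] add D_AH
      by (simp add: C_ops D_ops btpure_def)
  qed
qed

lemma underline_conv_ring:
  "u \<in> carrier (underline (op_ring A) conv_ring) \<longleftrightarrow>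
     u \<in> carrier conv_ring \<and> (\<forall>h\<in>carrier H. Q u \<one>\<^bsub>A\<^esub> h = u h)"
proof -
  have "restrict (Q u \<one>\<^bsub>A\<^esub>) (carrier H) = u \<longleftrightarrow> (\<forall>h\<in>carrier H. Q u \<one>\<^bsub>A\<^esub> h = u h)"
    if "u \<in> carrier conv_ring"
  proof
    assume "restrict (Q u \<one>\<^bsub>A\<^esub>) (carrier H) = u"
    then show "\<forall>h\<in>carrier H. Q u \<one>\<^bsub>A\<^esub> h = u h" by (metis restrict_apply')
  next
    assume "\<forall>h\<in>carrier H. Q u \<one>\<^bsub>A\<^esub> h = u h"
    then show "restrict (Q u \<one>\<^bsub>A\<^esub>) (carrier H) = u"
      using that by (intro extensionalityI [where A = "carrier H"]) (simp_all add: conv_ring_simps)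
  qed
  then show ?thesis by (auto simp: E.underline_carrier conv_ring_simps(7))
qed

lemma psi_D_bij:
  "bij_betw (\<lambda>u. restrict (psi u) (carrier D)) (carrier (underline (op_ring A) conv_ring))
     (carrier (left_dual A D))"
proof (rule bij_betwI')
  fix u v assume u: "u \<in> carrier (underline (op_ring A) conv_ring)"
    and v: "v \<in> carrier (underline (op_ring A) conv_ring)"
  \<comment> \<open>A function in \<open>E 1\<close> can be recovered from its values on
    \<open>D\<close>: the element \<open>(1 \<otimes> h) 1\<close> lies in \<open>D\<close>, and
    \<open>psi w\<close> takes the value \<open>Q w \<one> h = w h\<close> there.\<close>
  have val: "w h = psi w (ract C (tpure K A H \<one>\<^bsub>A\<^esub> h) \<one>\<^bsub>A\<^esub>)"
    if w: "w \<in> carrier (underline (op_ring A) conv_ring)" and h: "h \<in> carrier H" for w h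
  proof -
    have l: "w \<in> linear_maps K H A" and e: "Q w \<one>\<^bsub>A\<^esub> h = w h"
      using w h by (simp_all add: underline_conv_ring conv_ring_linear)
    have l2: "Q w \<one>\<^bsub>A\<^esub> \<in> linear_maps K H A" using Q_linear_H [OF l oneA_closed] by simp
    show ?thesis
      using h e psi_pure [OF l2 oneA_closed h] lin_closed [OF l h]
      by (simp add: psi_ract [OF l oneA_closed] tpure_closed modA modH)
  qed
  have "u = v" if eq: "restrict (psi u) (carrier D) = restrict (psi v) (carrier D)"
  proof (rule conv_ring_eqI)
    fix h assume h: "h \<in> carrier H"
    have "ract C (tpure K A H \<one>\<^bsub>A\<^esub> h) \<one>\<^bsub>A\<^esub> \<in> carrier D"
      using h by (simp add: D_ract tpure_closed modA modH)
    then have "psi u (ract C (tpure K A H \<one>\<^bsub>A\<^esub> h) \<one>\<^bsub>A\<^esub>) = psi v (ract C (tpure K A H \<one>\<^bsub>A\<^esub> h) \<one>\<^bsub>A\<^esub>)"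
      using fun_cong [OF eq] by (metis restrict_apply')
    then show "u h = v h" using val u v h by simp
  qed (use u v in \<open>simp_all add: underline_conv_ring\<close>)
  then show "restrict (psi u) (carrier D) = restrict (psi v) (carrier D) \<longleftrightarrow> u = v" by auto
next
  fix u assume "u \<in> carrier (underline (op_ring A) conv_ring)"
  then have l: "u \<in> linear_maps K H A" by (simp add: underline_conv_ring conv_ring_linear)
  show "restrict (psi u) (carrier D) \<in> carrier (left_dual A D)"
    using psi_linear [OF l]
    by (simp add: left_dual_simps D_ops D_AH D_add D_lact psi_lact [OF l] lin_add lin_closed)
next
  fix f assume f: "f \<in> carrier (left_dual A D)"
  \<comment> \<open>The extension of \<open>f\<close> to \<open>C\<close> along the projection
    \<open>x \<mapsto> x 1\<close>. It is invariant under the right action of 1, which places its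
    preimage under \<open>psi\<close> in \<open>E 1\<close>.\<close>
  let ?f = "\<lambda>x\<in>carrier AH. f (ract C x \<one>\<^bsub>A\<^esub>)"
  have fc: "f x \<in> carrier A" if "x \<in> carrier D" for x
    using f that by (auto simp: left_dual_simps)
  have fadd: "f (x \<oplus>\<^bsub>AH\<^esub> y) = f x \<oplus>\<^bsub>A\<^esub> f y" if "x \<in> carrier D" "y \<in> carrier D" for x y
    using f that by (auto simp: left_dual_simps D_ops)
  have flact: "f (lact C b x) = b \<otimes>\<^bsub>A\<^esub> f x" if "x \<in> carrier D" "b \<in> carrier A" for b x
    using f that by (auto simp: left_dual_simps D_ops)
  interpret AH: module K AH by (rule modAH)
  have "?f \<in> carrier (left_dual A C)"
    using fc fadd flact
    by (auto simp: left_dual_simps C_ops D_ract lin_add [OF ract_C_linear] lact_ract_C lact_C_closed)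
  then obtain u where u: "u \<in> carrier conv_ring" "?f = psi u"
    using psi_bij by (auto simp: bij_betw_def)
  note l = conv_ring_linear [OF u(1)]
  have l2: "Q u \<one>\<^bsub>A\<^esub> \<in> linear_maps K H A" using Q_linear_H [OF l oneA_closed] by simp
  have fo: "?f (ract C x \<one>\<^bsub>A\<^esub>) = ?f x" if "x \<in> carrier AH" for x
    using that D_one [OF D_ract [OF that oneA_closed]] by (simp add: ract_C_closed)
  have "Q u \<one>\<^bsub>A\<^esub> h = u h" if h: "h \<in> carrier H" for h
  proof -
    have p: "tpure K A H \<one>\<^bsub>A\<^esub> h \<in> carrier AH" using h by (simp add: tpure_closed modA modH)
    have "psi (Q u \<one>\<^bsub>A\<^esub>) (tpure K A H \<one>\<^bsub>A\<^esub> h) = psi u (tpure K A H \<one>\<^bsub>A\<^esub> h)"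
      using fo [OF p] psi_ract [OF l oneA_closed p] unfolding u(2) by simp
    then show ?thesis
      using psi_pure [OF l2 oneA_closed h] psi_pure [OF l oneA_closed h] lin_closed [OF l h] lin_closed [OF l2 h]
      by simp
  qed
  then have "u \<in> carrier (underline (op_ring A) conv_ring)"
    using u by (simp add: underline_conv_ring)
  moreover have "f = restrict (psi u) (carrier D)"
  proof (rule extensionalityI)
    show "f \<in> extensional (carrier D)" using f by (auto simp: left_dual_simps PiE_def)
    fix x assume x: "x \<in> carrier D"
    then show "f x = restrict (psi u) (carrier D) x"
      using D_AH [OF x] D_one [OF x] unfolding u(2) [symmetric] by simp
  qed simp
  ultimately show "\<exists>u\<in>carrier (underline (op_ring A) conv_ring). f = restrict (psi u) (carrier D)" by blast
qed

theorem transport_left_dual_D: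
  "lax_transport (op_ring A) (underline (op_ring A) conv_ring) (op_lax_ring (left_dual A D))
     (\<lambda>u. restrict (psi u) (carrier D))"
proof -
  have l: "u \<in> linear_maps K H A" if "u \<in> carrier (underline (op_ring A) conv_ring)" for u
    using that by (simp add: underline_conv_ring conv_ring_linear)
  have m: "psi (conv u v) c = restrict (psi u) (carrier D)
      (bsweedler A D D D (comul D c) (\<lambda>x y. ract C x (restrict (psi v) (carrier D) y)))"
    if u: "u \<in> linear_maps K H A" and v: "v \<in> linear_maps K H A" and c: "c \<in> carrier D" for u v c
  proof -
    have b: "D2.P.balanced D (\<lambda>x y. ract D x (restrict (psi v) (carrier D) y))"
      unfolding D2.P.balanced_def
      using psi_linear [OF v] psi_lact [OF v]
      by (simp add: D_ops D_AH D_ract D_lact D_add lin_closed lin_add [OF ract_C_linear]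
          lin_add [OF ract_C_linear_A] lin_add [OF psi_linear [OF v]] ract_C_ract)
    have "bsweedler A D D D (comul D c) (\<lambda>x y. ract D x (restrict (psi v) (carrier D) y)) \<in> carrier D"
      unfolding bsweedler_def
      by (rule D2.P.bal_lift_closed [OF D2.M.abelian_group_axioms b comul_D(1) [OF c]])
    then show ?thesis
      using psi_conv [OF u v D_AH [OF c]] translate_D [OF psi_in [OF v] comul_D(1) [OF c]] comul_D(2) [OF c]
      by (simp add: D_ops)
  qed
  show ?thesis
    unfolding lax_transport_def op_lax_ring_simps op_ring_simps left_dual_simps(2-) E.underline_ops
  proof (intro conjI ballI)
    show "bij_betw (\<lambda>u. restrict (psi u) (carrier D)) (carrier (underline (op_ring A) conv_ring))
       (carrier (left_dual A D))" by (rule psi_D_bij)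
  qed (rule restrict_ext; simp add: conv_ring_simps(2-) D_ops psi_restrict psi_zero psi_add psi_mult_right
      psi_ract psi_eta D_AH D_ract l m)+
qed

lemma psi_D_one: "restrict (psi \<one>\<^bsub>underline (op_ring A) conv_ring\<^esub>) (carrier D) = \<one>\<^bsub>op_lax_ring (left_dual A D)\<^esub>"
  unfolding op_lax_ring_simps left_dual_simps
  by (rule restrict_ext)
    (simp add: E.underline_ops conv_ring_simps psi_restrict D_ops D_AH counit_C_psi)

end

section \<open>The smash product\<close>

text \<open>Finite generation and projectivity of \<open>H\<close> are represented by a chosen dual
  basis, since the constructions below use the basis itself.\<close>

locale fgp_lax_comodule_algebra = lax_comodule_algebra K H \<Delta> \<epsilon> A \<rho>
  for K :: "'k ring" and H :: "('k, 'h) module" and \<Delta> :: "'h \<Rightarrow> ('h, 'h) tens"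
    and \<epsilon> :: "'h \<Rightarrow> 'k" and A :: "('k, 'a) module" and \<rho> :: "'a \<Rightarrow> ('a, 'h) tens" +
  fixes I :: "'i set" and b :: "'i \<Rightarrow> 'h" and d :: "'i \<Rightarrow> 'h \<Rightarrow> 'k"
  assumes dual_basis_H: "dual_basis K H I b d"
begin

abbreviation "Hd \<equiv> dual_algebra K H \<Delta> \<epsilon>"

abbreviation "AHd \<equiv> tensor K A Hd"

abbreviation "S \<equiv> smash K H \<Delta> \<epsilon> A \<rho>"

abbreviation "\<delta> \<equiv> dual_comult K H \<Delta> \<epsilon>"

abbreviation "dact \<equiv> dual_act K H A \<rho>"

abbreviation "dd i \<equiv> restrict (d i) (carrier H)"

lemma modHd: "module K Hd"
  by (rule module_dual [OF modH])

lemma dual_basis_Hd: "dual_basis K Hd I dd (\<lambda>i f. f (b i))"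
  by (rule dual_basis_dual [OF modH dual_basis_H])

lemma finite_I: "finite I"
  by (rule dual_basis.finite_I [OF dual_basis_H])

lemma b_closed: "i \<in> I \<Longrightarrow> b i \<in> carrier H"
  by (rule dual_basis.b_closed [OF dual_basis_H])

lemma dd_closed: "i \<in> I \<Longrightarrow> dd i \<in> carrier Hd"
  by (rule restrict_dual [OF modH dual_basis.d_linear [OF dual_basis_H]])

lemma lin_eval: "h \<in> carrier H \<Longrightarrow> (\<lambda>f. f h) \<in> linear_maps K Hd (ground K)"
  by (rule eval_linear [OF modH])

lemma lin_dual: "\<lbrakk>f \<in> carrier Hd; g \<in> linear_maps K X H\<rbrakk> \<Longrightarrow> (\<lambda>x. f (g x)) \<in> linear_maps K X (ground K)"
  by (rule lin_comp [OF dual_linear [OF modH]])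

lemma dual_closedK: "\<lbrakk>f \<in> carrier Hd; h \<in> carrier H\<rbrakk> \<Longrightarrow> f h \<in> carrier K"
  by (rule dual_closed [OF modH])

lemma dual_ext: "\<lbrakk>f \<in> carrier Hd; g \<in> carrier Hd; \<And>h. h \<in> carrier H \<Longrightarrow> f h = g h\<rbrakk> \<Longrightarrow> f = g"
  by (rule dual_eqI [OF modH])

lemmas Hd_simps = dual_simps [OF modH, where \<Delta> = \<Delta> and \<epsilon> = \<epsilon>]

lemmas dual_rules = lin_rules modHd lin_eval lin_dual dual_closedK

lemma one_Hd: "\<one>\<^bsub>Hd\<^esub> = restrict \<epsilon> (carrier H)"
  by (simp add: dual_algebra_def restrict_def)

lemma one_Hd_closed: "\<one>\<^bsub>Hd\<^esub> \<in> carrier Hd"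
  unfolding one_Hd by (rule restrict_dual [OF modH counit_linear])

lemma mult_Hd:
  "h \<in> carrier H \<Longrightarrow> (f \<otimes>\<^bsub>Hd\<^esub> g) h = sweedler K H H (ground K) (\<Delta> h) (\<lambda>p q. f p \<otimes>\<^bsub>K\<^esub> g q)"
  by (simp add: dual_algebra_def sweedler_ring)

lemma mult_Hd_closed:
  assumes f: "f \<in> carrier Hd" and g: "g \<in> carrier Hd"
  shows "f \<otimes>\<^bsub>Hd\<^esub> g \<in> carrier Hd"
proof -
  have "(\<lambda>h. sweedler K H H (ground K) (\<Delta> h) (\<lambda>p q. f p \<otimes>\<^bsub>K\<^esub> g q)) \<in> linear_maps K H (ground K)"
    by (intro dual_rules f g; assumption)
  then have "(\<lambda>h\<in>carrier H. sweedler K H H (ground K) (\<Delta> h) (\<lambda>p q. f p \<otimes>\<^bsub>K\<^esub> g q)) \<in> carrier Hd"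
    by (rule restrict_dual [OF modH])
  then show ?thesis by (simp add: dual_algebra_def sweedler_ring)
qed

lemma Hd_linI:
  assumes X: "module K X" and F: "\<And>x. x \<in> carrier X \<Longrightarrow> F x \<in> carrier Hd"
    and lin: "\<And>h. h \<in> carrier H \<Longrightarrow> (\<lambda>x. F x h) \<in> linear_maps K X (ground K)"
  shows "F \<in> linear_maps K X Hd"
proof (rule linI)
  interpret X: module K X by fact
  interpret Hd: module K Hd by (rule modHd)
  fix x y assume xy: "x \<in> carrier X" "y \<in> carrier X"
  show "F (x \<oplus>\<^bsub>X\<^esub> y) = F x \<oplus>\<^bsub>Hd\<^esub> F y"
    by (rule dual_ext) (use xy F in \<open>simp_all add: Hd_simps(2) lin_add [OF lin] Hd.M.a_closed [unfolded Hd_simps(2)]\<close>)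
next
  interpret X: module K X by fact
  interpret Hd: module K Hd by (rule modHd)
  fix c x assume c: "c \<in> carrier K" "x \<in> carrier X"
  show "F (c \<odot>\<^bsub>X\<^esub> x) = c \<odot>\<^bsub>Hd\<^esub> F x"
    by (rule dual_ext) (use c F in \<open>simp_all add: Hd_simps(4) lin_smult [OF lin] Hd.smult_closed [unfolded Hd_simps(4)]\<close>)
qed (rule F)

lemma mult_Hd_linear_left: "g \<in> carrier Hd \<Longrightarrow> (\<lambda>f. f \<otimes>\<^bsub>Hd\<^esub> g) \<in> linear_maps K Hd Hd"
proof (rule Hd_linI [OF modHd mult_Hd_closed])
  fix h assume g: "g \<in> carrier Hd" and h: "h \<in> carrier H"
  show "(\<lambda>f. (f \<otimes>\<^bsub>Hd\<^esub> g) h) \<in> linear_maps K Hd (ground K)"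
    unfolding mult_Hd [OF h] by (intro dual_rules g h; assumption)
qed

lemma mult_Hd_linear_right: "f \<in> carrier Hd \<Longrightarrow> (\<lambda>g. f \<otimes>\<^bsub>Hd\<^esub> g) \<in> linear_maps K Hd Hd"
proof (rule Hd_linI [OF modHd mult_Hd_closed])
  fix h assume f: "f \<in> carrier Hd" and h: "h \<in> carrier H"
  show "(\<lambda>g. (f \<otimes>\<^bsub>Hd\<^esub> g) h) \<in> linear_maps K Hd (ground K)"
    unfolding mult_Hd [OF h] by (intro dual_rules f h; assumption)
qed

lemma dact_linear_A: "f \<in> carrier Hd \<Longrightarrow> (\<lambda>a. dact f a) \<in> linear_maps K A A"
  unfolding dual_act_def by (intro dual_rules; assumption)

lemma dact_linear_Hd: "a \<in> carrier A \<Longrightarrow> (\<lambda>f. dact f a) \<in> linear_maps K Hd A"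
  unfolding dual_act_def by (intro dual_rules; assumption)

lemma dact_closed: "\<lbrakk>f \<in> carrier Hd; a \<in> carrier A\<rbrakk> \<Longrightarrow> dact f a \<in> carrier A"
  by (rule lin_closed [OF dact_linear_A])

lemma dact_counit: "dact \<epsilon> \<one>\<^bsub>A\<^esub> = e"
  by (simp add: dual_act_def e_def)

text \<open>Injectivity of the canonical map from \<open>H^* \<otimes> H^*\<close> to the dual of
  \<open>H \<otimes> H\<close>: the slices of a tensor at the \<open>b i\<close> are functionals on
  \<open>H\<close>, and functionals are determined by their values.\<close>

lemma Hd2_eqI:
  assumes s: "s \<in> carrier (tensor K Hd Hd)" and t: "t \<in> carrier (tensor K Hd Hd)"
    and eq: "\<And>h g. \<lbrakk>h \<in> carrier H; g \<in> carrier H\<rbrakk> \<Longrightarrow>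
       sweedler K Hd Hd (ground K) s (\<lambda>f1 f2. f1 h \<otimes>\<^bsub>K\<^esub> f2 g)
     = sweedler K Hd Hd (ground K) t (\<lambda>f1 f2. f1 h \<otimes>\<^bsub>K\<^esub> f2 g)"
  shows "s = t"
proof (rule dual_basis.tensor_eqI [OF dual_basis_Hd modHd s t])
  fix i assume i: "i \<in> I"
  have bi: "b i \<in> carrier H" by (rule b_closed [OF i])
  have v: "sweedler K Hd Hd Hd s (\<lambda>m n. n (b i) \<odot>\<^bsub>Hd\<^esub> m) h
      = sweedler K Hd Hd (ground K) s (\<lambda>f1 f2. f1 h \<otimes>\<^bsub>K\<^esub> f2 (b i))"
    if s: "s \<in> carrier (tensor K Hd Hd)" and h: "h \<in> carrier H" for s h
  proof -
    have "sweedler K Hd Hd Hd s (\<lambda>m n. n (b i) \<odot>\<^bsub>Hd\<^esub> m) h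
      = sweedler K Hd Hd (ground K) s (\<lambda>m n. (n (b i) \<odot>\<^bsub>Hd\<^esub> m) h)"
      by (rule lin_sw [OF _ _ _ _ lin_eval [OF h]]) (intro dual_rules s bi; assumption)+
    also have "\<dots> = sweedler K Hd Hd (ground K) s (\<lambda>f1 f2. f1 h \<otimes>\<^bsub>K\<^esub> f2 (b i))"
      by (rule sw_cong) (simp add: Hd_simps(4) h R.m_comm dual_closedK bi)
    finally show ?thesis .
  qed
  have c: "sweedler K Hd Hd Hd s (\<lambda>m n. n (b i) \<odot>\<^bsub>Hd\<^esub> m) \<in> carrier Hd"
    if "s \<in> carrier (tensor K Hd Hd)" for s
    by (rule dual_basis.slice_closed [OF dual_basis_Hd modHd i that])
  show "sweedler K Hd Hd Hd s (\<lambda>m n. n (b i) \<odot>\<^bsub>Hd\<^esub> m) = sweedler K Hd Hd Hd t (\<lambda>m n. n (b i) \<odot>\<^bsub>Hd\<^esub> m)"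
    by (rule dual_ext [OF c [OF s] c [OF t]]) (simp add: v s t eq bi)
qed

text \<open>The witness is the sum of \<open>f(- b\<^sub>i) \<otimes> d\<^sub>i\<close>. Its value
  at \<open>(h, g)\<close> is the sum of \<open>d\<^sub>i(g) f(h b\<^sub>i)\<close>, the dual basis
  expansion of \<open>g \<mapsto> f(h g)\<close>. Uniqueness is \<open>Hd2_eqI\<close>.\<close>

lemma dual_comult_ex1:
  assumes f: "f \<in> carrier Hd"
  shows "\<exists>!t. t \<in> carrier (tensor K Hd Hd) \<and> (\<forall>h\<in>carrier H. \<forall>g\<in>carrier H.
     sweedler K Hd Hd K t (\<lambda>f1 f2. f1 h \<otimes>\<^bsub>K\<^esub> f2 g) = f (h \<otimes>\<^bsub>H\<^esub> g))"
proof -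
  interpret T: module K "tensor K Hd Hd" by (rule module_tensor [OF modHd modHd])
  interpret G: module K "ground K" by (rule modK)
  have P: "module_pair K Hd Hd" using modHd modHd by (rule module_pair.intro)
  have fi: "(\<lambda>h\<in>carrier H. f (h \<otimes>\<^bsub>H\<^esub> b i)) \<in> carrier Hd" if "i \<in> I" for i
    using b_closed [OF that] by (intro restrict_dual modH) (intro dual_rules f; assumption)
  let ?p = "\<lambda>i. tpure K Hd Hd (\<lambda>h\<in>carrier H. f (h \<otimes>\<^bsub>H\<^esub> b i)) (dd i)"
  let ?t = "\<Oplus>\<^bsub>tensor K Hd Hd\<^esub>i\<in>I. ?p i"
  have p: "?p i \<in> carrier (tensor K Hd Hd)" if "i \<in> I" for i
    by (intro tpure_closed modHd fi dd_closed that)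
  have ev: "sweedler K Hd Hd (ground K) ?t (\<lambda>f1 f2. f1 h \<otimes>\<^bsub>K\<^esub> f2 g) = f (h \<otimes>\<^bsub>H\<^esub> g)"
    if h: "h \<in> carrier H" and g: "g \<in> carrier H" for h g
  proof -
    have bil: "(\<lambda>f1 f2. f1 h \<otimes>\<^bsub>K\<^esub> f2 g) \<in> bilinear_maps K Hd Hd (ground K)"
      by (intro dual_rules h g; assumption)
    have lf: "(\<lambda>k. f (h \<otimes>\<^bsub>H\<^esub> k)) \<in> linear_maps K H (ground K)"
      by (intro dual_rules f h; assumption)
    have "sweedler K Hd Hd (ground K) ?t (\<lambda>f1 f2. f1 h \<otimes>\<^bsub>K\<^esub> f2 g)
        = (\<Oplus>\<^bsub>ground K\<^esub>i\<in>I. sweedler K Hd Hd (ground K) (?p i) (\<lambda>f1 f2. f1 h \<otimes>\<^bsub>K\<^esub> f2 g))"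
      by (rule lin_finsum [OF module_pair.sweedler_linear [OF P modK bil] T.M.abelian_group_axioms
            G.M.abelian_group_axioms finite_I p])
    also have "\<dots> = (\<Oplus>\<^bsub>ground K\<^esub>i\<in>I. d i g \<odot>\<^bsub>ground K\<^esub> f (h \<otimes>\<^bsub>H\<^esub> b i))"
    proof (rule G.finsum_cong')
      fix i assume i: "i \<in> I"
      have "sweedler K Hd Hd (ground K) (?p i) (\<lambda>f1 f2. f1 h \<otimes>\<^bsub>K\<^esub> f2 g) = f (h \<otimes>\<^bsub>H\<^esub> b i) \<otimes>\<^bsub>K\<^esub> d i g"
        using module_pair.sweedler_pure [OF P modK bil fi [OF i] dd_closed [OF i]] h g by simp
      then show "sweedler K Hd Hd (ground K) (?p i) (\<lambda>f1 f2. f1 h \<otimes>\<^bsub>K\<^esub> f2 g)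
          = d i g \<odot>\<^bsub>ground K\<^esub> f (h \<otimes>\<^bsub>H\<^esub> b i)"
        using h g f b_closed [OF i] dual_basis.d_closed [OF dual_basis_H i g]
        by (simp add: R.m_comm dual_closedK)
    qed (use h g f b_closed dual_basis.d_closed [OF dual_basis_H _ g] in \<open>auto simp: dual_closedK\<close>)
    also have "\<dots> = f (h \<otimes>\<^bsub>H\<^esub> g)"
      by (rule dual_basis.linear_expand [OF dual_basis_H lf modK g, symmetric])
    finally show ?thesis .
  qed
  show ?thesis
  proof (rule ex1I [of _ ?t])
    show "?t \<in> carrier (tensor K Hd Hd) \<and> (\<forall>h\<in>carrier H. \<forall>g\<in>carrier H.
        sweedler K Hd Hd K ?t (\<lambda>f1 f2. f1 h \<otimes>\<^bsub>K\<^esub> f2 g) = f (h \<otimes>\<^bsub>H\<^esub> g))"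
      using p ev by (auto simp: sweedler_ring intro!: T.finsum_closed)
    fix t assume "t \<in> carrier (tensor K Hd Hd) \<and> (\<forall>h\<in>carrier H. \<forall>g\<in>carrier H.
        sweedler K Hd Hd K t (\<lambda>f1 f2. f1 h \<otimes>\<^bsub>K\<^esub> f2 g) = f (h \<otimes>\<^bsub>H\<^esub> g))"
    then show "t = ?t"
      using p ev by (intro Hd2_eqI) (auto simp: sweedler_ring intro!: T.finsum_closed)
  qed
qed

lemma dual_comult_closed: "f \<in> carrier Hd \<Longrightarrow> \<delta> f \<in> carrier (tensor K Hd Hd)"
  and dual_comult_eval: "\<lbrakk>f \<in> carrier Hd; h \<in> carrier H; g \<in> carrier H\<rbrakk> \<Longrightarrow>
     sweedler K Hd Hd (ground K) (\<delta> f) (\<lambda>f1 f2. f1 h \<otimes>\<^bsub>K\<^esub> f2 g) = f (h \<otimes>\<^bsub>H\<^esub> g)"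
proof -
  assume f: "f \<in> carrier Hd"
  have "\<delta> f \<in> carrier (tensor K Hd Hd) \<and> (\<forall>h\<in>carrier H. \<forall>g\<in>carrier H.
     sweedler K Hd Hd K (\<delta> f) (\<lambda>f1 f2. f1 h \<otimes>\<^bsub>K\<^esub> f2 g) = f (h \<otimes>\<^bsub>H\<^esub> g))"
    unfolding dual_comult_def Let_def by (rule theI' [OF dual_comult_ex1 [OF f]])
  then show "\<delta> f \<in> carrier (tensor K Hd Hd)"
    "\<lbrakk>h \<in> carrier H; g \<in> carrier H\<rbrakk> \<Longrightarrow>
     sweedler K Hd Hd (ground K) (\<delta> f) (\<lambda>f1 f2. f1 h \<otimes>\<^bsub>K\<^esub> f2 g) = f (h \<otimes>\<^bsub>H\<^esub> g)"
    by (simp_all add: sweedler_ring)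
qed

lemma dual_comult_linear: "\<delta> \<in> linear_maps K Hd (tensor K Hd Hd)"
proof -
  interpret T: module K "tensor K Hd Hd" by (rule module_tensor [OF modHd modHd])
  interpret Hd: module K Hd by (rule modHd)
  have P: "module_pair K Hd Hd" using modHd modHd by (rule module_pair.intro)
  have bil: "(\<lambda>f1 f2. f1 h \<otimes>\<^bsub>K\<^esub> f2 g) \<in> bilinear_maps K Hd Hd (ground K)"
    if "h \<in> carrier H" "g \<in> carrier H" for h g
    by (intro dual_rules that; assumption)
  note lin = module_pair.sweedler_linear [OF P modK bil]
  show ?thesis
  proof (rule linI)
    fix f g assume fg: "f \<in> carrier Hd" "g \<in> carrier Hd"
    show "\<delta> (f \<oplus>\<^bsub>Hd\<^esub> g) = \<delta> f \<oplus>\<^bsub>tensor K Hd Hd\<^esub> \<delta> g"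
      by (rule Hd2_eqI)
        (use fg in \<open>simp_all add: dual_comult_closed dual_comult_eval lin_add [OF lin] Hd_simps(2)
           Hd.M.a_closed [unfolded Hd_simps(2)]\<close>)
  next
    fix c f assume cf: "c \<in> carrier K" "f \<in> carrier Hd"
    show "\<delta> (c \<odot>\<^bsub>Hd\<^esub> f) = c \<odot>\<^bsub>tensor K Hd Hd\<^esub> \<delta> f"
      by (rule Hd2_eqI)
        (use cf in \<open>simp_all add: dual_comult_closed dual_comult_eval lin_smult [OF lin] Hd_simps(4)
           Hd.smult_closed [unfolded Hd_simps(4)]\<close>)
  qed (rule dual_comult_closed)
qed

lemma dual_comult_scale:
  assumes f: "f \<in> carrier Hd" and h: "h \<in> carrier H" and g: "g \<in> carrier H" and a: "a \<in> carrier A"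
  shows "sweedler K Hd Hd A (\<delta> f) (\<lambda>f1 f2. (f1 h \<otimes>\<^bsub>K\<^esub> f2 g) \<odot>\<^bsub>A\<^esub> a) = f (h \<otimes>\<^bsub>H\<^esub> g) \<odot>\<^bsub>A\<^esub> a"
proof -
  have "sweedler K Hd Hd (ground K) (\<delta> f) (\<lambda>f1 f2. f1 h \<otimes>\<^bsub>K\<^esub> f2 g) \<odot>\<^bsub>A\<^esub> a
     = sweedler K Hd Hd A (\<delta> f) (\<lambda>f1 f2. (f1 h \<otimes>\<^bsub>K\<^esub> f2 g) \<odot>\<^bsub>A\<^esub> a)"
    by (rule lin_sw [where \<phi> = "\<lambda>c. c \<odot>\<^bsub>A\<^esub> a"]) (intro dual_rules dual_comult_closed f g h a; assumption)+
  then show ?thesis using f g h by (simp add: dual_comult_eval)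
qed

lemmas S_rules = lin_rules modHd lin_comp [OF dual_comult_linear] dual_comult_closed
  lin_comp [OF mult_Hd_linear_left] lin_comp [OF mult_Hd_linear_right] mult_Hd_closed one_Hd_closed
  lin_comp [OF dact_linear_A] lin_comp [OF dact_linear_Hd] dact_closed
  lin_eval lin_dual dual_closedK

lemma S_ops:
  "carrier S = carrier AHd" "add S = add AHd" "\<zero>\<^bsub>S\<^esub> = \<zero>\<^bsub>AHd\<^esub>"
  "s \<otimes>\<^bsub>S\<^esub> t = sweedler K A Hd AHd s (\<lambda>a f. sweedler K A Hd AHd t (\<lambda>c g.
      sweedler K Hd Hd AHd (\<delta> f) (\<lambda>f1 f2. tpure K A Hd (dact f2 c \<otimes>\<^bsub>A\<^esub> a) (f1 \<otimes>\<^bsub>Hd\<^esub> g))))"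
  "\<one>\<^bsub>S\<^esub> = tpure K A Hd e \<one>\<^bsub>Hd\<^esub>"
  "lact S c s = sweedler K A Hd AHd s (\<lambda>a f. tpure K A Hd (a \<otimes>\<^bsub>A\<^esub> c) f)"
  "ract S s c = sweedler K A Hd AHd s (\<lambda>a f.
      sweedler K Hd Hd AHd (\<delta> f) (\<lambda>f1 f2. tpure K A Hd (dact f2 c \<otimes>\<^bsub>A\<^esub> a) f1))"
  "unit_map S c = tpure K A Hd (e \<otimes>\<^bsub>A\<^esub> c) \<one>\<^bsub>Hd\<^esub>"
  by (simp_all add: smash_def Let_def sweedler_tgroup dact_counit)

section \<open>Evaluation of the smash product in \<open>Hom(H, A)\<close>\<close>

definition phi :: "('a, 'h \<Rightarrow> 'k) tens \<Rightarrow> 'h \<Rightarrow> 'a" where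
  "phi s h = sweedler K A Hd A s (\<lambda>a f. f h \<odot>\<^bsub>A\<^esub> a)"

lemma phi_linear_S: "h \<in> carrier H \<Longrightarrow> (\<lambda>s. phi s h) \<in> linear_maps K AHd A"
  unfolding phi_def by (intro S_rules; assumption)

lemma phi_linear: "s \<in> carrier AHd \<Longrightarrow> phi s \<in> linear_maps K H A"
proof -
  assume s: "s \<in> carrier AHd"
  have "(\<lambda>h. phi s h) \<in> linear_maps K H A"
    unfolding phi_def by (intro S_rules s; assumption)
  then show ?thesis by simp
qed

lemma phi_pure: "\<lbrakk>a \<in> carrier A; f \<in> carrier Hd; h \<in> carrier H\<rbrakk> \<Longrightarrow> phi (tpure K A Hd a f) h = f h \<odot>\<^bsub>A\<^esub> a"
  unfolding phi_def by (rule sw_pure) (intro S_rules; assumption)+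

lemma AHd_pair: "module_pair K A Hd"
  using modA modHd by (rule module_pair.intro)

lemmas modAHd = module_tensor [OF modA modHd]

lemma phi_lact:
  assumes c: "c \<in> carrier A" and s: "s \<in> carrier AHd" and h: "h \<in> carrier H"
  shows "phi (lact S c s) h = phi s h \<otimes>\<^bsub>A\<^esub> c"
proof -
  have "phi (lact S c s) h = sweedler K A Hd A s (\<lambda>a f. phi (tpure K A Hd (a \<otimes>\<^bsub>A\<^esub> c) f) h)"
    unfolding S_ops by (rule lin_sw [OF _ _ _ _ phi_linear_S [OF h]]) (intro S_rules s c; assumption)+
  also have "\<dots> = sweedler K A Hd A s (\<lambda>a f. (f h \<odot>\<^bsub>A\<^esub> a) \<otimes>\<^bsub>A\<^esub> c)"
    by (rule sw_cong) (simp add: phi_pure c h dual_closedK A.smult_mult_left)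
  also have "\<dots> = phi s h \<otimes>\<^bsub>A\<^esub> c"
    unfolding phi_def
    by (rule lin_sw [symmetric, where \<phi> = "\<lambda>z. z \<otimes>\<^bsub>A\<^esub> c"]) (intro S_rules s c h; assumption)+
  finally show ?thesis .
qed

text \<open>The twist of the smash product becomes the action \<open>Q\<close>. Since
  \<open>f2\<close> acts on \<open>c\<close> by evaluating the second leg of
  \<open>\<rho>(c)\<close>, the two halves of \<open>\<delta> f\<close> recombine to
  \<open>f\<close> at the product of \<open>h\<close> with that leg. In \<open>Q\<close> the leg
  stands to the right of \<open>h\<close>, which is why the second half of the comultiplication is
  the one that acts.\<close>

lemma dual_comult_act:
  assumes f: "f \<in> carrier Hd" and c: "c \<in> carrier A" and a: "a \<in> carrier A" and h: "h \<in> carrier H"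
  shows "sweedler K Hd Hd A (\<delta> f) (\<lambda>f1 f2. f1 h \<odot>\<^bsub>A\<^esub> (dact f2 c \<otimes>\<^bsub>A\<^esub> a)) = Q (\<lambda>h. f h \<odot>\<^bsub>A\<^esub> a) c h"
proof -
  note r = S_rules f c a h
  have "sweedler K Hd Hd A (\<delta> f) (\<lambda>f1 f2. f1 h \<odot>\<^bsub>A\<^esub> (dact f2 c \<otimes>\<^bsub>A\<^esub> a))
     = sweedler K Hd Hd A (\<delta> f) (\<lambda>f1 f2. sweedler K A H A (\<rho> c) (\<lambda>x y. f1 h \<odot>\<^bsub>A\<^esub> ((f2 y \<odot>\<^bsub>A\<^esub> x) \<otimes>\<^bsub>A\<^esub> a)))"
    unfolding dual_act_def
    by (rule sw_cong, rule lin_sw [where \<phi> = "\<lambda>z. _ \<odot>\<^bsub>A\<^esub> (z \<otimes>\<^bsub>A\<^esub> a)"]) (intro r; assumption)+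
  also have "\<dots> = sweedler K Hd Hd A (\<delta> f) (\<lambda>f1 f2. sweedler K A H A (\<rho> c) (\<lambda>x y. (f1 h \<otimes>\<^bsub>K\<^esub> f2 y) \<odot>\<^bsub>A\<^esub> (x \<otimes>\<^bsub>A\<^esub> a)))"
    by (intro sw_cong) (simp add: dual_closedK a h A.smult_mult_left A.smult_assoc1)
  also have "\<dots> = sweedler K A H A (\<rho> c) (\<lambda>x y. sweedler K Hd Hd A (\<delta> f) (\<lambda>f1 f2. (f1 h \<otimes>\<^bsub>K\<^esub> f2 y) \<odot>\<^bsub>A\<^esub> (x \<otimes>\<^bsub>A\<^esub> a)))"
    by (rule sw_swap) (intro r; assumption)+
  also have "\<dots> = sweedler K A H A (\<rho> c) (\<lambda>x y. f (h \<otimes>\<^bsub>H\<^esub> y) \<odot>\<^bsub>A\<^esub> (x \<otimes>\<^bsub>A\<^esub> a))"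
    by (intro sw_cong dual_comult_scale r)
  also have "\<dots> = Q (\<lambda>h. f h \<odot>\<^bsub>A\<^esub> a) c h"
    unfolding Q_def
    by (rule sw_cong) (simp add: dual_closedK f a h A.smult_mult_right)
  finally show ?thesis .
qed

lemma Q_phi_linear: "\<lbrakk>c \<in> carrier A; h \<in> carrier H\<rbrakk> \<Longrightarrow> (\<lambda>s. Q (phi s) c h) \<in> linear_maps K AHd A"
  unfolding Q_def by (intro S_rules lin_comp [OF phi_linear_S] lin_comp [OF phi_linear] lin_closed [OF phi_linear]; assumption)

lemma phi_ract:
  assumes c: "c \<in> carrier A" and s: "s \<in> carrier AHd" and h: "h \<in> carrier H"
  shows "phi (ract S s c) h = Q (phi s) c h"
proof (rule module_pair.tensor_ext [OF AHd_pair modA _ Q_phi_linear [OF c h] _ s])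
  show "(\<lambda>s. phi (ract S s c) h) \<in> linear_maps K AHd A"
    unfolding S_ops by (intro lin_comp [OF phi_linear_S] S_rules c h; assumption)
  fix a f assume a: "a \<in> carrier A" and f: "f \<in> carrier Hd"
  have "ract S (tpure K A Hd a f) c = sweedler K Hd Hd AHd (\<delta> f) (\<lambda>f1 f2. tpure K A Hd (dact f2 c \<otimes>\<^bsub>A\<^esub> a) f1)"
    unfolding S_ops by (rule sw_pure) (intro S_rules a f c; assumption)+
  then have "phi (ract S (tpure K A Hd a f) c) h
      = phi (sweedler K Hd Hd AHd (\<delta> f) (\<lambda>f1 f2. tpure K A Hd (dact f2 c \<otimes>\<^bsub>A\<^esub> a) f1)) h"
    by simp
  also have "\<dots> = sweedler K Hd Hd A (\<delta> f) (\<lambda>f1 f2. phi (tpure K A Hd (dact f2 c \<otimes>\<^bsub>A\<^esub> a) f1) h)"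
    by (rule lin_sw [OF _ _ _ _ phi_linear_S [OF h]]) (intro S_rules a f c; assumption)+
  also have "\<dots> = sweedler K Hd Hd A (\<delta> f) (\<lambda>f1 f2. f1 h \<odot>\<^bsub>A\<^esub> (dact f2 c \<otimes>\<^bsub>A\<^esub> a))"
    by (rule sw_cong) (simp add: phi_pure dact_closed a c h)
  also have "\<dots> = Q (\<lambda>h. f h \<odot>\<^bsub>A\<^esub> a) c h"
    by (rule dual_comult_act [OF f c a h])
  also have "\<dots> = Q (phi (tpure K A Hd a f)) c h"
    by (rule Q_cong) (simp_all add: phi_pure a f h)
  finally show "phi (ract S (tpure K A Hd a f) c) h = Q (phi (tpure K A Hd a f)) c h" .
qed

lemma S_mult_pure:
  assumes "a \<in> carrier A" "f \<in> carrier Hd" "c \<in> carrier A" "g \<in> carrier Hd"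
  shows "tpure K A Hd a f \<otimes>\<^bsub>S\<^esub> tpure K A Hd c g
     = sweedler K Hd Hd AHd (\<delta> f) (\<lambda>f1 f2. tpure K A Hd (dact f2 c \<otimes>\<^bsub>A\<^esub> a) (f1 \<otimes>\<^bsub>Hd\<^esub> g))"
proof -
  have "tpure K A Hd a f \<otimes>\<^bsub>S\<^esub> tpure K A Hd c g = sweedler K A Hd AHd (tpure K A Hd c g) (\<lambda>c g.
      sweedler K Hd Hd AHd (\<delta> f) (\<lambda>f1 f2. tpure K A Hd (dact f2 c \<otimes>\<^bsub>A\<^esub> a) (f1 \<otimes>\<^bsub>Hd\<^esub> g)))"
    unfolding S_ops by (rule sw_pure) (intro S_rules assms; assumption)+
  also have "\<dots> = sweedler K Hd Hd AHd (\<delta> f) (\<lambda>f1 f2. tpure K A Hd (dact f2 c \<otimes>\<^bsub>A\<^esub> a) (f1 \<otimes>\<^bsub>Hd\<^esub> g))"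
    by (rule sw_pure) (intro S_rules assms; assumption)+
  finally show ?thesis .
qed

text \<open>The convolution of \<open>f1\<close> and \<open>g\<close> splits along
  \<open>\<Delta> h\<close>. For fixed \<open>p\<close> and \<open>q\<close> the sum over
  \<open>\<delta> f\<close> is the one in \<open>dual_comult_act\<close>, and the scalar
  \<open>g q\<close> moves into the second argument of \<open>Q\<close> by linearity, which leaves
  the product \<open>conv\<close>.\<close>

lemma phi_mult_pure:
  assumes a: "a \<in> carrier A" and f: "f \<in> carrier Hd" and c: "c \<in> carrier A" and g: "g \<in> carrier Hd"
    and h: "h \<in> carrier H"
  shows "phi (tpure K A Hd a f \<otimes>\<^bsub>S\<^esub> tpure K A Hd c g) h = conv (phi (tpure K A Hd a f)) (phi (tpure K A Hd c g)) h"
proof -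
  note r = S_rules a f c g h
  have fa: "(\<lambda>h. f h \<odot>\<^bsub>A\<^esub> a) \<in> linear_maps K H A" by (intro r; assumption)
  have "phi (tpure K A Hd a f \<otimes>\<^bsub>S\<^esub> tpure K A Hd c g) h
      = sweedler K Hd Hd A (\<delta> f) (\<lambda>f1 f2. phi (tpure K A Hd (dact f2 c \<otimes>\<^bsub>A\<^esub> a) (f1 \<otimes>\<^bsub>Hd\<^esub> g)) h)"
    unfolding S_mult_pure [OF a f c g]
    by (rule lin_sw [OF _ _ _ _ phi_linear_S [OF h]]) (intro r; assumption)+
  also have "\<dots> = sweedler K Hd Hd A (\<delta> f) (\<lambda>f1 f2.
      sweedler K H H (ground K) (\<Delta> h) (\<lambda>p q. f1 p \<otimes>\<^bsub>K\<^esub> g q) \<odot>\<^bsub>A\<^esub> (dact f2 c \<otimes>\<^bsub>A\<^esub> a))"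
    by (rule sw_cong) (simp add: phi_pure mult_Hd_closed dact_closed a c g h mult_Hd)
  also have "\<dots> = sweedler K Hd Hd A (\<delta> f) (\<lambda>f1 f2.
      sweedler K H H A (\<Delta> h) (\<lambda>p q. (f1 p \<otimes>\<^bsub>K\<^esub> g q) \<odot>\<^bsub>A\<^esub> (dact f2 c \<otimes>\<^bsub>A\<^esub> a)))"
    by (rule sw_cong, rule lin_sw [where \<phi> = "\<lambda>z. z \<odot>\<^bsub>A\<^esub> _"]) (intro r; assumption)+
  also have "\<dots> = sweedler K Hd Hd A (\<delta> f) (\<lambda>f1 f2.
      sweedler K H H A (\<Delta> h) (\<lambda>p q. g q \<odot>\<^bsub>A\<^esub> (f1 p \<odot>\<^bsub>A\<^esub> (dact f2 c \<otimes>\<^bsub>A\<^esub> a))))"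
    by (intro sw_cong) (simp add: dual_closedK dact_closed a c g R.m_comm flip: A.smult_assoc1)
  also have "\<dots> = sweedler K H H A (\<Delta> h) (\<lambda>p q. sweedler K Hd Hd A (\<delta> f) (\<lambda>f1 f2.
      g q \<odot>\<^bsub>A\<^esub> (f1 p \<odot>\<^bsub>A\<^esub> (dact f2 c \<otimes>\<^bsub>A\<^esub> a))))"
    by (rule sw_swap) (intro r; assumption)+
  also have "\<dots> = sweedler K H H A (\<Delta> h) (\<lambda>p q. g q \<odot>\<^bsub>A\<^esub> sweedler K Hd Hd A (\<delta> f) (\<lambda>f1 f2.
      f1 p \<odot>\<^bsub>A\<^esub> (dact f2 c \<otimes>\<^bsub>A\<^esub> a)))"
    by (rule sw_cong, rule lin_sw [symmetric]) (intro r; assumption)+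
  also have "\<dots> = sweedler K H H A (\<Delta> h) (\<lambda>p q. Q (\<lambda>h. f h \<odot>\<^bsub>A\<^esub> a) (g q \<odot>\<^bsub>A\<^esub> c) p)"
    by (intro sw_cong) (simp add: dual_comult_act f c a lin_smult [OF Q_linear_A [OF fa]] dual_closedK g)
  also have "\<dots> = conv (\<lambda>h. f h \<odot>\<^bsub>A\<^esub> a) (\<lambda>h. g h \<odot>\<^bsub>A\<^esub> c) h"
    by (simp add: conv_def)
  also have "\<dots> = conv (phi (tpure K A Hd a f)) (phi (tpure K A Hd c g)) h"
    by (rule conv_cong) (simp_all add: phi_pure a c f g)
  finally show ?thesis .
qed

lemma phi_mult:
  assumes s: "s \<in> carrier AHd" and t: "t \<in> carrier AHd" and h: "h \<in> carrier H"
  shows "phi (s \<otimes>\<^bsub>S\<^esub> t) h = conv (phi s) (phi t) h"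
proof (rule module_pair.tensor_ext [OF AHd_pair modA _ _ _ s])
  show "(\<lambda>s. phi (s \<otimes>\<^bsub>S\<^esub> t) h) \<in> linear_maps K AHd A"
    unfolding S_ops by (intro lin_comp [OF phi_linear_S] S_rules t h; assumption)
  show "(\<lambda>s. conv (phi s) (phi t) h) \<in> linear_maps K AHd A"
    unfolding conv_def
    by (intro lin_sw_body modH modA modAHd lin_closed [OF comult_linear] h bilI
        lin_comp [OF Q_linear_A] Q_linear_H Q_phi_linear lin_closed [OF phi_linear]
        phi_linear t lin_comp [OF Q_linear_H] lin_id; assumption)
  fix a f assume a: "a \<in> carrier A" and f: "f \<in> carrier Hd"
  have af: "tpure K A Hd a f \<in> carrier AHd" by (intro S_rules a f)
  note Qr = Q_linear_A [OF phi_linear [OF af]]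
  show "phi (tpure K A Hd a f \<otimes>\<^bsub>S\<^esub> t) h = conv (phi (tpure K A Hd a f)) (phi t) h"
  proof (rule module_pair.tensor_ext [OF AHd_pair modA _ _ _ t])
    show "(\<lambda>t. phi (tpure K A Hd a f \<otimes>\<^bsub>S\<^esub> t) h) \<in> linear_maps K AHd A"
      unfolding S_ops by (intro lin_comp [OF phi_linear_S] S_rules a f h; assumption)
    show "(\<lambda>t. conv (phi (tpure K A Hd a f)) (phi t) h) \<in> linear_maps K AHd A"
      unfolding conv_def
      by (intro lin_sw_body modH modA modAHd lin_closed [OF comult_linear] h bilI
          lin_comp [OF Qr] Q_linear_H [OF phi_linear [OF af]] lin_closed [OF phi_linear]
          phi_linear phi_linear_S; assumption)
  qed (rule phi_mult_pure [OF a f _ _ h])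
qed

lemma phi_unit: "\<lbrakk>a \<in> carrier A; h \<in> carrier H\<rbrakk> \<Longrightarrow> phi (unit_map S a) h = eta a h"
  by (simp add: S_ops phi_pure e_closed one_Hd_closed) (simp add: one_Hd eta_def)

lemma phi_one: "h \<in> carrier H \<Longrightarrow> phi \<one>\<^bsub>S\<^esub> h = eta \<one>\<^bsub>A\<^esub> h"
  by (simp add: S_ops phi_pure e_closed one_Hd_closed) (simp add: one_Hd eta_def e_closed)

definition Phi where "Phi s = restrict (phi s) (carrier H)"

text \<open>Injective because the values at the \<open>b i\<close> are the slices of the tensor with
  respect to the dual basis of \<open>H^*\<close>. Surjective because \<open>u\<close> is the image
  of the sum of \<open>u(b\<^sub>i) \<otimes> d\<^sub>i\<close>, by the dual basis expansion of
  \<open>u\<close>.\<close>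

lemma Phi_bij: "bij_betw Phi (carrier S) (carrier conv_ring)"
proof (rule bij_betwI')
  fix s t assume st: "s \<in> carrier S" "t \<in> carrier S"
  have "s = t" if "Phi s = Phi t"
  proof (rule dual_basis.tensor_eqI [OF dual_basis_Hd modA])
    fix i assume "i \<in> I"
    then have "b i \<in> carrier H" by (rule b_closed)
    then have "phi s (b i) = phi t (b i)"
      using fun_cong [OF that, of "b i"] by (simp add: Phi_def)
    then show "sweedler K A Hd A s (\<lambda>m n. n (b i) \<odot>\<^bsub>A\<^esub> m) = sweedler K A Hd A t (\<lambda>m n. n (b i) \<odot>\<^bsub>A\<^esub> m)"
      by (simp add: phi_def)
  qed (use st in \<open>simp_all add: S_ops\<close>)
  then show "Phi s = Phi t \<longleftrightarrow> s = t" by auto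
next
  fix s assume "s \<in> carrier S"
  then show "Phi s \<in> carrier conv_ring"
    by (simp add: Phi_def restrict_conv_ring phi_linear S_ops(1))
next
  fix u assume u: "u \<in> carrier conv_ring"
  note l = conv_ring_linear [OF u]
  interpret T: module K AHd by (rule modAHd)
  let ?p = "\<lambda>i. tpure K A Hd (u (b i)) (dd i)"
  let ?s = "\<Oplus>\<^bsub>AHd\<^esub>i\<in>I. ?p i"
  have p: "?p i \<in> carrier AHd" if "i \<in> I" for i
    by (intro tpure_closed modA modHd lin_closed [OF l] b_closed dd_closed that)
  have s: "?s \<in> carrier AHd" using p by (auto intro!: T.finsum_closed)
  have "phi ?s h = u h" if h: "h \<in> carrier H" for h
  proof -
    have "phi ?s h = (\<Oplus>\<^bsub>A\<^esub>i\<in>I. phi (?p i) h)"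
      by (rule lin_finsum [OF phi_linear_S [OF h] T.M.abelian_group_axioms
            module.axioms(2) [OF modA] finite_I p])
    also have "\<dots> = (\<Oplus>\<^bsub>A\<^esub>i\<in>I. d i h \<odot>\<^bsub>A\<^esub> u (b i))"
      using h lin_closed [OF l b_closed] dual_basis.d_closed [OF dual_basis_H]
      by (intro abelian_monoid.finsum_cong' [OF abelian_group.axioms(1) [OF module.axioms(2) [OF modA]]])
        (auto simp: phi_pure dd_closed)
    also have "\<dots> = u h"
      by (rule dual_basis.linear_expand [OF dual_basis_H l modA h, symmetric])
    finally show ?thesis .
  qed
  then have "u = Phi ?s"
    using phi_linear [OF s] by (intro conv_ring_eqI [OF u]) (simp_all add: Phi_def restrict_conv_ring)
  then show "\<exists>s\<in>carrier S. u = Phi s" using s by (auto simp: S_ops(1))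
qed

lemma S_closed:
  "\<lbrakk>s \<in> carrier AHd; t \<in> carrier AHd\<rbrakk> \<Longrightarrow> s \<otimes>\<^bsub>S\<^esub> t \<in> carrier AHd"
  "\<lbrakk>c \<in> carrier A; s \<in> carrier AHd\<rbrakk> \<Longrightarrow> lact S c s \<in> carrier AHd"
  "\<lbrakk>c \<in> carrier A; s \<in> carrier AHd\<rbrakk> \<Longrightarrow> ract S s c \<in> carrier AHd"
  "c \<in> carrier A \<Longrightarrow> unit_map S c \<in> carrier AHd"
  unfolding S_ops by (intro S_rules e_closed; assumption)+

theorem transport_smash:
  "lax_transport (op_ring A) conv_ring S (inv_into (carrier S) Phi)"
proof -
  let ?i = "inv_into (carrier S) Phi"
  interpret T: module K AHd by (rule modAHd)
  have bij: "bij_betw ?i (carrier conv_ring) (carrier S)"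
    by (rule bij_betw_inv_into [OF Phi_bij])
  have i: "?i u \<in> carrier AHd" "Phi (?i u) = u" if "u \<in> carrier conv_ring" for u
    using bij that Phi_bij by (auto simp: bij_betw_def S_ops(1) f_inv_into_f)
  \<comment> \<open>Every transport condition is verified on the other side: to identify the
    preimage of \<open>u\<close> with \<open>s\<close> it suffices to compute
    \<open>Phi s\<close>.\<close>
  have I: "?i u = s" if "s \<in> carrier AHd" "Phi s = u" for u s
    using Phi_bij that by (auto simp: bij_betw_def S_ops(1))
  have v: "phi (?i u) h = u h" if "u \<in> carrier conv_ring" "h \<in> carrier H" for u h
    using fun_cong [OF i(2) [OF that(1)], of h] that by (simp add: Phi_def)
  have Qv: "Q (phi (?i u)) c h = Q u c h" if "u \<in> carrier conv_ring" "h \<in> carrier H" for u c h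
    using that v by (intro Q_cong) auto
  have Cv: "conv (phi (?i u)) (phi (?i w)) h = conv u w h"
    if "u \<in> carrier conv_ring" "w \<in> carrier conv_ring" for u w h
    using that v by (intro conv_cong) auto
  have z: "phi \<zero>\<^bsub>AHd\<^esub> h = \<zero>\<^bsub>A\<^esub>" if "h \<in> carrier H" for h
    by (rule lin_zero [OF phi_linear_S [OF that] T.M.abelian_group_axioms module.axioms(2) [OF modA]])
  show ?thesis
    unfolding lax_transport_def op_ring_simps
  proof (intro conjI ballI bij)
    show "?i \<zero>\<^bsub>conv_ring\<^esub> = \<zero>\<^bsub>S\<^esub>"
      by (rule I) (auto simp: S_ops(3) Phi_def conv_ring_simps z intro!: restrict_ext)
  next
    fix u w assume uw: "u \<in> carrier conv_ring" "w \<in> carrier conv_ring"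
    show "?i (u \<oplus>\<^bsub>conv_ring\<^esub> w) = ?i u \<oplus>\<^bsub>S\<^esub> ?i w"
      by (rule I) (use uw in \<open>auto simp: S_ops(2) Phi_def conv_ring_simps(5) lin_add [OF phi_linear_S] i v
          intro!: restrict_ext\<close>)
    show "?i (u \<otimes>\<^bsub>conv_ring\<^esub> w) = ?i u \<otimes>\<^bsub>S\<^esub> ?i w"
      by (rule I) (use uw in \<open>auto simp: Phi_def conv_ring_simps(2) phi_mult i Cv S_closed
          intro!: restrict_ext\<close>)
  next
    fix c u assume cu: "c \<in> carrier A" "u \<in> carrier conv_ring"
    show "?i (lact conv_ring c u) = lact S c (?i u)"
      by (rule I) (use cu in \<open>auto simp: Phi_def conv_ring_simps(6) phi_lact i v S_closed
          intro!: restrict_ext\<close>)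
    show "?i (ract conv_ring u c) = ract S (?i u) c"
      by (rule I) (use cu in \<open>auto simp: Phi_def conv_ring_simps(7) phi_ract i Qv S_closed
          intro!: restrict_ext\<close>)
  next
    fix c assume "c \<in> carrier A"
    then show "?i (unit_map conv_ring c) = unit_map S c"
      by (intro I) (auto simp: Phi_def conv_ring_simps(8) phi_unit S_closed intro!: restrict_ext)
  qed
qed

lemma Phi_one: "inv_into (carrier S) Phi \<one>\<^bsub>underline (op_ring A) conv_ring\<^esub> = \<one>\<^bsub>underline (op_ring A) S\<^esub>"
proof -
  have c: "\<one>\<^bsub>S\<^esub> \<in> carrier S"
    unfolding S_ops by (intro S_rules e_closed)
  have "Phi \<one>\<^bsub>S\<^esub> = \<one>\<^bsub>conv_ring\<^esub>"
    unfolding Phi_def conv_ring_simps by (rule restrict_ext) (rule phi_one)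
  then have "inv_into (carrier S) Phi \<one>\<^bsub>conv_ring\<^esub> = \<one>\<^bsub>S\<^esub>"
    using Phi_bij c by (metis bij_betw_def inv_into_f_f)
  then show ?thesis by (simp add: underline_def)
qed

end

section \<open>Isomorphisms of module categories\<close>

lemma is_functor_comp:
  assumes "is_functor C D F0 F1" "is_functor D E G0 G1"
  shows "is_functor C E (\<lambda>X. G0 (F0 X)) (\<lambda>X Y f. G1 (F0 X) (F0 Y) (F1 X Y f))"
  using assms unfolding is_functor_def by simp

lemma isomorphic_categories_trans:
  assumes "isomorphic_categories C D" "isomorphic_categories D E"
  shows "isomorphic_categories C E"
proof -
  obtain F0 F1 G0 G1 where 1: "category C" "is_functor C D F0 F1" "is_functor D C G0 G1"
    "\<And>X. X \<in> Obj C \<Longrightarrow> G0 (F0 X) = X"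
    "\<And>X Y f. \<lbrakk>X \<in> Obj C; Y \<in> Obj C; f \<in> Hom C X Y\<rbrakk> \<Longrightarrow> G1 (F0 X) (F0 Y) (F1 X Y f) = f"
    "\<And>X. X \<in> Obj D \<Longrightarrow> F0 (G0 X) = X"
    "\<And>X Y f. \<lbrakk>X \<in> Obj D; Y \<in> Obj D; f \<in> Hom D X Y\<rbrakk> \<Longrightarrow> F1 (G0 X) (G0 Y) (G1 X Y f) = f"
    using assms(1) unfolding isomorphic_categories_def
    by (elim conjE exE) (rule that, (assumption | blast)+)
  obtain F0' F1' G0' G1' where 2: "category E" "is_functor D E F0' F1'" "is_functor E D G0' G1'"
    "\<And>X. X \<in> Obj D \<Longrightarrow> G0' (F0' X) = X"
    "\<And>X Y f. \<lbrakk>X \<in> Obj D; Y \<in> Obj D; f \<in> Hom D X Y\<rbrakk> \<Longrightarrow> G1' (F0' X) (F0' Y) (F1' X Y f) = f"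
    "\<And>X. X \<in> Obj E \<Longrightarrow> F0' (G0' X) = X"
    "\<And>X Y f. \<lbrakk>X \<in> Obj E; Y \<in> Obj E; f \<in> Hom E X Y\<rbrakk> \<Longrightarrow> F1' (G0' X) (G0' Y) (G1' X Y f) = f"
    using assms(2) unfolding isomorphic_categories_def
    by (elim conjE exE) (rule that, (assumption | blast)+)
  have F: "\<And>X. X \<in> Obj C \<Longrightarrow> F0 X \<in> Obj D"
    "\<And>X Y f. \<lbrakk>X \<in> Obj C; Y \<in> Obj C; f \<in> Hom C X Y\<rbrakk> \<Longrightarrow> F1 X Y f \<in> Hom D (F0 X) (F0 Y)"
    using 1(2) by (simp_all add: is_functor_def)
  have G: "\<And>X. X \<in> Obj E \<Longrightarrow> G0' X \<in> Obj D"
    "\<And>X Y f. \<lbrakk>X \<in> Obj E; Y \<in> Obj E; f \<in> Hom E X Y\<rbrakk> \<Longrightarrow> G1' X Y f \<in> Hom D (G0' X) (G0' Y)"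
    using 2(3) by (simp_all add: is_functor_def)
  show ?thesis
    unfolding isomorphic_categories_def
    apply (intro conjI 1(1) 2(1) exI)
         apply (rule is_functor_comp [OF 1(2) 2(2)])
        apply (rule is_functor_comp [OF 2(3) 1(3)])
       apply (simp_all add: 1(4-7) 2(4-7) F G)
    done
qed

lemma left_module_category_simps:
  "Obj (left_module_category R) = {M. left_module R M \<and> pure_additive M \<and>
                (\<forall>r x. r \<notin> carrier R \<or> x \<notin> carrier M \<longrightarrow> act M r x = undefined)}"
  "Hom (left_module_category R) M N = {f \<in> carrier M \<rightarrow>\<^sub>E carrier N.
                (\<forall>x\<in>carrier M. \<forall>y\<in>carrier M. f (x \<oplus>\<^bsub>M\<^esub> y) = f x \<oplus>\<^bsub>N\<^esub> f y) \<and>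
                (\<forall>r\<in>carrier R. \<forall>x\<in>carrier M. f (act M r x) = act N r (f x))}"
  "Ident (left_module_category R) M = (\<lambda>x\<in>carrier M. x)"
  "Comp (left_module_category R) L M N g f = compose (carrier L) g f"
  by (simp_all add: left_module_category_def)

lemma abelian_group_add_closed:
  "\<lbrakk>abelian_group M; x \<in> carrier M; y \<in> carrier M\<rbrakk> \<Longrightarrow> x \<oplus>\<^bsub>M\<^esub> y \<in> carrier M"
  by (rule abelian_monoid.a_closed [OF abelian_group.axioms(1)])

lemma category_left_module: "category (left_module_category R)"
proof (rule category.intro)
  fix X assume "X \<in> Obj (left_module_category R)"
  then show "Ident (left_module_category R) X \<in> Hom (left_module_category R) X X"
    by (auto simp: left_module_category_simps left_module_def abelian_group_add_closed)
next
  fix X Y Z f g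
  assume "X \<in> Obj (left_module_category R)" "Y \<in> Obj (left_module_category R)"
    "Z \<in> Obj (left_module_category R)" "f \<in> Hom (left_module_category R) X Y"
    "g \<in> Hom (left_module_category R) Y Z"
  then show "Comp (left_module_category R) X Y Z g f \<in> Hom (left_module_category R) X Z"
    by (auto simp: left_module_category_simps left_module_def abelian_group_add_closed compose_def PiE_def Pi_iff)
next
  fix X Y f
  assume "X \<in> Obj (left_module_category R)" "Y \<in> Obj (left_module_category R)"
    "f \<in> Hom (left_module_category R) X Y"
  then show "Comp (left_module_category R) X X Y f (Ident (left_module_category R) X) = f"
    by (auto simp: left_module_category_simps compose_def PiE_def extensional_def fun_eq_iff)
next
  fix X Y f
  assume "X \<in> Obj (left_module_category R)" "Y \<in> Obj (left_module_category R)"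
    "f \<in> Hom (left_module_category R) X Y"
  then show "Comp (left_module_category R) X Y Y (Ident (left_module_category R) Y) f = f"
    by (auto simp: left_module_category_simps compose_def PiE_def extensional_def fun_eq_iff Pi_iff)
next
  fix W X Y Z f g h
  assume "f \<in> Hom (left_module_category R) W X" "g \<in> Hom (left_module_category R) X Y"
  then show "Comp (left_module_category R) W Y Z h (Comp (left_module_category R) W X Y g f)
      = Comp (left_module_category R) W X Z (Comp (left_module_category R) X Y Z h g) f"
    by (auto simp: left_module_category_simps compose_def PiE_def Pi_iff fun_eq_iff)
qed

text \<open>The guard leaves the action \<open>undefined\<close> off the carriers, as the objects of
  the module category require; this makes restriction along a bijection and along its inverse cancel
  as an equality of records.\<close>

definition restrict_scalars :: "('s, 'z) ring_scheme \<Rightarrow> ('s \<Rightarrow> 'r) \<Rightarrow> ('r, 'm) lmod \<Rightarrow> ('s, 'm) lmod" where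
  "restrict_scalars S \<chi> M =
     \<lparr>carrier = carrier M, mult = mult M, one = one M, ring.zero = \<zero>\<^bsub>M\<^esub>, add = add M,
      act = (\<lambda>s x. if s \<in> carrier S \<and> x \<in> carrier M then act M (\<chi> s) x else undefined)\<rparr>"

lemma restrict_scalars_simps:
  "carrier (restrict_scalars S \<chi> M) = carrier M" "add (restrict_scalars S \<chi> M) = add M"
  "\<zero>\<^bsub>restrict_scalars S \<chi> M\<^esub> = \<zero>\<^bsub>M\<^esub>" "mult (restrict_scalars S \<chi> M) = mult M"
  "one (restrict_scalars S \<chi> M) = one M"
  "act (restrict_scalars S \<chi> M) s x = (if s \<in> carrier S \<and> x \<in> carrier M then act M (\<chi> s) x else undefined)"
  by (simp_all add: restrict_scalars_def)

lemma abelian_group_cong: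
  assumes "abelian_group M" "carrier N = carrier M" "add N = add M" "\<zero>\<^bsub>N\<^esub> = \<zero>\<^bsub>M\<^esub>"
  shows "abelian_group N"
proof -
  interpret abelian_group M by fact
  show ?thesis by (rule abelian_groupI) (auto simp: assms(2-) a_ac intro: add.l_inv_ex)
qed

lemma restrict_scalars_obj:
  assumes S: "ring S" and \<chi>: "\<chi> \<in> ring_hom S R" and M: "M \<in> Obj (left_module_category R)"
  shows "restrict_scalars S \<chi> M \<in> Obj (left_module_category S)"
proof -
  interpret S: ring S by fact
  have M: "left_module R M" "pure_additive M" using M by (simp_all add: left_module_category_simps)
  have "abelian_group (restrict_scalars S \<chi> M)"
    by (rule abelian_group_cong [of M]) (use M in \<open>simp_all add: left_module_def restrict_scalars_simps\<close>)
  moreover have "\<chi> s \<in> carrier R" if "s \<in> carrier S" for s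
    using ring_hom_closed [OF \<chi> that] .
  ultimately show ?thesis
    using M
    by (simp add: left_module_category_simps left_module_def restrict_scalars_simps pure_additive_def
        ring_hom_mult [OF \<chi>] ring_hom_add [OF \<chi>] ring_hom_one [OF \<chi>] abelian_group_add_closed)
qed

lemma restrict_scalars_functor:
  assumes S: "ring S" and \<chi>: "\<chi> \<in> ring_hom S R"
  shows "is_functor (left_module_category R) (left_module_category S) (restrict_scalars S \<chi>) (\<lambda>_ _ f. f)"
proof -
  have "f \<in> Hom (left_module_category S) (restrict_scalars S \<chi> M) (restrict_scalars S \<chi> N)"
    if "f \<in> Hom (left_module_category R) M N" for M N f
    using that ring_hom_closed [OF \<chi>]
    by (auto simp: left_module_category_simps restrict_scalars_simps PiE_def Pi_iff)
  then show ?thesis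
    unfolding is_functor_def
    by (auto simp: restrict_scalars_obj [OF S \<chi>] left_module_category_simps(3,4) restrict_scalars_simps)
qed

lemma restrict_scalars_inverse:
  assumes M: "M \<in> Obj (left_module_category R)" and "\<And>r. r \<in> carrier R \<Longrightarrow> \<chi>' r \<in> carrier S"
    "\<And>r. r \<in> carrier R \<Longrightarrow> \<chi> (\<chi>' r) = r"
  shows "restrict_scalars R \<chi>' (restrict_scalars S \<chi> M) = M"
proof -
  have "act (restrict_scalars R \<chi>' (restrict_scalars S \<chi> M)) = act M"
    using assms by (auto simp: left_module_category_simps restrict_scalars_simps fun_eq_iff)
  then show ?thesis by (simp add: restrict_scalars_def)
qed

text \<open>The functors are restriction along \<open>\<chi>\<close> and along its inverse. Both
  keep carriers, additions and maps, so only the actions have to be compared.\<close>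

lemma isomorphic_left_module_categories:
  fixes R :: "('r, 'y) ring_scheme" and S :: "('s, 'z) ring_scheme"
  assumes R: "ring R" and S: "ring S" and \<chi>: "\<chi> \<in> ring_hom S R" and bij: "bij_betw \<chi> (carrier S) (carrier R)"
  shows "isomorphic_categories (left_module_category R :: (('r, 'm) lmod, 'm \<Rightarrow> 'm) category)
    (left_module_category S :: (('s, 'm) lmod, 'm \<Rightarrow> 'm) category)"
proof -
  interpret S: ring S by fact
  let ?i = "inv_into (carrier S) \<chi>"
  have i: "?i r \<in> carrier S" "\<chi> (?i r) = r" if "r \<in> carrier R" for r
    using bij that by (auto simp: bij_betw_def f_inv_into_f inv_into_into)
  have i2: "?i (\<chi> s) = s" if "s \<in> carrier S" for s
    using bij that by (simp add: bij_betw_def)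
  have h: "?i \<in> ring_hom R S"
  proof (rule ring_hom_memI)
    fix x y assume xy: "x \<in> carrier R" "y \<in> carrier R"
    show "?i (x \<otimes>\<^bsub>R\<^esub> y) = ?i x \<otimes>\<^bsub>S\<^esub> ?i y"
      using i2 [of "?i x \<otimes>\<^bsub>S\<^esub> ?i y"] xy by (simp add: ring_hom_mult [OF \<chi>] i)
    show "?i (x \<oplus>\<^bsub>R\<^esub> y) = ?i x \<oplus>\<^bsub>S\<^esub> ?i y"
      using i2 [of "?i x \<oplus>\<^bsub>S\<^esub> ?i y"] xy by (simp add: ring_hom_add [OF \<chi>] i)
  next
    show "?i \<one>\<^bsub>R\<^esub> = \<one>\<^bsub>S\<^esub>"
      using i2 [of "\<one>\<^bsub>S\<^esub>"] by (simp add: ring_hom_one [OF \<chi>])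
  qed (rule i)
  note inv1 = restrict_scalars_inverse [where \<chi> = \<chi> and \<chi>' = ?i and S = S and R = R, OF _ i]
    and inv2 = restrict_scalars_inverse [where \<chi> = ?i and \<chi>' = \<chi> and S = R and R = S, OF _ ring_hom_closed [OF \<chi>] i2]
  show ?thesis
    unfolding isomorphic_categories_def
    by (rule conjI, rule category_left_module, rule conjI, rule category_left_module, rule exI, rule exI,
        rule exI, rule exI, rule conjI, rule restrict_scalars_functor [OF S \<chi>], rule conjI,
        rule restrict_scalars_functor [OF R h])
      (simp add: inv1 inv2)
qed


section \<open>Hopf modules as modules over the convolution ring\<close>

context lax_comodule_algebra
begin

abbreviation "E1 \<equiv> underline (op_ring A) conv_ring"

lemma over_ring_E1: "over_ring (op_ring A) E1"
  by (rule E.over_ring_underline [OF conv_ring_one])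

lemma ring_E1: "ring E1"
  using over_ring_E1 by (simp add: over_ring_def)

lemma E1_linear: "u \<in> carrier E1 \<Longrightarrow> u \<in> linear_maps K H A"
  by (simp add: underline_conv_ring conv_ring_linear)

lemma E1_Q: "\<lbrakk>u \<in> carrier E1; h \<in> carrier H\<rbrakk> \<Longrightarrow> Q u \<one>\<^bsub>A\<^esub> h = u h"
  by (simp add: underline_conv_ring)

lemma E1_eqI:
  "\<lbrakk>u \<in> carrier E1; v \<in> carrier E1; \<And>h. h \<in> carrier H \<Longrightarrow> u h = v h\<rbrakk> \<Longrightarrow> u = v"
  by (auto simp: underline_conv_ring intro: conv_ring_eqI)

lemma kmod_simps:
  "carrier (kmod A M) = carrier M" "add (kmod A M) = add M" "\<zero>\<^bsub>kmod A M\<^esub> = \<zero>\<^bsub>M\<^esub>"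
  "c \<odot>\<^bsub>kmod A M\<^esub> x = racton M x (c \<odot>\<^bsub>A\<^esub> \<one>\<^bsub>A\<^esub>)"
  by (simp_all add: kmod_def ring.defs)

context
  fixes M :: "('a, 'h, 'm) hmod"
  assumes M: "right_module A M"
begin

lemma racton_simps:
  "\<lbrakk>x \<in> carrier M; a \<in> carrier A\<rbrakk> \<Longrightarrow> racton M x a \<in> carrier M"
  "\<lbrakk>x \<in> carrier M; y \<in> carrier M; a \<in> carrier A\<rbrakk> \<Longrightarrow>
     racton M (x \<oplus>\<^bsub>M\<^esub> y) a = racton M x a \<oplus>\<^bsub>M\<^esub> racton M y a"
  "\<lbrakk>x \<in> carrier M; a \<in> carrier A; b \<in> carrier A\<rbrakk> \<Longrightarrow>
     racton M x (a \<oplus>\<^bsub>A\<^esub> b) = racton M x a \<oplus>\<^bsub>M\<^esub> racton M x b"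
  "\<lbrakk>x \<in> carrier M; a \<in> carrier A; b \<in> carrier A\<rbrakk> \<Longrightarrow> racton M x (a \<otimes>\<^bsub>A\<^esub> b) = racton M (racton M x a) b"
  "x \<in> carrier M \<Longrightarrow> racton M x \<one>\<^bsub>A\<^esub> = x"
  using M by (simp_all add: right_module_def)

lemma abelian_group_kmod: "abelian_group (kmod A M)"
  by (rule abelian_group_cong [of M]) (use M in \<open>simp_all add: right_module_def kmod_simps\<close>)

text \<open>The elements \<open>c \<odot> \<one>\<close> of \<open>A\<close> are central and
  \<open>K\<close> is commutative, so the right action through them is a module structure over
  \<open>K\<close>.\<close>

lemma modM: "module K (kmod A M)"
proof (rule moduleI [OF cringK abelian_group_kmod])
  fix c d x assume "c \<in> carrier K" "d \<in> carrier K" "x \<in> carrier (kmod A M)"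
  then show "(c \<oplus>\<^bsub>K\<^esub> d) \<odot>\<^bsub>kmod A M\<^esub> x = c \<odot>\<^bsub>kmod A M\<^esub> x \<oplus>\<^bsub>kmod A M\<^esub> d \<odot>\<^bsub>kmod A M\<^esub> x"
    "(c \<otimes>\<^bsub>K\<^esub> d) \<odot>\<^bsub>kmod A M\<^esub> x = c \<odot>\<^bsub>kmod A M\<^esub> (d \<odot>\<^bsub>kmod A M\<^esub> x)"
    by (simp_all add: kmod_simps A.smult_l_distr racton_simps A.smult_assoc1 A.smult_mult_left
        A.smult_mult_right R.m_comm flip: racton_simps(4))
qed (simp_all add: kmod_simps racton_simps)

lemma racton_linear_M: "a \<in> carrier A \<Longrightarrow> (\<lambda>x. racton M x a) \<in> linear_maps K (kmod A M) (kmod A M)"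
  by (rule linI)
    (simp_all add: kmod_simps racton_simps A.smult_mult_left A.smult_mult_right flip: racton_simps(4))

lemma racton_linear_A: "x \<in> carrier M \<Longrightarrow> (\<lambda>a. racton M x a) \<in> linear_maps K A (kmod A M)"
  by (rule linI)
    (simp_all add: kmod_simps racton_simps A.smult_mult_left A.smult_mult_right flip: racton_simps(4))

lemma kmod_carrierD: "x \<in> carrier (kmod A M) \<Longrightarrow> x \<in> carrier M"
  by (simp add: kmod_simps)

lemma lin_racton_M:
  "\<lbrakk>a \<in> carrier A; f \<in> linear_maps K X (kmod A M)\<rbrakk> \<Longrightarrow> (\<lambda>x. racton M (f x) a) \<in> linear_maps K X (kmod A M)"
  by (rule lin_comp [OF racton_linear_M])

lemma lin_racton_A:
  "\<lbrakk>x \<in> carrier (kmod A M); f \<in> linear_maps K X A\<rbrakk> \<Longrightarrow> (\<lambda>a. racton M x (f a)) \<in> linear_maps K X (kmod A M)"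
  by (rule lin_comp [OF racton_linear_A]) (simp_all add: kmod_simps)

lemma racton_closed_kmod: "\<lbrakk>x \<in> carrier (kmod A M); a \<in> carrier A\<rbrakk> \<Longrightarrow> racton M x a \<in> carrier (kmod A M)"
  by (simp add: kmod_simps racton_simps)

lemmas M_rules = lin_rules modM lin_racton_M lin_racton_A racton_closed_kmod

lemma smult_kmod_racton:
  "\<lbrakk>c \<in> carrier K; x \<in> carrier M; a \<in> carrier A\<rbrakk> \<Longrightarrow>
     c \<odot>\<^bsub>kmod A M\<^esub> racton M x a = racton M x (c \<odot>\<^bsub>A\<^esub> a)"
  "\<lbrakk>c \<in> carrier K; x \<in> carrier M; a \<in> carrier A\<rbrakk> \<Longrightarrow>
     racton M (c \<odot>\<^bsub>kmod A M\<^esub> x) a = racton M x (c \<odot>\<^bsub>A\<^esub> a)"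
  by (simp_all add: kmod_simps racton_simps A.smult_mult_left A.smult_mult_right flip: racton_simps(4))

text \<open>The right-hand side of the coassociativity law of \<open>\<M>\<^sub>A\<^sup>H\<close>, seen through a linear map \<open>\<Phi>\<close>.\<close>

lemma push_coassoc_rhs:
  assumes G: "module K G" and t: "t \<in> carrier (tensor K (kmod A M) H)"
    and \<Phi>: "\<Phi> \<in> linear_maps K (tensor K (tensor K (kmod A M) H) H) G"
    and p: "\<And>x k h. \<lbrakk>x \<in> carrier (kmod A M); k \<in> carrier H; h \<in> carrier H\<rbrakk> \<Longrightarrow>
       \<Phi> (tpure K (tensor K (kmod A M) H) H (tpure K (kmod A M) H x k) h) = \<gamma> x k h"
  shows "\<Phi> (sweedler K (kmod A M) H (tensor K (tensor K (kmod A M) H) H) t (\<lambda>x h.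
         sweedler K H H (tensor K (tensor K (kmod A M) H) H) (\<Delta> h) (\<lambda>h1 h2.
         sweedler K AH H (tensor K (tensor K (kmod A M) H) H)
           (sweedler K A H (tensor K AH H) (\<rho> \<one>\<^bsub>A\<^esub>) (\<lambda>u v. tpure K AH H (\<rho> u) v)) (\<lambda>s w.
         sweedler K A H (tensor K (tensor K (kmod A M) H) H) s (\<lambda>u v.
           tpure K (tensor K (kmod A M) H) H (tpure K (kmod A M) H (racton M x u) (h1 \<otimes>\<^bsub>H\<^esub> v)) (h2 \<otimes>\<^bsub>H\<^esub> w))))))
     = sweedler K (kmod A M) H G t (\<lambda>x h. sweedler K H H G (\<Delta> h) (\<lambda>h1 h2.
         sweedler K A H G (\<rho> \<one>\<^bsub>A\<^esub>) (\<lambda>u' w. sweedler K A H G (\<rho> u') (\<lambda>u v.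
           \<gamma> (racton M x u) (h1 \<otimes>\<^bsub>H\<^esub> v) (h2 \<otimes>\<^bsub>H\<^esub> w)))))"
    (is "\<Phi> (sweedler K ?M H ?MHH t (\<lambda>x h. sweedler K H H ?MHH (\<Delta> h) (\<lambda>h1 h2. sweedler K AH H ?MHH ?r (\<lambda>s w.
         sweedler K A H ?MHH s (\<lambda>u v. ?p x h1 h2 w u v))))) = _")
proof -
  note r = M_rules G t
  have "\<Phi> (sweedler K ?M H ?MHH t (\<lambda>x h. sweedler K H H ?MHH (\<Delta> h) (\<lambda>h1 h2. sweedler K AH H ?MHH ?r (\<lambda>s w.
         sweedler K A H ?MHH s (\<lambda>u v. ?p x h1 h2 w u v)))))
    = \<Phi> (sweedler K ?M H ?MHH t (\<lambda>x h. sweedler K H H ?MHH (\<Delta> h) (\<lambda>h1 h2.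
        sweedler K A H ?MHH (\<rho> \<one>\<^bsub>A\<^esub>) (\<lambda>u' w'. sweedler K AH H ?MHH (tpure K AH H (\<rho> u') w')
         (\<lambda>s w. sweedler K A H ?MHH s (\<lambda>u v. ?p x h1 h2 w u v))))))"
    by (rule arg_cong [of _ _ \<Phi>], rule sw_cong, rule sw_cong, rule sw_sw) (intro r; assumption)+
  also have "\<dots> = \<Phi> (sweedler K ?M H ?MHH t (\<lambda>x h. sweedler K H H ?MHH (\<Delta> h) (\<lambda>h1 h2.
        sweedler K A H ?MHH (\<rho> \<one>\<^bsub>A\<^esub>) (\<lambda>u' w. sweedler K A H ?MHH (\<rho> u') (\<lambda>u v. ?p x h1 h2 w u v)))))"
    by (rule arg_cong [of _ _ \<Phi>], rule sw_cong, rule sw_cong, rule sw_cong, rule sw_pure) (intro r; assumption)+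
  also have "\<dots> = sweedler K ?M H G t (\<lambda>x h. \<Phi> (sweedler K H H ?MHH (\<Delta> h) (\<lambda>h1 h2.
        sweedler K A H ?MHH (\<rho> \<one>\<^bsub>A\<^esub>) (\<lambda>u' w. sweedler K A H ?MHH (\<rho> u') (\<lambda>u v. ?p x h1 h2 w u v)))))"
    by (rule lin_sw [OF _ _ _ _ \<Phi>]) (intro r; assumption)+
  also have "\<dots> = sweedler K ?M H G t (\<lambda>x h. sweedler K H H G (\<Delta> h) (\<lambda>h1 h2. \<Phi> (
        sweedler K A H ?MHH (\<rho> \<one>\<^bsub>A\<^esub>) (\<lambda>u' w. sweedler K A H ?MHH (\<rho> u') (\<lambda>u v. ?p x h1 h2 w u v)))))"
    by (rule sw_cong, rule lin_sw [OF _ _ _ _ \<Phi>]) (intro r; assumption)+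
  also have "\<dots> = sweedler K ?M H G t (\<lambda>x h. sweedler K H H G (\<Delta> h) (\<lambda>h1 h2.
        sweedler K A H G (\<rho> \<one>\<^bsub>A\<^esub>) (\<lambda>u' w. \<Phi> (sweedler K A H ?MHH (\<rho> u') (\<lambda>u v. ?p x h1 h2 w u v)))))"
    by (rule sw_cong, rule sw_cong, rule lin_sw [OF _ _ _ _ \<Phi>]) (intro r; assumption)+
  also have "\<dots> = sweedler K ?M H G t (\<lambda>x h. sweedler K H H G (\<Delta> h) (\<lambda>h1 h2.
        sweedler K A H G (\<rho> \<one>\<^bsub>A\<^esub>) (\<lambda>u' w. sweedler K A H G (\<rho> u') (\<lambda>u v. \<Phi> (?p x h1 h2 w u v)))))"
    by (rule sw_cong, rule sw_cong, rule sw_cong, rule lin_sw [OF _ _ _ _ \<Phi>]) (intro r; assumption)+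
  also have "\<dots> = sweedler K ?M H G t (\<lambda>x h. sweedler K H H G (\<Delta> h) (\<lambda>h1 h2.
         sweedler K A H G (\<rho> \<one>\<^bsub>A\<^esub>) (\<lambda>u' w. sweedler K A H G (\<rho> u') (\<lambda>u v.
           \<gamma> (racton M x u) (h1 \<otimes>\<^bsub>H\<^esub> v) (h2 \<otimes>\<^bsub>H\<^esub> w)))))"
    by (intro sw_cong p racton_closed_kmod multH_closed)
  finally show ?thesis .
qed

end

section \<open>The action of functions \<open>H \<rightarrow> A\<close> on a Hopf module\<close>

definition hopf_act :: "('a, 'h, 'm) hmod \<Rightarrow> ('h \<Rightarrow> 'a) \<Rightarrow> 'm \<Rightarrow> 'm" where
  "hopf_act M u x = sweedler K (kmod A M) H (kmod A M) (coact M x) (\<lambda>y h. racton M y (u h))"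

context
  fixes M :: "('a, 'h, 'm) hmod"
  assumes hopf: "lax_hopf_module K H \<Delta> \<epsilon> A \<rho> M"
begin

lemma hopf_right_module: "right_module A M"
  using hopf by (simp add: lax_hopf_module_def Let_def)

lemma coact_linear: "coact M \<in> linear_maps K (kmod A M) (tensor K (kmod A M) H)"
  using hopf by (simp add: lax_hopf_module_def Let_def)

lemma coact_closed: "x \<in> carrier M \<Longrightarrow> coact M x \<in> carrier (tensor K (kmod A M) H)"
  using lin_closed [OF coact_linear] by (simp add: kmod_simps)

lemmas hM_rules = M_rules [OF hopf_right_module] lin_comp [OF coact_linear] lin_closed [OF coact_linear]

lemma coact_counit:
  "x \<in> carrier M \<Longrightarrow>
     sweedler K (kmod A M) H (kmod A M) (coact M x) (\<lambda>y h. \<epsilon> h \<odot>\<^bsub>kmod A M\<^esub> y) = x"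
  using hopf by (simp add: lax_hopf_module_def Let_def)

lemma coact_racton:
  "\<lbrakk>x \<in> carrier M; a \<in> carrier A\<rbrakk> \<Longrightarrow> coact M (racton M x a)
     = sweedler K (kmod A M) H (tensor K (kmod A M) H) (coact M x) (\<lambda>y h.
         sweedler K A H (tensor K (kmod A M) H) (\<rho> a) (\<lambda>a0 a1.
           tpure K (kmod A M) H (racton M y a0) (h \<otimes>\<^bsub>H\<^esub> a1)))"
  using hopf by (simp add: lax_hopf_module_def Let_def)

lemma sw_coact_racton:
  assumes G: "module K G" and \<beta>: "\<beta> \<in> bilinear_maps K (kmod A M) H G"
    and x: "x \<in> carrier (kmod A M)" and a: "a \<in> carrier A"
  shows "sweedler K (kmod A M) H G (coact M (racton M x a)) \<beta>
    = sweedler K (kmod A M) H G (coact M x) (\<lambda>y h. sweedler K A H G (\<rho> a) (\<lambda>a0 a1.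
        \<beta> (racton M y a0) (h \<otimes>\<^bsub>H\<^esub> a1)))"
proof -
  note r = hM_rules G \<beta> x a
  let ?M = "kmod A M"
  have "sweedler K ?M H G (coact M (racton M x a)) \<beta> = sweedler K ?M H G
      (sweedler K ?M H (tensor K ?M H) (coact M x) (\<lambda>y h. sweedler K A H (tensor K ?M H) (\<rho> a)
        (\<lambda>a0 a1. tpure K ?M H (racton M y a0) (h \<otimes>\<^bsub>H\<^esub> a1)))) \<beta>"
    using coact_racton x a by (simp add: kmod_simps)
  also have "\<dots> = sweedler K ?M H G (coact M x) (\<lambda>y h. sweedler K ?M H G
      (sweedler K A H (tensor K ?M H) (\<rho> a) (\<lambda>a0 a1. tpure K ?M H (racton M y a0) (h \<otimes>\<^bsub>H\<^esub> a1))) \<beta>)"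
    by (rule sw_sw) (intro r; assumption)+
  also have "\<dots> = sweedler K ?M H G (coact M x) (\<lambda>y h. sweedler K A H G (\<rho> a)
      (\<lambda>a0 a1. sweedler K ?M H G (tpure K ?M H (racton M y a0) (h \<otimes>\<^bsub>H\<^esub> a1)) \<beta>))"
    by (rule sw_cong, rule sw_sw) (intro r; assumption)+
  also have "\<dots> = sweedler K ?M H G (coact M x) (\<lambda>y h. sweedler K A H G (\<rho> a)
      (\<lambda>a0 a1. \<beta> (racton M y a0) (h \<otimes>\<^bsub>H\<^esub> a1)))"
    by (rule sw_cong, rule sw_cong, rule sw_pure) (intro r; assumption)+
  finally show ?thesis .
qed

text \<open>Compatibility of coaction and action at \<open>a = 1\<close>, combined with
  \<open>x 1 = x\<close>: a coaction absorbs the factor \<open>\<rho>(1)\<close>.\<close>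

lemma sw_coact_one:
  assumes G: "module K G" and \<beta>: "\<beta> \<in> bilinear_maps K (kmod A M) H G"
    and x: "x \<in> carrier (kmod A M)"
  shows "sweedler K (kmod A M) H G (coact M x) (\<lambda>y h. sweedler K A H G (\<rho> \<one>\<^bsub>A\<^esub>) (\<lambda>a0 a1.
        \<beta> (racton M y a0) (h \<otimes>\<^bsub>H\<^esub> a1))) = sweedler K (kmod A M) H G (coact M x) \<beta>"
  using sw_coact_racton [OF G \<beta> x oneA_closed] x
  by (simp add: racton_simps [OF hopf_right_module] kmod_simps)

text \<open>As in \<open>sw_coassoc\<close>, the law is evaluated through a functional on the
  threefold tensor product. Two nested sums over \<open>\<rho>\<close> occur on the right because
  the law involves the iterated coaction of 1.\<close>

lemma sw_hopf_coassoc: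
  assumes G: "module K G" and m: "m \<in> carrier (kmod A M)"
    and xy: "\<And>z. z \<in> carrier H \<Longrightarrow> (\<lambda>x y. \<gamma> x y z) \<in> bilinear_maps K (kmod A M) H G"
    and z: "\<And>x y. \<lbrakk>x \<in> carrier (kmod A M); y \<in> carrier H\<rbrakk> \<Longrightarrow> (\<lambda>z. \<gamma> x y z) \<in> linear_maps K H G"
  shows "sweedler K (kmod A M) H G (coact M m) (\<lambda>x h. sweedler K (kmod A M) H G (coact M x) (\<lambda>y k. \<gamma> y k h))
    = sweedler K (kmod A M) H G (coact M m) (\<lambda>x h. sweedler K H H G (\<Delta> h) (\<lambda>h1 h2.
         sweedler K A H G (\<rho> \<one>\<^bsub>A\<^esub>) (\<lambda>u' w. sweedler K A H G (\<rho> u') (\<lambda>u v.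
           \<gamma> (racton M x u) (h1 \<otimes>\<^bsub>H\<^esub> v) (h2 \<otimes>\<^bsub>H\<^esub> w)))))"
proof -
  let ?M = "kmod A M"
  let ?MHH = "tensor K (tensor K ?M H) H"
  obtain \<Phi> where \<Phi>: "\<Phi> \<in> linear_maps K ?MHH G"
    and s: "\<And>s z. \<lbrakk>s \<in> carrier (tensor K ?M H); z \<in> carrier H\<rbrakk> \<Longrightarrow>
           \<Phi> (tpure K (tensor K ?M H) H s z) = sweedler K ?M H G s (\<lambda>x y. \<gamma> x y z)"
    and p: "\<And>x y z. \<lbrakk>x \<in> carrier ?M; y \<in> carrier H; z \<in> carrier H\<rbrakk> \<Longrightarrow>
           \<Phi> (tpure K (tensor K ?M H) H (tpure K ?M H x y) z) = \<gamma> x y z"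
    by (rule trilinear_functional [OF modM [OF hopf_right_module] modH modH G xy z]) auto
  have c: "coact M m \<in> carrier (tensor K ?M H)" by (rule lin_closed [OF coact_linear m])
  have "sweedler K ?M H G (coact M m) (\<lambda>x h. sweedler K ?M H G (coact M x) (\<lambda>y k. \<gamma> y k h))
      = sweedler K ?M H G (coact M m) (\<lambda>x h. \<Phi> (tpure K (tensor K ?M H) H (coact M x) h))"
    by (rule sw_cong) (simp add: s lin_closed [OF coact_linear])
  also have "\<dots> = \<Phi> (sweedler K ?M H ?MHH (coact M m) (\<lambda>x h. tpure K (tensor K ?M H) H (coact M x) h))"
    by (rule lin_sw [symmetric, OF _ _ _ _ \<Phi>]) (intro hM_rules G m; assumption)+
  also have "\<dots> = \<Phi> (sweedler K (kmod A M) H ?MHH (coact M m) (\<lambda>x h.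
         sweedler K H H ?MHH (\<Delta> h) (\<lambda>h1 h2.
         sweedler K AH H ?MHH
           (sweedler K A H (tensor K AH H) (\<rho> \<one>\<^bsub>A\<^esub>) (\<lambda>u v. tpure K AH H (\<rho> u) v)) (\<lambda>s w.
         sweedler K A H ?MHH s (\<lambda>u v.
           tpure K (tensor K (kmod A M) H) H (tpure K (kmod A M) H (racton M x u) (h1 \<otimes>\<^bsub>H\<^esub> v)) (h2 \<otimes>\<^bsub>H\<^esub> w))))))"
    using hopf m by (simp add: lax_hopf_module_def Let_def kmod_simps(1))
  also have "\<dots> = sweedler K ?M H G (coact M m) (\<lambda>x h. sweedler K H H G (\<Delta> h) (\<lambda>h1 h2.
         sweedler K A H G (\<rho> \<one>\<^bsub>A\<^esub>) (\<lambda>u' w. sweedler K A H G (\<rho> u') (\<lambda>u v.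
           \<gamma> (racton M x u) (h1 \<otimes>\<^bsub>H\<^esub> v) (h2 \<otimes>\<^bsub>H\<^esub> w)))))"
    by (rule push_coassoc_rhs [OF hopf_right_module G c \<Phi> p])
  finally show ?thesis .
qed

text \<open>Let the coaction of \<open>x\<close> absorb \<open>\<rho>(1)\<close> inside the counit
  law. Multiplicativity of \<open>\<epsilon>\<close> contracts the new legs to \<open>e\<close>, so
  the counit law for \<open>x\<close> also yields \<open>x e\<close>.\<close>

lemma racton_e: "x \<in> carrier M \<Longrightarrow> racton M x e = x"
proof -
  assume x: "x \<in> carrier M"
  let ?M = "kmod A M"
  have x': "x \<in> carrier ?M" using x by (simp add: kmod_simps)
  have "x = sweedler K ?M H ?M (coact M x) (\<lambda>y h. \<epsilon> h \<odot>\<^bsub>?M\<^esub> y)"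
    by (rule coact_counit [OF x, symmetric])
  also have "\<dots> = sweedler K ?M H ?M (coact M x) (\<lambda>y h. sweedler K A H ?M (\<rho> \<one>\<^bsub>A\<^esub>) (\<lambda>a0 a1.
        \<epsilon> (h \<otimes>\<^bsub>H\<^esub> a1) \<odot>\<^bsub>?M\<^esub> racton M y a0))"
    by (rule sw_coact_one [symmetric, OF modM [OF hopf_right_module] _ x']) (intro hM_rules; assumption)
  also have "\<dots> = sweedler K ?M H ?M (coact M x) (\<lambda>y h. sweedler K A H ?M (\<rho> \<one>\<^bsub>A\<^esub>) (\<lambda>a0 a1.
        racton M (\<epsilon> h \<odot>\<^bsub>?M\<^esub> y) (\<epsilon> a1 \<odot>\<^bsub>A\<^esub> a0)))"
    by (intro sw_cong)
      (simp add: smult_kmod_racton [OF hopf_right_module] kmod_carrierD [OF hopf_right_module] counit_mult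
        counit_closed A.smult_assoc1)
  also have "\<dots> = sweedler K ?M H ?M (coact M x) (\<lambda>y h. racton M (\<epsilon> h \<odot>\<^bsub>?M\<^esub> y) e)"
    unfolding e_def by (rule sw_cong, rule lin_sw [symmetric]) (intro hM_rules; assumption)+
  also have "\<dots> = racton M (sweedler K ?M H ?M (coact M x) (\<lambda>y h. \<epsilon> h \<odot>\<^bsub>?M\<^esub> y)) e"
    by (rule lin_sw [symmetric, where \<phi> = "\<lambda>z. racton M z e"]) (intro hM_rules e_closed x'; assumption)+
  also have "\<dots> = racton M x e" by (simp add: coact_counit x)
  finally show ?thesis by simp
qed

context
  fixes u assumes u: "u \<in> linear_maps K H A"
begin

lemma hopf_act_linear: "(\<lambda>x. hopf_act M u x) \<in> linear_maps K (kmod A M) (kmod A M)"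
  unfolding hopf_act_def by (intro hM_rules lin_comp [OF u] lin_closed [OF u]; assumption)

lemma hopf_act_closed: "x \<in> carrier M \<Longrightarrow> hopf_act M u x \<in> carrier M"
  using lin_closed [OF hopf_act_linear] by (simp add: kmod_simps)

lemma hopf_act_bilinear: "(\<lambda>y h. racton M y (u h)) \<in> bilinear_maps K (kmod A M) H (kmod A M)"
  by (intro hM_rules lin_comp [OF u] lin_closed [OF u]; assumption)

end

lemma hopf_act_add:
  assumes u: "u \<in> linear_maps K H A" and v: "v \<in> linear_maps K H A" and x: "x \<in> carrier M"
  shows "hopf_act M (\<lambda>h. u h \<oplus>\<^bsub>A\<^esub> v h) x = hopf_act M u x \<oplus>\<^bsub>M\<^esub> hopf_act M v x"
proof -
  let ?M = "kmod A M"
  have "hopf_act M (\<lambda>h. u h \<oplus>\<^bsub>A\<^esub> v h) x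
     = sweedler K ?M H ?M (coact M x) (\<lambda>y h. racton M y (u h) \<oplus>\<^bsub>?M\<^esub> racton M y (v h))"
    unfolding hopf_act_def
    by (rule sw_cong) (simp add: kmod_simps racton_simps [OF hopf_right_module] lin_closed [OF u] lin_closed [OF v])
  also have "\<dots> = hopf_act M u x \<oplus>\<^bsub>?M\<^esub> hopf_act M v x"
    unfolding hopf_act_def
    by (rule sw_add_body [OF modM [OF hopf_right_module] modH modM [OF hopf_right_module] coact_closed [OF x]
          hopf_act_bilinear [OF u] hopf_act_bilinear [OF v]])
  finally show ?thesis by (simp add: kmod_simps)
qed

lemma hopf_act_cong: "(\<And>h. h \<in> carrier H \<Longrightarrow> u h = v h) \<Longrightarrow> hopf_act M u x = hopf_act M v x"
  unfolding hopf_act_def by (rule sw_cong) simp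

text \<open>After coassociativity of the Hopf module two nested coactions of 1 appear. The legs of
  the inner one are taken up by \<open>Q u\<close> through \<open>Q_left\<close>. The outer one
  leaves a sum over \<open>\<rho>(1)\<close> that is \<open>Q v \<one>\<close> at \<open>h2\<close>,
  and this is \<open>v h2\<close> because \<open>v\<close> lies in \<open>E1\<close>.\<close>

lemma hopf_act_conv:
  assumes u: "u \<in> linear_maps K H A" and v: "v \<in> carrier E1" and x: "x \<in> carrier M"
  shows "hopf_act M (conv u v) x = hopf_act M u (hopf_act M v x)"
proof -
  let ?M = "kmod A M"
  note vl = E1_linear [OF v]
  have x': "x \<in> carrier ?M" using x by (simp add: kmod_simps)
  note r = hM_rules u_rules [OF u] lin_comp [OF vl] lin_closed [OF vl] x'
  have "hopf_act M u (hopf_act M v x)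
     = sweedler K ?M H ?M (coact M x) (\<lambda>y h. hopf_act M u (racton M y (v h)))"
    unfolding hopf_act_def [of M v]
    by (rule lin_sw [OF _ _ _ _ hopf_act_linear [OF u]]) (intro r; assumption)+
  also have "\<dots> = sweedler K ?M H ?M (coact M x) (\<lambda>y h. sweedler K ?M H ?M (coact M y) (\<lambda>z k.
      sweedler K A H ?M (\<rho> (v h)) (\<lambda>a0 a1. racton M (racton M z a0) (u (k \<otimes>\<^bsub>H\<^esub> a1)))))"
    unfolding hopf_act_def
    by (rule sw_cong, rule sw_coact_racton) ((intro r)?; assumption)+
  also have "\<dots> = sweedler K ?M H ?M (coact M x) (\<lambda>y h. sweedler K ?M H ?M (coact M y) (\<lambda>z k.
      sweedler K A H ?M (\<rho> (v h)) (\<lambda>a0 a1. racton M z (a0 \<otimes>\<^bsub>A\<^esub> u (k \<otimes>\<^bsub>H\<^esub> a1)))))"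
    by (intro sw_cong) (simp add: racton_simps [OF hopf_right_module] kmod_simps lin_closed [OF u])
  also have "\<dots> = sweedler K ?M H ?M (coact M x) (\<lambda>y h. sweedler K ?M H ?M (coact M y) (\<lambda>z k.
      racton M z (Q u (v h) k)))"
    unfolding Q_def by (rule sw_cong, rule sw_cong, rule lin_sw [symmetric]) (intro r; assumption)+
  also have "\<dots> = sweedler K ?M H ?M (coact M x) (\<lambda>y h. sweedler K H H ?M (\<Delta> h) (\<lambda>h1 h2.
         sweedler K A H ?M (\<rho> \<one>\<^bsub>A\<^esub>) (\<lambda>o0 w. sweedler K A H ?M (\<rho> o0) (\<lambda>p q.
           racton M (racton M y p) (Q u (v (h2 \<otimes>\<^bsub>H\<^esub> w)) (h1 \<otimes>\<^bsub>H\<^esub> q))))))"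
    by (rule sw_hopf_coassoc) (intro r; assumption)+
  also have "\<dots> = sweedler K ?M H ?M (coact M x) (\<lambda>y h. sweedler K H H ?M (\<Delta> h) (\<lambda>h1 h2.
         sweedler K A H ?M (\<rho> \<one>\<^bsub>A\<^esub>) (\<lambda>o0 w. sweedler K A H ?M (\<rho> o0) (\<lambda>p q.
           racton M y (p \<otimes>\<^bsub>A\<^esub> Q u (v (h2 \<otimes>\<^bsub>H\<^esub> w)) (h1 \<otimes>\<^bsub>H\<^esub> q))))))"
    by (intro sw_cong) (simp add: racton_simps [OF hopf_right_module] kmod_simps lin_closed [OF vl] Q_closed [OF u])
  also have "\<dots> = sweedler K ?M H ?M (coact M x) (\<lambda>y h. sweedler K H H ?M (\<Delta> h) (\<lambda>h1 h2.
         sweedler K A H ?M (\<rho> \<one>\<^bsub>A\<^esub>) (\<lambda>o0 w. racton M y (sweedler K A H A (\<rho> o0) (\<lambda>p q.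
           p \<otimes>\<^bsub>A\<^esub> Q u (v (h2 \<otimes>\<^bsub>H\<^esub> w)) (h1 \<otimes>\<^bsub>H\<^esub> q))))))"
    by (rule sw_cong, rule sw_cong, rule sw_cong, rule lin_sw [symmetric]) (intro r; assumption)+
  also have "\<dots> = sweedler K ?M H ?M (coact M x) (\<lambda>y h. sweedler K H H ?M (\<Delta> h) (\<lambda>h1 h2.
         sweedler K A H ?M (\<rho> \<one>\<^bsub>A\<^esub>) (\<lambda>o0 w. racton M y (Q u (o0 \<otimes>\<^bsub>A\<^esub> v (h2 \<otimes>\<^bsub>H\<^esub> w)) h1))))"
    by (intro sw_cong) (simp add: Q_left [OF u] lin_closed [OF vl])
  also have "\<dots> = sweedler K ?M H ?M (coact M x) (\<lambda>y h. sweedler K H H ?M (\<Delta> h) (\<lambda>h1 h2.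
         racton M y (Q u (sweedler K A H A (\<rho> \<one>\<^bsub>A\<^esub>) (\<lambda>o0 w. o0 \<otimes>\<^bsub>A\<^esub> v (h2 \<otimes>\<^bsub>H\<^esub> w))) h1)))"
    by (rule sw_cong, rule sw_cong, rule lin_sw [symmetric, where \<phi> = "\<lambda>z. racton M _ (Q u z _)"])
      (intro r; assumption)+
  also have "\<dots> = sweedler K ?M H ?M (coact M x) (\<lambda>y h. sweedler K H H ?M (\<Delta> h) (\<lambda>h1 h2.
         racton M y (Q u (v h2) h1)))"
    unfolding Q_def [of v \<open>\<one>\<^bsub>A\<^esub>\<close>, symmetric] by (intro sw_cong) (simp add: E1_Q [OF v])
  also have "\<dots> = sweedler K ?M H ?M (coact M x) (\<lambda>y h. racton M y (conv u v h))"
    unfolding conv_def by (rule sw_cong, rule lin_sw [symmetric]) (intro r; assumption)+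
  also have "\<dots> = hopf_act M (conv u v) x" by (simp add: hopf_act_def)
  finally show ?thesis by simp
qed

text \<open>The counit law turns \<open>eta a\<close> into the right action of \<open>e a\<close>,
  and \<open>e\<close> acts as the identity by \<open>racton_e\<close>.\<close>

lemma hopf_act_eta:
  assumes a: "a \<in> carrier A" and x: "x \<in> carrier M"
  shows "hopf_act M (eta a) x = racton M x a"
proof -
  let ?M = "kmod A M"
  have ea: "e \<otimes>\<^bsub>A\<^esub> a \<in> carrier A" using a e_closed by simp
  have x': "x \<in> carrier ?M" using x by (simp add: kmod_simps)
  have "hopf_act M (eta a) x = sweedler K ?M H ?M (coact M x) (\<lambda>y h. racton M (\<epsilon> h \<odot>\<^bsub>?M\<^esub> y) (e \<otimes>\<^bsub>A\<^esub> a))"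
    unfolding hopf_act_def eta_def
    by (rule sw_cong) (simp add: smult_kmod_racton [OF hopf_right_module] kmod_simps(1) ea counit_closed)
  also have "\<dots> = racton M (sweedler K ?M H ?M (coact M x) (\<lambda>y h. \<epsilon> h \<odot>\<^bsub>?M\<^esub> y)) (e \<otimes>\<^bsub>A\<^esub> a)"
    by (rule lin_sw [symmetric, where \<phi> = "\<lambda>z. racton M z (e \<otimes>\<^bsub>A\<^esub> a)"]) (intro hM_rules ea x'; assumption)+
  also have "\<dots> = racton M x a"
    using a x by (simp add: coact_counit racton_simps [OF hopf_right_module] e_closed racton_e)
  finally show ?thesis .
qed

end

end

context lax_comodule_algebra
begin

section \<open>Arithmetic in \<open>E 1\<close> and the projection onto it\<close>

lemma E1_ops_closed:
  "a \<in> carrier A \<Longrightarrow> unit_map conv_ring a \<in> carrier E1"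
  "\<lbrakk>a \<in> carrier A; u \<in> carrier E1\<rbrakk> \<Longrightarrow> lact conv_ring a u \<in> carrier E1"
  "\<lbrakk>a \<in> carrier A; u \<in> carrier E1\<rbrakk> \<Longrightarrow> ract conv_ring u a \<in> carrier E1"
  "\<lbrakk>u \<in> carrier E1; v \<in> carrier E1\<rbrakk> \<Longrightarrow> u \<otimes>\<^bsub>E1\<^esub> v \<in> carrier E1"
  using over_ring_ops_closed [OF over_ring_E1]
  by (simp_all add: lax_ops_closed_def E.underline_ops)

lemma E1_unit_mult:
  "\<lbrakk>a \<in> carrier A; u \<in> carrier E1\<rbrakk> \<Longrightarrow> unit_map conv_ring a \<otimes>\<^bsub>E1\<^esub> u = lact conv_ring a u"
  "\<lbrakk>a \<in> carrier A; u \<in> carrier E1\<rbrakk> \<Longrightarrow> u \<otimes>\<^bsub>E1\<^esub> unit_map conv_ring a = ract conv_ring u a"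
  using over_ring_E1 by (simp_all add: over_ring_def E.underline_ops)

lemma E1_unit_hom: "unit_map conv_ring \<in> ring_hom (op_ring A) E1"
  using over_ring_E1 by (simp add: over_ring_def E.underline_ops)

text \<open>The idempotent projection of \<open>Hom(H, A)\<close> onto \<open>E1\<close>, given by
  the right action of 1 and restricted to the carrier so that its values are elements of the
  record.\<close>

definition bar :: "('h \<Rightarrow> 'a) \<Rightarrow> 'h \<Rightarrow> 'a" where "bar v = (\<lambda>h\<in>carrier H. Q v \<one>\<^bsub>A\<^esub> h)"

lemma bar_E1: "v \<in> linear_maps K H A \<Longrightarrow> bar v \<in> carrier E1"
  using Q_linear_H [of v "\<one>\<^bsub>A\<^esub>"]
  by (simp add: underline_conv_ring bar_def restrict_conv_ring Q_restrict Q_Q)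

lemma bar_id: "u \<in> carrier E1 \<Longrightarrow> bar u = u"
  by (rule E1_eqI) (simp_all add: bar_E1 E1_linear, simp add: bar_def E1_Q)

end

context fgp_lax_comodule_algebra
begin

section \<open>Hopf modules from modules over \<open>E 1\<close>\<close>

abbreviation "dA i \<equiv> \<lambda>h. d i h \<odot>\<^bsub>A\<^esub> \<one>\<^bsub>A\<^esub>"

abbreviation "U i \<equiv> bar (dA i)"

lemmas d_linear = dual_basis.d_linear [OF dual_basis_H]

lemma d_closed: "\<lbrakk>i \<in> I; h \<in> carrier H\<rbrakk> \<Longrightarrow> d i h \<in> carrier K"
  by (rule dual_basis.d_closed [OF dual_basis_H])

lemma dA_linear: "i \<in> I \<Longrightarrow> dA i \<in> linear_maps K H A"
  by (intro lin_rules d_linear)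

lemma U_E1: "i \<in> I \<Longrightarrow> U i \<in> carrier E1"
  by (rule bar_E1 [OF dA_linear])

text \<open>Expand \<open>v\<close> along the dual basis under the sum that defines
  \<open>Q v \<one>\<close>. The coefficients \<open>v (b i)\<close> multiply from the right, which
  is the left action of the opposite ring and commutes with the projection. So the
  \<open>U i\<close> generate \<open>E1\<close> as a left module over the opposite of
  \<open>A\<close>.\<close>

lemma bar_expand:
  assumes v: "v \<in> linear_maps K H A"
  shows "bar v = (\<Oplus>\<^bsub>E1\<^esub>i\<in>I. lact conv_ring (v (b i)) (U i))"
proof -
  interpret E1: ring E1 by (rule ring_E1)
  have vb: "v (b i) \<in> carrier A" if "i \<in> I" for i
    by (rule lin_closed [OF v b_closed [OF that]])
  have t: "lact conv_ring (v (b i)) (U i) \<in> carrier E1" if "i \<in> I" for i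
    by (intro E1_ops_closed vb U_E1 that)
  have ab: "abelian_group A" by (rule module.axioms(2) [OF modA])
  show ?thesis
  proof (rule E1_eqI)
    fix h assume h: "h \<in> carrier H"
    have "(\<Oplus>\<^bsub>E1\<^esub>i\<in>I. lact conv_ring (v (b i)) (U i)) h = (\<Oplus>\<^bsub>A\<^esub>i\<in>I. lact conv_ring (v (b i)) (U i) h)"
      by (rule additive_finsum [OF E1.is_abelian_group ab _ _ finite_I t, where f = "\<lambda>u. u h"])
        (use h in \<open>simp_all add: lin_closed [OF E1_linear], simp add: E.underline_ops conv_ring_simps(5)\<close>)
    also have "\<dots> = (\<Oplus>\<^bsub>A\<^esub>i\<in>I. sweedler K A H A (\<rho> \<one>\<^bsub>A\<^esub>) (\<lambda>x y. x \<otimes>\<^bsub>A\<^esub> (d i (h \<otimes>\<^bsub>H\<^esub> y) \<odot>\<^bsub>A\<^esub> v (b i))))"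
    proof (rule abelian_monoid.finsum_cong' [OF abelian_group.axioms(1) [OF ab]])
      fix i assume i: "i \<in> I"
      have "lact conv_ring (v (b i)) (U i) h = Q (\<lambda>h. dA i h \<otimes>\<^bsub>A\<^esub> v (b i)) \<one>\<^bsub>A\<^esub> h"
        using Q_mult_right [OF dA_linear [OF i] oneA_closed vb [OF i] h] h
        by (simp add: conv_ring_simps(6) bar_def)
      also have "\<dots> = Q (\<lambda>h. d i h \<odot>\<^bsub>A\<^esub> v (b i)) \<one>\<^bsub>A\<^esub> h"
        by (rule Q_cong) (simp_all add: d_closed i vb A.smult_mult_left h)
      finally show "lact conv_ring (v (b i)) (U i) h
        = sweedler K A H A (\<rho> \<one>\<^bsub>A\<^esub>) (\<lambda>x y. x \<otimes>\<^bsub>A\<^esub> (d i (h \<otimes>\<^bsub>H\<^esub> y) \<odot>\<^bsub>A\<^esub> v (b i)))"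
        by (simp add: Q_def)
    next
      show "(\<lambda>i. sweedler K A H A (\<rho> \<one>\<^bsub>A\<^esub>) (\<lambda>x y. x \<otimes>\<^bsub>A\<^esub> (d i (h \<otimes>\<^bsub>H\<^esub> y) \<odot>\<^bsub>A\<^esub> v (b i)))) \<in> I \<rightarrow> carrier A"
      proof
        fix i assume i: "i \<in> I"
        show "sweedler K A H A (\<rho> \<one>\<^bsub>A\<^esub>) (\<lambda>x y. x \<otimes>\<^bsub>A\<^esub> (d i (h \<otimes>\<^bsub>H\<^esub> y) \<odot>\<^bsub>A\<^esub> v (b i))) \<in> carrier A"
          by (intro lin_rules lin_comp [OF d_linear [OF i]] d_closed i h vb; assumption)
      qed
    qed simp
    also have "\<dots> = sweedler K A H A (\<rho> \<one>\<^bsub>A\<^esub>) (\<lambda>x y. \<Oplus>\<^bsub>A\<^esub>i\<in>I. x \<otimes>\<^bsub>A\<^esub> (d i (h \<otimes>\<^bsub>H\<^esub> y) \<odot>\<^bsub>A\<^esub> v (b i)))"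
    proof (rule sw_finsum_body [OF modA modH modA _ finite_I, symmetric])
      fix i assume i: "i \<in> I"
      show "(\<lambda>x y. x \<otimes>\<^bsub>A\<^esub> (d i (h \<otimes>\<^bsub>H\<^esub> y) \<odot>\<^bsub>A\<^esub> v (b i))) \<in> bilinear_maps K A H A"
        by (intro lin_rules lin_comp [OF d_linear [OF i]] d_closed i h vb; assumption)
    qed (intro lin_rules)
    also have "\<dots> = sweedler K A H A (\<rho> \<one>\<^bsub>A\<^esub>) (\<lambda>x y. x \<otimes>\<^bsub>A\<^esub> v (h \<otimes>\<^bsub>H\<^esub> y))"
    proof (rule sw_cong)
      fix x y assume xy: "x \<in> carrier A" "y \<in> carrier H"
      have "(\<Oplus>\<^bsub>A\<^esub>i\<in>I. x \<otimes>\<^bsub>A\<^esub> (d i (h \<otimes>\<^bsub>H\<^esub> y) \<odot>\<^bsub>A\<^esub> v (b i)))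
          = x \<otimes>\<^bsub>A\<^esub> (\<Oplus>\<^bsub>A\<^esub>i\<in>I. d i (h \<otimes>\<^bsub>H\<^esub> y) \<odot>\<^bsub>A\<^esub> v (b i))"
        by (rule additive_finsum [symmetric, OF ab ab _ _ finite_I, where f = "\<lambda>z. x \<otimes>\<^bsub>A\<^esub> z"])
          (use xy h vb d_closed in \<open>simp_all add: A.r_distr\<close>)
      also have "\<dots> = x \<otimes>\<^bsub>A\<^esub> v (h \<otimes>\<^bsub>H\<^esub> y)"
        using dual_basis.linear_expand [OF dual_basis_H v modA, of "h \<otimes>\<^bsub>H\<^esub> y"] xy h by simp
      finally show "(\<Oplus>\<^bsub>A\<^esub>i\<in>I. x \<otimes>\<^bsub>A\<^esub> (d i (h \<otimes>\<^bsub>H\<^esub> y) \<odot>\<^bsub>A\<^esub> v (b i))) = x \<otimes>\<^bsub>A\<^esub> v (h \<otimes>\<^bsub>H\<^esub> y)" .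
    qed
    also have "\<dots> = bar v h"
      using h by (simp add: bar_def Q_def)
    finally show "bar v h = (\<Oplus>\<^bsub>E1\<^esub>i\<in>I. lact conv_ring (v (b i)) (U i)) h" by simp
  qed (use t in \<open>auto intro!: bar_E1 v E1.finsum_closed\<close>)
qed

text \<open>A preliminary stage of \<open>to_hopf\<close>. The coaction is a sum in a tensor product
  over \<open>kmod A\<close> of the very record under construction; \<open>kmod\<close> does not
  read the field \<open>coact\<close>, so it can be formed while that field is still
  undefined.\<close>

definition to_right_module :: "('h \<Rightarrow> 'a, 'm) lmod \<Rightarrow> ('a, 'h, 'm) hmod" where
  "to_right_module L =
     \<lparr>carrier = carrier L, mult = undefined, one = undefined, ring.zero = \<zero>\<^bsub>L\<^esub>, add = add L,
      racton = (\<lambda>x a. if x \<in> carrier L \<and> a \<in> carrier A then act L (unit_map conv_ring a) x else undefined),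
      coact = undefined\<rparr>"

definition to_hopf :: "('h \<Rightarrow> 'a, 'm) lmod \<Rightarrow> ('a, 'h, 'm) hmod" where
  "to_hopf L = (to_right_module L)\<lparr>coact :=
     (\<lambda>x\<in>carrier L. \<Oplus>\<^bsub>tensor K (kmod A (to_right_module L)) H\<^esub>i\<in>I.
        tpure K (kmod A (to_right_module L)) H (act L (U i) x) (b i))\<rparr>"

lemma to_hopf_simps:
  "carrier (to_hopf L) = carrier L" "add (to_hopf L) = add L" "\<zero>\<^bsub>to_hopf L\<^esub> = \<zero>\<^bsub>L\<^esub>"
  "mult (to_hopf L) = undefined" "one (to_hopf L) = undefined"
  "racton (to_hopf L) x a = (if x \<in> carrier L \<and> a \<in> carrier A then act L (unit_map conv_ring a) x else undefined)"
  by (simp_all add: to_hopf_def to_right_module_def)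

lemma coact_to_hopf:
  "coact (to_hopf L) = (\<lambda>x\<in>carrier L. \<Oplus>\<^bsub>tensor K (kmod A (to_hopf L)) H\<^esub>i\<in>I.
      tpure K (kmod A (to_hopf L)) H (act L (U i) x) (b i))"
proof -
  have "kmod A (to_hopf L) = kmod A (to_right_module L)"
    by (simp add: to_hopf_def kmod_def ring.defs)
  then show ?thesis by (simp only:) (simp add: to_hopf_def)
qed

context
  fixes L :: "('h \<Rightarrow> 'a, 'm) lmod"
  assumes L: "left_module E1 L"
begin

abbreviation (input) "M \<equiv> to_hopf L"
abbreviation (input) "N \<equiv> kmod A (to_hopf L)"

lemma act_simps:
  "\<lbrakk>u \<in> carrier E1; x \<in> carrier L\<rbrakk> \<Longrightarrow> act L u x \<in> carrier L"
  "\<lbrakk>u \<in> carrier E1; x \<in> carrier L; y \<in> carrier L\<rbrakk> \<Longrightarrow> act L u (x \<oplus>\<^bsub>L\<^esub> y) = act L u x \<oplus>\<^bsub>L\<^esub> act L u y"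
  "\<lbrakk>u \<in> carrier E1; v \<in> carrier E1; x \<in> carrier L\<rbrakk> \<Longrightarrow> act L (u \<oplus>\<^bsub>E1\<^esub> v) x = act L u x \<oplus>\<^bsub>L\<^esub> act L v x"
  "\<lbrakk>u \<in> carrier E1; v \<in> carrier E1; x \<in> carrier L\<rbrakk> \<Longrightarrow> act L (u \<otimes>\<^bsub>E1\<^esub> v) x = act L u (act L v x)"
  "x \<in> carrier L \<Longrightarrow> act L \<one>\<^bsub>E1\<^esub> x = x"
  using L by (simp_all add: left_module_def)

lemma abelian_L: "abelian_group L"
  using L by (simp add: left_module_def)

text \<open>The unit map is a ring homomorphism from the opposite of \<open>A\<close> into
  \<open>E1\<close>; a left module restricted along it is a left module over the opposite ring, that
  is, a right \<open>A\<close>-module.\<close>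

lemma right_module_to_hopf: "right_module A M"
proof -
  have u: "unit_map conv_ring (a \<otimes>\<^bsub>A\<^esub> c) = unit_map conv_ring c \<otimes>\<^bsub>E1\<^esub> unit_map conv_ring a"
      "unit_map conv_ring (a \<oplus>\<^bsub>A\<^esub> c) = unit_map conv_ring a \<oplus>\<^bsub>E1\<^esub> unit_map conv_ring c"
    if "a \<in> carrier A" "c \<in> carrier A" for a c
    using ring_hom_mult [OF E1_unit_hom, of c a] ring_hom_add [OF E1_unit_hom, of a c] that by simp_all
  have one: "unit_map conv_ring \<one>\<^bsub>A\<^esub> = \<one>\<^bsub>E1\<^esub>"
    using ring_hom_one [OF E1_unit_hom] by simp
  have "abelian_group M"
    by (rule abelian_group_cong [OF abelian_L]) (simp_all add: to_hopf_simps)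
  then show ?thesis
    by (simp add: right_module_def to_hopf_simps E1_ops_closed act_simps u one
        abelian_group_add_closed [OF abelian_L])
qed

lemmas modN = modM [OF right_module_to_hopf]

lemmas N_rules = M_rules [OF right_module_to_hopf]

lemma carrier_N: "carrier N = carrier L"
  by (simp add: kmod_simps to_hopf_simps)

text \<open>Scalars act through the unit map, so the claim is that \<open>u\<close> commutes in
  \<open>E1\<close> with the image of \<open>c \<odot> \<one>\<close>. Both products take the value
  \<open>c \<odot> u h\<close> at \<open>h\<close>, by linearity of \<open>Q\<close> and because
  \<open>Q u \<one> = u\<close>.\<close>

lemma act_linear:
  assumes u: "u \<in> carrier E1"
  shows "(\<lambda>x. act L u x) \<in> linear_maps K N N"
proof (rule linI)
  fix c x assume c: "c \<in> carrier K" and x: "x \<in> carrier N"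
  let ?c = "c \<odot>\<^bsub>A\<^esub> \<one>\<^bsub>A\<^esub>"
  have c': "?c \<in> carrier A" using c by simp
  have "ract conv_ring u ?c = lact conv_ring ?c u"
  proof (rule E1_eqI)
    fix h assume h: "h \<in> carrier H"
    have "Q u ?c h = c \<odot>\<^bsub>A\<^esub> Q u \<one>\<^bsub>A\<^esub> h"
      by (rule lin_smult [OF Q_linear_A [OF E1_linear [OF u] h] c oneA_closed])
    then show "ract conv_ring u ?c h = lact conv_ring ?c u h"
      using h c lin_closed [OF E1_linear [OF u] h]
      by (simp add: conv_ring_simps E1_Q [OF u] A.smult_mult_right)
  qed (intro E1_ops_closed c' u)+
  then have "act L (u \<otimes>\<^bsub>E1\<^esub> unit_map conv_ring ?c) x = act L (unit_map conv_ring ?c \<otimes>\<^bsub>E1\<^esub> u) x"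
    by (simp only: E1_unit_mult c' u)
  then show "act L u (c \<odot>\<^bsub>N\<^esub> x) = c \<odot>\<^bsub>N\<^esub> act L u x"
    using x c' u by (simp add: kmod_simps to_hopf_simps act_simps E1_ops_closed)
qed (use u in \<open>simp_all add: kmod_simps to_hopf_simps act_simps\<close>)

lemma coact_term: "\<lbrakk>i \<in> I; x \<in> carrier L\<rbrakk> \<Longrightarrow> tpure K N H (act L (U i) x) (b i) \<in> carrier (tensor K N H)"
  by (intro tpure_closed modN modH b_closed) (simp_all add: carrier_N act_simps U_E1)

lemma coact_to_hopf_linear: "coact M \<in> linear_maps K N (tensor K N H)"
proof -
  interpret N: module K N by (rule modN)
  interpret T: module K "tensor K N H" by (rule module_tensor [OF modN modH])
  have "(\<lambda>x. \<Oplus>\<^bsub>tensor K N H\<^esub>i\<in>I. tpure K N H (act L (U i) x) (b i)) \<in> linear_maps K N (tensor K N H)"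
    by (intro lin_finsum_fun T.module_axioms N.M.abelian_group_axioms finite_I N.smult_closed
        lin_tpure_left modN modH b_closed act_linear U_E1)
  then show ?thesis
    unfolding coact_to_hopf carrier_N [symmetric] using restrict_linear [OF modN] by blast
qed

lemma coact_to_hopf_closed: "x \<in> carrier L \<Longrightarrow> coact M x \<in> carrier (tensor K N H)"
  using lin_closed [OF coact_to_hopf_linear] by (simp add: carrier_N)

lemma sw_coact_to_hopf:
  assumes G: "module K G" and \<beta>: "\<beta> \<in> bilinear_maps K N H G" and x: "x \<in> carrier L"
  shows "sweedler K N H G (coact M x) \<beta> = (\<Oplus>\<^bsub>G\<^esub>i\<in>I. \<beta> (act L (U i) x) (b i))"
proof -
  interpret G: module K G by fact
  interpret T: module K "tensor K N H" by (rule module_tensor [OF modN modH])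
  have P: "module_pair K N H" using modN modH by (rule module_pair.intro)
  have a: "act L (U i) x \<in> carrier N" if "i \<in> I" for i
    using that x by (simp add: carrier_N act_simps U_E1)
  have "sweedler K N H G (coact M x) \<beta>
      = (\<Oplus>\<^bsub>G\<^esub>i\<in>I. sweedler K N H G (tpure K N H (act L (U i) x) (b i)) \<beta>)"
    using x coact_term
    by (simp add: coact_to_hopf lin_finsum [OF module_pair.sweedler_linear [OF P G \<beta>]
          T.M.abelian_group_axioms G.M.abelian_group_axioms finite_I])
  also have "\<dots> = (\<Oplus>\<^bsub>G\<^esub>i\<in>I. \<beta> (act L (U i) x) (b i))"
    by (rule G.finsum_cong')
      (use a b_closed in \<open>auto simp: module_pair.sweedler_pure [OF P G \<beta>] bil_closed [OF \<beta>]\<close>)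
  finally show ?thesis .
qed

text \<open>The sum of \<open>(U\<^sub>i x) v(b\<^sub>i)\<close> is the action of the sum of the
  elements \<open>v(b\<^sub>i) U\<^sub>i\<close> of \<open>E1\<close>, which is \<open>bar v\<close>
  by \<open>bar_expand\<close>. Through this formula each law of the coaction becomes an identity
  between elements of \<open>E1\<close>.\<close>

lemma slice_act:
  assumes v: "v \<in> linear_maps K H A" and x: "x \<in> carrier L"
  shows "sweedler K N H N (coact M x) (\<lambda>y h. racton M y (v h)) = act L (bar v) x"
proof -
  interpret N: module K N by (rule modN)
  interpret E1: ring E1 by (rule ring_E1)
  have vb: "v (b i) \<in> carrier A" if "i \<in> I" for i
    by (rule lin_closed [OF v b_closed [OF that]])
  have t: "lact conv_ring (v (b i)) (U i) \<in> carrier E1" if "i \<in> I" for i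
    by (intro E1_ops_closed vb U_E1 that)
  have bil: "(\<lambda>y h. racton M y (v h)) \<in> bilinear_maps K N H N"
    by (intro N_rules lin_comp [OF v] lin_closed [OF v]; assumption)
  have "sweedler K N H N (coact M x) (\<lambda>y h. racton M y (v h)) = (\<Oplus>\<^bsub>N\<^esub>i\<in>I. racton M (act L (U i) x) (v (b i)))"
    by (rule sw_coact_to_hopf [OF modN bil x])
  also have "\<dots> = (\<Oplus>\<^bsub>N\<^esub>i\<in>I. act L (lact conv_ring (v (b i)) (U i)) x)"
  proof (rule N.finsum_cong')
    fix i assume i: "i \<in> I"
    have "act L (lact conv_ring (v (b i)) (U i)) x = act L (unit_map conv_ring (v (b i)) \<otimes>\<^bsub>E1\<^esub> U i) x"
      by (simp add: E1_unit_mult vb U_E1 i)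
    then show "racton M (act L (U i) x) (v (b i)) = act L (lact conv_ring (v (b i)) (U i)) x"
      using i x by (simp add: to_hopf_simps act_simps U_E1 vb E1_ops_closed)
  qed (use t x in \<open>auto simp: carrier_N act_simps\<close>)
  also have "\<dots> = act L (\<Oplus>\<^bsub>E1\<^esub>i\<in>I. lact conv_ring (v (b i)) (U i)) x"
    by (rule additive_finsum [symmetric, OF E1.is_abelian_group N.M.abelian_group_axioms _ _ finite_I t,
          where f = "\<lambda>u. act L u x"])
      (use x in \<open>simp_all add: carrier_N act_simps kmod_simps to_hopf_simps\<close>)
  also have "\<dots> = act L (bar v) x" by (simp add: bar_expand [OF v])
  finally show ?thesis .
qed

lemma slice_d:
  assumes i: "i \<in> I" and x: "x \<in> carrier L"
  shows "sweedler K N H N (coact M x) (\<lambda>y h. d i h \<odot>\<^bsub>N\<^esub> y) = act L (U i) x"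
  using slice_act [OF dA_linear [OF i] x] by (simp add: kmod_simps)

text \<open>By \<open>slice_act\<close> it suffices that the projection of
  \<open>h \<mapsto> \<epsilon>(h) 1\<close> is the unit of \<open>E1\<close>; multiplicativity of
  \<open>\<epsilon>\<close> gives the value \<open>\<epsilon>(h) e\<close>, which is
  \<open>eta \<one> h\<close>.\<close>

lemma to_hopf_counit:
  assumes x: "x \<in> carrier L"
  shows "sweedler K N H N (coact M x) (\<lambda>y h. \<epsilon> h \<odot>\<^bsub>N\<^esub> y) = x"
proof -
  have l: "(\<lambda>h. \<epsilon> h \<odot>\<^bsub>A\<^esub> \<one>\<^bsub>A\<^esub>) \<in> linear_maps K H A" by (intro lin_rules)
  have "bar (\<lambda>h. \<epsilon> h \<odot>\<^bsub>A\<^esub> \<one>\<^bsub>A\<^esub>) = \<one>\<^bsub>E1\<^esub>"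
  proof (rule E1_eqI)
    show "\<one>\<^bsub>E1\<^esub> \<in> carrier E1" using ring_E1 by (simp add: ring.ring_simprules)
    fix h assume h: "h \<in> carrier H"
    have "Q (\<lambda>h. \<epsilon> h \<odot>\<^bsub>A\<^esub> \<one>\<^bsub>A\<^esub>) \<one>\<^bsub>A\<^esub> h = sweedler K A H A (\<rho> \<one>\<^bsub>A\<^esub>) (\<lambda>x y. \<epsilon> h \<odot>\<^bsub>A\<^esub> (\<epsilon> y \<odot>\<^bsub>A\<^esub> x))"
      unfolding Q_def
      by (rule sw_cong) (simp add: h counit_mult counit_closed A.smult_mult_right A.smult_assoc1)
    also have "\<dots> = \<epsilon> h \<odot>\<^bsub>A\<^esub> e"
      unfolding e_def by (rule lin_sw [symmetric]) (intro lin_rules h; assumption)+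
    finally show "bar (\<lambda>h. \<epsilon> h \<odot>\<^bsub>A\<^esub> \<one>\<^bsub>A\<^esub>) h = \<one>\<^bsub>E1\<^esub> h"
      using h by (simp add: bar_def E.underline_ops conv_ring_simps eta_def e_closed)
  qed (rule bar_E1 [OF l])
  then show ?thesis
    using slice_act [OF l x] x by (simp add: kmod_simps act_simps)
qed

text \<open>Both sides are compared slice by slice. The slice of the right-hand side by
  \<open>d i\<close> is the action of the projection of \<open>Q (dA i) a\<close>, which is the
  element \<open>U i\<close> acted on by \<open>a\<close> from the right; this is the action of
  \<open>U i\<close> after that of \<open>a\<close>, the slice of the left-hand side.\<close>

lemma to_hopf_racton:
  assumes x: "x \<in> carrier L" and a: "a \<in> carrier A"
  shows "coact M (racton M x a) = sweedler K N H (tensor K N H) (coact M x) (\<lambda>y h.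
      sweedler K A H (tensor K N H) (\<rho> a) (\<lambda>a0 a1. tpure K N H (racton M y a0) (h \<otimes>\<^bsub>H\<^esub> a1)))"
proof (rule dual_basis.tensor_eqI [OF dual_basis_H modN])
  note r = N_rules coact_to_hopf_closed [OF x] a
  have xa: "racton M x a \<in> carrier L"
    using x a by (simp add: to_hopf_simps act_simps E1_ops_closed)
  then show "coact M (racton M x a) \<in> carrier (tensor K N H)" by (rule coact_to_hopf_closed)
  show "sweedler K N H (tensor K N H) (coact M x) (\<lambda>y h. sweedler K A H (tensor K N H) (\<rho> a)
      (\<lambda>a0 a1. tpure K N H (racton M y a0) (h \<otimes>\<^bsub>H\<^esub> a1))) \<in> carrier (tensor K N H)"
    by (intro r; assumption)
  fix i assume i: "i \<in> I"
  note ri = r lin_comp [OF d_linear [OF i]] d_closed [OF i] lin_comp [OF dA_linear [OF i]] lin_closed [OF dA_linear [OF i]]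
  note dl = dA_linear [OF i]
  have dQ: "Q (dA i) a \<in> linear_maps K H A" using Q_linear_H [OF dl a] by simp
  have "sweedler K N H N (sweedler K N H (tensor K N H) (coact M x) (\<lambda>y h. sweedler K A H (tensor K N H) (\<rho> a)
      (\<lambda>a0 a1. tpure K N H (racton M y a0) (h \<otimes>\<^bsub>H\<^esub> a1)))) (\<lambda>m n. d i n \<odot>\<^bsub>N\<^esub> m)
    = sweedler K N H N (coact M x) (\<lambda>y h. sweedler K N H N (sweedler K A H (tensor K N H) (\<rho> a)
      (\<lambda>a0 a1. tpure K N H (racton M y a0) (h \<otimes>\<^bsub>H\<^esub> a1))) (\<lambda>m n. d i n \<odot>\<^bsub>N\<^esub> m))"
    by (rule sw_sw) (intro ri; assumption)+
  also have "\<dots> = sweedler K N H N (coact M x) (\<lambda>y h. sweedler K A H N (\<rho> a)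
      (\<lambda>a0 a1. sweedler K N H N (tpure K N H (racton M y a0) (h \<otimes>\<^bsub>H\<^esub> a1)) (\<lambda>m n. d i n \<odot>\<^bsub>N\<^esub> m)))"
    by (rule sw_cong, rule sw_sw) (intro ri; assumption)+
  also have "\<dots> = sweedler K N H N (coact M x) (\<lambda>y h. sweedler K A H N (\<rho> a)
      (\<lambda>a0 a1. d i (h \<otimes>\<^bsub>H\<^esub> a1) \<odot>\<^bsub>N\<^esub> racton M y a0))"
    by (rule sw_cong, rule sw_cong, rule sw_pure) (intro ri; assumption)+
  also have "\<dots> = sweedler K N H N (coact M x) (\<lambda>y h. sweedler K A H N (\<rho> a)
      (\<lambda>a0 a1. racton M y (a0 \<otimes>\<^bsub>A\<^esub> dA i (h \<otimes>\<^bsub>H\<^esub> a1))))"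
    by (intro sw_cong)
      (simp add: smult_kmod_racton [OF right_module_to_hopf] kmod_carrierD [OF right_module_to_hopf]
        d_closed i A.smult_mult_right)
  also have "\<dots> = sweedler K N H N (coact M x) (\<lambda>y h. racton M y (Q (dA i) a h))"
    unfolding Q_def by (rule sw_cong, rule lin_sw [symmetric]) (intro ri; assumption)+
  also have "\<dots> = act L (bar (Q (dA i) a)) x"
    by (rule slice_act [OF dQ x])
  also have "bar (Q (dA i) a) = ract conv_ring (U i) a"
    unfolding bar_def conv_ring_simps
    by (rule restrict_ext) (simp add: Q_restrict Q_Q [OF dl] a)
  also have "act L (ract conv_ring (U i) a) x = act L (U i) (racton M x a)"
    using x a by (simp add: to_hopf_simps act_simps U_E1 i E1_ops_closed flip: E1_unit_mult)
  also have "\<dots> = sweedler K N H N (coact M (racton M x a)) (\<lambda>m n. d i n \<odot>\<^bsub>N\<^esub> m)"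
    by (rule slice_d [OF i xa, symmetric])
  finally show "sweedler K N H N (coact M (racton M x a)) (\<lambda>m n. d i n \<odot>\<^bsub>N\<^esub> m)
    = sweedler K N H N (sweedler K N H (tensor K N H) (coact M x) (\<lambda>y h. sweedler K A H (tensor K N H) (\<rho> a)
      (\<lambda>a0 a1. tpure K N H (racton M y a0) (h \<otimes>\<^bsub>H\<^esub> a1)))) (\<lambda>m n. d i n \<odot>\<^bsub>N\<^esub> m)" by simp
qed

text \<open>\<open>\<Psi>\<close> slices the last leg by \<open>d j\<close> and the middle leg by
  \<open>d i\<close>. These functionals separate elements of the threefold tensor product by
  \<open>double_slice_eqI\<close>, and the value on pure tensors is what
  \<open>push_coassoc_rhs\<close> asks for.\<close>

lemma coassoc_functional:
  assumes i: "i \<in> I" and j: "j \<in> I"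
  defines "\<Psi> \<equiv> \<lambda>T. sweedler K (tensor K N H) H N T (\<lambda>z h. d j h \<odot>\<^bsub>N\<^esub> sweedler K N H N z (\<lambda>m k. d i k \<odot>\<^bsub>N\<^esub> m))"
  shows "\<Psi> \<in> linear_maps K (tensor K (tensor K N H) H) N"
    and "\<lbrakk>z \<in> carrier (tensor K N H); h \<in> carrier H\<rbrakk> \<Longrightarrow>
      \<Psi> (tpure K (tensor K N H) H z h) = d j h \<odot>\<^bsub>N\<^esub> sweedler K N H N z (\<lambda>m k. d i k \<odot>\<^bsub>N\<^esub> m)"
    and "\<lbrakk>x \<in> carrier N; k \<in> carrier H; h \<in> carrier H\<rbrakk> \<Longrightarrow>
      \<Psi> (tpure K (tensor K N H) H (tpure K N H x k) h) = d j h \<odot>\<^bsub>N\<^esub> (d i k \<odot>\<^bsub>N\<^esub> x)"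
proof -
  note r = N_rules lin_comp [OF d_linear [OF i]] d_closed [OF i] d_linear [OF i]
    lin_comp [OF d_linear [OF j]] d_closed [OF j] d_linear [OF j]
  show "\<Psi> \<in> linear_maps K (tensor K (tensor K N H) H) N"
    unfolding \<Psi>_def by (intro r; assumption)
  have p: "\<Psi> (tpure K (tensor K N H) H z h) = d j h \<odot>\<^bsub>N\<^esub> sweedler K N H N z (\<lambda>m k. d i k \<odot>\<^bsub>N\<^esub> m)"
    if "z \<in> carrier (tensor K N H)" "h \<in> carrier H" for z h
    unfolding \<Psi>_def by (rule sw_pure) (intro r that; assumption)+
  then show "\<lbrakk>z \<in> carrier (tensor K N H); h \<in> carrier H\<rbrakk> \<Longrightarrow>
      \<Psi> (tpure K (tensor K N H) H z h) = d j h \<odot>\<^bsub>N\<^esub> sweedler K N H N z (\<lambda>m k. d i k \<odot>\<^bsub>N\<^esub> m)" .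
  assume x: "x \<in> carrier N" and k: "k \<in> carrier H" and h: "h \<in> carrier H"
  have "sweedler K N H N (tpure K N H x k) (\<lambda>m k. d i k \<odot>\<^bsub>N\<^esub> m) = d i k \<odot>\<^bsub>N\<^esub> x"
    by (rule sw_pure) (intro r x k; assumption)+
  then show "\<Psi> (tpure K (tensor K N H) H (tpure K N H x k) h) = d j h \<odot>\<^bsub>N\<^esub> (d i k \<odot>\<^bsub>N\<^esub> x)"
    using p [of "tpure K N H x k" h] x k h by (simp add: tpure_closed modN modH)
qed

text \<open>\<open>tensor_eqI\<close> twice, for the last leg and then for the middle one, after the
  inner slice has been moved under the outer sum.\<close>

lemma double_slice_eqI:
  assumes s: "s \<in> carrier (tensor K (tensor K N H) H)" and t: "t \<in> carrier (tensor K (tensor K N H) H)"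
    and eq: "\<And>i j. \<lbrakk>i \<in> I; j \<in> I\<rbrakk> \<Longrightarrow>
       sweedler K (tensor K N H) H N s (\<lambda>z h. d j h \<odot>\<^bsub>N\<^esub> sweedler K N H N z (\<lambda>m k. d i k \<odot>\<^bsub>N\<^esub> m))
     = sweedler K (tensor K N H) H N t (\<lambda>z h. d j h \<odot>\<^bsub>N\<^esub> sweedler K N H N z (\<lambda>m k. d i k \<odot>\<^bsub>N\<^esub> m))"
  shows "s = t"
proof (rule dual_basis.tensor_eqI [OF dual_basis_H module_tensor [OF modN modH] s t])
  fix j assume j: "j \<in> I"
  note c = dual_basis.slice_closed [OF dual_basis_H module_tensor [OF modN modH] j]
  have v: "sweedler K N H N (sweedler K (tensor K N H) H (tensor K N H) s (\<lambda>z h. d j h \<odot>\<^bsub>tensor K N H\<^esub> z))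
      (\<lambda>m k. d i k \<odot>\<^bsub>N\<^esub> m)
     = sweedler K (tensor K N H) H N s (\<lambda>z h. d j h \<odot>\<^bsub>N\<^esub> sweedler K N H N z (\<lambda>m k. d i k \<odot>\<^bsub>N\<^esub> m))"
    if s: "s \<in> carrier (tensor K (tensor K N H) H)" and i: "i \<in> I" for s i
  proof -
    note r = N_rules lin_comp [OF d_linear [OF i]] d_closed [OF i] d_linear [OF i]
      lin_comp [OF d_linear [OF j]] d_closed [OF j] d_linear [OF j] s
    have l: "(\<lambda>z. sweedler K N H N z (\<lambda>m k. d i k \<odot>\<^bsub>N\<^esub> m)) \<in> linear_maps K (tensor K N H) N"
      by (intro r; assumption)
    have "sweedler K N H N (sweedler K (tensor K N H) H (tensor K N H) s (\<lambda>z h. d j h \<odot>\<^bsub>tensor K N H\<^esub> z))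
      (\<lambda>m k. d i k \<odot>\<^bsub>N\<^esub> m)
      = sweedler K (tensor K N H) H N s (\<lambda>z h. sweedler K N H N (d j h \<odot>\<^bsub>tensor K N H\<^esub> z) (\<lambda>m k. d i k \<odot>\<^bsub>N\<^esub> m))"
      by (rule sw_sw) (intro r; assumption)+
    also have "\<dots> = sweedler K (tensor K N H) H N s (\<lambda>z h. d j h \<odot>\<^bsub>N\<^esub> sweedler K N H N z (\<lambda>m k. d i k \<odot>\<^bsub>N\<^esub> m))"
      by (rule sw_cong) (simp add: lin_smult [OF l] d_closed j)
    finally show ?thesis .
  qed
  show "sweedler K (tensor K N H) H (tensor K N H) s (\<lambda>m n. d j n \<odot>\<^bsub>tensor K N H\<^esub> m)
      = sweedler K (tensor K N H) H (tensor K N H) t (\<lambda>m n. d j n \<odot>\<^bsub>tensor K N H\<^esub> m)"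
    by (rule dual_basis.tensor_eqI [OF dual_basis_H modN c [OF s] c [OF t]]) (simp add: v s t eq j)
qed

text \<open>Both factors are actions of 1. The one on \<open>U i\<close> is absorbed by
  \<open>Q_Q\<close>, and the one on \<open>U j\<close> contributes \<open>\<rho>(1)\<close>, whose
  first leg then coacts inside \<open>Q (dA i)\<close>. The outcome has the two nested coactions of
  1 that occur in the coassociativity law of a Hopf module.\<close>

lemma conv_U_U:
  assumes i: "i \<in> I" and j: "j \<in> I" and h: "h \<in> carrier H"
  shows "conv (U i) (U j) h = sweedler K H H A (\<Delta> h) (\<lambda>h1 h2.
         sweedler K A H A (\<rho> \<one>\<^bsub>A\<^esub>) (\<lambda>u' w. sweedler K A H A (\<rho> u') (\<lambda>u v.
           d j (h2 \<otimes>\<^bsub>H\<^esub> w) \<odot>\<^bsub>A\<^esub> (d i (h1 \<otimes>\<^bsub>H\<^esub> v) \<odot>\<^bsub>A\<^esub> u))))"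
proof -
  note di = dA_linear [OF i] and dj = dA_linear [OF j]
  note r = lin_rules lin_comp [OF d_linear [OF i]] d_closed [OF i]
    lin_comp [OF d_linear [OF j]] d_closed [OF j]
    lin_comp [OF Q_linear_A [OF di]] lin_comp [OF Q_linear_H [OF di]] Q_closed [OF di]
  have "conv (U i) (U j) h = sweedler K H H A (\<Delta> h) (\<lambda>p q. Q (Q (dA i) \<one>\<^bsub>A\<^esub>) (Q (dA j) \<one>\<^bsub>A\<^esub> q) p)"
    unfolding conv_def bar_def by (rule sw_cong) (simp add: Q_restrict)
  also have "\<dots> = sweedler K H H A (\<Delta> h) (\<lambda>p q. Q (dA i) (Q (dA j) \<one>\<^bsub>A\<^esub> q) p)"
    by (rule sw_cong) (simp add: Q_Q [OF di] Q_closed [OF dj])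
  also have "\<dots> = sweedler K H H A (\<Delta> h) (\<lambda>p q. Q (dA i)
      (sweedler K A H A (\<rho> \<one>\<^bsub>A\<^esub>) (\<lambda>u' w. d j (q \<otimes>\<^bsub>H\<^esub> w) \<odot>\<^bsub>A\<^esub> u')) p)"
    unfolding Q_def [of "dA j"]
    by (rule sw_cong, rule arg_cong [of _ _ "\<lambda>z. Q (dA i) z _"], rule sw_cong)
      (simp add: A.smult_mult_right d_closed j)
  also have "\<dots> = sweedler K H H A (\<Delta> h) (\<lambda>p q.
      sweedler K A H A (\<rho> \<one>\<^bsub>A\<^esub>) (\<lambda>u' w. Q (dA i) (d j (q \<otimes>\<^bsub>H\<^esub> w) \<odot>\<^bsub>A\<^esub> u') p))"
    by (rule sw_cong, rule lin_sw [where \<phi> = "\<lambda>z. Q (dA i) z _"]) (intro r; assumption)+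
  also have "\<dots> = sweedler K H H A (\<Delta> h) (\<lambda>p q.
      sweedler K A H A (\<rho> \<one>\<^bsub>A\<^esub>) (\<lambda>u' w. d j (q \<otimes>\<^bsub>H\<^esub> w) \<odot>\<^bsub>A\<^esub>
        sweedler K A H A (\<rho> u') (\<lambda>u v. d i (p \<otimes>\<^bsub>H\<^esub> v) \<odot>\<^bsub>A\<^esub> u)))"
  proof (intro sw_cong)
    fix p q u' w assume *: "p \<in> carrier H" "q \<in> carrier H" "u' \<in> carrier A" "w \<in> carrier H"
    have "Q (dA i) u' p = sweedler K A H A (\<rho> u') (\<lambda>u v. d i (p \<otimes>\<^bsub>H\<^esub> v) \<odot>\<^bsub>A\<^esub> u)"
      unfolding Q_def by (rule sw_cong) (simp add: * d_closed i A.smult_mult_right)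
    then show "Q (dA i) (d j (q \<otimes>\<^bsub>H\<^esub> w) \<odot>\<^bsub>A\<^esub> u') p = d j (q \<otimes>\<^bsub>H\<^esub> w) \<odot>\<^bsub>A\<^esub>
        sweedler K A H A (\<rho> u') (\<lambda>u v. d i (p \<otimes>\<^bsub>H\<^esub> v) \<odot>\<^bsub>A\<^esub> u)"
      using * by (simp add: lin_smult [OF Q_linear_A [OF di]] d_closed j)
  qed
  also have "\<dots> = sweedler K H H A (\<Delta> h) (\<lambda>h1 h2.
         sweedler K A H A (\<rho> \<one>\<^bsub>A\<^esub>) (\<lambda>u' w. sweedler K A H A (\<rho> u') (\<lambda>u v.
           d j (h2 \<otimes>\<^bsub>H\<^esub> w) \<odot>\<^bsub>A\<^esub> (d i (h1 \<otimes>\<^bsub>H\<^esub> v) \<odot>\<^bsub>A\<^esub> u))))"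
    by (rule sw_cong, rule sw_cong, rule lin_sw) (intro r; assumption)+
  finally show ?thesis .
qed

text \<open>Equality is tested on the slices by \<open>d i\<close> in the middle leg and
  \<open>d j\<close> in the last one. On the left they give \<open>U i\<close> acting after
  \<open>U j\<close>, hence the product of the two in \<open>E1\<close>; on the right they give the
  action of the function computed in \<open>conv_U_U\<close>.\<close>

lemma to_hopf_coassoc:
  assumes m: "m \<in> carrier L"
  shows "sweedler K N H (tensor K (tensor K N H) H) (coact M m) (\<lambda>x h. tpure K (tensor K N H) H (coact M x) h)
    = sweedler K N H (tensor K (tensor K N H) H) (coact M m) (\<lambda>x h.
         sweedler K H H (tensor K (tensor K N H) H) (\<Delta> h) (\<lambda>h1 h2.
         sweedler K AH H (tensor K (tensor K N H) H)
           (sweedler K A H (tensor K AH H) (\<rho> \<one>\<^bsub>A\<^esub>) (\<lambda>u v. tpure K AH H (\<rho> u) v)) (\<lambda>s w.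
         sweedler K A H (tensor K (tensor K N H) H) s (\<lambda>u v.
           tpure K (tensor K N H) H (tpure K N H (racton M x u) (h1 \<otimes>\<^bsub>H\<^esub> v)) (h2 \<otimes>\<^bsub>H\<^esub> w)))))"
    (is "?l = ?r")
proof (rule double_slice_eqI)
  have cm: "coact M m \<in> carrier (tensor K N H)" by (rule coact_to_hopf_closed [OF m])
  note r = N_rules lin_comp [OF coact_to_hopf_linear] lin_closed [OF coact_to_hopf_linear] cm
  show "?l \<in> carrier (tensor K (tensor K N H) H)" by (intro r; assumption)
  show "?r \<in> carrier (tensor K (tensor K N H) H)" by (intro r; assumption)
  fix i j assume i: "i \<in> I" and j: "j \<in> I"
  let ?\<Psi> = "\<lambda>T. sweedler K (tensor K N H) H N T (\<lambda>z h. d j h \<odot>\<^bsub>N\<^esub> sweedler K N H N z (\<lambda>m k. d i k \<odot>\<^bsub>N\<^esub> m))"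
  note \<Psi> = coassoc_functional [OF i j]
  let ?W = "\<lambda>h. sweedler K H H A (\<Delta> h) (\<lambda>h1 h2.
         sweedler K A H A (\<rho> \<one>\<^bsub>A\<^esub>) (\<lambda>u' w. sweedler K A H A (\<rho> u') (\<lambda>u v.
           d j (h2 \<otimes>\<^bsub>H\<^esub> w) \<odot>\<^bsub>A\<^esub> (d i (h1 \<otimes>\<^bsub>H\<^esub> v) \<odot>\<^bsub>A\<^esub> u))))"
  note rd = r lin_comp [OF d_linear [OF i]] d_closed [OF i] d_linear [OF i]
    lin_comp [OF d_linear [OF j]] d_closed [OF j] d_linear [OF j]
  have Wl: "?W \<in> linear_maps K H A" by (intro rd; assumption)
  have "?\<Psi> ?l = sweedler K N H N (coact M m) (\<lambda>x h. ?\<Psi> (tpure K (tensor K N H) H (coact M x) h))"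
    by (rule lin_sw [OF _ _ _ _ \<Psi>(1)]) (intro r; assumption)+
  also have "\<dots> = sweedler K N H N (coact M m) (\<lambda>x h. act L (U i) (d j h \<odot>\<^bsub>N\<^esub> x))"
    by (rule sw_cong)
      (simp add: \<Psi>(2) lin_closed [OF coact_to_hopf_linear] slice_d i j d_closed carrier_N [symmetric]
        lin_smult [OF act_linear [OF U_E1]])
  also have "\<dots> = act L (U i) (sweedler K N H N (coact M m) (\<lambda>x h. d j h \<odot>\<^bsub>N\<^esub> x))"
    by (rule lin_sw [symmetric, OF _ _ _ _ act_linear [OF U_E1 [OF i]]]) (intro rd; assumption)+
  also have "\<dots> = act L (U i \<otimes>\<^bsub>E1\<^esub> U j) m"
    by (simp add: slice_d j m act_simps U_E1 i)
  \<comment> \<open>The product lies in \<open>E1\<close>, so it equals its own projection; in the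
    form \<open>bar ?W\<close> the formula \<open>slice_act\<close> turns its action back into a sum
    over the coaction.\<close>
  also have "U i \<otimes>\<^bsub>E1\<^esub> U j = bar ?W"
  proof (rule E1_eqI)
    fix h assume h: "h \<in> carrier H"
    have c: "(U i \<otimes>\<^bsub>E1\<^esub> U j) k = ?W k" if "k \<in> carrier H" for k
      using that by (simp add: E.underline_ops conv_ring_simps(2) conv_U_U i j)
    have "bar ?W h = Q ?W \<one>\<^bsub>A\<^esub> h"
      using h by (simp only: bar_def [of ?W] restrict_apply if_True)
    also have "\<dots> = Q (U i \<otimes>\<^bsub>E1\<^esub> U j) \<one>\<^bsub>A\<^esub> h"
      by (rule Q_cong [OF _ h]) (simp only: c)
    finally have "bar ?W h = Q (U i \<otimes>\<^bsub>E1\<^esub> U j) \<one>\<^bsub>A\<^esub> h" .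
    then show "(U i \<otimes>\<^bsub>E1\<^esub> U j) h = bar ?W h"
      using E1_Q [OF E1_ops_closed(4) [OF U_E1 [OF i] U_E1 [OF j]] h] by simp
  qed (intro E1_ops_closed U_E1 i j bar_E1 Wl)+
  also have "act L (bar ?W) m = sweedler K N H N (coact M m) (\<lambda>x h. racton M x (?W h))"
    by (rule slice_act [OF Wl m, symmetric])
  also have "\<dots> = sweedler K N H N (coact M m) (\<lambda>x h. sweedler K H H N (\<Delta> h) (\<lambda>h1 h2.
      racton M x (sweedler K A H A (\<rho> \<one>\<^bsub>A\<^esub>) (\<lambda>u' w. sweedler K A H A (\<rho> u') (\<lambda>u v.
           d j (h2 \<otimes>\<^bsub>H\<^esub> w) \<odot>\<^bsub>A\<^esub> (d i (h1 \<otimes>\<^bsub>H\<^esub> v) \<odot>\<^bsub>A\<^esub> u))))))"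
    by (rule sw_cong, rule lin_sw) (intro rd; assumption)+
  also have "\<dots> = sweedler K N H N (coact M m) (\<lambda>x h. sweedler K H H N (\<Delta> h) (\<lambda>h1 h2.
      sweedler K A H N (\<rho> \<one>\<^bsub>A\<^esub>) (\<lambda>u' w. racton M x (sweedler K A H A (\<rho> u') (\<lambda>u v.
           d j (h2 \<otimes>\<^bsub>H\<^esub> w) \<odot>\<^bsub>A\<^esub> (d i (h1 \<otimes>\<^bsub>H\<^esub> v) \<odot>\<^bsub>A\<^esub> u))))))"
    by (rule sw_cong, rule sw_cong, rule lin_sw) (intro rd; assumption)+
  also have "\<dots> = sweedler K N H N (coact M m) (\<lambda>x h. sweedler K H H N (\<Delta> h) (\<lambda>h1 h2.
      sweedler K A H N (\<rho> \<one>\<^bsub>A\<^esub>) (\<lambda>u' w. sweedler K A H N (\<rho> u') (\<lambda>u v.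
           racton M x (d j (h2 \<otimes>\<^bsub>H\<^esub> w) \<odot>\<^bsub>A\<^esub> (d i (h1 \<otimes>\<^bsub>H\<^esub> v) \<odot>\<^bsub>A\<^esub> u))))))"
    by (rule sw_cong, rule sw_cong, rule sw_cong, rule lin_sw) (intro rd; assumption)+
  also have "\<dots> = sweedler K N H N (coact M m) (\<lambda>x h. sweedler K H H N (\<Delta> h) (\<lambda>h1 h2.
      sweedler K A H N (\<rho> \<one>\<^bsub>A\<^esub>) (\<lambda>u' w. sweedler K A H N (\<rho> u') (\<lambda>u v.
           d j (h2 \<otimes>\<^bsub>H\<^esub> w) \<odot>\<^bsub>N\<^esub> (d i (h1 \<otimes>\<^bsub>H\<^esub> v) \<odot>\<^bsub>N\<^esub> racton M x u)))))"
    by (intro sw_cong)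
      (simp add: smult_kmod_racton [OF right_module_to_hopf] kmod_carrierD [OF right_module_to_hopf] d_closed i j)
  also have "\<dots> = ?\<Psi> ?r"
    by (rule push_coassoc_rhs [OF right_module_to_hopf modN cm \<Psi>(1) \<Psi>(3), symmetric])
  finally show "?\<Psi> ?l = ?\<Psi> ?r" .
qed

lemma lax_hopf_module_to_hopf: "lax_hopf_module K H \<Delta> \<epsilon> A \<rho> M"
  unfolding lax_hopf_module_def Let_def
  using right_module_to_hopf coact_to_hopf_linear to_hopf_counit to_hopf_coassoc to_hopf_racton
  by (auto simp only: to_hopf_simps(1))

end

end

section \<open>The category of Hopf modules and the two mutually inverse functors\<close>

lemma lax_hopf_module_category_simps:
  "Obj (lax_hopf_module_category K H \<Delta> \<epsilon> A \<rho>) = {M. lax_hopf_module K H \<Delta> \<epsilon> A \<rho> M \<and> pure_additive M \<and>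
                (\<forall>x a. x \<notin> carrier M \<or> a \<notin> carrier A \<longrightarrow> racton M x a = undefined) \<and>
                coact M \<in> extensional (carrier M)}"
  "Hom (lax_hopf_module_category K H \<Delta> \<epsilon> A \<rho>) M N = {f \<in> carrier M \<rightarrow>\<^sub>E carrier N.
                (\<forall>x\<in>carrier M. \<forall>y\<in>carrier M. f (x \<oplus>\<^bsub>M\<^esub> y) = f x \<oplus>\<^bsub>N\<^esub> f y) \<and>
                (\<forall>x\<in>carrier M. \<forall>a\<in>carrier A. f (racton M x a) = racton N (f x) a) \<and>
                (\<forall>x\<in>carrier M.
                   sweedler K (kmod A M) H (tensor K (kmod A N) H) (coact M x)
                     (\<lambda>y h. tpure K (kmod A N) H (f y) h)
                 = coact N (f x))}"
  "Ident (lax_hopf_module_category K H \<Delta> \<epsilon> A \<rho>) M = (\<lambda>x\<in>carrier M. x)"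
  "Comp (lax_hopf_module_category K H \<Delta> \<epsilon> A \<rho>) L M N g f = compose (carrier L) g f"
  by (simp_all add: lax_hopf_module_category_def)

context lax_comodule_algebra
begin

abbreviation "HM \<equiv> lax_hopf_module_category K H \<Delta> \<epsilon> A \<rho>"

lemma hopf_hom_linear:
  assumes f: "f \<in> Hom HM M N"
  shows "f \<in> linear_maps K (kmod A M) (kmod A N)"
  using f by (intro linI) (auto simp: lax_hopf_module_category_simps kmod_simps PiE_def Pi_iff)

lemma category_lax_hopf_module:
  "category (HM :: (('a, 'h, 'm) hmod, 'm \<Rightarrow> 'm) category)"
proof (rule category.intro)
  fix M :: "('a, 'h, 'm) hmod" assume M: "M \<in> Obj HM"
  then have hM: "lax_hopf_module K H \<Delta> \<epsilon> A \<rho> M" by (simp add: lax_hopf_module_category_simps)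
  note R = hopf_right_module [OF hM]
  note mM = modM [OF R]
  have "sweedler K (kmod A M) H (tensor K (kmod A M) H) (coact M x)
      (\<lambda>y h. tpure K (kmod A M) H ((\<lambda>x\<in>carrier M. x) y) h) = coact M x" if "x \<in> carrier M" for x
  proof -
    have "sweedler K (kmod A M) H (tensor K (kmod A M) H) (coact M x)
      (\<lambda>y h. tpure K (kmod A M) H ((\<lambda>x\<in>carrier M. x) y) h)
      = sweedler K (kmod A M) H (tensor K (kmod A M) H) (coact M x) (tpure K (kmod A M) H)"
      by (rule sw_cong) (simp add: kmod_simps)
    then show ?thesis by (simp only: sw_tpure [OF mM modH coact_closed [OF hM that]])
  qed
  then show "Ident HM M \<in> Hom HM M M"
    using racton_simps [OF R] R
    by (simp add: lax_hopf_module_category_simps right_module_def abelian_group_add_closed)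
next
  fix L M N :: "('a, 'h, 'm) hmod" and f g
  assume L: "L \<in> Obj HM" and M: "M \<in> Obj HM" and N: "N \<in> Obj HM"
    and f: "f \<in> Hom HM L M" and g: "g \<in> Hom HM M N"
  have hL: "lax_hopf_module K H \<Delta> \<epsilon> A \<rho> L" and hM: "lax_hopf_module K H \<Delta> \<epsilon> A \<rho> M"
    and hN: "lax_hopf_module K H \<Delta> \<epsilon> A \<rho> N"
    using L M N by (simp_all add: lax_hopf_module_category_simps)
  note R = hopf_right_module [OF hL]
  note m = modM [OF R] modM [OF hopf_right_module [OF hM]] modM [OF hopf_right_module [OF hN]]
  note fl = hopf_hom_linear [OF f] and gl = hopf_hom_linear [OF g]
  note r = lin_rules m lin_comp [OF fl] lin_comp [OF gl] lin_closed [OF fl] lin_closed [OF gl]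
  have ff: "f x \<in> carrier M" if "x \<in> carrier L" for x
    using lin_closed [OF fl] that by (simp add: kmod_simps)
  have fc: "sweedler K (kmod A L) H (tensor K (kmod A M) H) (coact L x)
       (\<lambda>y h. tpure K (kmod A M) H (f y) h) = coact M (f x)" if "x \<in> carrier L" for x
    using f that by (simp add: lax_hopf_module_category_simps)
  have gc: "sweedler K (kmod A M) H (tensor K (kmod A N) H) (coact M x)
       (\<lambda>y h. tpure K (kmod A N) H (g y) h) = coact N (g x)" if "x \<in> carrier M" for x
    using g that by (simp add: lax_hopf_module_category_simps)
  have "sweedler K (kmod A L) H (tensor K (kmod A N) H) (coact L x)
      (\<lambda>y h. tpure K (kmod A N) H (compose (carrier L) g f y) h) = coact N (g (f x))"
    if x: "x \<in> carrier L" for x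
  proof -
    note c = coact_closed [OF hL x]
    \<comment> \<open>The map induced by \<open>g \<circ> f\<close> is factored through the tensor
      product with \<open>M\<close>, so that the coaction conditions for \<open>f\<close> and for
      \<open>g\<close> can be used one after the other.\<close>
    have "sweedler K (kmod A L) H (tensor K (kmod A N) H) (coact L x)
        (\<lambda>y h. tpure K (kmod A N) H (compose (carrier L) g f y) h)
      = sweedler K (kmod A L) H (tensor K (kmod A N) H) (coact L x)
        (\<lambda>y h. sweedler K (kmod A M) H (tensor K (kmod A N) H) (tpure K (kmod A M) H (f y) h)
           (\<lambda>y h. tpure K (kmod A N) H (g y) h))"
    proof (rule sw_cong)
      fix y h assume y: "y \<in> carrier (kmod A L)" and h: "h \<in> carrier H"
      have "sweedler K (kmod A M) H (tensor K (kmod A N) H) (tpure K (kmod A M) H (f y) h)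
           (\<lambda>y h. tpure K (kmod A N) H (g y) h) = tpure K (kmod A N) H (g (f y)) h"
        by (rule sw_pure) (intro r y h; assumption)+
      then show "tpure K (kmod A N) H (compose (carrier L) g f y) h
        = sweedler K (kmod A M) H (tensor K (kmod A N) H) (tpure K (kmod A M) H (f y) h)
           (\<lambda>y h. tpure K (kmod A N) H (g y) h)"
        using y by (simp add: compose_def kmod_simps)
    qed
    also have "\<dots> = sweedler K (kmod A M) H (tensor K (kmod A N) H)
        (sweedler K (kmod A L) H (tensor K (kmod A M) H) (coact L x) (\<lambda>y h. tpure K (kmod A M) H (f y) h))
        (\<lambda>y h. tpure K (kmod A N) H (g y) h)"
      by (rule sw_sw [symmetric]) (intro r c; assumption)+
    also have "\<dots> = coact N (g (f x))"
      by (simp only: fc [OF x] gc [OF ff [OF x]])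
    finally show ?thesis .
  qed
  then show "Comp HM L M N g f \<in> Hom HM L N"
    using f g racton_simps [OF R] R
    by (auto simp: lax_hopf_module_category_simps right_module_def abelian_group_add_closed compose_def
        PiE_def Pi_iff)
next
  fix X Y :: "('a, 'h, 'm) hmod" and f
  assume "X \<in> Obj HM" "Y \<in> Obj HM" "f \<in> Hom HM X Y"
  then show "Comp HM X X Y f (Ident HM X) = f"
    by (auto simp: lax_hopf_module_category_simps compose_def PiE_def extensional_def fun_eq_iff)
next
  fix X Y :: "('a, 'h, 'm) hmod" and f
  assume "X \<in> Obj HM" "Y \<in> Obj HM" "f \<in> Hom HM X Y"
  then show "Comp HM X Y Y (Ident HM Y) f = f"
    by (auto simp: lax_hopf_module_category_simps compose_def PiE_def extensional_def fun_eq_iff Pi_iff)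
next
  fix W X Y Z :: "('a, 'h, 'm) hmod" and f g h
  assume "f \<in> Hom HM W X" "g \<in> Hom HM X Y"
  then show "Comp HM W Y Z h (Comp HM W X Y g f) = Comp HM W X Z (Comp HM X Y Z h g) f"
    by (auto simp: lax_hopf_module_category_simps compose_def PiE_def Pi_iff fun_eq_iff)
qed

text \<open>The coaction absorbs \<open>\<rho>(1)\<close>, so a function and its projection act
  alike on a Hopf module. In particular \<open>U i\<close> acts by slicing the coaction with
  \<open>d i\<close>.\<close>

lemma hopf_act_bar:
  fixes M :: "('a, 'h, 'm) hmod"
  assumes hopf: "lax_hopf_module K H \<Delta> \<epsilon> A \<rho> M"
    and u: "u \<in> linear_maps K H A" and x: "x \<in> carrier M"
  shows "hopf_act M (bar u) x = hopf_act M u x"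
proof -
  let ?M = "kmod A M"
  note R = hopf_right_module [OF hopf]
  have x': "x \<in> carrier ?M" using x by (simp add: kmod_simps)
  note r = hM_rules [OF hopf] lin_comp [OF u] lin_closed [OF u] x'
  have "hopf_act M (bar u) x = sweedler K ?M H ?M (coact M x) (\<lambda>y h. racton M y
      (sweedler K A H A (\<rho> \<one>\<^bsub>A\<^esub>) (\<lambda>a k. a \<otimes>\<^bsub>A\<^esub> u (h \<otimes>\<^bsub>H\<^esub> k))))"
    unfolding hopf_act_def by (rule sw_cong) (simp add: bar_def Q_def)
  also have "\<dots> = sweedler K ?M H ?M (coact M x) (\<lambda>y h.
      sweedler K A H ?M (\<rho> \<one>\<^bsub>A\<^esub>) (\<lambda>a k. racton M y (a \<otimes>\<^bsub>A\<^esub> u (h \<otimes>\<^bsub>H\<^esub> k))))"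
    by (rule sw_cong, rule lin_sw) (intro r; assumption)+
  also have "\<dots> = sweedler K ?M H ?M (coact M x) (\<lambda>y h.
      sweedler K A H ?M (\<rho> \<one>\<^bsub>A\<^esub>) (\<lambda>a k. racton M (racton M y a) (u (h \<otimes>\<^bsub>H\<^esub> k))))"
    by (intro sw_cong) (simp add: racton_simps [OF R] kmod_simps lin_closed [OF u])
  also have "\<dots> = hopf_act M u x"
    unfolding hopf_act_def
    by (rule sw_coact_one [OF hopf modM [OF R] hopf_act_bilinear [OF hopf u] x'])
  finally show ?thesis .
qed

definition to_lmod :: "('a, 'h, 'm) hmod \<Rightarrow> ('h \<Rightarrow> 'a, 'm) lmod" where
  "to_lmod M =
     \<lparr>carrier = carrier M, mult = mult M, one = one M, ring.zero = \<zero>\<^bsub>M\<^esub>, add = add M,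
      act = (\<lambda>u x. if u \<in> carrier E1 \<and> x \<in> carrier M then hopf_act M u x else undefined)\<rparr>"

lemma to_lmod_simps:
  "carrier (to_lmod M) = carrier M" "add (to_lmod M) = add M" "\<zero>\<^bsub>to_lmod M\<^esub> = \<zero>\<^bsub>M\<^esub>"
  "mult (to_lmod M) = mult M" "one (to_lmod M) = one M"
  "act (to_lmod M) u x = (if u \<in> carrier E1 \<and> x \<in> carrier M then hopf_act M u x else undefined)"
  by (simp_all add: to_lmod_def)

lemma to_lmod_obj:
  fixes M :: "('a, 'h, 'm) hmod"
  assumes M: "M \<in> Obj HM"
  shows "to_lmod M \<in> Obj (left_module_category E1)"
proof -
  have h: "lax_hopf_module K H \<Delta> \<epsilon> A \<rho> M" and p: "pure_additive M"
    using M by (simp_all add: lax_hopf_module_category_simps)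
  note R = hopf_right_module [OF h]
  interpret E1: ring E1 by (rule ring_E1)
  have ab: "abelian_group (to_lmod M)"
    by (rule abelian_group_cong [of M]) (use R in \<open>simp_all add: right_module_def to_lmod_simps\<close>)
  have 1: "hopf_act M u x \<in> carrier M" if "u \<in> carrier E1" "x \<in> carrier M" for u x
    by (rule hopf_act_closed [OF h E1_linear [OF that(1)] that(2)])
  have 2: "hopf_act M u (x \<oplus>\<^bsub>M\<^esub> y) = hopf_act M u x \<oplus>\<^bsub>M\<^esub> hopf_act M u y"
    if "u \<in> carrier E1" "x \<in> carrier M" "y \<in> carrier M" for u x y
    using lin_add [OF hopf_act_linear [OF h E1_linear [OF that(1)]], of x y] that by (simp add: kmod_simps)
  have 3: "hopf_act M (u \<oplus>\<^bsub>E1\<^esub> v) x = hopf_act M u x \<oplus>\<^bsub>M\<^esub> hopf_act M v x"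
    if "u \<in> carrier E1" "v \<in> carrier E1" "x \<in> carrier M" for u v x
  proof -
    have "hopf_act M (u \<oplus>\<^bsub>E1\<^esub> v) x = hopf_act M (\<lambda>h. u h \<oplus>\<^bsub>A\<^esub> v h) x"
      by (rule hopf_act_cong [OF h]) (simp add: E.underline_ops conv_ring_simps)
    then show ?thesis
      by (simp only: hopf_act_add [OF h E1_linear [OF that(1)] E1_linear [OF that(2)] that(3)])
  qed
  have 4: "hopf_act M (u \<otimes>\<^bsub>E1\<^esub> v) x = hopf_act M u (hopf_act M v x)"
    if "u \<in> carrier E1" "v \<in> carrier E1" "x \<in> carrier M" for u v x
  proof -
    have "hopf_act M (u \<otimes>\<^bsub>E1\<^esub> v) x = hopf_act M (conv u v) x"
      by (rule hopf_act_cong [OF h]) (simp add: E.underline_ops conv_ring_simps)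
    then show ?thesis
      by (simp only: hopf_act_conv [OF h E1_linear [OF that(1)] that(2,3)])
  qed
  have 5: "hopf_act M \<one>\<^bsub>E1\<^esub> x = x" if "x \<in> carrier M" for x
  proof -
    have "hopf_act M \<one>\<^bsub>E1\<^esub> x = hopf_act M (eta \<one>\<^bsub>A\<^esub>) x"
      by (rule hopf_act_cong [OF h]) (simp add: E.underline_ops conv_ring_simps)
    then show ?thesis
      using that by (simp add: hopf_act_eta [OF h] racton_simps [OF R])
  qed
  show ?thesis
    using p ab
    by (simp add: left_module_category_simps left_module_def to_lmod_simps pure_additive_def 1 2 3 4 5
        abelian_group_add_closed [OF ab, unfolded to_lmod_simps])
qed

lemma to_lmod_hom:
  fixes M N :: "('a, 'h, 'm) hmod"
  assumes M: "M \<in> Obj HM" and N: "N \<in> Obj HM" and f: "f \<in> Hom HM M N"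
  shows "f \<in> Hom (left_module_category E1) (to_lmod M) (to_lmod N)"
proof -
  have hM: "lax_hopf_module K H \<Delta> \<epsilon> A \<rho> M" and hN: "lax_hopf_module K H \<Delta> \<epsilon> A \<rho> N"
    using M N by (simp_all add: lax_hopf_module_category_simps)
  note fl = hopf_hom_linear [OF f]
  let ?M = "kmod A M" and ?N = "kmod A N"
  have "f (hopf_act M u x) = hopf_act N u (f x)" if u: "u \<in> carrier E1" and x: "x \<in> carrier M" for u x
  proof -
    note ul = E1_linear [OF u]
    note r = hM_rules [OF hM] hM_rules [OF hN] coact_closed [OF hM x]
      lin_comp [OF fl] lin_comp [OF ul] lin_closed [OF fl] lin_closed [OF ul] fl
    have "f (hopf_act M u x) = sweedler K ?M H ?N (coact M x) (\<lambda>y h. f (racton M y (u h)))"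
      unfolding hopf_act_def by (rule lin_sw) (intro r; assumption)+
    also have "\<dots> = sweedler K ?M H ?N (coact M x) (\<lambda>y h. racton N (f y) (u h))"
      by (rule sw_cong) (use f lin_closed [OF ul] in \<open>simp add: lax_hopf_module_category_simps kmod_simps\<close>)
    also have "\<dots> = sweedler K ?M H ?N (coact M x) (\<lambda>y h.
        sweedler K ?N H ?N (tpure K ?N H (f y) h) (\<lambda>y h. racton N y (u h)))"
      by (rule sw_cong, rule sw_pure [symmetric]) (intro r; assumption)+
    also have "\<dots> = sweedler K ?N H ?N
        (sweedler K ?M H (tensor K ?N H) (coact M x) (\<lambda>y h. tpure K ?N H (f y) h)) (\<lambda>y h. racton N y (u h))"
      by (rule sw_sw [symmetric]) (intro r; assumption)+
    also have "\<dots> = hopf_act N u (f x)"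
      using f x by (simp add: lax_hopf_module_category_simps hopf_act_def)
    finally show ?thesis .
  qed
  then show ?thesis
    using f by (auto simp: left_module_category_simps lax_hopf_module_category_simps to_lmod_simps PiE_def Pi_iff)
qed

end

context fgp_lax_comodule_algebra
begin

lemma to_hopf_obj:
  assumes L: "L \<in> Obj (left_module_category E1)"
  shows "to_hopf L \<in> Obj HM"
  using L lax_hopf_module_to_hopf
  by (auto simp: left_module_category_simps lax_hopf_module_category_simps pure_additive_def to_hopf_simps
      coact_to_hopf)

text \<open>By \<open>slice_act\<close> the new action of \<open>u\<close> is the old action of
  \<open>bar u\<close>, and \<open>bar u = u\<close> on \<open>E1\<close>.\<close>

lemma to_lmod_to_hopf:
  assumes L: "L \<in> Obj (left_module_category E1)"
  shows "to_lmod (to_hopf L) = L"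
proof -
  have l: "left_module E1 L" and p: "pure_additive L"
    and o: "\<And>u x. u \<notin> carrier E1 \<or> x \<notin> carrier L \<Longrightarrow> act L u x = undefined"
    using L by (simp_all add: left_module_category_simps)
  have "hopf_act (to_hopf L) u x = act L u x" if "u \<in> carrier E1" "x \<in> carrier L" for u x
    unfolding hopf_act_def using slice_act [OF l E1_linear [OF that(1)] that(2)]
    by (simp only: bar_id [OF that(1)])
  then have "act (to_lmod (to_hopf L)) = act L"
    using o by (auto simp: to_lmod_simps to_hopf_simps fun_eq_iff)
  then show ?thesis
    using p by (intro lmod.equality ring.equality) (simp_all add: to_lmod_simps to_hopf_simps pure_additive_def)
qed

text \<open>Since \<open>U i\<close> acts as the slice by \<open>d i\<close>, the rebuilt coaction
  is the dual basis expansion of the given one. The \<open>A\<close>-action is recovered by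
  \<open>hopf_act_eta\<close>.\<close>

lemma to_hopf_to_lmod:
  fixes M :: "('a, 'h, 'm) hmod"
  assumes M: "M \<in> Obj HM"
  shows "to_hopf (to_lmod M) = M"
proof -
  have h: "lax_hopf_module K H \<Delta> \<epsilon> A \<rho> M" and p: "pure_additive M"
    and o: "\<And>x a. x \<notin> carrier M \<or> a \<notin> carrier A \<Longrightarrow> racton M x a = undefined"
    and e: "coact M \<in> extensional (carrier M)"
    using M by (simp_all add: lax_hopf_module_category_simps)
  note R = hopf_right_module [OF h]
  let ?M = "kmod A M"
  have "hopf_act M (unit_map conv_ring a) x = racton M x a" if "x \<in> carrier M" "a \<in> carrier A" for x a
  proof -
    have "hopf_act M (unit_map conv_ring a) x = hopf_act M (eta a) x"
      by (rule hopf_act_cong [OF h]) (simp add: conv_ring_simps)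
    then show ?thesis using that by (simp add: hopf_act_eta [OF h])
  qed
  then have r: "racton (to_hopf (to_lmod M)) = racton M"
    using o by (auto simp: to_lmod_simps to_hopf_simps fun_eq_iff E1_ops_closed)
  \<comment> \<open>\<open>kmod\<close> copies the fields \<open>mult\<close> and \<open>one\<close>
    too; they agree because in an object both are \<open>undefined\<close>.\<close>
  have k: "kmod A (to_hopf (to_lmod M)) = ?M"
    unfolding kmod_def r
    using p by (simp add: ring.defs to_lmod_simps to_hopf_simps pure_additive_def)
  have "hopf_act M (U i) x = sweedler K ?M H ?M (coact M x) (\<lambda>m n. d i n \<odot>\<^bsub>?M\<^esub> m)"
    if i: "i \<in> I" and x: "x \<in> carrier M" for i x
    unfolding hopf_act_bar [OF h dA_linear [OF i] x] by (simp add: hopf_act_def kmod_simps)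
  note a = this
  have "coact (to_hopf (to_lmod M)) = coact M"
  proof (rule extensionalityI [OF _ e])
    show "coact (to_hopf (to_lmod M)) \<in> extensional (carrier M)"
      by (simp add: coact_to_hopf to_lmod_simps)
    fix x assume x: "x \<in> carrier M"
    note c = coact_closed [OF h x]
    interpret T: module K "tensor K ?M H" by (rule module_tensor [OF modM [OF R] modH])
    have "coact (to_hopf (to_lmod M)) x
      = (\<Oplus>\<^bsub>tensor K ?M H\<^esub>i\<in>I. tpure K ?M H (act (to_lmod M) (U i) x) (b i))"
      using x by (simp add: coact_to_hopf k to_lmod_simps(1))
    also have "\<dots> = (\<Oplus>\<^bsub>tensor K ?M H\<^esub>i\<in>I. tpure K ?M H
        (sweedler K ?M H ?M (coact M x) (\<lambda>m n. d i n \<odot>\<^bsub>?M\<^esub> m)) (b i))"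
      by (rule T.finsum_cong') (use x in \<open>simp_all add: to_lmod_simps U_E1 a b_closed tpure_closed modM [OF R] modH
          dual_basis.slice_closed [OF dual_basis_H modM [OF R] _ c]\<close>)
    also have "\<dots> = coact M x"
      by (rule dual_basis.tensor_expand [OF dual_basis_H modM [OF R] c, symmetric])
    finally show "coact (to_hopf (to_lmod M)) x = coact M x" .
  qed
  then show ?thesis
    using p r by (intro hmod.equality) (simp_all add: to_lmod_simps to_hopf_simps pure_additive_def)
qed

text \<open>Compatibility with the coaction is compatibility with the \<open>U i\<close>, and
  \<open>A\<close>-linearity is compatibility with the values of the unit map; both are instances of
  \<open>E1\<close>-linearity.\<close>

lemma to_hopf_hom:
  assumes L: "L \<in> Obj (left_module_category E1)" and L': "L' \<in> Obj (left_module_category E1)"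
    and f: "f \<in> Hom (left_module_category E1) L L'"
  shows "f \<in> Hom HM (to_hopf L) (to_hopf L')"
proof -
  have l: "left_module E1 L" and l': "left_module E1 L'"
    using L L' by (simp_all add: left_module_category_simps)
  have act: "f (act L u x) = act L' u (f x)" if "u \<in> carrier E1" "x \<in> carrier L" for u x
    using f that by (simp add: left_module_category_simps)
  have fc: "f x \<in> carrier L'" if "x \<in> carrier L" for x
    using f that by (auto simp: left_module_category_simps)
  let ?M = "kmod A (to_hopf L)" and ?N = "kmod A (to_hopf L')"
  have fl: "f \<in> linear_maps K ?M ?N"
    by (rule linI)
      (use f in \<open>auto simp: left_module_category_simps kmod_simps to_hopf_simps E1_ops_closed\<close>)
  have "sweedler K ?M H (tensor K ?N H) (coact (to_hopf L) x) (\<lambda>y h. tpure K ?N H (f y) h)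
      = coact (to_hopf L') (f x)" if x: "x \<in> carrier L" for x
  proof -
    note r = N_rules [OF l] N_rules [OF l'] lin_comp [OF fl] lin_closed [OF fl]
    interpret T: module K "tensor K ?N H" by (rule module_tensor [OF modN [OF l'] modH])
    have b: "(\<lambda>y h. tpure K ?N H (f y) h) \<in> bilinear_maps K ?M H (tensor K ?N H)"
      by (intro r; assumption)
    have "sweedler K ?M H (tensor K ?N H) (coact (to_hopf L) x) (\<lambda>y h. tpure K ?N H (f y) h)
      = (\<Oplus>\<^bsub>tensor K ?N H\<^esub>i\<in>I. tpure K ?N H (f (act L (U i) x)) (b i))"
      by (rule sw_coact_to_hopf [OF l T.module_axioms b x])
    also have "\<dots> = (\<Oplus>\<^bsub>tensor K ?N H\<^esub>i\<in>I. tpure K ?N H (act L' (U i) (f x)) (b i))"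
      by (rule T.finsum_cong') (use coact_term [OF l' _ fc [OF x]] in \<open>simp_all add: act U_E1 x\<close>)
    also have "\<dots> = coact (to_hopf L') (f x)"
      using fc [OF x] by (simp add: coact_to_hopf)
    finally show ?thesis .
  qed
  then show ?thesis
    using f act fc
    by (simp add: left_module_category_simps lax_hopf_module_category_simps to_hopf_simps E1_ops_closed)
qed

lemma isomorphic_categories_E1:
  "isomorphic_categories (left_module_category E1 :: (('h \<Rightarrow> 'a, 'm) lmod, 'm \<Rightarrow> 'm) category)
     (HM :: (('a, 'h, 'm) hmod, 'm \<Rightarrow> 'm) category)"
proof -
  have F: "is_functor (left_module_category E1 :: (('h \<Rightarrow> 'a, 'm) lmod, 'm \<Rightarrow> 'm) category)
      (HM :: (('a, 'h, 'm) hmod, 'm \<Rightarrow> 'm) category) to_hopf (\<lambda>_ _ f. f)"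
    unfolding is_functor_def
    by (auto simp: to_hopf_obj to_hopf_hom left_module_category_simps(3,4)
        lax_hopf_module_category_simps(3,4) to_hopf_simps)
  have G: "is_functor (HM :: (('a, 'h, 'm) hmod, 'm \<Rightarrow> 'm) category)
      (left_module_category E1 :: (('h \<Rightarrow> 'a, 'm) lmod, 'm \<Rightarrow> 'm) category) to_lmod (\<lambda>_ _ f. f)"
    unfolding is_functor_def
    by (auto simp: to_lmod_obj to_lmod_hom left_module_category_simps(3,4)
        lax_hopf_module_category_simps(3,4) to_lmod_simps)
  show ?thesis
    unfolding isomorphic_categories_def
    by (rule conjI, rule category_left_module, rule conjI, rule category_lax_hopf_module,
        rule exI, rule exI, rule exI, rule exI, rule conjI, rule F, rule conjI, rule G)
      (simp add: to_lmod_to_hopf to_hopf_to_lmod)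
qed

lemma over_ring_smash: "over_ring (op_ring A) (underline (op_ring A) S)"
  by (rule lax_transport_over_ring [OF lax_transport_underline [OF transport_smash lax_ring_laws_conv_ring]])
    (rule over_ring_E1 Phi_one)+

text \<open>The transport onto the smash product restricts to a ring isomorphism from
  \<open>E1\<close>, with \<open>Phi_one\<close> supplying the unit. Restriction of scalars along it
  reduces the claim to modules over \<open>E1\<close>.\<close>

lemma isomorphic_categories_smash:
  "isomorphic_categories
     (left_module_category (underline (op_ring A) S) :: ((('a, 'h \<Rightarrow> 'k) tens, 'm) lmod, 'm \<Rightarrow> 'm) category)
     (HM :: (('a, 'h, 'm) hmod, 'm \<Rightarrow> 'm) category)"
proof -
  let ?\<chi> = "inv_into (carrier S) Phi"
  have T: "lax_transport (op_ring A) E1 (underline (op_ring A) S) ?\<chi>"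
    by (rule lax_transport_underline [OF transport_smash lax_ring_laws_conv_ring])
  have R: "ring (underline (op_ring A) S)"
    using over_ring_smash by (simp add: over_ring_def)
  have bij: "bij_betw ?\<chi> (carrier E1) (carrier (underline (op_ring A) S))"
    using T by (simp add: lax_transport_def)
  have h: "?\<chi> \<in> ring_hom E1 (underline (op_ring A) S)"
    by (rule ring_hom_memI) (use T bij Phi_one in \<open>auto simp: lax_transport_def bij_betw_def\<close>)
  show ?thesis
    by (rule isomorphic_categories_trans [OF isomorphic_left_module_categories [OF R ring_E1 h bij]
          isomorphic_categories_E1])
qed

end

theorem proposition4p8:
  fixes K :: "'k ring" and H :: "('k, 'h) module" and A :: "('k, 'a) module"
    and \<Delta> :: "'h \<Rightarrow> ('h, 'h) tens" and \<epsilon> :: "'h \<Rightarrow> 'k" and \<rho> :: "'a \<Rightarrow> ('a, 'h) tens"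
  assumes "bialgebra K H \<Delta> \<epsilon>"
    and "finitely_generated K H" and "projective K H"
    and "lax_comodule_algebra K H \<Delta> \<epsilon> A \<rho>"
  shows "isomorphic_left_unital_lax_rings (op_ring A)
           (op_lax_ring (left_dual A (AH_coring K H \<Delta> \<epsilon> A \<rho>)))
           (smash K H \<Delta> \<epsilon> A \<rho>)
       \<and> isomorphic_over_rings (op_ring A)
           (op_lax_ring (left_dual A (underline_coring A (AH_coring K H \<Delta> \<epsilon> A \<rho>))))
           (underline (op_ring A) (smash K H \<Delta> \<epsilon> A \<rho>))
       \<and> isomorphic_categories
           (left_module_category (underline (op_ring A) (smash K H \<Delta> \<epsilon> A \<rho>))
              :: ((('a, 'h \<Rightarrow> 'k) tens, 'm) lmod, 'm \<Rightarrow> 'm) category)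
           (lax_hopf_module_category K H \<Delta> \<epsilon> A \<rho>
              :: (('a, 'h, 'm) hmod, 'm \<Rightarrow> 'm) category)"
proof -
  interpret lax_comodule_algebra K H \<Delta> \<epsilon> A \<rho> by fact
  \<comment> \<open>The dual basis is auxiliary: the choice made here is not visible in any of the
    three conclusions.\<close>
  obtain I and b :: "'h \<Rightarrow> 'h" and d where "dual_basis K H I b d"
    by (rule ex_dual_basis [OF modH assms(2,3)])
  then interpret fgp_lax_comodule_algebra K H \<Delta> \<epsilon> A \<rho> I b d
    by (intro fgp_lax_comodule_algebra.intro assms(4) fgp_lax_comodule_algebra_axioms.intro)
  have D: "over_ring (op_ring A) (op_lax_ring (left_dual A D))"
    by (rule lax_transport_over_ring [OF transport_left_dual_D]) (rule over_ring_E1 psi_D_one)+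
  show ?thesis
    unfolding isomorphic_left_unital_lax_rings_def isomorphic_over_rings_def
    by (intro conjI
        lax_ring_laws.left_unital_lax_ring [OF lax_transport_laws [OF transport_left_dual_C lax_ring_laws_conv_ring]]
        lax_ring_laws.left_unital_lax_ring [OF lax_transport_laws [OF transport_smash lax_ring_laws_conv_ring]]
        lax_transport_iso [OF transport_left_dual_C transport_smash E.ops_closed]
        D over_ring_smash
        lax_transport_iso [OF transport_left_dual_D
          lax_transport_underline [OF transport_smash lax_ring_laws_conv_ring]
          over_ring_ops_closed [OF over_ring_E1]]
        isomorphic_categories_smash)
qed

end
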